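(* Let $r\in[1,2]$, $\sigma\in L^r_\alpha(\mathcal X)$, and let $\varphi,\psi\in L^1_\alpha(\mathbb R^{d+1}_+)\cap L^2_\alpha(\mathbb R^{d+1}_+)\cap L^\infty_\alpha(\mathbb R^{d+1}_+)$ be Weinstein wavelets. Let $r'$ be the conjugate exponent of $r$. Then the two-wavelet localization operator (understood in the weak sense) $$\mathcal L_{\varphi,\psi}(\sigma):L^p_\alpha(\mathbb R^{d+1}_+)\longrightarrow L^p_\alpha(\mathbb R^{d+1}_+)$$ is compact for all $p\in[r,r']$.
   Context: Fix an integer $d\ge 1$ and a real $\alpha>-1/2$. Let $\mathbb R^{d+1}_+=\mathbb R^d\times(0,\infty)$, with points $x=(x',x_{d+1})$, equipped with the measure $$d\mu_\alpha(x)=\frac{x_{d+1}^{2\alpha+1}}{(2\pi)^d2^{2\alpha}\Gamma^2(\alpha+1)}\,dx.$$ For $1\le p\le\infty$, $L^p_\alpha(\mathbb R^{d+1}_+)$ is the $L^p$ space of complex-valued functions for $\mu_\alpha$, with norm $\|\cdot\|_{\alpha,p}$; $\langle f,g\rangle_{\alpha,2}=\int_{\mathbb R^{d+1}_+} f\overline g\,d\mu_\alpha$. Let $\mathcal X=\{(a,x): a>0,\ x\in\mathbb R^{d+1}_+\}$ with measure $d\mu_\alpha(a,x)=\frac{d\mu_\alpha(x)\,da}{a^{2\alpha+d+3}}$, and $L^p_\alpha(\mathcal X)$ the corresponding $L^p$ space. Weinstein transform: $\mathcal F_W(\varphi)(\lambda)=\int_{\mathbb R^{d+1}_+}\varphi(x)\,e^{-i\langle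 x',\lambda'\rangle}j_\alpha(x_{d+1}\lambda_{d+1})\,d\mu_\alpha(x)$ for $\varphi\in L^1_\alpha(\mathbb R^{d+1}_+)$, where $j_\alpha(s)=\Gamma(\alpha+1)\sum_{k\ge0}\frac{(-1)^ks^{2k}}{2^{2k}k!\,\Gamma(\alpha+k+1)}$; it extends uniquely to an isometric isomorphism of $L^2_\alpha(\mathbb R^{d+1}_+)$. A function $\varphi$ is a Weinstein wavelet if $C_\varphi:=\int_0^\infty|\mathcal F_W(\varphi)(a\xi)|^2\frac{da}{a}$ is, for almost all $\xi\in\mathbb R^{d+1}_+$, a constant (independent of $\xi$) with $0<C_\varphi<\infty$. Generalized translation, for $x,y\in\mathbb R^{d+1}_+$: $$\tau^\alpha_x\varphi(y)=\frac{\Gamma(\alpha+1)}{\sqrt\pi\,\Gamma(\alpha+1/2)}\int_0^\pi\varphi\Big(x'+y',\sqrt{x_{d+1}^2+y_{d+1}^2+2x_{d+1}y_{d+1}\cos\theta}\Big)(\sin\theta)^{2\alpha}\,d\theta;$$ it extends to a contraction on every $L^p_\alpha(\mathbb R^{d+1}_+)$. For $a>0$ put $\varphi_a(x)=a^{-(2\alpha+d+2)}\varphi(x/a)$ and $\varphi_{a,x}(y)=a^{\alpha+1+\frac d2}\,\tau^\alpha_x\varphi_a(y)$. Weinstein continuous wavelet transform: $\Phi^W_\varphi(f)(a,x)=\int_{\mathbb R^{d+1}_+}f(y)\,\overline{\varphi_{a,x}(y)}\,d\mu_\alpha(y)$ for $(a,x)\in\mathcal X$. The two-wavelet localization operator is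 formally $\mathcal L_{\varphi,\psi}(\sigma)(f)(y)=\int_{\mathcal X}\sigma(a,x)\Phi^W_\varphi(f)(a,x)\psi_{a,x}(y)\,d\mu_\alpha(a,x)$. Weak sense on $L^p_\alpha(\mathbb R^{d+1}_+)$, with $\frac1p+\frac1q=1$: $\mathcal L_{\varphi,\psi}(\sigma)$ is the unique bounded linear operator on $L^p_\alpha(\mathbb R^{d+1}_+)$ with $$\langle\mathcal L_{\varphi,\psi}(\sigma)(f),g\rangle_{\alpha,2}=\int_{\mathcal X}\sigma(a,x)\,\Phi^W_\varphi(f)(a,x)\,\overline{\Phi^W_\psi(g)(a,x)}\,d\mu_\alpha(a,x)$$ for all $f\in L^p_\alpha(\mathbb R^{d+1}_+)$ and $g\in L^q_\alpha(\mathbb R^{d+1}_+)$ for which the integrand is absolutely integrable on $\mathcal X$ (under the hypotheses of the claim, this operator exists and is unique for every $p\in[r,r']$). *)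

theory Defs
  imports "HOL-Probability.Essential_Supremum"
begin

section \<open>Complex Lebesgue spaces with exponent in \<open>[1,\<infinity>]\<close>\<close>

text \<open>Elements of the spaces are represented by measurable functions; identities between
  them are meant almost everywhere.  Exponents are of type \<^typ>\<open>ennreal\<close>, where
  \<open>inverse \<infinity> = 0\<close>, so that conjugacy of \<open>p\<close> and \<open>q\<close> reads
  \<open>inverse p + inverse q = 1\<close>, including the pair \<open>1, \<infinity>\<close>.\<close>

definition Lp_space :: "ennreal \<Rightarrow> 'a measure \<Rightarrow> ('a \<Rightarrow> complex) set" where
  "Lp_space p M = {f \<in> borel_measurable M.
     if p = \<infinity> then esssup M (\<lambda>x. ennreal (cmod (f x))) < \<infinity>
     else integrable M (\<lambda>x. cmod (f x) powr enn2real p)}"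

definition Lp_norm :: "ennreal \<Rightarrow> 'a measure \<Rightarrow> ('a \<Rightarrow> complex) \<Rightarrow> real" where
  "Lp_norm p M f =
     (if p = \<infinity> then enn2real (esssup M (\<lambda>x. ennreal (cmod (f x))))
      else (LINT x|M. cmod (f x) powr enn2real p) powr (1 / enn2real p))"

text \<open>Linearity and boundedness together imply that such an operator respects almost
  everywhere equality, hence it induces an operator on equivalence classes.\<close>

definition bounded_linear_op_Lp ::
  "ennreal \<Rightarrow> 'a measure \<Rightarrow> (('a \<Rightarrow> complex) \<Rightarrow> ('a \<Rightarrow> complex)) \<Rightarrow> bool" where
  "bounded_linear_op_Lp p M T \<longleftrightarrow>
     (\<forall>f \<in> Lp_space p M. T f \<in> Lp_space p M) \<and>
     (\<forall>f \<in> Lp_space p M. \<forall>g \<in> Lp_space p M. AE x in M. T (\<lambda>y. f y + g y) x = T f x + T g x) \<and>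
     (\<forall>f \<in> Lp_space p M. \<forall>c. AE x in M. T (\<lambda>y. c * f y) x = c * T f x) \<and>
     (\<exists>B. \<forall>f \<in> Lp_space p M. Lp_norm p M (T f) \<le> B * Lp_norm p M f)"

definition compact_op_Lp ::
  "ennreal \<Rightarrow> 'a measure \<Rightarrow> (('a \<Rightarrow> complex) \<Rightarrow> ('a \<Rightarrow> complex)) \<Rightarrow> bool" where
  "compact_op_Lp p M T \<longleftrightarrow>
     bounded_linear_op_Lp p M T \<and>
     (\<forall>F :: nat \<Rightarrow> 'a \<Rightarrow> complex.
        (\<forall>n. F n \<in> Lp_space p M) \<and> (\<exists>B. \<forall>n. Lp_norm p M (F n) \<le> B) \<longrightarrow>
        (\<exists>h \<in> Lp_space p M. \<exists>s :: nat \<Rightarrow> nat. strict_mono s \<and>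
           (\<lambda>n. Lp_norm p M (\<lambda>x. T (F (s n)) x - h x)) \<longlonglongrightarrow> 0))"

section \<open>Weinstein analysis on the half space\<close>

text \<open>\<open>\<real>\<^sup>d \<times> (0,\<infinity>)\<close> is rendered inside \<^typ>\<open>(real ^ 'd) \<times> real\<close> by a measure that
  vanishes outside of it; values of functions there are irrelevant.\<close>

definition weinstein_measure :: "real \<Rightarrow> ((real ^ 'd) \<times> real) measure" where
  "weinstein_measure \<alpha> = density lborel
     (\<lambda>x. ennreal (snd x powr (2 * \<alpha> + 1)
                   / ((2 * pi) ^ CARD('d) * 2 powr (2 * \<alpha>) * (Gamma (\<alpha> + 1))\<^sup>2))
          * indicator {x. snd x > 0} x)"

definition weinstein_measure_X :: "real \<Rightarrow> (real \<times> (real ^ 'd) \<times> real) measure" where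
  "weinstein_measure_X \<alpha> =
     density lborel (\<lambda>a. ennreal (1 / a powr (2 * \<alpha> + real CARD('d) + 3)) * indicator {0<..} a)
     \<Otimes>\<^sub>M weinstein_measure \<alpha>"

definition bessel_j :: "real \<Rightarrow> real \<Rightarrow> real" where
  "bessel_j \<alpha> s =
     Gamma (\<alpha> + 1) * (\<Sum>k. (-1) ^ k * s ^ (2 * k) / (2 ^ (2 * k) * fact k * Gamma (\<alpha> + real k + 1)))"

text \<open>The integral formula on \<open>L\<^sup>1\<close>; its extension to \<open>L\<^sup>2\<close> is not needed here.\<close>

definition weinstein_transform ::
  "real \<Rightarrow> ((real ^ 'd) \<times> real \<Rightarrow> complex) \<Rightarrow> (real ^ 'd) \<times> real \<Rightarrow> complex" where
  "weinstein_transform \<alpha> \<phi> l =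
     (LINT x|weinstein_measure \<alpha>.
        \<phi> x * exp (- \<i> * of_real (fst x \<bullet> fst l)) * of_real (bessel_j \<alpha> (snd x * snd l)))"

definition weinstein_wavelet :: "real \<Rightarrow> ((real ^ 'd) \<times> real \<Rightarrow> complex) \<Rightarrow> bool" where
  "weinstein_wavelet \<alpha> \<phi> \<longleftrightarrow>
     (\<exists>C::real. 0 < C \<and>
        (AE \<xi> in weinstein_measure \<alpha>.
           (\<integral>\<^sup>+ a\<in>{0<..}. ennreal ((cmod (weinstein_transform \<alpha> \<phi> (a *\<^sub>R \<xi>)))\<^sup>2 / a) \<partial>lborel)
             = ennreal C))"

definition weinstein_translation ::
  "real \<Rightarrow> (real ^ 'd) \<times> real \<Rightarrow> ((real ^ 'd) \<times> real \<Rightarrow> complex) \<Rightarrow> (real ^ 'd) \<times> real \<Rightarrow> complex" where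
  "weinstein_translation \<alpha> x \<phi> y =
     of_real (Gamma (\<alpha> + 1) / (sqrt pi * Gamma (\<alpha> + 1 / 2))) *
     (LINT \<theta>:{0..pi}|lborel.
        \<phi> (fst x + fst y, sqrt ((snd x)\<^sup>2 + (snd y)\<^sup>2 + 2 * snd x * snd y * cos \<theta>))
        * of_real (sin \<theta> powr (2 * \<alpha>)))"

definition weinstein_dilation ::
  "real \<Rightarrow> real \<Rightarrow> ((real ^ 'd) \<times> real \<Rightarrow> complex) \<Rightarrow> (real ^ 'd) \<times> real \<Rightarrow> complex" where
  "weinstein_dilation \<alpha> a \<phi> x =
     of_real (a powr (- (2 * \<alpha> + real CARD('d) + 2))) * \<phi> (x /\<^sub>R a)"

definition weinstein_atom ::
  "real \<Rightarrow> ((real ^ 'd) \<times> real \<Rightarrow> complex) \<Rightarrow> real \<Rightarrow> (real ^ 'd) \<times> real \<Rightarrow> (real ^ 'd) \<times> real \<Rightarrow> complex"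
where
  "weinstein_atom \<alpha> \<phi> a x y =
     of_real (a powr (\<alpha> + 1 + real CARD('d) / 2))
     * weinstein_translation \<alpha> x (weinstein_dilation \<alpha> a \<phi>) y"

definition weinstein_cwt ::
  "real \<Rightarrow> ((real ^ 'd) \<times> real \<Rightarrow> complex) \<Rightarrow> ((real ^ 'd) \<times> real \<Rightarrow> complex)
     \<Rightarrow> real \<times> (real ^ 'd) \<times> real \<Rightarrow> complex" where
  "weinstein_cwt \<alpha> \<phi> f = (\<lambda>(a, x). LINT y|weinstein_measure \<alpha>. f y * cnj (weinstein_atom \<alpha> \<phi> a x y))"

text \<open>\<open>T\<close> is a bounded operator on \<open>L\<^sup>p\<close> that represents the two-wavelet localization operator
  with symbol \<open>\<sigma>\<close> in the weak sense.\<close>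

definition is_localization_op ::
  "real \<Rightarrow> ((real ^ 'd) \<times> real \<Rightarrow> complex) \<Rightarrow> ((real ^ 'd) \<times> real \<Rightarrow> complex)
     \<Rightarrow> (real \<times> (real ^ 'd) \<times> real \<Rightarrow> complex) \<Rightarrow> ennreal
     \<Rightarrow> (((real ^ 'd) \<times> real \<Rightarrow> complex) \<Rightarrow> ((real ^ 'd) \<times> real \<Rightarrow> complex)) \<Rightarrow> bool" where
  "is_localization_op \<alpha> \<phi> \<psi> \<sigma> p T \<longleftrightarrow>
     bounded_linear_op_Lp p (weinstein_measure \<alpha>) T \<and>
     (\<forall>q. inverse p + inverse q = 1 \<longrightarrow>
       (\<forall>f \<in> Lp_space p (weinstein_measure \<alpha>). \<forall>g \<in> Lp_space q (weinstein_measure \<alpha>).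
          integrable (weinstein_measure_X \<alpha>)
            (\<lambda>z. \<sigma> z * weinstein_cwt \<alpha> \<phi> f z * cnj (weinstein_cwt \<alpha> \<psi> g z)) \<longrightarrow>
          (LINT y|weinstein_measure \<alpha>. T f y * cnj (g y)) =
          (LINT z|weinstein_measure_X \<alpha>.
             \<sigma> z * weinstein_cwt \<alpha> \<phi> f z * cnj (weinstein_cwt \<alpha> \<psi> g z))))"

end

theory Submission
 imports Defs "HOL-Probability.Probability" "HOL-Complex_Analysis.Great_Picard"
  "HOL-Computational_Algebra.Formal_Power_Series"
begin

text \<open>Write \<open>s = \<alpha> + 1 + d/2\<close> and \<open>1/p + 1/q = 1\<close>. The heart of the matter is that the product of the
wavelet transform \<open>\<Phi> f\<close> (wavelet \<open>\<phi>\<close>) and the conjugate of \<open>\<Psi> g\<close> (wavelet \<open>\<psi>\<close>) lies in \<open>L\<^sup>r\<^sup>'\<close> with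
norm at most a constant times \<open>\<parallel>f\<parallel>\<^sub>p \<parallel>g\<parallel>\<^sub>q\<close>, for \<open>p\<close> between \<open>r\<close> and \<open>r'\<close>. Since \<open>r'\<close> may exceed 2 this does
not follow from Plancherel alone: by duality let \<open>p \<ge> 2\<close>; then \<open>a\<^sup>-\<^sup>w \<Phi> f\<close> and \<open>a\<^sup>w \<Psi> g\<close>, with \<open>w = s (1 - 2/p)\<close>,
are bounded by Hoelder, and \<open>a\<^sup>-\<^sup>w \<Phi> f\<close> is in \<open>L\<^sup>p\<close> by interpolating (Marcinkiewicz) the square function
estimate at \<open>p = 2\<close>, which is Plancherel plus admissibility, with the trivial bound at infinity.
Hence the form defined by a symbol \<open>\<sigma>\<close> has norm at most a constant times \<open>\<parallel>\<sigma>\<parallel>\<^sub>r\<close>, and \<open>\<sigma>\<close> may be replaced by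
truncations that are integrable and live on a compact range of scales. There the operator is an \<open>L\<^sup>1\<close>
superposition of uniformly bounded rank one operators with kernels bounded in every \<open>L\<^sup>p\<close>, which
finite rank operators approximate in norm, also for \<open>p = 1\<close> and \<open>p = \<infinity>\<close>.\<close>

text \<open>The transform is given only as an integral on L^1, so Plancherel is reached through
  Gaussian means: damping by exp(-t |xi|^2) turns the transform, by the product formula for
  \<open>bessel_j\<close>, into an average of translates, and t -> 0 settles bounded continuous
  integrable functions. Beyond that class only an upper bound on the square function is wanted, and
  it passes to limits by Fatou's lemma.

  The range r <= p <= r' is symmetric under conjugation. It says that p and q are both at most r',
  and one of them, P say, is at least 2: the P-th power of the corresponding weighted transform is
  integrable, and the remaining r' - P powers, like the other transform, are handled by sup bounds.
  For r = 1 sup bounds suffice.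

  A bounded form on L^1 x L^infinity need not come from an operator into L^1, because the dual of
  L^infinity is too large. The operator is therefore built as a norm limit of explicit truncated
  operators and inherits from them the approximation by finite rank. Compactness is thus proved at
  each p directly.\<close>

lemmas integrable_dominated = Bochner_Integration.integrable_bound

abbreviation (input) wmeas :: "real => ((real ^ 'd) \<times> real) measure" where
 "wmeas == weinstein_measure"

section \<open>Conjugate exponents in the extended half line\<close>

lemma conjugate_exponent_cases [consumes 1, case_names one infinity finite]:
 fixes p q :: ennreal
 assumes pq: "inverse p + inverse q = 1"
 obtains "p = 1" "q = top" | "p = top" "q = 1"
 | P Q :: real where "1 < P" "1 < Q" "1 / P + 1 / Q = 1" "p = ennreal P" "q = ennreal Q"
proof -
 have p0: "p ~= 0" and q0: "q ~= 0" using pq by auto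
 show ?thesis
 proof (cases p)
  case top
  then have "inverse q = 1" using pq by simp
  then have "q = 1"
  proof (cases q)
   case (real Q)
   have "Q > 0" using real q0 by (simp add: ennreal_eq_0_iff order_less_le)
   then have "ennreal (inverse Q) = ennreal 1" using \<open>inverse q = 1\<close> real by (simp add: inverse_ennreal)
   then show ?thesis using \<open>Q > 0\<close> real by (simp add: inverse_eq_1_iff)
  qed simp
  then show ?thesis using top that by simp
 next
  case (real P)
  have P: "P > 0" using real p0 by (simp add: ennreal_eq_0_iff order_less_le)
  show ?thesis
  proof (cases q)
   case top
   then have "ennreal (inverse P) = ennreal 1" using pq real P by (simp add: inverse_ennreal)
   then have "P = 1" using P by (simp add: field_simps)
   then show ?thesis using top real that by simp
  next
   case (real Q)
   have Q: "Q > 0" using real q0 by (simp add: ennreal_eq_0_iff order_less_le)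
   have "ennreal (inverse P + inverse Q) = ennreal 1"
    using pq real P Q \<open>p = ennreal P\<close> by (simp add: inverse_ennreal)
   then have e: "1 / P + 1 / Q = 1" using P Q by (subst (asm) ennreal_inj) (auto simp: field_simps)
   have "1 / P < 1" "1 / Q < 1" using e P Q by (smt (verit) divide_pos_pos)+
   then have "1 < P" "1 < Q" using P Q by (auto simp: field_simps)
   then show ?thesis using e real \<open>p = ennreal P\<close> that by blast
  qed
 qed
qed

lemma exponent_ge_1_cases [consumes 1, case_names infinity finite]:
 fixes p :: ennreal
 assumes "1 <= p"
 obtains "p = top" | P :: real where "1 <= P" "p = ennreal P"
 using assms by (cases p) auto

lemma conjugate_exponent_ge_1:
 fixes p q :: ennreal
 assumes "inverse p + inverse q = 1"
 shows "1 <= p" "1 <= q"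
 using assms by (cases rule: conjugate_exponent_cases; auto)+

section \<open>Lebesgue spaces: Minkowski, Hoelder, duality and completeness\<close>

lemma Lp_space_measurable [measurable_dest]: "f \<in> Lp_space p M ==> f \<in> borel_measurable M"
 by (simp add: Lp_space_def)

lemma Lp_space_ennreal:
 "0 < P ==> Lp_space (ennreal P) M = {f \<in> borel_measurable M. integrable M (%x. cmod (f x) powr P)}"
 by (auto simp: Lp_space_def)

lemma Lp_norm_ennreal: "0 < P ==> Lp_norm (ennreal P) M f = (LINT x|M. cmod (f x) powr P) powr (1 / P)"
 by (simp add: Lp_norm_def)

lemma Lp_norm_powr: "0 < P ==> Lp_norm (ennreal P) M f powr P = (LINT x|M. cmod (f x) powr P)"
 by (simp add: Lp_norm_ennreal powr_powr)

lemma Lp_norm_nonneg [simp]: "0 <= Lp_norm p M f"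
 by (simp add: Lp_norm_def)

lemma Lp_space_1: "Lp_space 1 M = {f. integrable M f}"
proof -
 have "integrable M (%x. cmod (f x)) \<longleftrightarrow> integrable M f" if "f \<in> borel_measurable M" for f :: "'a => complex"
  using that integrable_norm_iff by blast
 then show ?thesis using Lp_space_ennreal[of 1 M] borel_measurable_integrable by force
qed

lemma Lp_norm_1: "Lp_norm 1 M f = (LINT x|M. cmod (f x))"
 using Lp_norm_ennreal[of 1 M f] by simp

lemma Lp_space_inftyI:
 assumes [measurable]: "f \<in> borel_measurable M" and "AE x in M. cmod (f x) <= C"
 shows "f \<in> Lp_space top M"
proof -
 have "esssup M (%x. ennreal (cmod (f x))) <= ennreal C"
  using assms by (intro esssup_I) (auto intro: ennreal_leI)
 also have "... < top" by simp
 finally show ?thesis by (simp add: Lp_space_def)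
qed

lemma Lp_norm_infty_le:
 assumes [measurable]: "f \<in> borel_measurable M" and "AE x in M. cmod (f x) <= C" "0 <= C"
 shows "Lp_norm top M f <= C"
proof -
 have "esssup M (%x. ennreal (cmod (f x))) <= ennreal C"
  using assms by (intro esssup_I) (auto intro: ennreal_leI)
 then show ?thesis using assms by (auto simp: Lp_norm_def intro: enn2real_leI)
qed

lemma Lp_space_infty_AE:
 assumes "f \<in> Lp_space top M"
 shows "AE x in M. cmod (f x) <= Lp_norm top M f"
proof -
 have fin: "esssup M (%x. ennreal (cmod (f x))) < top" using assms by (simp add: Lp_space_def)
 have "AE x in M. ennreal (cmod (f x)) <= esssup M (%x. ennreal (cmod (f x)))" by (rule esssup_AE)
 then show ?thesis
 proof eventually_elim
  case (elim x)
  have "cmod (f x) = enn2real (ennreal (cmod (f x)))" by simp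
  also have "... <= enn2real (esssup M (%x. ennreal (cmod (f x))))"
   using elim fin by (intro enn2real_mono)
  finally show ?case by (simp add: Lp_norm_def)
 qed
qed

lemma Lp_norm_le_ennreal:
 assumes "1 <= P" "(LINT x|M. cmod (f x) powr P) <= C powr P" "0 <= C"
 shows "Lp_norm (ennreal P) M f <= C"
proof -
 have "(LINT x|M. cmod (f x) powr P) powr (1 / P) <= (C powr P) powr (1 / P)"
  using assms by (intro powr_mono2) (auto intro: integral_nonneg_AE)
 then show ?thesis using assms by (simp add: Lp_norm_ennreal powr_powr)
qed

lemma Lp_space_mono:
 assumes p: "1 <= p" and g: "g \<in> Lp_space p M" and [measurable]: "f \<in> borel_measurable M"
  and le: "AE x in M. cmod (f x) <= cmod (g x)"
 shows "f \<in> Lp_space p M" "Lp_norm p M f <= Lp_norm p M g"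
proof -
 have "f \<in> Lp_space p M & Lp_norm p M f <= Lp_norm p M g"
  using p
 proof (cases rule: exponent_ge_1_cases)
  case infinity
  have b: "AE x in M. cmod (f x) <= Lp_norm top M g"
   using le Lp_space_infty_AE[of g M] g infinity by auto
  then show ?thesis using infinity by (auto intro: Lp_space_inftyI Lp_norm_infty_le)
 next
  case (finite P)
  have ig: "integrable M (%x. cmod (g x) powr P)" using g finite by (simp add: Lp_space_ennreal)
  have leP: "AE x in M. cmod (f x) powr P <= cmod (g x) powr P"
   using le by eventually_elim (use finite in \<open>auto intro: powr_mono2\<close>)
  have i: "integrable M (%x. cmod (f x) powr P)"
   by (rule integrable_dominated[OF ig]) (use leP in auto)
  have "(LINT x|M. cmod (f x) powr P) <= (LINT x|M. cmod (g x) powr P)"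
   using leP by (intro integral_mono_AE i ig)
  also have "... = Lp_norm p M g powr P" using finite by (simp add: Lp_norm_powr)
  finally show ?thesis using finite i by (auto intro: Lp_norm_le_ennreal simp: Lp_space_ennreal)
 qed
 then show "f \<in> Lp_space p M" "Lp_norm p M f <= Lp_norm p M g" by auto
qed

lemma Lp_norm_cong_AE:
 assumes "1 <= p" "g \<in> Lp_space p M" "f \<in> borel_measurable M" "AE x in M. f x = g x"
 shows "Lp_norm p M f = Lp_norm p M g"
proof (rule antisym)
 have f: "f \<in> Lp_space p M" using assms by (auto intro: Lp_space_mono(1)[OF assms(1,2)])
 show "Lp_norm p M f <= Lp_norm p M g" using assms by (auto intro: Lp_space_mono(2)[OF assms(1,2)])
 show "Lp_norm p M g <= Lp_norm p M f" using assms by (auto intro!: Lp_space_mono(2)[OF assms(1) f])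
qed

lemma Lp_space_cmult:
 assumes p: "1 <= p" and f: "f \<in> Lp_space p M"
 shows "(%x. c * f x) \<in> Lp_space p M" "Lp_norm p M (%x. c * f x) = cmod c * Lp_norm p M f"
proof -
 have [measurable]: "f \<in> borel_measurable M" using f by measurable
 have 1: "(%x. c * f x) \<in> Lp_space p M & Lp_norm p M (%x. c * f x) <= cmod c * Lp_norm p M f"
  if f: "f \<in> Lp_space p M" for c f
  using p
 proof (cases rule: exponent_ge_1_cases)
  case infinity
  have [measurable]: "f \<in> borel_measurable M" using f by measurable
  have "AE x in M. cmod (c * f x) <= cmod c * Lp_norm top M f"
   using Lp_space_infty_AE[OF f[unfolded infinity]]
   by eventually_elim (simp add: norm_mult mult_left_mono)
  then show ?thesis using infinity by (auto intro!: Lp_space_inftyI Lp_norm_infty_le)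
 next
  case (finite P)
  have [measurable]: "f \<in> borel_measurable M" using f by measurable
  have i: "integrable M (%x. cmod (f x) powr P)" using f finite by (simp add: Lp_space_ennreal)
  have "(LINT x|M. cmod (c * f x) powr P) = cmod c powr P * (LINT x|M. cmod (f x) powr P)"
   by (simp add: norm_mult powr_mult)
  also have "... = (cmod c * Lp_norm p M f) powr P"
   using finite by (simp add: powr_mult Lp_norm_powr)
  finally have "Lp_norm p M (%x. c * f x) <= cmod c * Lp_norm p M f"
   using finite by (auto intro: Lp_norm_le_ennreal)
  then show ?thesis using i finite by (simp add: Lp_space_ennreal norm_mult powr_mult)
 qed
 show "(%x. c * f x) \<in> Lp_space p M" using 1[OF f] by simp
 show "Lp_norm p M (%x. c * f x) = cmod c * Lp_norm p M f"
 proof (cases "c = 0")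
  case True then show ?thesis using 1[OF f, of c] Lp_norm_nonneg[of p M] by (smt (verit) mult_eq_0_iff norm_zero)
 next
  case False
  \<comment> \<open>The reverse inequality is the bound just proved, applied to the factor
    \<open>inverse c\<close>.\<close>
  have "Lp_norm p M f = Lp_norm p M (%x. inverse c * (c * f x))" using False by (simp add: mult.assoc[symmetric])
  also have "... <= cmod (inverse c) * Lp_norm p M (%x. c * f x)" using 1[of "%x. c * f x"] 1[OF f] by simp
  finally show ?thesis using 1[OF f, of c] False by (simp add: norm_divide field_simps)
 qed
qed

text \<open>For positive a and b this is convexity of the power function; at the boundary it reduces
  to t^P <= t for t in [0, 1].\<close>

lemma powr_convex_combination:
 fixes a b t P :: real
 assumes "1 <= P" "0 <= a" "0 <= b" "0 <= t" "t <= 1"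
 shows "((1 - t) * a + t * b) powr P <= (1 - t) * a powr P + t * b powr P"
proof -
 consider "a = 0" | "b = 0" | "a > 0" "b > 0" using assms by fastforce
 then show ?thesis
 proof cases
  case 1
  have "(t * b) powr P = t powr P * b powr P" using assms by (simp add: powr_mult)
  also have "... <= t * b powr P" 
   using assms powr_mono'[of 1 P t] by (intro mult_right_mono) auto
  finally show ?thesis using 1 assms by simp
 next
  case 2
  have "((1 - t) * a) powr P = (1 - t) powr P * a powr P" using assms by (simp add: powr_mult)
  also have "... <= (1 - t) * a powr P" 
   using assms powr_mono'[of 1 P "1 - t"] by (intro mult_right_mono) auto
  finally show ?thesis using 2 assms by simp
 next
  case 3
  then show ?thesis using convex_onD[OF powr_convex[of P], of t a b] assms by simp
 qed
qed

lemma Lp_norm_eq_0_AE: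
 assumes p: "1 <= p" and f: "f \<in> Lp_space p M" and 0: "Lp_norm p M f = 0"
 shows "AE x in M. f x = 0"
 using p
proof (cases rule: exponent_ge_1_cases)
 case infinity
 then show ?thesis using Lp_space_infty_AE[of f M] f 0 by simp
next
 case (finite P)
 have "(LINT x|M. cmod (f x) powr P) = 0" using 0 finite by (simp add: Lp_norm_ennreal)
 then have "AE x in M. cmod (f x) powr P = 0"
  using f finite by (subst (asm) integral_nonneg_eq_0_iff_AE) (auto simp: Lp_space_ennreal)
 then show ?thesis by simp
qed

lemma zero_in_Lp_space [simp]: "1 <= p ==> (%x. 0) \<in> Lp_space p M"
 by (erule exponent_ge_1_cases) (auto simp: Lp_space_ennreal intro!: Lp_space_inftyI[where C=0])

lemma Lp_norm_zero_fun [simp]: "1 <= p ==> Lp_norm p M (%x. 0) = 0"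
 using Lp_norm_infty_le[of "%x. 0" M 0]
 by (erule_tac exponent_ge_1_cases) (auto simp: Lp_norm_ennreal intro!: antisym)

text \<open>Minkowski's inequality by convexity. With a and b the two norms, |f + g| / (a + b) is at
  most the combination of |f| / a and |g| / b with weights a / (a + b) and b / (a + b), and the P-th
  powers of these quotients have integral 1. Vanishing norms are treated apart because of the
  division.\<close>

lemma Lp_space_add:
 assumes p: "1 <= p" and f: "f \<in> Lp_space p M" and g: "g \<in> Lp_space p M"
 shows "(%x. f x + g x) \<in> Lp_space p M"
  and "Lp_norm p M (%x. f x + g x) <= Lp_norm p M f + Lp_norm p M g"
proof -
 have [measurable]: "f \<in> borel_measurable M" "g \<in> borel_measurable M" using f g by measurable
 have "(%x. f x + g x) \<in> Lp_space p M & Lp_norm p M (%x. f x + g x) <= Lp_norm p M f + Lp_norm p M g"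
  using p
 proof (cases rule: exponent_ge_1_cases)
  case infinity
  have "AE x in M. cmod (f x + g x) <= Lp_norm top M f + Lp_norm top M g"
   using Lp_space_infty_AE[OF f[unfolded infinity]] Lp_space_infty_AE[OF g[unfolded infinity]]
   by eventually_elim (auto intro: norm_triangle_le)
  then show ?thesis using infinity by (auto intro!: Lp_space_inftyI Lp_norm_infty_le)
 next
  case (finite P)
  have i: "integrable M (%x. cmod (f x) powr P)" "integrable M (%x. cmod (g x) powr P)"
   using f g finite by (simp_all add: Lp_space_ennreal)
  show ?thesis
  proof (cases "Lp_norm p M f = 0 \<or> Lp_norm p M g = 0")
   case True
   then consider "AE x in M. f x = 0" | "AE x in M. g x = 0"
    using Lp_norm_eq_0_AE[OF p f] Lp_norm_eq_0_AE[OF p g] by blast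
   then show ?thesis
   proof cases
    case 1
    then have "AE x in M. cmod (f x + g x) <= cmod (g x)" by (auto elim: eventually_mono)
    then show ?thesis using Lp_space_mono[OF p g, of "%x. f x + g x"] by (auto intro: order_trans add_increasing)
   next
    case 2
    then have "AE x in M. cmod (f x + g x) <= cmod (f x)" by (auto elim: eventually_mono)
    then show ?thesis using Lp_space_mono[OF p f, of "%x. f x + g x"] by (auto intro: order_trans add_increasing2)
   qed
  next
   case False
   define a b where "a = Lp_norm p M f" and "b = Lp_norm p M g"
   have ab: "a > 0" "b > 0" using False unfolding a_def b_def by (auto simp: order_less_le)
   define t where "t = b / (a + b)"
   have t: "0 <= t" "t <= 1" "1 - t = a / (a + b)" using ab by (auto simp: t_def field_simps)
   have pw: "cmod (f x + g x) powr P \<le>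
    (a + b) powr P * ((1 - t) * a powr (-P) * cmod (f x) powr P + t * b powr (-P) * cmod (g x) powr P)" for x
   proof -
    have "cmod (f x + g x) <= cmod (f x) + cmod (g x)" by (rule norm_triangle_ineq)
    also have "... = (a + b) * ((1 - t) * (cmod (f x) / a) + t * (cmod (g x) / b))"
    proof -
     have "(a + b) * (1 - t) = a" "(a + b) * t = b" using ab unfolding t(3) unfolding t_def by auto
     then show ?thesis using ab by (simp add: distrib_left mult.assoc[symmetric])
    qed
    finally have "cmod (f x + g x) powr P <= ((a + b) * ((1 - t) * (cmod (f x) / a) + t * (cmod (g x) / b))) powr P"
     using finite by (intro powr_mono2) auto
    also have "... = (a + b) powr P * ((1 - t) * (cmod (f x) / a) + t * (cmod (g x) / b)) powr P"
     by (rule powr_mult)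
    also have "... <= (a + b) powr P * ((1 - t) * (cmod (f x) / a) powr P + t * (cmod (g x) / b) powr P)"
     using finite ab t by (intro mult_left_mono powr_convex_combination) auto
    finally show ?thesis using ab by (simp add: powr_divide powr_minus_divide)
   qed
   have ii: "integrable M (%x. (a + b) powr P * ((1 - t) * a powr (-P) * cmod (f x) powr P + t * b powr (-P) * cmod (g x) powr P))"
    using i by auto
   have iS: "integrable M (%x. cmod (f x + g x) powr P)"
    by (rule integrable_dominated[OF ii]) (use pw in \<open>auto intro: order_trans[OF _ abs_ge_self]\<close>)
   have Na: "a powr P = (LINT x|M. cmod (f x) powr P)" "b powr P = (LINT x|M. cmod (g x) powr P)"
    unfolding a_def b_def using finite by (auto simp: Lp_norm_powr)
   have "(LINT x|M. cmod (f x + g x) powr P) \<le>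
    (LINT x|M. (a + b) powr P * ((1 - t) * a powr (-P) * cmod (f x) powr P + t * b powr (-P) * cmod (g x) powr P))"
    by (intro integral_mono iS ii pw)
   also have "... = (a + b) powr P * ((1 - t) * a powr (-P) * a powr P + t * b powr (-P) * b powr P)"
    using i by (simp add: Na)
   also have "... = (a + b) powr P" using ab by (simp add: powr_minus field_simps)
   finally have "Lp_norm p M (%x. f x + g x) <= a + b"
    using finite ab by (auto intro!: Lp_norm_le_ennreal)
   then show ?thesis using iS finite by (simp add: a_def b_def Lp_space_ennreal)
  qed
 qed
 then show "(%x. f x + g x) \<in> Lp_space p M"
  and "Lp_norm p M (%x. f x + g x) <= Lp_norm p M f + Lp_norm p M g" by auto
qed

lemma Lp_space_diff:
 assumes p: "1 <= p" and f: "f \<in> Lp_space p M" and g: "g \<in> Lp_space p M"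
 shows "(%x. f x - g x) \<in> Lp_space p M"
  and "Lp_norm p M (%x. f x - g x) <= Lp_norm p M f + Lp_norm p M g"
 using Lp_space_add[OF p f Lp_space_cmult(1)[OF p g, of "-1"]] Lp_space_cmult(2)[OF p g, of "-1"] by simp_all

lemma Lp_norm_diff_commute: "Lp_norm p M (%x. f x - g x) = Lp_norm p M (%x. g x - f x)"
 by (simp add: Lp_norm_def norm_minus_commute)

lemma Lp_norm_triangle_diff:
 assumes p: "1 <= p" and "f \<in> Lp_space p M" "g \<in> Lp_space p M" "h \<in> Lp_space p M"
 shows "Lp_norm p M (%x. f x - h x) <= Lp_norm p M (%x. f x - g x) + Lp_norm p M (%x. g x - h x)"
 using Lp_space_add(2)[OF p Lp_space_diff(1)[OF p assms(2,3)] Lp_space_diff(1)[OF p assms(3,4)]] by simp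

lemma Lp_space_sum:
 assumes p: "1 <= p" and "finite I" "!!i. i \<in> I ==> f i \<in> Lp_space p M"
 shows "(%x. \<Sum>i\<in>I. f i x) \<in> Lp_space p M"
  and "Lp_norm p M (%x. \<Sum>i\<in>I. f i x) <= (\<Sum>i\<in>I. Lp_norm p M (f i))"
proof -
 have "(%x. \<Sum>i\<in>I. f i x) \<in> Lp_space p M & Lp_norm p M (%x. \<Sum>i\<in>I. f i x) <= (\<Sum>i\<in>I. Lp_norm p M (f i))"
  using assms(2,3)
 proof (induction I)
  case empty then show ?case using p by simp
 next
  case (insert i I)
  then show ?case using Lp_space_add[OF p, of "f i" M "%x. \<Sum>i\<in>I. f i x"] by fastforce
 qed
 then show "(%x. \<Sum>i\<in>I. f i x) \<in> Lp_space p M"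
  and "Lp_norm p M (%x. \<Sum>i\<in>I. f i x) <= (\<Sum>i\<in>I. Lp_norm p M (f i))" by auto
qed

text \<open>Young's inequality for |f| / a and |g| / b, where a and b are the norms, integrated over
  the space. The two endpoint pairs are one computation, \<open>aux\<close>, read in both
  orders.\<close>

lemma Lp_Holder:
 assumes pq: "inverse p + inverse q = 1" and f: "f \<in> Lp_space p M" and g: "g \<in> Lp_space q M"
 shows "integrable M (%x. f x * g x)" "(LINT x|M. cmod (f x * g x)) <= Lp_norm p M f * Lp_norm q M g"
proof -
 have [measurable]: "f \<in> borel_measurable M" "g \<in> borel_measurable M" using f g by measurable
 have aux: "integrable M (%x. f x * g x) & (LINT x|M. cmod (f x * g x)) <= Lp_norm 1 M f * Lp_norm top M g"
  if f: "f \<in> Lp_space 1 M" and g: "g \<in> Lp_space top M" for f g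
 proof -
  have [measurable]: "f \<in> borel_measurable M" "g \<in> borel_measurable M" using f g by measurable
  have le: "AE x in M. cmod (f x * g x) <= Lp_norm top M g * cmod (f x)"
   using Lp_space_infty_AE[OF g] by eventually_elim (simp add: norm_mult mult.commute[of _ "cmod (f _)"] mult_left_mono)
  have i: "integrable M (%x. Lp_norm top M g * cmod (f x))"
   using f by (auto simp: Lp_space_1)
  have i2: "integrable M (%x. f x * g x)"
   by (rule integrable_dominated[OF i]) (use le in auto)
  moreover have "(LINT x|M. cmod (f x * g x)) <= (LINT x|M. Lp_norm top M g * cmod (f x))"
   by (intro integral_mono_AE i le integrable_norm i2)
  ultimately show ?thesis by (simp add: Lp_norm_1 mult.commute)
 qed
 have "integrable M (%x. f x * g x) & (LINT x|M. cmod (f x * g x)) <= Lp_norm p M f * Lp_norm q M g"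
  using pq
 proof (cases rule: conjugate_exponent_cases)
  case one then show ?thesis using aux f g by simp
 next
  case infinity then show ?thesis using aux[of g f] f g by (simp add: mult.commute)
 next
  case (finite P Q)
  have i: "integrable M (%x. cmod (f x) powr P)" "integrable M (%x. cmod (g x) powr Q)"
   using f g finite by (simp_all add: Lp_space_ennreal)
  have pg: "1 <= p" "1 <= q" using conjugate_exponent_ge_1[OF pq] by auto
  show ?thesis
  proof (cases "Lp_norm p M f = 0 \<or> Lp_norm q M g = 0")
   case True
   then have z: "AE x in M. f x * g x = 0"
    using Lp_norm_eq_0_AE[OF pg(1) f] Lp_norm_eq_0_AE[OF pg(2) g] by (auto elim: eventually_mono)
   then have "integrable M (%x. f x * g x)"
    by (subst integrable_cong_AE[where g="%x. 0"]) auto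
   moreover have "(LINT x|M. cmod (f x * g x)) = (LINT x|M. 0)"
    using z by (intro integral_cong_AE) (auto elim: eventually_mono)
   ultimately show ?thesis by simp
  next
   case False
   define a b where "a = Lp_norm p M f" and "b = Lp_norm q M g"
   have ab: "a > 0" "b > 0" using False unfolding a_def b_def by (auto simp: order_less_le)
   have pw: "cmod (f x * g x) <= a * b * (a powr (-P) / P * cmod (f x) powr P + b powr (-Q) / Q * cmod (g x) powr Q)" for x
   proof -
    have "cmod (f x * g x) = a * b * ((cmod (f x) / a) * (cmod (g x) / b))" using ab by (simp add: norm_mult)
    also have "... <= a * b * ((cmod (f x) / a) powr P / P + (cmod (g x) / b) powr Q / Q)"
     using finite ab by (intro mult_left_mono Youngs_inequality) auto
    finally show ?thesis using ab by (simp add: powr_divide powr_minus_divide)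
   qed
   have ii: "integrable M (%x. a * b * (a powr (-P) / P * cmod (f x) powr P + b powr (-Q) / Q * cmod (g x) powr Q))"
    using i by auto
   have i2: "integrable M (%x. f x * g x)"
    by (rule integrable_dominated[OF ii]) (use pw in \<open>auto intro: order_trans[OF _ abs_ge_self]\<close>)
   have Na: "a powr P = (LINT x|M. cmod (f x) powr P)" "b powr Q = (LINT x|M. cmod (g x) powr Q)"
    unfolding a_def b_def using finite by (auto simp: Lp_norm_powr)
   have "(LINT x|M. cmod (f x * g x)) \<le>
    (LINT x|M. a * b * (a powr (-P) / P * cmod (f x) powr P + b powr (-Q) / Q * cmod (g x) powr Q))"
    by (intro integral_mono integrable_norm i2 ii pw)
   also have "... = a * b * (a powr (-P) / P * a powr P + b powr (-Q) / Q * b powr Q)"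
    using i by (simp add: Na)
   also have "... = a * b * (1 / P + 1 / Q)" using ab by (simp add: powr_minus field_simps)
   finally show ?thesis using i2 finite by (simp add: a_def b_def)
  qed
 qed
 then show "integrable M (%x. f x * g x)" "(LINT x|M. cmod (f x * g x)) <= Lp_norm p M f * Lp_norm q M g" by auto
qed

lemma borel_measurable_cnj_comp [measurable (raw)]:
 "f \<in> borel_measurable M ==> (%x. cnj (f x)) \<in> borel_measurable M"
 by (rule borel_measurable_continuous_on[of cnj]) (auto intro: continuous_intros)

lemma Lp_space_cnj: "g \<in> Lp_space q M ==> (%x. cnj (g x)) \<in> Lp_space q M"
 by (auto simp: Lp_space_def)

lemma Lp_norm_cnj: "Lp_norm q M (%x. cnj (g x)) = Lp_norm q M g"
 by (simp add: Lp_norm_def)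

lemma Lp_pairing:
 assumes pq: "inverse p + inverse q = 1" and f: "f \<in> Lp_space p M" and g: "g \<in> Lp_space q M"
 shows "integrable M (%x. f x * cnj (g x))"
  and "cmod (LINT x|M. f x * cnj (g x)) <= Lp_norm p M f * Lp_norm q M g"
proof -
 note * = Lp_Holder[OF pq f Lp_space_cnj[OF g]]
 show "integrable M (%x. f x * cnj (g x))" using * by auto
 have "cmod (LINT x|M. f x * cnj (g x)) <= (LINT x|M. cmod (f x * cnj (g x)))" by (rule integral_norm_bound)
 also have "... <= Lp_norm p M f * Lp_norm q M g" using * by (simp add: Lp_norm_cnj)
 finally show "cmod (LINT x|M. f x * cnj (g x)) <= Lp_norm p M f * Lp_norm q M g" .
qed

lemma Lp_nn_integral:
 assumes "0 < P" "f \<in> Lp_space (ennreal P) M"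
 shows "(nn_integral M (%x. ennreal (cmod (f x) powr P))) = ennreal (Lp_norm (ennreal P) M f powr P)"
 using assms by (subst nn_integral_eq_integral) (auto simp: Lp_space_ennreal Lp_norm_powr)

lemma Lp_nn_integralI:
 assumes P: "1 <= P" and [measurable]: "f \<in> borel_measurable M"
  and le: "(nn_integral M (%x. ennreal (cmod (f x) powr P))) <= ennreal (C powr P)" and C: "0 <= C"
 shows "f \<in> Lp_space (ennreal P) M" "Lp_norm (ennreal P) M f <= C"
proof -
 have i: "integrable M (%x. cmod (f x) powr P)"
  using le by (intro integrableI_bounded) (auto simp: le_less_trans)
 then show "f \<in> Lp_space (ennreal P) M" using P by (simp add: Lp_space_ennreal)
 have "ennreal (LINT x|M. cmod (f x) powr P) <= ennreal (C powr P)"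
  using le by (subst (asm) nn_integral_eq_integral[OF i]) auto
 then show "Lp_norm (ennreal P) M f <= C" using P C by (auto intro!: Lp_norm_le_ennreal)
qed

text \<open>The converse of Hoelder, tested on explicit extremal functions: sgn h for p = 1, and sgn
  h times |h|^(P-1) for finite exponents. For p = infinity there is no extremal function in general;
  sgn h is restricted to a part of finite measure of the set where |h| exceeds C by a fixed amount,
  and sigma-finiteness supplies enough such parts.\<close>

lemma Lp_norm_dual_le:
 assumes sf: "sigma_finite_measure M" and pq: "inverse p + inverse q = 1"
  and h: "h \<in> Lp_space p M" and C: "0 <= C"
  and le: "!!g. g \<in> Lp_space q M ==> cmod (LINT x|M. h x * cnj (g x)) <= C * Lp_norm q M g"
 shows "Lp_norm p M h <= C"
proof -
 have [measurable]: "h \<in> borel_measurable M" using h by measurable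
 have sg: "cmod (sgn z) <= 1" "z * cnj (sgn z) = of_real (cmod z)" for z :: complex
 proof -
  show "cmod (sgn z) <= 1" by (simp add: norm_sgn)
  have "z * cnj (sgn z) = (z * cnj z) / of_real (cmod z)" by (simp add: sgn_div_norm divide_inverse scaleR_conv_of_real mult_ac)
  also have "... = of_real (cmod z)"
   by (subst complex_norm_square[symmetric]) (simp add: power2_eq_square)
  finally show "z * cnj (sgn z) = of_real (cmod z)" .
 qed
 have [measurable]: "(%x. sgn (h x)) \<in> borel_measurable M" by (simp add: sgn_div_norm)
 show ?thesis using pq
 proof (cases rule: conjugate_exponent_cases)
  case one
  have g: "(%x. sgn (h x)) \<in> Lp_space top M" using sg by (intro Lp_space_inftyI[where C=1]) auto
  have ng: "Lp_norm top M (%x. sgn (h x)) <= 1" using sg by (intro Lp_norm_infty_le) auto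
  have "(LINT x|M. cmod (h x)) = cmod (LINT x|M. h x * cnj (sgn (h x)))" by (simp add: sg)
  also have "... <= C * Lp_norm q M (%x. sgn (h x))" using g one by (intro le) simp
  also have "... <= C * 1" using ng C one by (intro mult_left_mono) auto
  finally show ?thesis using one by (simp add: Lp_norm_1)
 next
  case infinity
  interpret sigma_finite_measure M by fact
  obtain A :: "nat => 'a set" where A: "range A \<subseteq> sets M" "(\<Union>i. A i) = space M" "!!i. emeasure M (A i) ~= \<infinity>"
   using sigma_finite by blast
  have [measurable]: "A i \<in> sets M" for i using A by auto
  have bd: "AE x in M. x \<in> A i --> cmod (h x) <= C + 1 / real (Suc n)" for i n
  proof -
   define E where "E = {x \<in> space M. x \<in> A i & C + 1 / real (Suc n) < cmod (h x)}"
   have [measurable]: "E \<in> sets M" unfolding E_def by measurable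
   have "E \<subseteq> A i" by (auto simp: E_def)
   then have fin: "emeasure M E < \<infinity>"
    using A(3)[of i] emeasure_mono[of E "A i" M] by (auto simp: less_top intro: le_less_trans)
   define g where "g = (%x. sgn (h x) * indicator E x)"
   have [measurable]: "g \<in> borel_measurable M" unfolding g_def by measurable
   have gle: "cmod (g x) <= indicator E x" for x using sg(1)[of "h x"] by (auto simp: g_def indicator_def)
   have iE: "integrable M (indicator E :: _ => real)" using fin by simp
   have ig: "integrable M g" by (rule integrable_dominated[OF iE]) (use gle in auto)
   have g: "g \<in> Lp_space q M" using ig infinity by (simp add: Lp_space_1)
   have "Lp_norm q M g <= (LINT x|M. indicator E x)"
    unfolding infinity Lp_norm_1 by (intro integral_mono ig iE integrable_norm gle)
   then have ng: "Lp_norm q M g <= measure M E" by simp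
   have eq: "h x * cnj (g x) = of_real (cmod (h x) * indicator E x)" for x
    using sg(2)[of "h x"] by (auto simp: g_def indicator_def)
   have ih: "integrable M (%x. cmod (h x) * indicator E x)"
    using Lp_pairing(1)[OF pq h g] unfolding eq by (simp only: complex_of_real_integrable_eq)
   \<comment> \<open>Testing against sgn h on E yields (C + 1/(n+1)) |E| <= C |E|, which forces the
     finite number |E| to vanish.\<close>
   have "measure M E * (C + 1 / real (Suc n)) = (LINT x|M. (C + 1 / real (Suc n)) * indicator E x)" by simp
   also have "... <= (LINT x|M. cmod (h x) * indicator E x)"
    by (intro integral_mono ih integrable_mult_right iE) (auto simp: E_def indicator_def)
   also have "... = cmod (LINT x|M. h x * cnj (g x))"
    unfolding eq integral_complex_of_real norm_of_real
    by (rule abs_of_nonneg[symmetric]) (auto intro!: integral_nonneg_AE)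
   also have "... <= C * measure M E" using le[OF g] mult_left_mono[OF ng C] by linarith
   finally have "measure M E * (1 / real (Suc n)) <= 0" by (simp add: algebra_simps)
   then have "measure M E = 0" using measure_nonneg[of M E] by (simp add: field_simps order_antisym)
   then have "emeasure M E = 0" using fin by (auto simp: measure_def enn2real_eq_0_iff)
   then have "AE x in M. x \<notin> E" by (intro AE_not_in) auto
   moreover have "AE x in M. x \<in> space M" by (rule AE_space)
   ultimately show ?thesis by eventually_elim (auto simp: E_def not_less)
  qed
  have "AE x in M. \<forall>i n. x \<in> A i --> cmod (h x) <= C + 1 / real (Suc n)"
   unfolding AE_all_countable using bd by blast
  then have "AE x in M. cmod (h x) <= C"
  proof (rule AE_mp, intro AE_I2 impI)
   fix x assume x: "x \<in> space M" "\<forall>i n. x \<in> A i --> cmod (h x) <= C + 1 / real (Suc n)"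
   then obtain i where "x \<in> A i" using A by blast
   then have "cmod (h x) <= C + 1 / real (Suc n)" for n using x by blast
   moreover have "(%n. C + 1 / real (Suc n)) \<longlonglongrightarrow> C + 0"
    by (intro tendsto_add tendsto_const) (use LIMSEQ_inverse_real_of_nat in \<open>simp add: inverse_eq_divide\<close>)
   ultimately show "cmod (h x) <= C" by (intro LIMSEQ_le_const[of _ C]) auto
  qed
  then show ?thesis using infinity C by (auto intro: Lp_norm_infty_le)
 next
  case (finite P Q)
  define g where "g = (%x. sgn (h x) * of_real (cmod (h x) powr (P - 1)))"
  have [measurable]: "g \<in> borel_measurable M" unfolding g_def by measurable
  have PQ: "(P - 1) * Q = P" using finite by (simp add: field_simps)
  have ng: "cmod (g x) powr Q = cmod (h x) powr P" for x
  proof (cases "h x = 0")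
   case True then show ?thesis using finite by (simp add: g_def)
  next
   case False
   then have "cmod (g x) = cmod (h x) powr (P - 1)" by (simp add: g_def norm_mult norm_sgn)
   then show ?thesis using PQ by (simp add: powr_powr)
  qed
  have i: "integrable M (%x. cmod (h x) powr P)" using h finite by (simp add: Lp_space_ennreal)
  have g: "g \<in> Lp_space q M" using finite i by (simp add: Lp_space_ennreal ng)
  define N where "N = Lp_norm p M h"
  have N: "N powr P = (LINT x|M. cmod (h x) powr P)" using finite by (simp add: N_def Lp_norm_powr)
  have Ng: "Lp_norm q M g = (N powr P) powr (1 / Q)" using finite by (simp add: Lp_norm_ennreal ng N)
  have eq: "h x * cnj (g x) = of_real (cmod (h x) powr P)" for x
  proof (cases "h x = 0")
   case False
   have "h x * cnj (g x) = of_real (cmod (h x) * cmod (h x) powr (P - 1))"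
    using sg(2)[of "h x"] by (simp add: g_def mult.assoc[symmetric])
   also have "cmod (h x) * cmod (h x) powr (P - 1) = cmod (h x) powr P"
    using False by (simp add: powr_mult_base)
   finally show ?thesis .
  qed (use finite in auto)
  have "N powr P = cmod (LINT x|M. h x * cnj (g x))" 
   unfolding eq integral_complex_of_real norm_of_real N
   by (rule abs_of_nonneg[symmetric]) (auto intro!: integral_nonneg_AE)
  also have "... <= C * (N powr P) powr (1 / Q)" using le[OF g] Ng by simp
  finally have fin: "N powr P <= C * N powr (P / Q)" by (simp add: powr_powr)
  have N0: "0 <= N" by (simp add: N_def)
  show ?thesis
  proof (cases "N = 0")
   case False
   then have "N > 0" using N0 by simp
   \<comment> \<open>The test function has norm N^(P/Q), so the hypothesis reads N^P <= C N^(P/Q);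
     this identity lets one factor N survive the cancellation.\<close>
   have "P = P / Q + 1" using PQ finite by (simp add: field_simps)
   then have "N powr P = N powr (P / Q) * N" using \<open>N > 0\<close> by (metis powr_add powr_one less_imp_le)
   then have "N * N powr (P / Q) <= C * N powr (P / Q)" using fin by (simp add: mult.commute)
   then show ?thesis using \<open>N > 0\<close> by (simp add: N_def[symmetric])
  qed (use C N_def in simp)
 qed
qed

text \<open>Riesz-Fischer. Both cases produce a limit h for which the Cauchy index
  \<open>N e\<close> of the sequence also bounds the distance to h by e. For p = infinity the
  sequence is uniformly Cauchy off one null set; for finite exponents a rapidly converging
  subsequence has a pointwise limit, and Fatou transfers the Cauchy bound to it.\<close>

lemma Lp_complete:
 assumes p: "1 <= p" and u: "!!n. u n \<in> Lp_space p M"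
  and Cauchy: "!!e. 0 < e ==> \<exists>N. \<forall>m\<ge>N. \<forall>n\<ge>N. Lp_norm p M (%x. u m x - u n x) < e"
 shows "\<exists>h \<in> Lp_space p M. (%n. Lp_norm p M (%x. u n x - h x)) \<longlonglongrightarrow> 0"
proof -
 have [measurable]: "u n \<in> borel_measurable M" for n using u[of n] by measurable
 obtain N where N: "!!e m n. 0 < e ==> m >= N e ==> n >= N e ==> Lp_norm p M (%x. u m x - u n x) < e"
  using Cauchy by metis
 have key: "\<exists>h \<in> borel_measurable M. \<forall>e>0. \<forall>n\<ge>N e.
   (%x. u n x - h x) \<in> Lp_space p M & Lp_norm p M (%x. u n x - h x) <= e"
  using p
 proof (cases rule: exponent_ge_1_cases)
  case infinity
  define h where "h x = lim (%n. u n x)" for x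
  have [measurable]: "h \<in> borel_measurable M" unfolding h_def by measurable
  have "AE x in M. \<forall>m n. cmod (u m x - u n x) <= Lp_norm top M (%x. u m x - u n x)"
   unfolding AE_all_countable
   using Lp_space_infty_AE[OF Lp_space_diff(1)[OF p u u, unfolded infinity]] by blast
  then have ae: "AE x in M. \<forall>e>0. \<forall>n\<ge>N e. cmod (u n x - h x) <= e"
  proof eventually_elim
   case (elim x)
   have c: "cmod (u m x - u n x) <= e" if "0 < e" "m >= N e" "n >= N e" for e m n
    using elim[rule_format, of m n] N[OF that] infinity by simp
   have "Cauchy (%n. u n x)"
   proof (rule CauchyI)
    fix e :: real assume "0 < e"
    then show "\<exists>M. \<forall>m\<ge>M. \<forall>n\<ge>M. norm (u m x - u n x) < e"
     by (intro exI[of _ "N (e / 2)"] allI impI le_less_trans[OF c[of "e / 2"]]) auto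
   qed
   then have lim: "(%n. u n x) \<longlonglongrightarrow> h x"
    unfolding h_def by (simp add: Cauchy_convergent_iff convergent_LIMSEQ_iff)
   show ?case
   proof (intro allI impI)
    fix e n assume e: "(0::real) < e" "N e <= n"
    have "(%m. cmod (u n x - u m x)) \<longlonglongrightarrow> cmod (u n x - h x)" by (intro tendsto_intros lim)
    then show "cmod (u n x - h x) <= e"
     by (rule LIMSEQ_le_const2) (use c[OF e(1) e(2)] in blast)
   qed
  qed
  show ?thesis
  proof (intro bexI[of _ h] allI impI)
   fix e n assume e: "(0::real) < e" "N e <= n"
   have "AE x in M. cmod (u n x - h x) <= e" using ae by eventually_elim (use e in blast)
   then show "(%x. u n x - h x) \<in> Lp_space p M & Lp_norm p M (%x. u n x - h x) <= e"
    using e infinity by (auto intro!: Lp_space_inftyI Lp_norm_infty_le)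
  qed simp
 next
  case (finite P)
  \<comment> \<open>Stage k of the subsequence lies beyond the Cauchy index of (1/4)^k, so
    consecutive differences have norm at most 4^(-k).\<close>
  define s where "s = rec_nat (N 1) (%k m. max (Suc m) (N ((1/4::real) ^ Suc k)))"
  have s0: "s (Suc k) = max (Suc (s k)) (N ((1/4) ^ Suc k))" for k by (simp add: s_def)
  have sm: "strict_mono s" by (simp add: strict_mono_Suc_iff s0 less_max_iff_disj)
  have sN: "s k >= N ((1/4) ^ k)" for k by (cases k) (simp_all add: s_def)
  define v where "v k x = u (s (Suc k)) x - u (s k) x" for k x
  have [measurable]: "v k \<in> borel_measurable M" for k unfolding v_def by measurable
  have vL: "v k \<in> Lp_space (ennreal P) M" for k
   unfolding v_def using Lp_space_diff(1)[OF p u u] finite by simp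
  have vN: "Lp_norm (ennreal P) M (v k) <= (1/4) ^ k" for k
  proof -
   have "s k <= s (Suc k)" using sm by (simp add: strict_mono_less_eq)
   then show ?thesis
    unfolding v_def using N[of "(1/4)^k" "s (Suc k)" "s k"] sN[of k] finite by simp
  qed
  \<comment> \<open>The bound 4^(-k) leaves room for the weight 2^k. Finiteness of the weighted sum
    at a point then gives |v k x| <= const 2^(-k), hence absolute convergence of the telescoping
    series there, without the triangle inequality for infinite sums.\<close>
  have sumb: "(nn_integral M (%x. (\<Sum>k. ennreal ((2 ^ k * cmod (v k x)) powr P)))) <= (\<Sum>k. ennreal ((1/2) ^ k))"
  proof -
   have "(nn_integral M (%x. (\<Sum>k. ennreal ((2 ^ k * cmod (v k x)) powr P))))
     = (\<Sum>k. nn_integral M (%x. ennreal ((2 ^ k * cmod (v k x)) powr P)))"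
    by (intro nn_integral_suminf) auto
   also have "... <= (\<Sum>k. ennreal ((1/2) ^ k))"
   proof (intro suminf_le summableI)
    fix k
    have "(nn_integral M (%x. ennreal ((2 ^ k * cmod (v k x)) powr P)))
     = (nn_integral M (%x. ennreal ((2 ^ k) powr P) * ennreal (cmod (v k x) powr P)))"
     by (simp add: powr_mult ennreal_mult)
    also have "... = ennreal ((2 ^ k) powr P) * ennreal (Lp_norm (ennreal P) M (v k) powr P)"
     using finite by (subst nn_integral_cmult) (auto simp: Lp_nn_integral[OF _ vL])
    also have "... <= ennreal ((2 ^ k) powr P) * ennreal (((1/4) ^ k) powr P)"
     using finite vN by (intro mult_left_mono ennreal_leI powr_mono2) auto
    also have "... = ennreal (((1/2) ^ k) powr P)"
    proof -
     have "(2 ^ k * (1/4) ^ k) = ((1/2::real) ^ k)" by (simp add: power_mult_distrib[symmetric])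
     then show ?thesis by (simp add: ennreal_mult[symmetric] powr_mult[symmetric])
    qed
    also have "... <= ennreal ((1/2) ^ k)"
     using finite powr_mono'[of 1 P "(1/2)^k"] by (intro ennreal_leI) (auto simp: power_le_one)
    finally show "(nn_integral M (%x. ennreal ((2 ^ k * cmod (v k x)) powr P))) <= ennreal ((1/2) ^ k)" .
   qed
   finally show ?thesis .
  qed
  have "(\<Sum>k. ennreal ((1/2) ^ k)) = ennreal (\<Sum>k. (1/2) ^ k)"
   by (intro suminf_ennreal_eq) (auto intro: sums_ennreal[THEN iffD2] summable_sums summable_geometric)
  then have "(\<Sum>k. ennreal ((1/2) ^ k)) < top" by simp
  then have "(nn_integral M (%x. (\<Sum>k. ennreal ((2 ^ k * cmod (v k x)) powr P)))) ~= \<infinity>"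
   using sumb by (auto simp: top_unique)
  then have ae: "AE x in M. (\<Sum>k. ennreal ((2 ^ k * cmod (v k x)) powr P)) ~= \<infinity>"
   by (intro nn_integral_noteq_infinite) auto
  define h where "h x = lim (%n. u (s n) x)" for x
  have [measurable]: "h \<in> borel_measurable M" unfolding h_def by measurable
  have lim: "AE x in M. (%k. u (s k) x) \<longlonglongrightarrow> h x"
   using ae
  proof eventually_elim
   case (elim x)
   define w where "w k = ennreal ((2 ^ k * cmod (v k x)) powr P)" for k
   obtain K where K: "0 <= K" "suminf w = ennreal K"
    using elim unfolding w_def[symmetric] by (cases "suminf w") auto
   have vb: "cmod (v k x) <= K powr (1 / P) * (1/2) ^ k" for k
   proof -
    have "w k <= ennreal K" unfolding K(2)[symmetric] using sum_le_suminf[of w "{k}"] by simp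
    then have "(2 ^ k * cmod (v k x)) powr P <= K" unfolding w_def using K(1) by (subst (asm) ennreal_le_iff) auto
    then have "((2 ^ k * cmod (v k x)) powr P) powr (1 / P) <= K powr (1 / P)"
     using finite by (intro powr_mono2) auto
    then have "2 ^ k * cmod (v k x) <= K powr (1 / P)" using finite by (simp add: powr_powr)
    then show ?thesis by (simp add: field_simps power_divide)
   qed
   have "summable (%k. K powr (1 / P) * (1/2) ^ k)" by (intro summable_mult summable_geometric) simp
   then have "summable (%k. v k x)" by (rule summable_comparison_test') (use vb in auto)
   then have "(%n. \<Sum>k<n. v k x) \<longlonglongrightarrow> (\<Sum>k. v k x)" by (rule summable_LIMSEQ)
   then have "(%n. u (s 0) x + (\<Sum>k<n. v k x)) \<longlonglongrightarrow> u (s 0) x + (\<Sum>k. v k x)" by (intro tendsto_intros)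
   moreover have "u (s 0) x + (\<Sum>k<n. v k x) = u (s n) x" for n
    unfolding v_def by (subst sum_lessThan_telescope) simp
   ultimately have "convergent (%n. u (s n) x)" by (auto simp: convergent_def)
   then show ?case by (simp add: h_def convergent_LIMSEQ_iff)
  qed
  show ?thesis
  proof (intro bexI[of _ h] allI impI)
   fix e n assume e: "(0::real) < e" "N e <= n"
   \<comment> \<open>Fatou along the subsequence: every u n with n >= N e stays within e of the
     pointwise limit. In particular h differs from some u n by a function of the space, which puts h
     itself in the space.\<close>
   have "(nn_integral M (%x. ennreal (cmod (u n x - h x) powr P)))
     = (nn_integral M (%x. liminf (%k. ennreal (cmod (u n x - u (s k) x) powr P))))"
   proof (intro nn_integral_cong_AE)
    show "AE x in M. ennreal (cmod (u n x - h x) powr P) = liminf (%k. ennreal (cmod (u n x - u (s k) x) powr P))"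
     using lim
    proof eventually_elim
     case (elim x)
     have "(%k. ennreal (cmod (u n x - u (s k) x) powr P)) \<longlonglongrightarrow> ennreal (cmod (u n x - h x) powr P)"
      using finite by (intro tendsto_ennrealI tendsto_powr' tendsto_intros elim) auto
     then show ?case by (rule lim_imp_Liminf[OF trivial_limit_sequentially, symmetric])
    qed
   qed
   also have "... <= liminf (%k. nn_integral M (%x. ennreal (cmod (u n x - u (s k) x) powr P)))"
    by (intro nn_integral_liminf) auto
   also have "... <= ennreal (e powr P)"
   proof (intro Liminf_le eventually_sequentiallyI)
    fix k assume k: "N e <= k"
    then have "N e <= s k" using strict_mono_imp_increasing[OF sm, of k] by simp
    then have "Lp_norm (ennreal P) M (%x. u n x - u (s k) x) <= e"
     using N[OF e(1) e(2), of "s k"] finite by simp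
    then show "(nn_integral M (%x. ennreal (cmod (u n x - u (s k) x) powr P))) <= ennreal (e powr P)"
     using finite Lp_space_diff(1)[OF p u u, of n "s k"]
     by (subst Lp_nn_integral) (auto intro!: powr_mono2)
   qed simp
   finally show "(%x. u n x - h x) \<in> Lp_space p M & Lp_norm p M (%x. u n x - h x) <= e"
    using Lp_nn_integralI[of P "%x. u n x - h x" M e] finite e by auto
  qed simp
 qed
 then obtain h where [measurable]: "h \<in> borel_measurable M"
  and h: "!!e n. 0 < e ==> N e <= n ==> (%x. u n x - h x) \<in> Lp_space p M & Lp_norm p M (%x. u n x - h x) <= e"
  by blast
 have "h \<in> Lp_space p M"
  using Lp_space_diff(1)[OF p u[of "N 1"], of "%x. u (N 1) x - h x"] h[of 1 "N 1"] by simp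
 moreover have "(%n. Lp_norm p M (%x. u n x - h x)) \<longlonglongrightarrow> 0"
 proof (rule LIMSEQ_I)
  fix e :: real assume "0 < e"
  have "norm (Lp_norm p M (%x. u n x - h x) - 0) < e" if "N (e / 2) <= n" for n
   using h[of "e / 2" n] that \<open>0 < e\<close> by (simp only: diff_0_right real_norm_def abs_of_nonneg[OF Lp_norm_nonneg]) auto
  then show "\<exists>no. \<forall>n\<ge>no. norm (Lp_norm p M (%x. u n x - h x) - 0) < e" by blast
 qed
 ultimately show ?thesis by blast
qed

text \<open>Interpolation between L^1 and L^infinity in its simplest form, |f|^P <= A^(P-1) |f|.
  Writing 1/p as \<open>enn2real (inverse p)\<close> lets p = infinity share the formula, and
  keeping A and B apart preserves the exact dependence on the scale when f is a wavelet
  atom.\<close>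

lemma bounded_integrable_in_Lp:
 fixes f :: "'a => complex"
 assumes p: "1 <= p" and [measurable]: "f \<in> borel_measurable M"
  and A: "0 < A" "AE x in M. cmod (f x) <= A"
  and B: "0 < B" "(nn_integral M (%x. ennreal (cmod (f x)))) <= ennreal B"
 shows "f \<in> Lp_space p M"
  and "Lp_norm p M f <= A powr (1 - enn2real (inverse p)) * B powr enn2real (inverse p)"
proof -
 have "f \<in> Lp_space p M & Lp_norm p M f <= A powr (1 - enn2real (inverse p)) * B powr enn2real (inverse p)"
  using p
 proof (cases rule: exponent_ge_1_cases)
  case infinity
  then show ?thesis using A B by (auto intro: Lp_space_inftyI Lp_norm_infty_le)
 next
  case (finite P)
  have inv: "enn2real (inverse p) = 1 / P" using finite by (simp add: inverse_ennreal inverse_eq_divide)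
  define C where "C = A powr (1 - 1 / P) * B powr (1 / P)"
  have C: "C powr P = A powr (P - 1) * B" "0 <= C"
  proof -
   have "(1 - 1 / P) * P = P - 1" using finite by (simp add: field_simps)
   then show "C powr P = A powr (P - 1) * B" using finite B by (simp add: C_def powr_mult powr_powr)
  qed (simp add: C_def)
  have "(nn_integral M (%x. ennreal (cmod (f x) powr P))) <= (nn_integral M (%x. ennreal (A powr (P - 1)) * ennreal (cmod (f x))))"
  proof (intro nn_integral_mono_AE)
   show "AE x in M. ennreal (cmod (f x) powr P) <= ennreal (A powr (P - 1)) * ennreal (cmod (f x))"
    using A(2)
   proof eventually_elim
    case (elim x)
    have "cmod (f x) powr P = cmod (f x) powr (P - 1) * cmod (f x)"
     using powr_mult_base[of "cmod (f x)" "P - 1"] by (simp add: mult.commute)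
    also have "... <= A powr (P - 1) * cmod (f x)"
     using elim finite by (intro mult_right_mono powr_mono2) auto
    finally show ?case by (simp add: ennreal_mult[symmetric] ennreal_leI)
   qed
  qed
  also have "... <= ennreal (A powr (P - 1)) * ennreal B"
   using B by (subst nn_integral_cmult) (auto intro: mult_left_mono)
  also have "... = ennreal (C powr P)" using B C by (simp add: ennreal_mult)
  finally show ?thesis
   using Lp_nn_integralI[of P f M C] finite C(2) unfolding inv C_def[symmetric] by simp
 qed
 then show "f \<in> Lp_space p M"
  and "Lp_norm p M f <= A powr (1 - enn2real (inverse p)) * B powr enn2real (inverse p)" by auto
qed

corollary bounded_integrable_in_Lp':
 fixes f :: "'a => complex"
 assumes p: "1 <= p" and [measurable]: "f \<in> borel_measurable M"
  and A: "0 < A" "AE x in M. cmod (f x) <= A" "(nn_integral M (%x. ennreal (cmod (f x)))) <= ennreal A"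
 shows "f \<in> Lp_space p M" "Lp_norm p M f <= A"
 using bounded_integrable_in_Lp[of p f M A A] assms by (simp_all add: powr_add[symmetric])

section \<open>Finite rank approximation, compactness, and operators given by forms\<close>

definition finite_rank_approximable ::
 "ennreal => 'a measure => (('a => complex) => ('a => complex)) => bool" where
 "finite_rank_approximable p M T \<longleftrightarrow>
  (\<forall>e>0. \<exists>(n::nat) c h C. 0 <= C & (\<forall>i<n. h i \<in> Lp_space p M) &
    (\<forall>i<n. \<forall>f \<in> Lp_space p M. cmod (c i f) <= C * Lp_norm p M f) &
    (\<forall>f \<in> Lp_space p M. Lp_norm p M (%x. T f x - (\<Sum>i<n. c i f * h i x)) <= e * Lp_norm p M f))"

text \<open>Given a bounded sequence, the coefficients of all approximants, for all accuracies
  1/(k+1), are countably many bounded scalar sequences; a diagonal argument makes them converge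
  along one subsequence. Along it the images under T are Cauchy. Extraction works with scalars
  alone, so a bound on each coefficient is what the notion of approximability records.\<close>

lemma finite_rank_approximable_imp_compact:
 assumes p: "1 <= p" and T: "bounded_linear_op_Lp p M T" and fr: "finite_rank_approximable p M T"
 shows "compact_op_Lp p M T"
 unfolding compact_op_Lp_def
proof (intro conjI allI impI T)
 fix F :: "nat => 'a => complex"
 assume "(\<forall>n. F n \<in> Lp_space p M) & (\<exists>B. \<forall>n. Lp_norm p M (F n) <= B)"
 then obtain B0 where F: "!!n. F n \<in> Lp_space p M" and B0: "!!n. Lp_norm p M (F n) <= B0" by blast
 define B where "B = max B0 1"
 have B: "Lp_norm p M (F n) <= B" "B > 0" for n using B0[of n] by (auto simp: B_def)
 have TL: "T f \<in> Lp_space p M" if "f \<in> Lp_space p M" for f using T that by (auto simp: bounded_linear_op_Lp_def)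
 define Q where "Q k n c h C \<longleftrightarrow> 0 <= C & (\<forall>i<n. h i \<in> Lp_space p M) &
    (\<forall>i<n. \<forall>f \<in> Lp_space p M. cmod (c i f) <= C * Lp_norm p M f) &
    (\<forall>f \<in> Lp_space p M. Lp_norm p M (%x. T f x - (\<Sum>i<n. c i f * h i x)) <= 1 / real (Suc k) * Lp_norm p M f)"
  for k n :: nat and c h and C :: real
 have "\<exists>n c h C. Q k n c h C" for k
 proof -
  have "0 < 1 / real (Suc k)" by simp
  then show ?thesis using fr unfolding finite_rank_approximable_def Q_def by blast
 qed
 then obtain n c h C where "!!k. Q k (n k) (c k) (h k) (C k)" by metis
 note nchC = this[unfolded Q_def]
 \<comment> \<open>Indexing by pairs (k, i) lets one diagonal extraction serve all approximants.
   Division by the common bound brings everything into the unit disc, and the + 1 keeps the divisor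
   positive.\<close>
 define a where "a m = (%(k, i). if i < n k then c k i (F m) / of_real (C k * B + 1) else 0)" for m
 have a1: "norm (a m x) <= 1" for m x
 proof (cases x)
  case (Pair k i)
  show ?thesis
  proof (cases "i < n k")
   case True
   have "cmod (c k i (F m)) <= C k * Lp_norm p M (F m)" using nchC[of k] True F by blast
   also have "... <= C k * B" using B nchC[of k] by (intro mult_left_mono) auto
   finally have "cmod (c k i (F m)) <= C k * B + 1" by simp
   moreover have "C k * B + 1 > 0" using B(2) nchC[of k] by (intro add_nonneg_pos mult_nonneg_nonneg) auto
   ultimately show ?thesis using True Pair by (simp only: a_def split_conv if_True norm_divide norm_of_real) simp
  qed (simp add: a_def Pair)
 qed
 obtain s where s: "strict_mono s" and lim: "!!x. \<exists>l. (%m. a (s m) x) \<longlonglongrightarrow> l"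
  using function_convergent_subsequence[of "UNIV :: (nat \<times> nat) set" a 1] a1 by auto
 have conv: "\<exists>l. (%m. c k i (F (s m))) \<longlonglongrightarrow> l" if "i < n k" for k i
 proof -
  obtain l where l: "(%m. a (s m) (k, i)) \<longlonglongrightarrow> l" using lim by blast
  have "C k * B + 1 > 0" using B(2) nchC[of k] by (intro add_nonneg_pos mult_nonneg_nonneg) auto
  then have ne: "complex_of_real (C k * B + 1) ~= 0" by (metis of_real_eq_0_iff less_irrefl)
  have "(%m. a (s m) (k, i) * of_real (C k * B + 1)) \<longlonglongrightarrow> l * of_real (C k * B + 1)"
   by (intro tendsto_intros l)
  moreover have "a (s m) (k, i) * of_real (C k * B + 1) = c k i (F (s m))" for m
   using that ne by (simp add: a_def del: of_real_add of_real_mult)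
  ultimately show ?thesis by auto
 qed
 have TFs: "T (F (s m)) \<in> Lp_space p M" for m using TL F by blast
 have "\<exists>h \<in> Lp_space p M. (%m. Lp_norm p M (%x. T (F (s m)) x - h x)) \<longlonglongrightarrow> 0"
 proof (rule Lp_complete[OF p TFs])
  fix e :: real assume e: "0 < e"
  \<comment> \<open>Each of the two approximation errors stays below e/4 and the finite rank part
    contributes at most e/4, so the total stays below e.\<close>
  obtain k where "B / (e / 4) < real k" using reals_Archimedean2 by blast
  then have k: "1 / real (Suc k) * B < e / 4" using e by (simp add: field_simps)
  define R where "R m x = (\<Sum>i<n k. c k i (F m) * h k i x)" for m x
  have hL: "h k i \<in> Lp_space p M" if "i < n k" for i using nchC[of k] that by blast
  have RL: "R m \<in> Lp_space p M" for m
   unfolding R_def using Lp_space_cmult(1)[OF p hL] by (intro Lp_space_sum(1)[OF p]) auto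
  have TR: "Lp_norm p M (%x. T (F m) x - R m x) < e / 4" for m
  proof -
   have "Lp_norm p M (%x. T (F m) x - R m x) <= 1 / real (Suc k) * Lp_norm p M (F m)"
    unfolding R_def using nchC[of k] F by blast
   also have "... <= 1 / real (Suc k) * B" by (intro mult_left_mono B) auto
   finally show ?thesis using k by linarith
  qed
  define H where "H = (\<Sum>i<n k. Lp_norm p M (h k i)) + 1"
  have H: "H > 0" unfolding H_def by (intro add_nonneg_pos sum_nonneg) auto
  have "\<exists>N. \<forall>m\<ge>N. \<forall>m'\<ge>N. cmod (c k i (F (s m)) - c k i (F (s m'))) < e / (4 * H)" if "i < n k" for i
  proof -
   have "Cauchy (%m. c k i (F (s m)))" using conv[OF that] by (auto intro: LIMSEQ_imp_Cauchy)
   then show ?thesis using e H by (auto simp: Cauchy_iff)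
  qed
  then obtain N where N: "!!i m m'. i < n k ==> m >= N i ==> m' >= N i ==>
    cmod (c k i (F (s m)) - c k i (F (s m'))) < e / (4 * H)" by metis
  have RR: "Lp_norm p M (%x. R (s m) x - R (s m') x) <= e / 4"
   if "m >= Max (insert 0 (N ` {..<n k}))" "m' >= Max (insert 0 (N ` {..<n k}))" for m m'
  proof -
   have "R (s m) x - R (s m') x = (\<Sum>i<n k. (c k i (F (s m)) - c k i (F (s m'))) * h k i x)" for x
    by (simp add: R_def sum_subtractf left_diff_distrib)
   then have "Lp_norm p M (%x. R (s m) x - R (s m') x)
     <= (\<Sum>i<n k. Lp_norm p M (%x. (c k i (F (s m)) - c k i (F (s m'))) * h k i x))"
    using Lp_space_sum(2)[OF p, of "{..<n k}" "%i x. (c k i (F (s m)) - c k i (F (s m'))) * h k i x"]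
     Lp_space_cmult(1)[OF p hL] by auto
   also have "... = (\<Sum>i<n k. cmod (c k i (F (s m)) - c k i (F (s m'))) * Lp_norm p M (h k i))"
    using Lp_space_cmult(2)[OF p hL] by (intro sum.cong) auto
   also have "... <= (\<Sum>i<n k. e / (4 * H) * Lp_norm p M (h k i))"
   proof (intro sum_mono mult_right_mono Lp_norm_nonneg)
    fix i assume i: "i \<in> {..<n k}"
    then have "N i <= Max (insert 0 (N ` {..<n k}))" by (intro Max_ge) auto
    then have "m >= N i" "m' >= N i" using that by (meson order_trans)+
    then show "cmod (c k i (F (s m)) - c k i (F (s m'))) <= e / (4 * H)" using N[of i m m'] i by simp
   qed
   also have "... = e / (4 * H) * (H - 1)" by (simp add: H_def sum_distrib_left)
   also have "... <= e / (4 * H) * H" using e H by (intro mult_left_mono) auto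
   also have "... = e / 4" using H by simp
   finally show ?thesis .
  qed
  show "\<exists>N. \<forall>m\<ge>N. \<forall>m'\<ge>N. Lp_norm p M (%x. T (F (s m)) x - T (F (s m')) x) < e"
  proof (intro exI allI impI)
   fix m m' assume m: "Max (insert 0 (N ` {..<n k})) <= m" "Max (insert 0 (N ` {..<n k})) <= m'"
   have 1: "Lp_norm p M (%x. T (F (s m)) x - T (F (s m')) x)
    <= Lp_norm p M (%x. T (F (s m)) x - R (s m) x) + Lp_norm p M (%x. R (s m) x - T (F (s m')) x)"
    by (rule Lp_norm_triangle_diff[OF p TFs RL TFs])
   have 2: "Lp_norm p M (%x. R (s m) x - T (F (s m')) x)
    <= Lp_norm p M (%x. R (s m) x - R (s m') x) + Lp_norm p M (%x. R (s m') x - T (F (s m')) x)"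
    by (rule Lp_norm_triangle_diff[OF p RL RL TFs])
   have 3: "Lp_norm p M (%x. R (s m') x - T (F (s m')) x) = Lp_norm p M (%x. T (F (s m')) x - R (s m') x)"
    by (rule Lp_norm_diff_commute)
   show "Lp_norm p M (%x. T (F (s m)) x - T (F (s m')) x) < e"
    using e 1 2 3 TR[of "s m"] TR[of "s m'"] RR[OF m] by linarith
  qed
 qed
 then show "\<exists>h\<in>Lp_space p M. \<exists>s. strict_mono s & (%m. Lp_norm p M (%x. T (F (s m)) x - h x)) \<longlonglongrightarrow> 0"
  using s by blast
qed

lemma Lp_pairing_tendsto:
 assumes pq: "inverse p + inverse q = 1" and u: "!!n. u n \<in> Lp_space p M" and h: "h \<in> Lp_space p M"
  and g: "g \<in> Lp_space q M" and lim: "(%n. Lp_norm p M (%x. u n x - h x)) \<longlonglongrightarrow> 0"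
 shows "(%n. LINT x|M. u n x * cnj (g x)) \<longlonglongrightarrow> (LINT x|M. h x * cnj (g x))"
proof -
 have p: "1 <= p" using conjugate_exponent_ge_1[OF pq] by simp
 have "(%n. Lp_norm p M (%x. u n x - h x) * Lp_norm q M g) \<longlonglongrightarrow> 0 * Lp_norm q M g"
  by (intro tendsto_intros lim)
 then have z: "(%n. Lp_norm p M (%x. u n x - h x) * Lp_norm q M g) \<longlonglongrightarrow> 0" by simp
 have "(%n. (LINT x|M. u n x * cnj (g x)) - (LINT x|M. h x * cnj (g x))) \<longlonglongrightarrow> 0"
 proof (rule Lim_null_comparison[OF _ z])
  show "\<forall>\<^sub>F n in sequentially. cmod ((LINT x|M. u n x * cnj (g x)) - (LINT x|M. h x * cnj (g x)))
    <= Lp_norm p M (%x. u n x - h x) * Lp_norm q M g"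
  proof (intro always_eventually allI)
   fix n
   have "(LINT x|M. u n x * cnj (g x)) - (LINT x|M. h x * cnj (g x)) = (LINT x|M. (u n x - h x) * cnj (g x))"
    using Lp_pairing(1)[OF pq u g] Lp_pairing(1)[OF pq h g] by (simp add: left_diff_distrib)
   then show "cmod ((LINT x|M. u n x * cnj (g x)) - (LINT x|M. h x * cnj (g x)))
    <= Lp_norm p M (%x. u n x - h x) * Lp_norm q M g"
    using Lp_pairing(2)[OF pq Lp_space_diff(1)[OF p u h] g] by simp
  qed
 qed
 then show ?thesis by (simp add: LIM_zero_iff)
qed

lemma Lp_AE_eqI:
 assumes sf: "sigma_finite_measure M" and pq: "inverse p + inverse q = 1"
  and h: "h \<in> Lp_space p M" "k \<in> Lp_space p M"
  and eq: "!!g. g \<in> Lp_space q M ==> (LINT x|M. h x * cnj (g x)) = (LINT x|M. k x * cnj (g x))"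
 shows "AE x in M. h x = k x"
proof -
 have p: "1 <= p" using conjugate_exponent_ge_1[OF pq] by simp
 have "Lp_norm p M (%x. h x - k x) <= 0"
 proof (rule Lp_norm_dual_le[OF sf pq Lp_space_diff(1)[OF p h]])
  fix g assume g: "g \<in> Lp_space q M"
  have "(LINT x|M. (h x - k x) * cnj (g x)) = 0"
   using Lp_pairing(1)[OF pq h(1) g] Lp_pairing(1)[OF pq h(2) g] eq[OF g] by (simp add: left_diff_distrib)
  then show "cmod (LINT x|M. (h x - k x) * cnj (g x)) <= 0 * Lp_norm q M g" by simp
 qed simp
 then have "Lp_norm p M (%x. h x - k x) = 0" by (simp add: order_antisym)
 then have "AE x in M. h x - k x = 0" by (rule Lp_norm_eq_0_AE[OF p Lp_space_diff(1)[OF p h]])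
 then show ?thesis by simp
qed

text \<open>Instead of representing a functional on L^q, which fails for q = infinity, the value T f
  is obtained as the limit of S n f: the form compares two approximants, and the converse of Hoelder
  turns this into a Cauchy estimate in norm. The same estimate says that S n tends to T in operator
  norm, so T inherits finite rank approximability.\<close>

lemma compact_operator_of_form:
 fixes B :: "('a => complex) => ('a => complex) => complex"
 assumes sf: "sigma_finite_measure M" and pq: "inverse p + inverse q = 1"
  and add: "!!f f' g. f \<in> Lp_space p M ==> f' \<in> Lp_space p M ==> g \<in> Lp_space q M ==>
    B (%x. f x + f' x) g = B f g + B f' g"
  and cmult: "!!f c g. f \<in> Lp_space p M ==> g \<in> Lp_space q M ==> B (%x. c * f x) g = c * B f g"
  and bound: "!!f g. f \<in> Lp_space p M ==> g \<in> Lp_space q M ==>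
    cmod (B f g) <= C * Lp_norm p M f * Lp_norm q M g" and C: "0 <= C"
  and S: "!!n f. f \<in> Lp_space p M ==> S n f \<in> Lp_space p M"
  and fr: "!!n. finite_rank_approximable p M (S n)"
  and approx: "!!n f g. f \<in> Lp_space p M ==> g \<in> Lp_space q M ==>
    cmod (B f g - (LINT x|M. S n f x * cnj (g x))) <= \<delta> n * Lp_norm p M f * Lp_norm q M g"
  and \<delta>: "\<delta> \<longlonglongrightarrow> (0::real)" "!!n. 0 <= \<delta> n"
 shows "\<exists>T. compact_op_Lp p M T &
  (\<forall>f \<in> Lp_space p M. \<forall>g \<in> Lp_space q M. (LINT x|M. T f x * cnj (g x)) = B f g)"
proof -
 have p: "1 <= p" using conjugate_exponent_ge_1[OF pq] by simp
 have ex: "\<exists>h \<in> Lp_space p M. \<forall>g \<in> Lp_space q M. (LINT x|M. h x * cnj (g x)) = B f g"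
  if f: "f \<in> Lp_space p M" for f
 proof -
  have Sd: "Lp_norm p M (%x. S m f x - S n f x) <= (\<delta> m + \<delta> n) * Lp_norm p M f" for m n
  proof (rule Lp_norm_dual_le[OF sf pq Lp_space_diff(1)[OF p S[OF f] S[OF f]]])
   fix g assume g: "g \<in> Lp_space q M"
   have "(LINT x|M. (S m f x - S n f x) * cnj (g x))
    = (B f g - (LINT x|M. S n f x * cnj (g x))) - (B f g - (LINT x|M. S m f x * cnj (g x)))"
    using Lp_pairing(1)[OF pq S[OF f] g] by (simp add: left_diff_distrib)
   then have "cmod (LINT x|M. (S m f x - S n f x) * cnj (g x))
    <= cmod (B f g - (LINT x|M. S n f x * cnj (g x))) + cmod (B f g - (LINT x|M. S m f x * cnj (g x)))"
    by (simp only: norm_triangle_ineq4)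
   also have "... <= \<delta> n * Lp_norm p M f * Lp_norm q M g + \<delta> m * Lp_norm p M f * Lp_norm q M g"
    using approx[OF f g] by (intro add_mono) auto
   finally show "cmod (LINT x|M. (S m f x - S n f x) * cnj (g x)) <= (\<delta> m + \<delta> n) * Lp_norm p M f * Lp_norm q M g"
    by (simp add: algebra_simps)
  qed (use \<delta> in auto)
  have "\<exists>h \<in> Lp_space p M. (%n. Lp_norm p M (%x. S n f x - h x)) \<longlonglongrightarrow> 0"
  proof (rule Lp_complete[OF p S[OF f]])
   fix e :: real assume e: "0 < e"
   define K where "K = Lp_norm p M f + 1"
   have K: "K > 0" "Lp_norm p M f <= K" unfolding K_def using Lp_norm_nonneg[of p M f] by linarith+
   obtain N where N: "!!n. n >= N ==> \<delta> n < e / (2 * K)"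
    using order_tendstoD(2)[OF \<delta>(1), of "e / (2 * K)"] e K by (auto simp: eventually_sequentially)
   show "\<exists>N. \<forall>m\<ge>N. \<forall>n\<ge>N. Lp_norm p M (%x. S m f x - S n f x) < e"
   proof (intro exI[of _ N] allI impI)
    fix m n assume mn: "m >= N" "n >= N"
    have "Lp_norm p M (%x. S m f x - S n f x) <= (\<delta> m + \<delta> n) * Lp_norm p M f" by (rule Sd)
    also have "... <= (\<delta> m + \<delta> n) * K" using \<delta>(2) K by (intro mult_left_mono) auto
    also have "... < (e / (2 * K) + e / (2 * K)) * K" using N[OF mn(1)] N[OF mn(2)] K by (intro mult_strict_right_mono) auto
    also have "... = e" using K by simp
    finally show "Lp_norm p M (%x. S m f x - S n f x) < e" .
   qed
  qed
  then obtain h where h: "h \<in> Lp_space p M" "(%n. Lp_norm p M (%x. S n f x - h x)) \<longlonglongrightarrow> 0" by blast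
  show ?thesis
  proof (intro bexI[OF _ h(1)] ballI)
   fix g assume g: "g \<in> Lp_space q M"
   have 1: "(%n. LINT x|M. S n f x * cnj (g x)) \<longlonglongrightarrow> (LINT x|M. h x * cnj (g x))"
    by (rule Lp_pairing_tendsto[OF pq S[OF f] h(1) g h(2)])
   have "(%n. \<delta> n * Lp_norm p M f * Lp_norm q M g) \<longlonglongrightarrow> 0 * Lp_norm p M f * Lp_norm q M g"
    by (intro tendsto_intros \<delta>)
   then have z: "(%n. \<delta> n * Lp_norm p M f * Lp_norm q M g) \<longlonglongrightarrow> 0" by simp
   have "(%n. B f g - (LINT x|M. S n f x * cnj (g x))) \<longlonglongrightarrow> 0"
    by (rule Lim_null_comparison[OF _ z]) (use approx[OF f g] in auto)
   then have "(%n. B f g - (B f g - (LINT x|M. S n f x * cnj (g x)))) \<longlonglongrightarrow> B f g - 0"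
    by (intro tendsto_intros)
   then have "(%n. LINT x|M. S n f x * cnj (g x)) \<longlonglongrightarrow> B f g" by simp
   then show "(LINT x|M. h x * cnj (g x)) = B f g" using 1 LIMSEQ_unique by blast
  qed
 qed
 \<comment> \<open>The representing function is determined only up to a null set, so linearity of
   this choice can only be expected almost everywhere; it follows by testing against all g.\<close>
 define T where "T f = (SOME h. h \<in> Lp_space p M & (\<forall>g \<in> Lp_space q M. (LINT x|M. h x * cnj (g x)) = B f g))" for f
 have T: "T f \<in> Lp_space p M" "g \<in> Lp_space q M ==> (LINT x|M. T f x * cnj (g x)) = B f g"
  if "f \<in> Lp_space p M" for f g
  using someI_ex[of "%h. h \<in> Lp_space p M & (\<forall>g \<in> Lp_space q M. (LINT x|M. h x * cnj (g x)) = B f g)"] ex[OF that]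
  unfolding T_def[symmetric] by blast+
 have bl: "bounded_linear_op_Lp p M T"
  unfolding bounded_linear_op_Lp_def
 proof (intro conjI ballI allI)
  fix f f' assume f: "f \<in> Lp_space p M" "f' \<in> Lp_space p M"
  show "AE x in M. T (%y. f y + f' y) x = T f x + T f' x"
  proof (rule Lp_AE_eqI[OF sf pq])
   fix g assume g: "g \<in> Lp_space q M"
   have "(LINT x|M. (T f x + T f' x) * cnj (g x)) = B f g + B f' g"
    using Lp_pairing(1)[OF pq T(1)[OF f(1)] g] Lp_pairing(1)[OF pq T(1)[OF f(2)] g]
    by (simp add: distrib_right T(2)[OF f(1) g] T(2)[OF f(2) g])
   then show "(LINT x|M. T (%y. f y + f' y) x * cnj (g x)) = (LINT x|M. (T f x + T f' x) * cnj (g x))"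
    using T(2)[OF Lp_space_add(1)[OF p f] g] add[OF f g] by simp
  qed (intro T(1) Lp_space_add(1)[OF p] f)+
 next
  fix f c assume f: "f \<in> Lp_space p M"
  show "AE x in M. T (%y. c * f y) x = c * T f x"
  proof (rule Lp_AE_eqI[OF sf pq])
   fix g assume g: "g \<in> Lp_space q M"
   have "(LINT x|M. (c * T f x) * cnj (g x)) = c * B f g"
    using T(2)[OF f g] by (simp add: mult.assoc)
   then show "(LINT x|M. T (%y. c * f y) x * cnj (g x)) = (LINT x|M. (c * T f x) * cnj (g x))"
    using T(2)[OF Lp_space_cmult(1)[OF p f] g] cmult[OF f g] by simp
  qed (intro T(1) Lp_space_cmult(1)[OF p] f)+
 next
  show "\<exists>B. \<forall>f\<in>Lp_space p M. Lp_norm p M (T f) <= B * Lp_norm p M f"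
  proof (intro exI[of _ C] ballI)
   fix f assume f: "f \<in> Lp_space p M"
   show "Lp_norm p M (T f) <= C * Lp_norm p M f"
    by (rule Lp_norm_dual_le[OF sf pq T(1)[OF f]]) (use bound[OF f] T(2)[OF f] C in auto)
  qed
 qed (use T in auto)
 have "finite_rank_approximable p M T"
  unfolding finite_rank_approximable_def
 proof (intro allI impI)
  fix e :: real assume e: "0 < e"
  obtain n where n: "\<delta> n < e / 2"
   using order_tendstoD(2)[OF \<delta>(1), of "e / 2"] e by (auto simp: eventually_sequentially)
  define Q where "Q N c h D \<longleftrightarrow> 0 <= D & (\<forall>i<N. h i \<in> Lp_space p M) &
    (\<forall>i<N. \<forall>f \<in> Lp_space p M. cmod (c i f) <= D * Lp_norm p M f) &
    (\<forall>f \<in> Lp_space p M. Lp_norm p M (%x. S n f x - (\<Sum>i<N. c i f * h i x)) <= e / 2 * Lp_norm p M f)"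
   for N :: nat and c h and D :: real
  have "0 < e / 2" using e by simp
  then have "\<exists>N c h D. Q N c h D" using fr[of n] unfolding finite_rank_approximable_def Q_def by blast
  then obtain N c h D where "Q N c h D" by blast
  then have *: "0 <= D" "!!i. i < N ==> h i \<in> Lp_space p M"
   "!!i f. i < N ==> f \<in> Lp_space p M ==> cmod (c i f) <= D * Lp_norm p M f"
   "!!f. f \<in> Lp_space p M ==> Lp_norm p M (%x. S n f x - (\<Sum>i<N. c i f * h i x)) <= e / 2 * Lp_norm p M f"
   unfolding Q_def by blast+
  have "Lp_norm p M (%x. T f x - (\<Sum>i<N. c i f * h i x)) <= e * Lp_norm p M f" if f: "f \<in> Lp_space p M" for f
  proof -
   have hL: "(%x. \<Sum>i<N. c i f * h i x) \<in> Lp_space p M"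
    using Lp_space_cmult(1)[OF p *(2)] by (intro Lp_space_sum(1)[OF p]) auto
   have "Lp_norm p M (%x. T f x - S n f x) <= \<delta> n * Lp_norm p M f"
   proof (rule Lp_norm_dual_le[OF sf pq Lp_space_diff(1)[OF p T(1)[OF f] S[OF f]]])
    fix g assume g: "g \<in> Lp_space q M"
    have "(LINT x|M. (T f x - S n f x) * cnj (g x)) = B f g - (LINT x|M. S n f x * cnj (g x))"
     using Lp_pairing(1)[OF pq T(1)[OF f] g] Lp_pairing(1)[OF pq S[OF f] g] by (simp add: left_diff_distrib T(2)[OF f g])
    then show "cmod (LINT x|M. (T f x - S n f x) * cnj (g x)) <= \<delta> n * Lp_norm p M f * Lp_norm q M g"
     using approx[OF f g] by simp
   qed (use \<delta> in auto)
   also have "... <= e / 2 * Lp_norm p M f" using n by (intro mult_right_mono) auto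
   finally show ?thesis
    using Lp_norm_triangle_diff[OF p T(1)[OF f] S[OF f, of n] hL] *(4)[OF f] by (simp add: field_simps)
  qed
  then show "\<exists>(n::nat) c h C. 0 <= C & (\<forall>i<n. h i \<in> Lp_space p M) &
    (\<forall>i<n. \<forall>f \<in> Lp_space p M. cmod (c i f) <= C * Lp_norm p M f) &
    (\<forall>f \<in> Lp_space p M. Lp_norm p M (%x. T f x - (\<Sum>i<n. c i f * h i x)) <= e * Lp_norm p M f)"
   using *(1-3) by (intro exI[of _ N] exI[of _ c] exI[of _ h] exI[of _ D]) auto
 qed
 then show ?thesis using finite_rank_approximable_imp_compact[OF p bl] T(2) by blast
qed

section \<open>Superpositions of kernels and approximation by finite rank operators\<close>

lemma norm_integral_le_AE:
 fixes f :: "'a => 'b::{banach, second_countable_topology}" and g :: "'a => real"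
 assumes "integrable M g" and le: "AE x in M. norm (f x) <= g x"
 shows "norm (LINT x|M. f x) <= (LINT x|M. g x)"
proof -
 have "norm (LINT x|M. f x) <= (LINT x|M. norm (f x))" by (rule integral_norm_bound)
 also have "... <= (LINT x|M. g x)"
  using assms(1) le by (rule integral_mono_AE') (use le in \<open>auto elim!: eventually_mono intro: order_trans[OF norm_ge_zero]\<close>)
 finally show ?thesis .
qed

lemma norm_integral_le_nn_integral:
 fixes f :: "'a => 'b::{banach, second_countable_topology}"
 shows "ennreal (norm (LINT x|M. f x)) <= (nn_integral M (%x. ennreal (norm (f x))))"
 by (cases "integrable M f") (auto simp: integral_norm_bound_ennreal not_integrable_integral_eq)

lemma integrable_mult_bounded:
 fixes w u :: "'z => complex"
 assumes w: "integrable Z w" and u[measurable]: "u \<in> borel_measurable Z" and A: "!!z. z \<in> space Z ==> cmod (u z) <= A"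
 shows "integrable Z (%z. w z * u z)"
proof (rule integrable_dominated[of Z "%z. A * cmod (w z)"])
 have [measurable]: "w \<in> borel_measurable Z" using w by auto
 show "(%z. w z * u z) \<in> borel_measurable Z" by measurable
 show "AE z in Z. norm (w z * u z) <= norm (A * cmod (w z))"
  using order_trans[OF A abs_ge_self] by (intro AE_I2) (simp add: norm_mult abs_mult mult.commute[of "cmod (w _)"] mult_right_mono)
qed (use w in auto)

text \<open>The last claim is Minkowski's integral inequality by duality: pair with g, exchange the
  integrals, and bound slice by slice. The uniform bounds in L^1 and L^infinity put the
  superposition in both spaces, hence in every L^p, and also provide the absolute integrability that
  Fubini requires.\<close>

lemma superposition_in_Lp:
 fixes K :: "'z \<times> 'a => complex" and w :: "'z => complex"
 assumes Z: "sigma_finite_measure Z" and M: "sigma_finite_measure M"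
  and pq: "inverse p + inverse q = 1"
  and w: "integrable Z w" and K[measurable]: "K \<in> borel_measurable (Z \<Otimes>\<^sub>M M)"
  and A: "0 <= A" "!!z x. z \<in> space Z ==> x \<in> space M ==> cmod (K (z, x)) <= A"
   "!!z. z \<in> space Z ==> (nn_integral M (%x. ennreal (cmod (K (z, x))))) <= ennreal A"
 defines "F \<equiv> %x. LINT z|Z. w z * K (z, x)"
 shows "F \<in> Lp_space p M"
  and "g \<in> Lp_space q M ==> (LINT x|M. F x * cnj (g x)) = (LINT z|Z. w z * (LINT x|M. K (z, x) * cnj (g x)))"
  and "(!!z. z \<in> space Z ==> Lp_norm p M (%x. K (z, x)) <= b z) ==> integrable Z (%z. cmod (w z) * b z) ==>
   Lp_norm p M F <= (LINT z|Z. cmod (w z) * b z)"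
proof -
 interpret Z: sigma_finite_measure Z by fact
 interpret M: sigma_finite_measure M by fact
 interpret pair_sigma_finite Z M ..
 have [measurable]: "w \<in> borel_measurable Z" using w by auto
 have p: "1 <= p" and q: "1 <= q" using conjugate_exponent_ge_1[OF pq] by auto
 have [measurable]: "F \<in> borel_measurable M" unfolding F_def by measurable
 define W where "W = (LINT z|Z. cmod (w z))"
 have W: "(nn_integral Z (%z. ennreal (cmod (w z)))) = ennreal W" "0 <= W"
  unfolding W_def using w by (auto intro!: nn_integral_eq_integral)
 define A' where "A' = A * W + 1"
 have A': "A' > 0" "A * W <= A'" unfolding A'_def using A W by (auto intro: add_nonneg_pos)
 have Fle: "cmod (F x) <= A'" if "x \<in> space M" for x
 proof -
  have "cmod (F x) <= (LINT z|Z. A * cmod (w z))"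
   unfolding F_def
  proof (rule norm_integral_le_AE)
   show "integrable Z (%z. A * cmod (w z))" using w by auto
   show "AE z in Z. cmod (w z * K (z, x)) <= A * cmod (w z)"
    using A(2) that by (intro AE_I2) (simp add: norm_mult mult.commute[of A] mult_left_mono)
  qed
  also have "... = A * W" by (simp add: W_def)
  finally show ?thesis using A' by simp
 qed
 have F1: "(nn_integral M (%x. ennreal (cmod (F x)))) <= ennreal A'"
 proof -
  have "(nn_integral M (%x. ennreal (cmod (F x)))) <= (nn_integral M (%x. nn_integral Z (%z. ennreal (cmod (w z)) * ennreal (cmod (K (z, x))))))"
   unfolding F_def
  proof (intro nn_integral_mono)
   fix x assume "x \<in> space M"
   have "ennreal (cmod (LINT z|Z. w z * K (z, x))) <= (nn_integral Z (%z. ennreal (cmod (w z * K (z, x)))))"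
    by (rule norm_integral_le_nn_integral)
   then show "ennreal (cmod (LINT z|Z. w z * K (z, x))) <= (nn_integral Z (%z. ennreal (cmod (w z)) * ennreal (cmod (K (z, x)))))"
    by (simp add: norm_mult ennreal_mult)
  qed
  also have "... = (nn_integral Z (%z. nn_integral M (%x. ennreal (cmod (w z)) * ennreal (cmod (K (z, x))))))"
   by (rule Fubini') (simp add: case_prod_beta')
  also have "... = (nn_integral Z (%z. ennreal (cmod (w z)) * (nn_integral M (%x. ennreal (cmod (K (z, x)))))))"
   by (intro nn_integral_cong nn_integral_cmult) measurable
  also have "... <= (nn_integral Z (%z. ennreal (cmod (w z)) * ennreal A))"
   using A by (intro nn_integral_mono mult_left_mono) auto
  also have "... = ennreal W * ennreal A" by (subst nn_integral_multc) (auto simp: W)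
  also have "... <= ennreal A'" using A A' W by (simp add: ennreal_mult[symmetric] mult.commute ennreal_leI)
  finally show ?thesis .
 qed
 show FL: "F \<in> Lp_space p M"
  using Fle F1 A' by (intro bounded_integrable_in_Lp'(1)[OF p, of F M A']) auto
 have A1: "0 < A + 1" using A by simp
 have KL: "(%x. K (z, x)) \<in> Lp_space p M" "Lp_norm p M (%x. K (z, x)) <= A + 1" if z: "z \<in> space Z" for z
 proof -
  have [measurable]: "(%x. K (z, x)) \<in> borel_measurable M" using z by measurable
  have 1: "AE x in M. cmod (K (z, x)) <= A + 1" using A(2)[OF z] by (intro AE_I2) (simp add: add_increasing2)
  have 2: "(nn_integral M (%x. ennreal (cmod (K (z, x))))) <= ennreal (A + 1)"
   using A(3)[OF z] by (rule order_trans) (simp add: ennreal_leI)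
  show "(%x. K (z, x)) \<in> Lp_space p M" "Lp_norm p M (%x. K (z, x)) <= A + 1"
   using bounded_integrable_in_Lp'[OF p _ A1 1 2] by auto
 qed
 have main: "(LINT x|M. F x * cnj (g x)) = (LINT z|Z. w z * (LINT x|M. K (z, x) * cnj (g x)))"
  if g: "g \<in> Lp_space q M" for g
 proof -
  have [measurable]: "g \<in> borel_measurable M" using g by measurable
  have int: "integrable (Z \<Otimes>\<^sub>M M) (%(z, x). w z * K (z, x) * cnj (g x))"
  proof (rule Fubini_integrable)
   show "AE z in Z. integrable M (%x. case (z, x) of (z, x) => w z * K (z, x) * cnj (g x))"
    using Lp_pairing(1)[OF pq KL(1) g] by (intro AE_I2) (simp add: mult.assoc)
   show "integrable Z (%z. LINT x|M. norm (case (z, x) of (z, x) => w z * K (z, x) * cnj (g x)))"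
   proof (rule integrable_dominated[of Z "%z. cmod (w z) * ((A + 1) * Lp_norm q M g)"])
    show "integrable Z (%z. cmod (w z) * ((A + 1) * Lp_norm q M g))" using w by auto
    show "AE z in Z. norm (LINT x|M. norm (case (z, x) of (z, x) => w z * K (z, x) * cnj (g x)))
      <= norm (cmod (w z) * ((A + 1) * Lp_norm q M g))"
    proof (intro AE_I2)
     fix z assume z: "z \<in> space Z"
     have "(LINT x|M. cmod (K (z, x) * cnj (g x))) <= Lp_norm p M (%x. K (z, x)) * Lp_norm q M g"
      using Lp_Holder(2)[OF pq KL(1)[OF z] Lp_space_cnj[OF g]] by (simp add: Lp_norm_cnj)
     also have "... <= (A + 1) * Lp_norm q M g" using KL(2)[OF z] by (intro mult_right_mono) auto
     finally have le: "(LINT x|M. cmod (K (z, x) * cnj (g x))) <= (A + 1) * Lp_norm q M g" .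
     have "(LINT x|M. norm (case (z, x) of (z, x) => w z * K (z, x) * cnj (g x)))
      = cmod (w z) * (LINT x|M. cmod (K (z, x) * cnj (g x)))"
      by (simp add: norm_mult mult.assoc)
     then show "norm (LINT x|M. norm (case (z, x) of (z, x) => w z * K (z, x) * cnj (g x)))
      <= norm (cmod (w z) * ((A + 1) * Lp_norm q M g))"
      using mult_left_mono[OF le, of "cmod (w z)"] A1
      by (simp add: abs_mult integral_nonneg_AE)
    qed
   qed measurable
  qed measurable
  have "(LINT x|M. F x * cnj (g x)) = (LINT x|M. LINT z|Z. w z * K (z, x) * cnj (g x))"
   by (simp add: F_def)
  also have "... = (LINT z|Z. LINT x|M. w z * K (z, x) * cnj (g x))"
   by (rule Fubini_integral[OF int])
  finally show ?thesis by (simp add: mult.assoc)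
 qed
 then show "g \<in> Lp_space q M ==> (LINT x|M. F x * cnj (g x)) = (LINT z|Z. w z * (LINT x|M. K (z, x) * cnj (g x)))" .
 assume b: "!!z. z \<in> space Z ==> Lp_norm p M (%x. K (z, x)) <= b z" and ib: "integrable Z (%z. cmod (w z) * b z)"
 have b0: "0 <= b z" if "z \<in> space Z" for z using b[OF that] Lp_norm_nonneg[of p M "%x. K (z, x)"] by linarith
 show "Lp_norm p M F <= (LINT z|Z. cmod (w z) * b z)"
 proof (rule Lp_norm_dual_le[OF M pq FL])
  fix g assume g: "g \<in> Lp_space q M"
  have [measurable]: "g \<in> borel_measurable M" using g by measurable
  have "cmod (LINT z|Z. w z * (LINT x|M. K (z, x) * cnj (g x))) <= (LINT z|Z. cmod (w z) * b z * Lp_norm q M g)"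
  proof (rule norm_integral_le_AE)
   show "integrable Z (%z. cmod (w z) * b z * Lp_norm q M g)" using ib by auto
   show "AE z in Z. cmod (w z * (LINT x|M. K (z, x) * cnj (g x))) <= cmod (w z) * b z * Lp_norm q M g"
   proof (intro AE_I2)
    fix z assume z: "z \<in> space Z"
    have "cmod (LINT x|M. K (z, x) * cnj (g x)) <= Lp_norm p M (%x. K (z, x)) * Lp_norm q M g"
     by (rule Lp_pairing(2)[OF pq KL(1)[OF z] g])
    also have "... <= b z * Lp_norm q M g" by (intro mult_right_mono b z) simp
    finally show "cmod (w z * (LINT x|M. K (z, x) * cnj (g x))) <= cmod (w z) * b z * Lp_norm q M g"
     by (simp add: norm_mult mult.assoc mult_left_mono)
   qed
  qed
  then show "cmod (LINT x|M. F x * cnj (g x)) <= (LINT z|Z. cmod (w z) * b z) * Lp_norm q M g"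
   by (simp add: main[OF g])
 next
  show "0 <= (LINT z|Z. cmod (w z) * b z)" using b0 by (intro integral_nonneg_AE AE_I2) auto
 qed
qed

text \<open>A kernel of finite rank: on each of finitely many pieces of M it depends on z only. The
  piece containing x is coded by the number \<pi> x, with 0 for the outside, where the kernel
  vanishes. Codes rather than finite sums of products make the class closed under arbitrary
  pointwise operations that fix 0.\<close>

definition slice_simple :: "'z measure => 'a measure => ('z \<times> 'a => complex) => bool" where
 "slice_simple Z M k \<longleftrightarrow> (\<exists>(\<pi>::'a => nat) u.
  \<pi> \<in> M \<rightarrow>\<^sub>M count_space UNIV & finite (\<pi> ` space M) & emeasure M {x \<in> space M. \<pi> x ~= 0} < \<infinity> &
  (\<forall>i. u i \<in> borel_measurable Z) & (\<forall>z. u 0 z = 0) & k = (%(z, x). u (\<pi> x) z))"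

lemma slice_simple_measurable:
 fixes M :: "'a measure"
 assumes "slice_simple Z M k"
 shows "k \<in> borel_measurable (Z \<Otimes>\<^sub>M M)"
proof -
 obtain \<pi> :: "'a => nat" and u where *: "\<pi> \<in> M \<rightarrow>\<^sub>M count_space UNIV" "\<forall>i. u i \<in> borel_measurable Z"
  and k: "k = (%(z, x). u (\<pi> x) z)" using assms unfolding slice_simple_def by blast
 have [measurable]: "\<pi> \<in> M \<rightarrow>\<^sub>M count_space UNIV" "u i \<in> borel_measurable Z" for i using * by auto
 have "(%y. u (\<pi> (snd y)) (fst y)) \<in> borel_measurable (Z \<Otimes>\<^sub>M M)"
  by (rule measurable_compose_countable[of "%i y. u i (fst y)"]) measurable
 then show ?thesis by (simp add: k case_prod_beta')
qed

text \<open>The common refinement of two coded partitions is coded by pairing the two codes. Since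
  the code of (0, 0) is 0, the outside of both partitions is again coded by 0.\<close>

lemma slice_simple_combine:
 fixes M :: "'a measure"
 assumes 1: "slice_simple Z M k" and 2: "slice_simple Z M l"
  and G: "(%(a, b). G a b) \<in> borel_measurable (borel \<Otimes>\<^sub>M borel)" "G 0 0 = 0"
 shows "slice_simple Z M (%y. G (k y) (l y))"
proof -
 obtain \<pi> :: "'a => nat" and u where *: "\<pi> \<in> M \<rightarrow>\<^sub>M count_space UNIV" "\<forall>i. u i \<in> borel_measurable Z"
  "finite (\<pi> ` space M)" "emeasure M {x \<in> space M. \<pi> x ~= 0} < \<infinity>" "\<forall>z. u 0 z = 0" "k = (%(z, x). u (\<pi> x) z)"
  using 1 unfolding slice_simple_def by blast
 then have k: "\<pi> \<in> M \<rightarrow>\<^sub>M count_space UNIV" "!!i. u i \<in> borel_measurable Z" "finite (\<pi> ` space M)"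
  "emeasure M {x \<in> space M. \<pi> x ~= 0} < \<infinity>" "!!z. u 0 z = 0" "k = (%(z, x). u (\<pi> x) z)"
  by blast+
 obtain \<rho> :: "'a => nat" and v where *: "\<rho> \<in> M \<rightarrow>\<^sub>M count_space UNIV" "\<forall>i. v i \<in> borel_measurable Z"
  "finite (\<rho> ` space M)" "emeasure M {x \<in> space M. \<rho> x ~= 0} < \<infinity>" "\<forall>z. v 0 z = 0" "l = (%(z, x). v (\<rho> x) z)"
  using 2 unfolding slice_simple_def by blast
 then have l: "\<rho> \<in> M \<rightarrow>\<^sub>M count_space UNIV" "!!i. v i \<in> borel_measurable Z" "finite (\<rho> ` space M)"
  "emeasure M {x \<in> space M. \<rho> x ~= 0} < \<infinity>" "!!z. v 0 z = 0" "l = (%(z, x). v (\<rho> x) z)"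
  by blast+
 note [measurable] = k(1,2) l(1,2) G(1)
 define \<tau> where "\<tau> x = prod_encode (\<pi> x, \<rho> x)" for x
 define w where "w i z = G (u (fst (prod_decode i)) z) (v (snd (prod_decode i)) z)" for i z
 have [measurable]: "\<tau> \<in> M \<rightarrow>\<^sub>M count_space UNIV" unfolding \<tau>_def by measurable
 have wm: "w i \<in> borel_measurable Z" for i
 proof -
  have "(%z. (%(a, b). G a b) (u (fst (prod_decode i)) z, v (snd (prod_decode i)) z)) \<in> borel_measurable Z"
   by measurable
  then show ?thesis by (simp add: w_def[abs_def])
 qed
 have 0: "prod_encode (0, 0) = 0" by (simp add: prod_encode_def)
 then have d0: "prod_decode 0 = (0, 0)" by (metis prod_encode_inverse)
 have "\<tau> ` space M \<subseteq> prod_encode ` (\<pi> ` space M \<times> \<rho> ` space M)" by (auto simp: \<tau>_def)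
 then have fin: "finite (\<tau> ` space M)" using k(3) l(3) finite_subset by blast
 have "{x \<in> space M. \<tau> x ~= 0} \<subseteq> {x \<in> space M. \<pi> x ~= 0} \<union> {x \<in> space M. \<rho> x ~= 0}"
  by (auto simp: \<tau>_def intro!: gr0I dest: arg_cong[where f=fst] simp: 0)
 then have "emeasure M {x \<in> space M. \<tau> x ~= 0}
   <= emeasure M ({x \<in> space M. \<pi> x ~= 0} \<union> {x \<in> space M. \<rho> x ~= 0})"
  by (intro emeasure_mono) auto
 also have "... <= emeasure M {x \<in> space M. \<pi> x ~= 0} + emeasure M {x \<in> space M. \<rho> x ~= 0}"
  by (intro emeasure_subadditive) auto
 also have "... < \<infinity>" using k(4) l(4) by simp
 finally have fm: "emeasure M {x \<in> space M. \<tau> x ~= 0} < \<infinity>" .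
 have "(%y. G (k y) (l y)) = (%(z, x). w (\<tau> x) z)"
  by (auto simp: k(6) l(6) w_def \<tau>_def)
 then show ?thesis
  unfolding slice_simple_def using fin fm wm G(2)
  by (intro exI[of _ \<tau>] exI[of _ w]) (auto simp: w_def d0 k(5) l(5))
qed

lemma slice_simple_rectangle:
 assumes [measurable]: "A \<in> sets Z" "B \<in> sets M" and "emeasure M B < \<infinity>"
 shows "slice_simple Z M (%(z, x). indicator A z * indicator B x)"
proof -
 let ?\<pi> = "%x. if x \<in> B then 1 else 0 :: nat" and ?u = "%(i::nat) z. if i = 0 then 0 else indicator A z :: complex"
 show ?thesis unfolding slice_simple_def
 proof (intro exI[of _ ?\<pi>] exI[of _ ?u] conjI)
 show "?\<pi> \<in> M \<rightarrow>\<^sub>M count_space UNIV" by measurable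
 show "finite (?\<pi> ` space M)" by (rule finite_subset[of _ "{0, 1}"]) auto
 have "{x \<in> space M. ?\<pi> x ~= 0} = B" using sets.sets_into_space[OF assms(2)] by auto
 then show "emeasure M {x \<in> space M. ?\<pi> x ~= 0} < \<infinity>" using assms by simp
 qed (auto simp: indicator_def fun_eq_iff)
qed

definition slice_approximable :: "'z measure => 'a measure => ('z \<times> 'a => complex) => bool" where
 "slice_approximable Z M f \<longleftrightarrow> (\<forall>e::real. 0 < e -->
  (\<exists>k. slice_simple Z M k & (nn_integral (Z \<Otimes>\<^sub>M M) (%y. ennreal (cmod (f y - k y)))) < ennreal e))"

lemma slice_approximable_limit:
 assumes app: "!!i::nat. slice_approximable Z M (s i)"
  and [measurable]: "!!i. s i \<in> borel_measurable (Z \<Otimes>\<^sub>M M)" "f \<in> borel_measurable (Z \<Otimes>\<^sub>M M)"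
  and w: "w \<in> borel_measurable (Z \<Otimes>\<^sub>M M)" "(nn_integral (Z \<Otimes>\<^sub>M M) (%y. ennreal (w y))) < \<infinity>"
  and le: "!!i y. y \<in> space (Z \<Otimes>\<^sub>M M) ==> cmod (s i y) <= w y"
  and lim: "!!y. y \<in> space (Z \<Otimes>\<^sub>M M) ==> (%i. s i y) \<longlonglongrightarrow> f y"
 shows "slice_approximable Z M f"
 unfolding slice_approximable_def
proof (intro allI impI)
 fix e :: real assume e: "0 < e"
 have "(%i. nn_integral (Z \<Otimes>\<^sub>M M) (%y. ennreal (norm (f y - s i y)))) \<longlonglongrightarrow> 0"
  using w le lim by (intro nn_integral_dominated_convergence_norm[where w=w]) auto
 then have "\<forall>\<^sub>F i in sequentially. (nn_integral (Z \<Otimes>\<^sub>M M) (%y. ennreal (norm (f y - s i y)))) < ennreal (e / 2)"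
  using e by (intro order_tendstoD(2)) auto
 then obtain i where i: "(nn_integral (Z \<Otimes>\<^sub>M M) (%y. ennreal (cmod (f y - s i y)))) < ennreal (e / 2)"
  by (auto simp: eventually_sequentially)
 obtain k where k: "slice_simple Z M k" "(nn_integral (Z \<Otimes>\<^sub>M M) (%y. ennreal (cmod (s i y - k y)))) < ennreal (e / 2)"
  using app[of i] e unfolding slice_approximable_def by (meson half_gt_zero)
 have [measurable]: "k \<in> borel_measurable (Z \<Otimes>\<^sub>M M)" by (rule slice_simple_measurable[OF k(1)])
 have "(nn_integral (Z \<Otimes>\<^sub>M M) (%y. ennreal (cmod (f y - k y))))
  <= (nn_integral (Z \<Otimes>\<^sub>M M) (%y. ennreal (cmod (f y - s i y)) + ennreal (cmod (s i y - k y))))"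
 proof (intro nn_integral_mono)
  fix y
  have "cmod (f y - k y) <= cmod (f y - s i y) + cmod (s i y - k y)"
   using norm_triangle_ineq[of "f y - s i y" "s i y - k y"] by simp
  then show "ennreal (cmod (f y - k y)) <= ennreal (cmod (f y - s i y)) + ennreal (cmod (s i y - k y))"
   by (simp add: ennreal_plus[symmetric] ennreal_leI del: ennreal_plus)
 qed
 also have "... = (nn_integral (Z \<Otimes>\<^sub>M M) (%y. ennreal (cmod (f y - s i y)))) + (nn_integral (Z \<Otimes>\<^sub>M M) (%y. ennreal (cmod (s i y - k y))))"
  by (intro nn_integral_add) measurable
 also have "... < ennreal (e / 2) + ennreal (e / 2)" using i k(2) by (rule add_strict_mono)
 also have "... = ennreal e" using e by (simp add: ennreal_plus[symmetric] del: ennreal_plus)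
 finally show "\<exists>k. slice_simple Z M k & (nn_integral (Z \<Otimes>\<^sub>M M) (%y. ennreal (cmod (f y - k y)))) < ennreal e"
  using k(1) by blast
qed

lemma slice_simple_approximable: "slice_simple Z M k ==> slice_approximable Z M k"
 unfolding slice_approximable_def by (intro allI impI exI[of _ k]) simp

text \<open>A Lipschitz map turns L^1 errors into L^1 errors, so this one closure property covers
  sums, differences and multiples.\<close>

lemma slice_approximable_lipschitz:
 assumes f: "slice_approximable Z M f" and g: "slice_approximable Z M g"
  and [measurable]: "f \<in> borel_measurable (Z \<Otimes>\<^sub>M M)" "g \<in> borel_measurable (Z \<Otimes>\<^sub>M M)"
  and G: "(%(a, b). G a b) \<in> borel_measurable (borel \<Otimes>\<^sub>M borel)" "G 0 0 = 0"
  and L: "!!a b a' b'. cmod (G a b - G a' b') <= L * (cmod (a - a') + cmod (b - b'))" "0 < L"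
 shows "slice_approximable Z M (%y. G (f y) (g y))"
 unfolding slice_approximable_def
proof (intro allI impI)
 fix e :: real assume e: "0 < e"
 then have e2: "0 < e / (2 * L)" using L by simp
 obtain k where k: "slice_simple Z M k" "(nn_integral (Z \<Otimes>\<^sub>M M) (%y. ennreal (cmod (f y - k y)))) < ennreal (e / (2 * L))"
  using f e2 unfolding slice_approximable_def by meson
 obtain l where l: "slice_simple Z M l" "(nn_integral (Z \<Otimes>\<^sub>M M) (%y. ennreal (cmod (g y - l y)))) < ennreal (e / (2 * L))"
  using g e2 unfolding slice_approximable_def by meson
 have [measurable]: "k \<in> borel_measurable (Z \<Otimes>\<^sub>M M)" "l \<in> borel_measurable (Z \<Otimes>\<^sub>M M)"
  using k l slice_simple_measurable by auto
 have "(nn_integral (Z \<Otimes>\<^sub>M M) (%y. ennreal (cmod (G (f y) (g y) - G (k y) (l y)))))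
  <= (nn_integral (Z \<Otimes>\<^sub>M M) (%y. ennreal L * (ennreal (cmod (f y - k y)) + ennreal (cmod (g y - l y)))))"
  using L by (intro nn_integral_mono)
   (simp add: ennreal_plus[symmetric] ennreal_mult[symmetric] ennreal_leI del: ennreal_plus)
 also have "... = ennreal L * ((nn_integral (Z \<Otimes>\<^sub>M M) (%y. ennreal (cmod (f y - k y)))) + (nn_integral (Z \<Otimes>\<^sub>M M) (%y. ennreal (cmod (g y - l y)))))"
  by (subst nn_integral_cmult) (auto simp: nn_integral_add)
 also have "... < ennreal L * (ennreal (e / (2 * L)) + ennreal (e / (2 * L)))"
  using L by (intro ennreal_mult_strict_left_mono add_strict_mono k l) auto
 also have "... = ennreal e"
  using e L by (simp add: ennreal_plus[symmetric] ennreal_mult[symmetric] field_simps del: ennreal_plus)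
 finally show "\<exists>k. slice_simple Z M k & (nn_integral (Z \<Otimes>\<^sub>M M) (%y. ennreal (cmod (G (f y) (g y) - k y)))) < ennreal e"
  using slice_simple_combine[OF k(1) l(1) G] by blast
qed

text \<open>Measurable rectangles are stable under intersection and generate the product
  sigma-algebra, so a Dynkin argument applies once all sets are cut down to some \<open>R n\<close>:
  complements relative to \<open>R n\<close> keep finite measure. Dominated convergence in n finally
  removes the cut.\<close>

lemma slice_approximable_indicator:
 assumes Z: "finite_measure Z" and M: "sigma_finite_measure M"
  and A: "A \<in> sets (Z \<Otimes>\<^sub>M M)" "emeasure (Z \<Otimes>\<^sub>M M) A < \<infinity>"
 shows "slice_approximable Z M (indicator A)"
proof -
 interpret Z: finite_measure Z by fact
 interpret M: sigma_finite_measure M by fact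
 obtain Y :: "nat => 'b set" where Y: "range Y \<subseteq> sets M" "(\<Union>i. Y i) = space M"
  "!!i. emeasure M (Y i) ~= \<infinity>" "incseq Y" using M.sigma_finite_incseq by blast
 have [measurable]: "Y i \<in> sets M" for i using Y by auto
 define R where "R n = space Z \<times> Y n" for n
 have [measurable]: "R n \<in> sets (Z \<Otimes>\<^sub>M M)" for n unfolding R_def by measurable
 have Rfin: "emeasure (Z \<Otimes>\<^sub>M M) (R n) < \<infinity>" for n
  unfolding R_def using Y(3)[of n] Z.emeasure_finite[of "space Z"]
  by (simp add: M.emeasure_pair_measure_Times ennreal_mult_eq_top_iff less_top[symmetric])
 have Rapp: "slice_approximable Z M (indicator (R n))" for n
 proof -
  have "slice_simple Z M (%(z, x). indicator (space Z) z * indicator (Y n) x)"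
   using Y(3)[of n] by (intro slice_simple_rectangle) (auto simp: less_top)
  also have "(%(z, x). indicator (space Z) z * indicator (Y n) x) = (indicator (R n) :: _ => complex)"
   by (auto simp: R_def indicator_def fun_eq_iff)
  finally show ?thesis by (rule slice_simple_approximable)
 qed
 have step: "slice_approximable Z M (indicator (D \<inter> R n))" if D: "D \<in> sets (Z \<Otimes>\<^sub>M M)" for D n
  using Int_stable_pair_measure_generator[of Z M] pair_measure_closed[of Z M] D[unfolded sets_pair_measure]
 proof (induction D rule: sigma_sets_induct_disjoint)
  case (basic D)
  then obtain B C where [measurable]: "B \<in> sets Z" "C \<in> sets M" and D: "D = B \<times> C" by auto
  have "emeasure M (C \<inter> Y n) <= emeasure M (Y n)" by (intro emeasure_mono) auto
  then have "emeasure M (C \<inter> Y n) < \<infinity>" using Y(3)[of n] by (auto simp: less_top intro: le_less_trans)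
  then have "slice_simple Z M (%(z, x). indicator B z * indicator (C \<inter> Y n) x)"
   by (intro slice_simple_rectangle) auto
  also have "(%(z, x). indicator B z * indicator (C \<inter> Y n) x) = (indicator (D \<inter> R n) :: _ => complex)"
   using sets.sets_into_space[OF \<open>B \<in> sets Z\<close>] by (auto simp: R_def D indicator_def fun_eq_iff)
  finally show ?case by (rule slice_simple_approximable)
 next
  case empty
  have "slice_simple Z M (%(z, x). indicator {} z * indicator {} x)"
   by (intro slice_simple_rectangle) auto
  also have "(%(z, x). indicator {} z * indicator {} x) = (indicator ({} \<inter> R n) :: _ => complex)" by auto
  finally show ?case by (rule slice_simple_approximable)
 next
  case (compl D)
  have [measurable]: "D \<in> sets (Z \<Otimes>\<^sub>M M)" using compl(1) by (simp add: sets_pair_measure)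
  have "slice_approximable Z M (%y. indicator (R n) y - indicator (D \<inter> R n) y)"
  proof (rule slice_approximable_lipschitz[OF Rapp compl(2), where L=1 and G="%a b. a - b"])
   fix a b a' b' :: complex
   show "cmod ((a - b) - (a' - b')) <= 1 * (cmod (a - a') + cmod (b - b'))"
    using norm_triangle_ineq4[of "a - a'" "b - b'"] by (simp add: algebra_simps)
  qed auto
  also have "(%y. indicator (R n) y - indicator (D \<inter> R n) y) =
    (indicator ((space Z \<times> space M - D) \<inter> R n) :: _ => complex)"
   using sets.sets_into_space[of "R n" "Z \<Otimes>\<^sub>M M"] by (auto simp: indicator_def fun_eq_iff space_pair_measure)
  finally show ?case .
 next
  case (union D)
  have [measurable]: "D i \<in> sets (Z \<Otimes>\<^sub>M M)" for i using union(2) by (auto simp: sets_pair_measure)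
  have fin: "slice_approximable Z M (indicator ((\<Union>i<m. D i) \<inter> R n))" for m
  proof (induction m)
   case 0
   have "slice_simple Z M (%(z, x). indicator {} z * indicator {} x)"
    by (intro slice_simple_rectangle) auto
   also have "(%(z, x). indicator {} z * indicator {} x) = (indicator ((\<Union>i<0. D i) \<inter> R n) :: _ => complex)" by auto
   finally show ?case by (rule slice_simple_approximable)
  next
   case (Suc m)
   have "slice_approximable Z M (%y. indicator ((\<Union>i<m. D i) \<inter> R n) y + indicator (D m \<inter> R n) y)"
   proof (rule slice_approximable_lipschitz[OF Suc union(3), where L=1 and G="%a b. a + b"])
    fix a b a' b' :: complex
    show "cmod ((a + b) - (a' + b')) <= 1 * (cmod (a - a') + cmod (b - b'))"
     using norm_triangle_ineq[of "a - a'" "b - b'"] by (simp add: algebra_simps)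
   qed auto
   also have "(%y. indicator ((\<Union>i<m. D i) \<inter> R n) y + indicator (D m \<inter> R n) y) =
     (indicator ((\<Union>i<Suc m. D i) \<inter> R n) :: _ => complex)"
   proof -
    have "D i \<inter> D m = {}" if "i < m" for i
     using union(1) that by (auto simp: disjoint_family_on_def)
    then show ?thesis by (auto simp: indicator_def fun_eq_iff lessThan_Suc)
   qed
   finally show ?case .
  qed
  show ?case
  proof (rule slice_approximable_limit[OF fin, where w = "indicator (R n)"])
   show "(%m. indicator ((\<Union>i<m. D i) \<inter> R n) y :: complex) \<longlonglongrightarrow> indicator (\<Union> (range D) \<inter> R n) y" for y
   proof -
    have "(%m. indicator (\<Union>i<m. D i \<inter> R n) y :: complex) \<longlonglongrightarrow> indicator (\<Union>i. D i \<inter> R n) y"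
     by (rule LIMSEQ_indicator_UN)
    then show ?thesis by (simp add: Int_UN_distrib2)
   qed
  next
   show "(nn_integral (Z \<Otimes>\<^sub>M M) (%y. ennreal (indicator (R n) y))) < \<infinity>"
    using Rfin[of n] by (simp add: ennreal_indicator)
  qed (auto simp: indicator_def)
 qed
 show ?thesis
 proof (rule slice_approximable_limit[OF step[OF A(1)], where w = "indicator A"])
  fix y assume y: "y \<in> space (Z \<Otimes>\<^sub>M M)"
  have "(\<Union>i. R i) = space (Z \<Otimes>\<^sub>M M)" unfolding R_def using Y(2) by (auto simp: space_pair_measure)
  then obtain i where "y \<in> R i" using y by blast
  then have "\<forall>\<^sub>F n in sequentially. y \<in> R n"
   using incseqD[OF Y(4), of i] by (intro eventually_sequentiallyI[of i]) (auto simp: R_def)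
  then have "\<forall>\<^sub>F n in sequentially. indicator (A \<inter> R n) y = (indicator A y :: complex)"
   by eventually_elim (auto simp: indicator_def)
  then show "(%n. indicator (A \<inter> R n) y :: complex) \<longlonglongrightarrow> indicator A y"
   by (rule tendsto_eventually)
 next
  show "(nn_integral (Z \<Otimes>\<^sub>M M) (%y. ennreal (indicator A y))) < \<infinity>"
   using A by (simp add: ennreal_indicator)
 qed (use A(1) in \<open>auto simp: indicator_def\<close>)
qed

lemma integrable_slice_approximable:
 assumes Z: "finite_measure Z" and M: "sigma_finite_measure M"
  and f: "integrable (Z \<Otimes>\<^sub>M M) f"
 shows "slice_approximable Z M f"
 using f
proof (induction rule: integrable_induct)
 case (base A c)
 note [measurable] = base(1)
 have ap: "slice_approximable Z M (indicator A)" by (rule slice_approximable_indicator[OF Z M base])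
 have "slice_approximable Z M (%y. c * indicator A y)"
 proof (rule slice_approximable_lipschitz[OF ap ap, where L="cmod c + 1" and G="%a b. c * a"])
  fix a b a' b' :: complex
  have "cmod (c * a - c * a') = cmod c * cmod (a - a')" by (simp add: norm_mult right_diff_distrib[symmetric])
  also have "... <= (cmod c + 1) * (cmod (a - a') + cmod (b - b'))" by (intro mult_mono) auto
  finally show "cmod (c * a - c * a') <= (cmod c + 1) * (cmod (a - a') + cmod (b - b'))" .
  show "0 < cmod c + 1" by (simp add: add_nonneg_pos)
 qed auto
 also have "(%y. c * indicator A y) = (%y. indicator A y *\<^sub>R c)" by (auto simp: indicator_def)
 finally show ?case .
next
 case (add f g)
 show ?case
 proof (rule slice_approximable_lipschitz[OF add.IH, where L=1 and G="%a b. a + b"])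
  fix a b a' b' :: complex
  show "cmod ((a + b) - (a' + b')) <= 1 * (cmod (a - a') + cmod (b - b'))"
   using norm_triangle_ineq[of "a - a'" "b - b'"] by (simp add: algebra_simps)
 qed (use add in auto)
next
 case (lim f s)
 have "(nn_integral (Z \<Otimes>\<^sub>M M) (%y. ennreal (2 * cmod (f y)))) = 2 * (nn_integral (Z \<Otimes>\<^sub>M M) (%y. ennreal (cmod (f y))))"
  using lim.hyps(4) by (subst nn_integral_cmult[symmetric]) (auto simp: ennreal_mult)
 also have "... < \<infinity>" using lim.hyps(4) by (auto simp: integrable_iff_bounded ennreal_mult_less_top)
 finally show ?case
  using lim.hyps by (intro slice_approximable_limit[OF lim.IH, where w = "%y. 2 * cmod (f y)"]) auto
qed

text \<open>The nearest point projection onto the disc. Applied to the values of an approximating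
  kernel it restores the bound A and, as the exact kernel already takes its values in the disc, does
  not enlarge the error.\<close>

lemma lipschitz_retraction_cball:
 fixes A :: real
 assumes "0 <= A"
 obtains P :: "complex => complex" where "P \<in> borel_measurable borel" "!!a. cmod (P a) <= A"
  "!!a b. cmod (P a - P b) <= cmod (a - b)" "!!a. cmod a <= A ==> P a = a"
proof -
 have S: "convex (cball (0::complex) A)" "closed (cball (0::complex) A)" "cball (0::complex) A ~= {}"
  using assms by auto
 show ?thesis
 proof (rule that[of "closest_point (cball 0 A)"])
  show "closest_point (cball 0 A) \<in> borel_measurable (borel :: complex measure)"
   using continuous_on_closest_point[OF S] by (rule borel_measurable_continuous_onI)
  show "cmod (closest_point (cball 0 A) a) <= A" for a
   using closest_point_in_set[OF S(2,3), of a] by simp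
  show "cmod (closest_point (cball 0 A) a - closest_point (cball 0 A) b) <= cmod (a - b)" for a b
   using closest_point_lipschitz[OF S, of a b] by (simp add: dist_norm)
  show "closest_point (cball 0 A) a = a" if "cmod a <= A" for a
   using that by (intro closest_point_self) simp
 qed
qed

text \<open>Step kernels are dense in L^1 of the product of |s| dz with M, the first factor being a
  finite measure because s is integrable. The projection onto the disc of radius A keeps the
  approximants uniformly bounded, which is what later permits the passage from L^1 to L^p.\<close>

lemma kernel_approximation_L1:
 fixes K :: "'z \<times> 'a => complex" and s :: "'z => complex"
 assumes Z: "sigma_finite_measure Z" and M: "sigma_finite_measure M"
  and s: "integrable Z s" and K[measurable]: "K \<in> borel_measurable (Z \<Otimes>\<^sub>M M)"
  and A: "0 <= A" "!!z x. z \<in> space Z ==> x \<in> space M ==> cmod (K (z, x)) <= A"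
   "!!z. z \<in> space Z ==> (nn_integral M (%x. ennreal (cmod (K (z, x))))) <= ennreal A"
  and e: "0 < (e::real)"
 shows "\<exists>B u n. (\<forall>i. B i \<in> sets M) & (\<forall>i. emeasure M (B i) < \<infinity>) & (\<forall>i. u i \<in> borel_measurable Z) &
   (\<forall>i z. cmod (u i z) <= A) & (\<forall>z x. cmod (\<Sum>i<n::nat. u i z * indicator (B i) x) <= A) &
   (nn_integral Z (%z. ennreal (cmod (s z)) * (nn_integral M (%x. ennreal (cmod (K (z, x) - (\<Sum>i<n. u i z * indicator (B i) x))))))) <= ennreal e"
proof -
 interpret Z: sigma_finite_measure Z by fact
 interpret M: sigma_finite_measure M by fact
 have [measurable]: "s \<in> borel_measurable Z" using s by auto
 define P where "P = density Z (%z. ennreal (cmod (s z)))"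
 have sP [measurable_cong]: "sets P = sets Z" by (simp add: P_def)
 have spP: "space P = space Z" by (simp add: P_def)
 have emP: "emeasure P (space P) = (nn_integral Z (%z. ennreal (cmod (s z))))"
  unfolding P_def by (subst emeasure_density) (auto simp: space_density intro!: nn_integral_cong)
 have finP: "emeasure P (space P) < \<infinity>" unfolding emP using s by (simp add: integrable_iff_bounded)
 interpret P: finite_measure P by standard (use finP in auto)
 have sPM [measurable_cong]: "sets (P \<Otimes>\<^sub>M M) = sets (Z \<Otimes>\<^sub>M M)" by (intro sets_pair_measure_cong sP refl)
 have KP: "K \<in> borel_measurable (P \<Otimes>\<^sub>M M)" by measurable
 have nnP: "(nn_integral (P \<Otimes>\<^sub>M M) (%y. h y)) = (nn_integral Z (%z. ennreal (cmod (s z)) * (nn_integral M (%x. h (z, x)))))"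
  if [measurable]: "h \<in> borel_measurable (Z \<Otimes>\<^sub>M M)" for h
 proof -
  have h2: "h \<in> borel_measurable (P \<Otimes>\<^sub>M M)" by measurable
  have "(nn_integral (P \<Otimes>\<^sub>M M) (%y. h y)) = (\<integral>\<^sup>+z. \<integral>\<^sup>+x. h (z, x) \<partial>M \<partial>P)"
   by (rule M.nn_integral_fst[OF h2, symmetric])
  also have "... = (nn_integral Z (%z. ennreal (cmod (s z)) * (nn_integral M (%x. h (z, x)))))"
   unfolding P_def by (intro nn_integral_density) measurable
  finally show ?thesis .
 qed
 have "(nn_integral (P \<Otimes>\<^sub>M M) (%y. ennreal (cmod (K y)))) = (nn_integral Z (%z. ennreal (cmod (s z)) * (nn_integral M (%x. ennreal (cmod (K (z, x)))))))"
  by (intro nnP) measurable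
 also have "... <= (nn_integral Z (%z. ennreal (cmod (s z)) * ennreal A))"
  using A(3) by (intro nn_integral_mono mult_left_mono) auto
 also have "... = (nn_integral Z (%z. ennreal (cmod (s z)))) * ennreal A" by (intro nn_integral_multc) measurable
 also have "... < \<infinity>" using s by (auto simp: integrable_iff_bounded ennreal_mult_less_top)
 finally have iK: "integrable (P \<Otimes>\<^sub>M M) K" using KP by (simp add: integrable_iff_bounded)
 obtain k where k: "slice_simple P M k" "(nn_integral (P \<Otimes>\<^sub>M M) (%y. ennreal (cmod (K y - k y)))) < ennreal e"
  using integrable_slice_approximable[OF P.finite_measure_axioms M iK] e unfolding slice_approximable_def by meson
 obtain T where [measurable]: "T \<in> borel_measurable borel" and TA: "!!a. cmod (T a) <= A"
  and TL: "!!a b. cmod (T a - T b) <= cmod (a - b)" and TI: "!!a. cmod a <= A ==> T a = a"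
  using lipschitz_retraction_cball[OF A(1)] by blast
 have T0: "T 0 = 0" using TI A by simp
 obtain \<pi> :: "'a => nat" and v where *: "\<pi> \<in> M \<rightarrow>\<^sub>M count_space UNIV" "\<forall>i. v i \<in> borel_measurable P"
  "finite (\<pi> ` space M)" "emeasure M {x \<in> space M. \<pi> x ~= 0} < \<infinity>" "\<forall>z. v 0 z = 0" "k = (%(z, x). v (\<pi> x) z)"
  using k(1) unfolding slice_simple_def by blast
 have [measurable]: "\<pi> \<in> M \<rightarrow>\<^sub>M count_space UNIV" using * by auto
 have vm [measurable]: "v i \<in> borel_measurable Z" for i using *(2) measurable_cong_sets[OF sP refl] by blast
 define n where "n = Suc (Max (insert 0 (\<pi> ` space M)))"
 have n: "\<pi> x < n" if "x \<in> space M" for x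
  unfolding n_def using *(3) that by (auto simp: less_Suc_eq_le intro!: Max_ge)
 \<comment> \<open>Piece 0 may have infinite measure, but the kernel vanishes on it, so it can be
   replaced by the empty set.\<close>
 define B where "B i = (if i = 0 then {} else {x \<in> space M. \<pi> x = i})" for i
 define u where "u i z = T (v i z)" for i z
 have Bm [measurable]: "B i \<in> sets M" for i
  by (cases "i = 0") (simp_all add: B_def)
 have Bf: "emeasure M (B i) < \<infinity>" for i
 proof -
  have "emeasure M (B i) <= emeasure M {x \<in> space M. \<pi> x ~= 0}" by (intro emeasure_mono) (auto simp: B_def)
  then show ?thesis using *(4) by (rule le_less_trans)
 qed
 have um [measurable]: "u i \<in> borel_measurable Z" for i unfolding u_def by measurable
 have sum: "(\<Sum>i<n. u i z * indicator (B i) x) = (if x \<in> space M then u (\<pi> x) z else 0)" for z x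
 proof (cases "x \<in> space M")
  case True
  have "(\<Sum>i<n. u i z * indicator (B i) x) = (\<Sum>i<n. if i = \<pi> x then u (\<pi> x) z else 0)"
   using True *(5) by (intro sum.cong) (auto simp: B_def indicator_def u_def T0)
  then show ?thesis using True n[OF True] by simp
 next
  case False
  then show ?thesis by (auto simp: B_def indicator_def intro!: sum.neutral)
 qed
 have "(nn_integral Z (%z. ennreal (cmod (s z)) * (nn_integral M (%x. ennreal (cmod (K (z, x) - (\<Sum>i<n. u i z * indicator (B i) x)))))))
  <= (nn_integral Z (%z. ennreal (cmod (s z)) * (nn_integral M (%x. ennreal (cmod (K (z, x) - k (z, x)))))))"
 proof (intro nn_integral_mono mult_left_mono ennreal_leI)
  fix z x assume z: "z \<in> space Z" and x: "x \<in> space M"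
  have "cmod (T (K (z, x)) - T (v (\<pi> x) z)) <= cmod (K (z, x) - v (\<pi> x) z)" by (rule TL)
  then show "cmod (K (z, x) - (\<Sum>i<n. u i z * indicator (B i) x)) <= cmod (K (z, x) - k (z, x))"
   unfolding sum using x TI[OF A(2)[OF z x]] by (simp add: *(6) u_def)
 qed simp
 also have "... = (nn_integral (P \<Otimes>\<^sub>M M) (%y. ennreal (cmod (K y - k y))))"
 proof -
  have "k \<in> borel_measurable (P \<Otimes>\<^sub>M M)" using slice_simple_measurable k(1) by blast
  then have [measurable]: "k \<in> borel_measurable (Z \<Otimes>\<^sub>M M)" using measurable_cong_sets[OF sPM refl] by blast
  show ?thesis by (intro nnP[symmetric]) measurable
 qed
 also have "... <= ennreal e" using k(2) by simp
 finally have fin: "(nn_integral Z (%z. ennreal (cmod (s z)) * (nn_integral M (%x. ennreal (cmod (K (z, x) - (\<Sum>i<n. u i z * indicator (B i) x))))))) <= ennreal e" .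
 show ?thesis
 proof (intro exI[of _ B] exI[of _ u] exI[of _ n] conjI allI Bm Bf um fin)
  show "cmod (u i z) <= A" for i z by (simp add: u_def TA)
  show "cmod (\<Sum>i<n. u i z * indicator (B i) x) <= A" for z x unfolding sum by (simp add: u_def TA A(1))
 qed
qed

text \<open>A root lies below a line with small intercept. This converts smallness of the
  |s|-weighted mean of L^1 errors into smallness of the mean of L^P errors, which involve P-th roots
  of the former. The two regimes meet at t = \<delta>^P.\<close>

lemma powr_inverse_le_linear:
 fixes t \<delta> P :: real
 assumes "1 <= P" "0 < \<delta>" "0 <= t"
 shows "t powr (1 / P) <= \<delta> + \<delta> powr (1 - P) * t"
proof (cases "t <= \<delta> powr P")
 case True
 then have "t powr (1 / P) <= (\<delta> powr P) powr (1 / P)" using assms by (intro powr_mono2) auto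
 also have "... = \<delta>" using assms by (simp add: powr_powr)
 finally show ?thesis using assms by (simp add: add_increasing2)
next
 case False
 then have t: "t > 0" using assms by (smt (verit) powr_ge_zero)
 have "t powr (1 / P) = t powr (1 / P - 1) * t" using powr_mult_base[of t "1 / P - 1"] t by (simp add: mult.commute)
 also have "t powr (1 / P - 1) <= (\<delta> powr P) powr (1 / P - 1)"
  using False assms t by (intro powr_mono2') auto
 also have "(\<delta> powr P) powr (1 / P - 1) = \<delta> powr (1 - P)"
 proof -
  have "P * (1 / P - 1) = 1 - P" using assms by (simp add: field_simps)
  then show ?thesis by (simp add: powr_powr)
 qed
 finally show ?thesis using assms t by (simp add: mult_right_mono add_increasing)
qed

text \<open>The error of a slice is bounded by \<open>A'\<close> >= 1, so its L^P norm is at most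
  \<open>A'\<close> times the P-th root of its L^1 norm. The linear majorant of the root then serves
  as b, and its integral against |s| is controlled by the L^1 approximation.\<close>

lemma kernel_approximation_Lp:
 fixes K :: "'z \<times> 'a => complex" and s :: "'z => complex"
 assumes Z: "sigma_finite_measure Z" and M: "sigma_finite_measure M"
  and s: "integrable Z s" and K[measurable]: "K \<in> borel_measurable (Z \<Otimes>\<^sub>M M)"
  and A: "0 <= A" "!!z x. z \<in> space Z ==> x \<in> space M ==> cmod (K (z, x)) <= A"
   "!!z. z \<in> space Z ==> (nn_integral M (%x. ennreal (cmod (K (z, x))))) <= ennreal A"
  and e: "0 < (e::real)" and p: "1 <= p" "p < \<infinity>"
 shows "\<exists>B u n C b. (\<forall>i. B i \<in> sets M) & (\<forall>i. emeasure M (B i) < \<infinity>) & (\<forall>i. u i \<in> borel_measurable Z) &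
   (\<forall>i z. cmod (u i z) <= A) &
   (\<forall>z\<in>space Z. \<forall>x\<in>space M. cmod (K (z, x) - (\<Sum>i<n::nat. u i z * indicator (B i) x)) <= C) &
   (\<forall>z\<in>space Z. (nn_integral M (%x. ennreal (cmod (K (z, x) - (\<Sum>i<n. u i z * indicator (B i) x))))) <= ennreal C) &
   0 <= C &
   (\<forall>z\<in>space Z. Lp_norm p M (%x. K (z, x) - (\<Sum>i<n. u i z * indicator (B i) x)) <= b z) &
   integrable Z (%z. cmod (s z) * b z) & (LINT z|Z. cmod (s z) * b z) <= e"
proof -
 interpret Z: sigma_finite_measure Z by fact
 interpret M: sigma_finite_measure M by fact
 have [measurable]: "s \<in> borel_measurable Z" using s by auto
 obtain P where P: "1 <= P" "p = ennreal P" using p by (cases rule: exponent_ge_1_cases[OF p(1)]) auto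
 define W where "W = (LINT z|Z. cmod (s z))"
 have W0: "0 <= W" unfolding W_def by (auto intro: integral_nonneg_AE)
 define A' where "A' = 2 * A + 1"
 have A': "1 <= A'" using A by (simp add: A'_def)
 \<comment> \<open>\<delta> and \<epsilon> are chosen so that \<open>A' * \<delta> * (W + 1)\<close>
   and \<open>A' * \<delta> powr (1 - P) * \<epsilon>\<close> are both equal to e / 2.\<close>
 define \<delta> where "\<delta> = e / (2 * A' * (W + 1))"
 have \<delta>: "0 < \<delta>" using e A' W0 by (simp add: \<delta>_def)
 define \<epsilon> where "\<epsilon> = e / (2 * A' * \<delta> powr (1 - P))"
 have \<epsilon>: "0 < \<epsilon>" using e A' \<delta> by (simp add: \<epsilon>_def)
 obtain B u and n :: nat where *: "\<forall>i. B i \<in> sets M" "\<forall>i. emeasure M (B i) < \<infinity>" "\<forall>i. u i \<in> borel_measurable Z"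
   "\<forall>i z. cmod (u i z) <= A" "\<forall>z x. cmod (\<Sum>i<n. u i z * indicator (B i) x) <= A"
  and fin: "(nn_integral Z (%z. ennreal (cmod (s z)) * (nn_integral M (%x. ennreal (cmod (K (z, x) - (\<Sum>i<n. u i z * indicator (B i) x))))))) <= ennreal \<epsilon>"
  by atomize_elim (rule kernel_approximation_L1[OF Z M s K A \<epsilon>])
 note B = *(1,2)[rule_format] and u = *(3-5)[rule_format]
 note [measurable] = B(1) u(1)
 define D where "D y = K y - (\<Sum>i<n. u i (fst y) * indicator (B i) (snd y))" for y
 have [measurable]: "D \<in> borel_measurable (Z \<Otimes>\<^sub>M M)" unfolding D_def by measurable
 have Deq: "K (z, x) - (\<Sum>i<n. u i z * indicator (B i) x) = D (z, x)" for z x by (simp add: D_def)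
 note fin = fin[unfolded Deq]
 have DA: "cmod (D (z, x)) <= 2 * A" if "z \<in> space Z" "x \<in> space M" for z x
  using norm_triangle_ineq4[of "K (z, x)" "\<Sum>i<n. u i z * indicator (B i) x"] A(2)[OF that] u(3)[of z x]
  by (simp add: D_def)
 define C where "C = 2 * A + (A + (\<Sum>i<n. A * measure M (B i)))"
 have C: "0 <= C" "2 * A <= C" "A + (\<Sum>i<n. A * measure M (B i)) <= C"
  unfolding C_def using A(1) by (auto intro!: add_nonneg_nonneg sum_nonneg)
 have DC: "(nn_integral M (%x. ennreal (cmod (D (z, x))))) <= ennreal C" if z: "z \<in> space Z" for z
 proof -
  have [measurable]: "(%x. K (z, x)) \<in> borel_measurable M" using z by measurable
  have "(nn_integral M (%x. ennreal (cmod (D (z, x)))))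
   <= (nn_integral M (%x. ennreal (cmod (K (z, x))) + (\<Sum>i<n. ennreal A * indicator (B i) x)))"
  proof (intro nn_integral_mono)
   fix x
   have "cmod (D (z, x)) <= cmod (K (z, x)) + cmod (\<Sum>i<n. u i z * indicator (B i) x)"
    by (simp add: D_def norm_triangle_ineq4)
   also have "cmod (\<Sum>i<n. u i z * indicator (B i) x) <= (\<Sum>i<n. A * indicator (B i) x)"
    using u(2) by (intro sum_norm_le) (auto simp: norm_mult indicator_def)
   finally have "ennreal (cmod (D (z, x))) <= ennreal (cmod (K (z, x)) + (\<Sum>i<n. A * indicator (B i) x))"
    by (intro ennreal_leI) simp
   also have "... = ennreal (cmod (K (z, x))) + (\<Sum>i<n. ennreal (A * indicator (B i) x))"
    using A(1) by (subst ennreal_plus) (auto intro!: sum_nonneg simp: sum_ennreal)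
   also have "(\<Sum>i<n. ennreal (A * indicator (B i) x)) = (\<Sum>i<n. ennreal A * indicator (B i) x)"
    using A(1) by (intro sum.cong) (auto simp: indicator_def)
   finally show "ennreal (cmod (D (z, x))) <= ennreal (cmod (K (z, x))) + (\<Sum>i<n. ennreal A * indicator (B i) x)" .
  qed
  also have "... = (nn_integral M (%x. ennreal (cmod (K (z, x))))) + (\<Sum>i<n. ennreal A * emeasure M (B i))"
  proof -
   have "(nn_integral M (%x. (\<Sum>i<n. ennreal A * indicator (B i) x))) = (\<Sum>i<n. nn_integral M (%x. ennreal A * indicator (B i) x))"
    by (rule nn_integral_sum) measurable
   also have "... = (\<Sum>i<n. ennreal A * emeasure M (B i))"
    by (intro sum.cong refl nn_integral_cmult_indicator B)
   finally show ?thesis by (subst nn_integral_add) measurable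
  qed
  also have "... <= ennreal A + (\<Sum>i<n. ennreal (A * measure M (B i)))"
  proof (intro add_mono A(3) z eq_refl sum.cong refl)
   fix i
   have "emeasure M (B i) = ennreal (measure M (B i))"
    using B(2)[of i] by (intro emeasure_eq_ennreal_measure) (auto simp: less_top)
   then show "ennreal A * emeasure M (B i) = ennreal (A * measure M (B i))" using A(1) by (simp add: ennreal_mult)
  qed
  also have "... = ennreal (A + (\<Sum>i<n. A * measure M (B i)))"
   using A(1) by (subst ennreal_plus) (auto intro!: sum_nonneg simp: sum_ennreal)
  also have "... <= ennreal C" using C(3) by (rule ennreal_leI)
  finally show ?thesis .
 qed
 define t where "t z = enn2real (nn_integral M (%x. ennreal (cmod (D (z, x)))))" for z
 have [measurable]: "t \<in> borel_measurable Z" unfolding t_def by measurable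
 have t: "(nn_integral M (%x. ennreal (cmod (D (z, x))))) = ennreal (t z)" "0 <= t z" if "z \<in> space Z" for z
  using DC[OF that] unfolding t_def by (auto simp: ennreal_enn2real_if top_unique)
 have "(nn_integral Z (%z. ennreal (cmod (s z) * t z))) = (nn_integral Z (%z. ennreal (cmod (s z)) * (nn_integral M (%x. ennreal (cmod (D (z, x)))))))"
  using t by (intro nn_integral_cong) (simp add: ennreal_mult)
 then have nt: "(nn_integral Z (%z. ennreal (cmod (s z) * t z))) <= ennreal \<epsilon>" using fin by simp
 have ist: "integrable Z (%z. cmod (s z) * t z)"
  using nt t(2) by (intro integrableI_nonneg) (auto intro: le_less_trans simp: AE_I2)
 have st: "(LINT z|Z. cmod (s z) * t z) <= \<epsilon>"
 proof -
  have "ennreal (LINT z|Z. cmod (s z) * t z) = (nn_integral Z (%z. ennreal (cmod (s z) * t z)))"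
   using t(2) by (intro nn_integral_eq_integral[symmetric] ist AE_I2) auto
  then have "ennreal (LINT z|Z. cmod (s z) * t z) <= ennreal \<epsilon>" using nt by simp
  then show ?thesis using \<epsilon> by (subst (asm) ennreal_le_iff) auto
 qed
 define b where "b z = A' * (\<delta> + \<delta> powr (1 - P) * t z)" for z
 have b: "Lp_norm p M (%x. D (z, x)) <= b z" if z: "z \<in> space Z" for z
 proof -
  have [measurable]: "(%x. D (z, x)) \<in> borel_measurable M" using z by measurable
  have "(nn_integral M (%x. ennreal (cmod (D (z, x)) powr P))) <= (nn_integral M (%x. ennreal (A' powr (P - 1)) * ennreal (cmod (D (z, x)))))"
  proof (intro nn_integral_mono)
   fix x assume x: "x \<in> space M"
   have "cmod (D (z, x)) powr P = cmod (D (z, x)) powr (P - 1) * cmod (D (z, x))"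
    using powr_mult_base[of "cmod (D (z, x))" "P - 1"] by (simp add: mult.commute)
   also have "... <= A' powr (P - 1) * cmod (D (z, x))"
    using DA[OF z x] P by (intro mult_right_mono powr_mono2) (auto simp: A'_def)
   finally show "ennreal (cmod (D (z, x)) powr P) <= ennreal (A' powr (P - 1)) * ennreal (cmod (D (z, x)))"
    by (simp add: ennreal_mult[symmetric] ennreal_leI)
  qed
  also have "... = ennreal (A' powr (P - 1) * t z)" using t[OF z] by (simp add: nn_integral_cmult ennreal_mult)
  also have "... = ennreal (((A' powr (P - 1)) powr (1 / P) * t z powr (1 / P)) powr P)"
   using P t(2)[OF z] by (simp add: powr_mult powr_powr)
  finally have "Lp_norm p M (%x. D (z, x)) <= (A' powr (P - 1)) powr (1 / P) * t z powr (1 / P)"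
   using Lp_nn_integralI(2)[OF P(1), of "%x. D (z, x)" M] P by simp
  also have "... <= A' * t z powr (1 / P)"
  proof (intro mult_right_mono)
   have "(A' powr (P - 1)) powr (1 / P) = A' powr ((P - 1) / P)" by (simp add: powr_powr)
   also have "... <= A' powr 1" using A' P by (intro powr_mono) auto
   finally show "(A' powr (P - 1)) powr (1 / P) <= A'" using A' by simp
  qed simp
  also have "... <= b z"
   unfolding b_def using A' P \<delta> t(2)[OF z] by (intro mult_left_mono powr_inverse_le_linear) auto
  finally show ?thesis .
 qed
 have beq: "cmod (s z) * b z = A' * \<delta> * cmod (s z) + A' * \<delta> powr (1 - P) * (cmod (s z) * t z)" for z
  by (simp add: b_def algebra_simps)
 have ib: "integrable Z (%z. cmod (s z) * b z)" unfolding beq using s ist by auto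
 have "(LINT z|Z. cmod (s z) * b z) = A' * \<delta> * W + A' * \<delta> powr (1 - P) * (LINT z|Z. cmod (s z) * t z)"
  unfolding beq W_def using s ist by simp
 also have "... <= A' * \<delta> * (W + 1) + A' * \<delta> powr (1 - P) * \<epsilon>"
  using st A' \<delta> by (intro add_mono mult_left_mono) auto
 also have "... = e" using A' W0 \<delta> e by (simp add: \<delta>_def \<epsilon>_def) (simp add: field_simps)
 finally have be: "(LINT z|Z. cmod (s z) * b z) <= e" .
 show ?thesis
 proof (intro exI[of _ B] exI[of _ u] exI[of _ n] exI[of _ C] exI[of _ b] conjI allI ballI B u C(1) ib be)
  show "cmod (K (z, x) - (\<Sum>i<n. u i z * indicator (B i) x)) <= C" if "z \<in> space Z" "x \<in> space M" for z x
   unfolding Deq using DA[OF that] C(2) by linarith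
  show "(nn_integral M (%x. ennreal (cmod (K (z, x) - (\<Sum>i<n. u i z * indicator (B i) x))))) <= ennreal C" if "z \<in> space Z" for z
   unfolding Deq by (rule DC[OF that])
  show "Lp_norm p M (%x. K (z, x) - (\<Sum>i<n. u i z * indicator (B i) x)) <= b z" if "z \<in> space Z" for z
   unfolding Deq by (rule b[OF that])
 qed
qed

text \<open>For finite \<open>p\<close> the kernel \<open>K2\<close> is approximated in \<open>L\<^sup>p\<close>; for \<open>p = \<infinity>\<close> step functions are not dense,
 and instead \<open>K1\<close> is approximated in \<open>L\<^sup>1\<close>.\<close>

theorem kernel_operator:
 fixes K1 K2 :: "'z \<times> 'a => complex" and s :: "'z => complex"
 assumes Z: "sigma_finite_measure Z" and M: "sigma_finite_measure M"
  and pq: "inverse p + inverse q = 1" and s: "integrable Z s"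
  and K1 [measurable]: "K1 \<in> borel_measurable (Z \<Otimes>\<^sub>M M)" and K2 [measurable]: "K2 \<in> borel_measurable (Z \<Otimes>\<^sub>M M)"
  and A: "0 <= A"
  and A1: "!!z x. z \<in> space Z ==> x \<in> space M ==> cmod (K1 (z, x)) <= A"
   "!!z. z \<in> space Z ==> (nn_integral M (%x. ennreal (cmod (K1 (z, x))))) <= ennreal A"
  and A2: "!!z x. z \<in> space Z ==> x \<in> space M ==> cmod (K2 (z, x)) <= A"
   "!!z. z \<in> space Z ==> (nn_integral M (%x. ennreal (cmod (K2 (z, x))))) <= ennreal A"
 defines "S \<equiv> %f x. LINT z|Z. s z * (LINT y|M. f y * K1 (z, y)) * K2 (z, x)"
 shows "f \<in> Lp_space p M ==> S f \<in> Lp_space p M"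
  and "f \<in> Lp_space p M ==> g \<in> Lp_space q M ==> (LINT x|M. S f x * cnj (g x)) =
   (LINT z|Z. s z * (LINT y|M. f y * K1 (z, y)) * (LINT x|M. K2 (z, x) * cnj (g x)))"
  and "finite_rank_approximable p M S"
proof -
 interpret Z: sigma_finite_measure Z by fact
 interpret M: sigma_finite_measure M by fact
 have [measurable]: "s \<in> borel_measurable Z" using s by auto
 have p: "1 <= p" and q: "1 <= q" using conjugate_exponent_ge_1[OF pq] by auto
 have AA: "0 < A + 1" using A by simp
 have K1q: "(%x. K1 (z, x)) \<in> Lp_space q M" "Lp_norm q M (%x. K1 (z, x)) <= A + 1"
  and K2p: "(%x. K2 (z, x)) \<in> Lp_space p M" "Lp_norm p M (%x. K2 (z, x)) <= A + 1"
  if z: "z \<in> space Z" for z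
 proof -
  have [measurable]: "(%x. K1 (z, x)) \<in> borel_measurable M" "(%x. K2 (z, x)) \<in> borel_measurable M"
   using z by measurable
  have 1: "AE x in M. cmod (K1 (z, x)) <= A + 1" "AE x in M. cmod (K2 (z, x)) <= A + 1"
   using A1(1)[OF z] A2(1)[OF z] by (auto intro!: AE_I2 simp: add_increasing2)
  have 2: "(nn_integral M (%x. ennreal (cmod (K1 (z, x))))) <= ennreal (A + 1)" "(nn_integral M (%x. ennreal (cmod (K2 (z, x))))) <= ennreal (A + 1)"
   using A1(2)[OF z] A2(2)[OF z] by (auto intro: order_trans simp: ennreal_leI)
  show "(%x. K1 (z, x)) \<in> Lp_space q M" "Lp_norm q M (%x. K1 (z, x)) <= A + 1"
   using bounded_integrable_in_Lp'[OF q _ AA 1(1) 2(1)] by auto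
  show "(%x. K2 (z, x)) \<in> Lp_space p M" "Lp_norm p M (%x. K2 (z, x)) <= A + 1"
   using bounded_integrable_in_Lp'[OF p _ AA 1(2) 2(2)] by auto
 qed
 define c where "c f z = (LINT y|M. f y * K1 (z, y))" for f z
 have cm: "c f \<in> borel_measurable Z" if "f \<in> Lp_space p M" for f
 proof -
  have [measurable]: "f \<in> borel_measurable M" using that by measurable
  show ?thesis unfolding c_def[abs_def] by measurable
 qed
 have cb: "cmod (c f z) <= (A + 1) * Lp_norm p M f" if f: "f \<in> Lp_space p M" and z: "z \<in> space Z" for f z
 proof -
  have "cmod (c f z) <= (LINT y|M. cmod (f y * K1 (z, y)))" unfolding c_def by (rule integral_norm_bound)
  also have "... <= Lp_norm p M f * Lp_norm q M (%x. K1 (z, x))" by (rule Lp_Holder(2)[OF pq f K1q(1)[OF z]])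
  also have "... <= Lp_norm p M f * (A + 1)" by (intro mult_left_mono K1q(2) z) simp
  finally show ?thesis by (simp add: mult.commute)
 qed
 have wint: "integrable Z (%z. s z * c f z)" if f: "f \<in> Lp_space p M" for f
  by (rule integrable_mult_bounded[OF s cm[OF f] cb[OF f]])
 have Seq: "S f = (%x. LINT z|Z. (s z * c f z) * K2 (z, x))" for f by (simp add: S_def c_def)
 show SL: "S f \<in> Lp_space p M" if "f \<in> Lp_space p M" for f
  unfolding Seq by (rule superposition_in_Lp(1)[OF Z M pq wint[OF that] K2 A A2])
 show "(LINT x|M. S f x * cnj (g x)) =
   (LINT z|Z. s z * (LINT y|M. f y * K1 (z, y)) * (LINT x|M. K2 (z, x) * cnj (g x)))"
  if "f \<in> Lp_space p M" "g \<in> Lp_space q M" for f g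
  unfolding Seq using superposition_in_Lp(2)[OF Z M pq wint[OF that(1)] K2 A A2 that(2)] by (simp add: c_def)
 have indL: "(%x. indicator B x) \<in> Lp_space r M" if "B \<in> sets M" "emeasure M B < \<infinity>" "1 <= r" for B r
 proof (rule bounded_integrable_in_Lp(1)[of r _ M 1 "measure M B + 1"])
  have "(nn_integral M (%x. ennreal (cmod (indicator B x)))) = (nn_integral M (%x. indicator B x))"
   by (intro nn_integral_cong) (auto simp: indicator_def)
  also have "... = ennreal (measure M B)"
   using that by (simp add: emeasure_eq_ennreal_measure less_top)
  finally show "(nn_integral M (%x. ennreal (cmod (indicator B x)))) <= ennreal (measure M B + 1)"
   by (simp add: ennreal_leI)
 qed (use that in \<open>auto simp: indicator_def add_nonneg_pos\<close>)
 show "finite_rank_approximable p M S"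
  unfolding finite_rank_approximable_def
 proof (intro allI impI)
  fix e :: real assume e: "0 < e"
  \<comment> \<open>The kernel that is not replaced has slices of norm at most A + 1 and contributes
    this factor to the error.\<close>
  define e' where "e' = e / (A + 1)"
  have e': "0 < e'" "(A + 1) * e' = e" using e AA by (simp_all add: e'_def)
  show "\<exists>(n::nat) c h C. 0 <= C & (\<forall>i<n. h i \<in> Lp_space p M) &
    (\<forall>i<n. \<forall>f\<in>Lp_space p M. cmod (c i f) <= C * Lp_norm p M f) &
    (\<forall>f\<in>Lp_space p M. Lp_norm p M (%x. S f x - (\<Sum>i<n. c i f * h i x)) <= e * Lp_norm p M f)"
  proof (cases "p = \<infinity>")
   case False
   then have "p < \<infinity>" by (simp add: less_top)
   obtain B u and n :: nat and C b where *: "\<forall>i. B i \<in> sets M" "\<forall>i. emeasure M (B i) < \<infinity>"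
    "\<forall>i. u i \<in> borel_measurable Z" "\<forall>i z. cmod (u i z) <= A"
    "\<forall>z\<in>space Z. \<forall>x\<in>space M. cmod (K2 (z, x) - (\<Sum>i<n. u i z * indicator (B i) x)) <= C"
    "\<forall>z\<in>space Z. (nn_integral M (%x. ennreal (cmod (K2 (z, x) - (\<Sum>i<n. u i z * indicator (B i) x))))) <= ennreal C"
    "0 <= C"
    "\<forall>z\<in>space Z. Lp_norm p M (%x. K2 (z, x) - (\<Sum>i<n. u i z * indicator (B i) x)) <= b z"
    "integrable Z (%z. cmod (s z) * b z)" "(LINT z|Z. cmod (s z) * b z) <= e'"
    by atomize_elim (rule kernel_approximation_Lp[OF Z M s K2 A A2 e'(1) p \<open>p < \<infinity>\<close>])
   note B = *(1,2)[rule_format] and u = *(3,4)[rule_format] and D = *(5-7)[rule_format] and b = *(8-10)[rule_format]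
   note [measurable] = B(1) u(1)
   define DD where "DD y = K2 y - (\<Sum>i<n. u i (fst y) * indicator (B i) (snd y))" for y
   have [measurable]: "DD \<in> borel_measurable (Z \<Otimes>\<^sub>M M)" unfolding DD_def by measurable
   have Deq: "K2 (z, x) - (\<Sum>i<n. u i z * indicator (B i) x) = DD (z, x)" for z x by (simp add: DD_def)
   note DD' = D[unfolded Deq] and bD = b(1)[unfolded Deq]
   \<comment> \<open>With a step kernel on the output side the x-dependence leaves the z-integral,
     and what remains is the coefficient of the indicator of \<open>B i\<close>.\<close>
   define d where "d i f = (LINT z|Z. s z * c f z * u i z)" for i f
   have iu: "integrable Z (%z. s z * c f z * u i z)" if f: "f \<in> Lp_space p M" for f i
    by (rule integrable_mult_bounded[OF wint[OF f] u])
   have db: "cmod (d i f) <= (LINT z|Z. cmod (s z)) * ((A + 1) * A) * Lp_norm p M f" if f: "f \<in> Lp_space p M" for i f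
   proof -
    have "cmod (d i f) <= (LINT z|Z. cmod (s z) * (((A + 1) * Lp_norm p M f) * A))"
     unfolding d_def
    proof (rule norm_integral_le_AE)
     show "integrable Z (%z. cmod (s z) * (((A + 1) * Lp_norm p M f) * A))" using s by auto
     show "AE z in Z. cmod (s z * c f z * u i z) <= cmod (s z) * (((A + 1) * Lp_norm p M f) * A)"
     proof (intro AE_I2)
      fix z assume z: "z \<in> space Z"
      have "cmod (c f z) * cmod (u i z) <= ((A + 1) * Lp_norm p M f) * A"
       using AA by (intro mult_mono cb f z u(2)) auto
      then have "cmod (s z) * (cmod (c f z) * cmod (u i z)) <= cmod (s z) * (((A + 1) * Lp_norm p M f) * A)"
       by (rule mult_left_mono) simp
      then show "cmod (s z * c f z * u i z) <= cmod (s z) * (((A + 1) * Lp_norm p M f) * A)"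
       by (simp add: norm_mult mult.assoc)
     qed
    qed
    then show ?thesis by (simp add: mult_ac)
   qed
   have ap: "Lp_norm p M (%x. S f x - (\<Sum>i<n. d i f * indicator (B i) x)) <= e * Lp_norm p M f"
    if f: "f \<in> Lp_space p M" for f
   proof -
    have iK: "integrable Z (%z. s z * c f z * K2 (z, x))" if x: "x \<in> space M" for x
     by (rule integrable_mult_bounded[OF wint[OF f] _ A2(1)[OF _ x]]) (use x in measurable)
    have eq: "S f x - (\<Sum>i<n. d i f * indicator (B i) x) = (LINT z|Z. (s z * c f z) * DD (z, x))" if x: "x \<in> space M" for x
    proof -
     have "(LINT z|Z. (s z * c f z) * DD (z, x))
      = (LINT z|Z. s z * c f z * K2 (z, x) - (\<Sum>i<n. indicator (B i) x * (s z * c f z * u i z)))"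
      by (intro Bochner_Integration.integral_cong) (simp_all only: DD_def right_diff_distrib sum_distrib_left mult_ac fst_conv snd_conv)
     also have "... = S f x - (\<Sum>i<n. indicator (B i) x * d i f)"
      using iK[OF x] iu[OF f] by (subst Bochner_Integration.integral_diff) (auto simp: Seq d_def)
     finally show ?thesis by (simp add: mult.commute)
    qed
    have "Lp_norm p M (%x. S f x - (\<Sum>i<n. d i f * indicator (B i) x)) = Lp_norm p M (%x. LINT z|Z. (s z * c f z) * DD (z, x))"
    proof (rule Lp_norm_cong_AE[OF p superposition_in_Lp(1)[OF Z M pq wint[OF f] _ D(3)]])
     show "(%x. S f x - (\<Sum>i<n. d i f * indicator (B i) x)) \<in> borel_measurable M"
      using SL[OF f] by measurable
    qed (use eq DD' in auto)
    also have "... <= (LINT z|Z. cmod (s z * c f z) * b z)"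
    proof (rule superposition_in_Lp(3)[OF Z M pq wint[OF f] _ D(3)])
     show "integrable Z (%z. cmod (s z * c f z) * b z)"
     proof (rule integrable_dominated[of Z "%z. (A + 1) * Lp_norm p M f * (cmod (s z) * b z)"])
      show "integrable Z (%z. (A + 1) * Lp_norm p M f * (cmod (s z) * b z))" using b by auto
      have [measurable]: "c f \<in> borel_measurable Z" by (rule cm[OF f])
      have "(%z. cmod (c f z) * (cmod (s z) * b z)) \<in> borel_measurable Z"
       using borel_measurable_integrable[OF b(2)] by measurable
      then show "(%z. cmod (s z * c f z) * b z) \<in> borel_measurable Z" by (simp add: norm_mult mult_ac)
      show "AE z in Z. norm (cmod (s z * c f z) * b z) <= norm ((A + 1) * Lp_norm p M f * (cmod (s z) * b z))"
      proof (intro AE_I2)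
       fix z assume z: "z \<in> space Z"
       have "norm (cmod (s z * c f z) * b z) = cmod (c f z) * \<bar>cmod (s z) * b z\<bar>" by (simp add: norm_mult abs_mult mult_ac)
       also have "... <= ((A + 1) * Lp_norm p M f) * \<bar>cmod (s z) * b z\<bar>" by (intro mult_right_mono cb f z) simp
       also have "... = norm ((A + 1) * Lp_norm p M f * (cmod (s z) * b z))" using AA by (simp add: abs_mult)
       finally show "norm (cmod (s z * c f z) * b z) <= norm ((A + 1) * Lp_norm p M f * (cmod (s z) * b z))" .
      qed
     qed
    qed (use DD' bD in auto)
    also have "... <= (LINT z|Z. (A + 1) * Lp_norm p M f * (cmod (s z) * b z))"
    proof (rule integral_mono_AE')
     show "integrable Z (%z. (A + 1) * Lp_norm p M f * (cmod (s z) * b z))" using b by auto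
     have b0: "0 <= b z" if "z \<in> space Z" for z using b(1)[OF that] Lp_norm_nonneg order_trans by blast
     then show "AE z in Z. 0 <= (A + 1) * Lp_norm p M f * (cmod (s z) * b z)" using AA by (intro AE_I2) simp
     show "AE z in Z. cmod (s z * c f z) * b z <= (A + 1) * Lp_norm p M f * (cmod (s z) * b z)"
     proof (intro AE_I2)
      fix z assume z: "z \<in> space Z"
      have "cmod (s z * c f z) * b z = cmod (c f z) * (cmod (s z) * b z)" by (simp add: norm_mult mult_ac)
      also have "... <= ((A + 1) * Lp_norm p M f) * (cmod (s z) * b z)" using b0[OF z] by (intro mult_right_mono cb f z) simp
      finally show "cmod (s z * c f z) * b z <= (A + 1) * Lp_norm p M f * (cmod (s z) * b z)" .
     qed
    qed
    also have "... = (A + 1) * Lp_norm p M f * (LINT z|Z. cmod (s z) * b z)" by simp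
    also have "... <= (A + 1) * Lp_norm p M f * e'" using b AA by (intro mult_left_mono) auto
    also have "... = e * Lp_norm p M f" using e' by (simp add: mult_ac)
    finally show ?thesis .
   qed
   show ?thesis
    using db ap indL[OF B p] A
    by (intro exI[of _ n] exI[of _ d] exI[of _ "%i x. indicator (B i) x"] exI[of _ "(LINT z|Z. cmod (s z)) * ((A + 1) * A)"])
     (auto intro!: mult_nonneg_nonneg integral_nonneg_AE)
  next
   case True
   have "q = 1" using pq True by (cases rule: conjugate_exponent_cases) auto
   then have "q < \<infinity>" by simp
   obtain B u and n :: nat and C b where *: "\<forall>i. B i \<in> sets M" "\<forall>i. emeasure M (B i) < \<infinity>"
    "\<forall>i. u i \<in> borel_measurable Z" "\<forall>i z. cmod (u i z) <= A"
    "\<forall>z\<in>space Z. \<forall>x\<in>space M. cmod (K1 (z, x) - (\<Sum>i<n. u i z * indicator (B i) x)) <= C"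
    "\<forall>z\<in>space Z. (nn_integral M (%x. ennreal (cmod (K1 (z, x) - (\<Sum>i<n. u i z * indicator (B i) x))))) <= ennreal C"
    "0 <= C"
    "\<forall>z\<in>space Z. Lp_norm q M (%x. K1 (z, x) - (\<Sum>i<n. u i z * indicator (B i) x)) <= b z"
    "integrable Z (%z. cmod (s z) * b z)" "(LINT z|Z. cmod (s z) * b z) <= e'"
    by atomize_elim (rule kernel_approximation_Lp[OF Z M s K1 A A1 e'(1) q \<open>q < \<infinity>\<close>])
   note B = *(1,2)[rule_format] and u = *(3,4)[rule_format] and D = *(5-7)[rule_format] and b = *(8-10)[rule_format]
   note [measurable] = B(1) u(1)
   \<comment> \<open>Here the step kernel is on the input side: f enters only through its integrals
     over the sets \<open>B i\<close>, while the range is spanned by superpositions of slices of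
     K2.\<close>
   define d where "d i f = (LINT y|M. f y * indicator (B i) y)" for i and f :: "'a => complex"
   define h where "h i x = (LINT z|Z. (s z * u i z) * K2 (z, x))" for i x
   have su: "integrable Z (%z. s z * u i z)" for i
    by (rule integrable_mult_bounded[OF s u])
   have hL: "h i \<in> Lp_space p M" for i
    unfolding h_def by (rule superposition_in_Lp(1)[OF Z M pq su K2 A A2])
   define E where "E = (\<Sum>i<n. Lp_norm q M (%x. indicator (B i) x))"
   have E0: "0 <= E" unfolding E_def by (intro sum_nonneg) simp
   have db: "cmod (d i f) <= E * Lp_norm p M f" if f: "f \<in> Lp_space p M" and i: "i < n" for i f
   proof -
    have "cmod (d i f) <= (LINT y|M. cmod (f y * indicator (B i) y))" unfolding d_def by (rule integral_norm_bound)
    also have "... <= Lp_norm p M f * Lp_norm q M (%x. indicator (B i) x)"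
     by (rule Lp_Holder(2)[OF pq f indL[OF B q]])
    also have "... <= Lp_norm p M f * E"
     unfolding E_def using i by (intro mult_left_mono member_le_sum) auto
    finally show ?thesis by (simp add: mult.commute)
   qed
   have ap: "Lp_norm p M (%x. S f x - (\<Sum>i<n. d i f * h i x)) <= e * Lp_norm p M f"
    if f: "f \<in> Lp_space p M" for f
   proof -
    \<comment> \<open>The error made in the inner integral; Hoelder with f bounded and the kernel
      error in L^1 controls it by b.\<close>
    define cd where "cd z = c f z - (\<Sum>i<n. d i f * u i z)" for z
    have [measurable]: "c f \<in> borel_measurable Z" by (rule cm[OF f])
    have [measurable]: "cd \<in> borel_measurable Z" unfolding cd_def by measurable
    have fm [measurable]: "f \<in> borel_measurable M" using f by measurable
    have DL: "(%x. K1 (z, x) - (\<Sum>i<n. u i z * indicator (B i) x)) \<in> Lp_space q M" if z: "z \<in> space Z" for z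
     using Lp_space_cmult(1)[OF q indL[OF B q]]
     by (intro Lp_space_diff(1)[OF q K1q(1)[OF z]] Lp_space_sum(1)[OF q]) auto
    have cdb: "cmod (cd z) <= Lp_norm p M f * b z" if z: "z \<in> space Z" for z
    proof -
     have "cd z = (LINT y|M. f y * K1 (z, y) - (\<Sum>i<n. u i z * (f y * indicator (B i) y)))"
      using Lp_Holder(1)[OF pq f K1q(1)[OF z]] Lp_Holder(1)[OF pq f indL[OF B q]]
      by (subst Bochner_Integration.integral_diff) (auto simp: cd_def c_def d_def mult.commute)
     also have "... = (LINT y|M. f y * (K1 (z, y) - (\<Sum>i<n. u i z * indicator (B i) y)))"
      by (intro Bochner_Integration.integral_cong) (simp_all only: right_diff_distrib sum_distrib_left mult_ac)
     finally have cdz: "cd z = (LINT y|M. f y * (K1 (z, y) - (\<Sum>i<n. u i z * indicator (B i) y)))" .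
     have "cmod (cd z) <= (LINT y|M. cmod (f y * (K1 (z, y) - (\<Sum>i<n. u i z * indicator (B i) y))))"
      unfolding cdz by (rule integral_norm_bound)
     also have "... <= Lp_norm p M f * Lp_norm q M (%x. K1 (z, x) - (\<Sum>i<n. u i z * indicator (B i) x))"
      by (rule Lp_Holder(2)[OF pq f DL[OF z]])
     also have "... <= Lp_norm p M f * b z" by (intro mult_left_mono b z) simp
     finally show ?thesis .
    qed
    have b0: "0 <= b z" if "z \<in> space Z" for z using b(1)[OF that] Lp_norm_nonneg order_trans by blast
    have isb: "integrable Z (%z. Lp_norm p M f * (cmod (s z) * b z))" using b by auto
    have scd: "cmod (s z * cd z) <= Lp_norm p M f * (cmod (s z) * b z)" if z: "z \<in> space Z" for z
     using mult_left_mono[OF cdb[OF z], of "cmod (s z)"] by (simp add: norm_mult mult_ac)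
    have icd: "integrable Z (%z. s z * cd z)"
     by (rule integrable_dominated[OF isb])
      (use scd in \<open>auto intro!: AE_I2 intro: order_trans[OF _ abs_ge_self]\<close>)
    have iK: "integrable Z (%z. w z * K2 (z, x))" if x: "x \<in> space M" and w: "integrable Z w" for x w
     by (rule integrable_mult_bounded[OF w _ A2(1)[OF _ x]]) (use x in measurable)
    have eq: "S f x - (\<Sum>i<n. d i f * h i x) = (LINT z|Z. (s z * cd z) * K2 (z, x))" if x: "x \<in> space M" for x
    proof -
     have "(LINT z|Z. (s z * cd z) * K2 (z, x))
      = (LINT z|Z. (s z * c f z) * K2 (z, x) - (\<Sum>i<n. d i f * ((s z * u i z) * K2 (z, x))))"
      by (intro Bochner_Integration.integral_cong) (auto simp: cd_def right_diff_distrib left_diff_distrib sum_distrib_left sum_distrib_right mult_ac)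
     also have "... = S f x - (\<Sum>i<n. d i f * h i x)"
      using iK[OF x wint[OF f]] iK[OF x su] by (subst Bochner_Integration.integral_diff) (auto simp: Seq h_def)
     finally show ?thesis by simp
    qed
    have "Lp_norm p M (%x. S f x - (\<Sum>i<n. d i f * h i x)) = Lp_norm p M (%x. LINT z|Z. (s z * cd z) * K2 (z, x))"
    proof (rule Lp_norm_cong_AE[OF p superposition_in_Lp(1)[OF Z M pq icd K2 A A2]])
     show "(%x. S f x - (\<Sum>i<n. d i f * h i x)) \<in> borel_measurable M"
      using SL[OF f] hL by measurable
    qed (use eq in auto)
    also have "... <= (LINT z|Z. cmod (s z * cd z) * (A + 1))"
     by (rule superposition_in_Lp(3)[OF Z M pq icd K2 A A2 K2p(2)]) (use icd in auto)
    also have "... <= (LINT z|Z. (Lp_norm p M f * (cmod (s z) * b z)) * (A + 1))"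
     using isb scd icd AA b0 by (intro integral_mono_AE' AE_I2 mult_right_mono integrable_mult_left) auto
    also have "... = Lp_norm p M f * (LINT z|Z. cmod (s z) * b z) * (A + 1)" by simp
    also have "... <= Lp_norm p M f * e' * (A + 1)" using b AA by (intro mult_left_mono mult_right_mono) auto
    also have "... = e * Lp_norm p M f" using e' by (simp add: mult_ac)
    finally show ?thesis .
   qed
   show ?thesis
    using db ap hL E0 by (intro exI[of _ n] exI[of _ d] exI[of _ h] exI[of _ E]) auto
  qed
 qed
qed

section \<open>Integrals over the half line and the upper half plane\<close>

text \<open>Reduces integrals over the half line to compact intervals starting at 0, on which the
  substitution rule is applied.\<close>

lemma nn_integral_greaterThan_SUP:
 fixes f :: "real => ennreal"
 assumes [measurable]: "f \<in> borel_measurable borel"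
 shows "(nn_integral lborel (%x. f x * indicator {0<..} x)) = (SUP n. nn_integral lborel (%x. f x * indicator {0..real (Suc n)} x))"
proof -
 have "(nn_integral lborel (%x. f x * indicator {0<..} x)) = (nn_integral lborel (%x. f x * indicator {0..} x))"
 proof (rule nn_integral_cong_AE)
  have "AE x in lborel. x ~= (0::real)" by (rule AE_lborel_singleton)
  then show "AE x in lborel. f x * indicator {0<..} x = f x * indicator {0..} x"
   by eventually_elim (auto simp: indicator_def)
 qed
 also have "... = (nn_integral lborel (%x. (SUP n. f x * indicator {0..real (Suc n)} x)))"
 proof (rule nn_integral_cong)
  fix x :: real
  show "f x * indicator {0..} x = (SUP n. f x * indicator {0..real (Suc n)} x)"
  proof (rule antisym)
   obtain n where "x <= real n" using real_arch_simple by blast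
   then have "f x * indicator {0..} x <= f x * indicator {0..real (Suc n)} x" by (auto simp: indicator_def)
   also have "... <= (SUP n. f x * indicator {0..real (Suc n)} x)" by (rule SUP_upper) simp
   finally show "f x * indicator {0..} x <= (SUP n. f x * indicator {0..real (Suc n)} x)" .
  qed (auto intro!: SUP_least simp: indicator_def)
 qed
 also have "... = (SUP n. nn_integral lborel (%x. f x * indicator {0..real (Suc n)} x))"
  by (intro nn_integral_monotone_convergence_SUP incseq_SucI le_funI) (auto simp: indicator_def)
 finally show ?thesis .
qed

text \<open>The substitution s = t x^2 in Euler's integral for the Gamma function.\<close>

lemma nn_integral_gaussian_powr:
 fixes b t :: real
 assumes b: "b > -1" and t: "t > 0"
 shows "(nn_integral lborel (%x. ennreal (x powr b * exp (- t * x\<^sup>2)) * indicator {0<..} x))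
  = ennreal (Gamma ((b + 1) / 2) / (2 * t powr ((b + 1) / 2)))"
proof -
 define a where "a = (b + 1) / 2"
 have a: "a > 0" using b by (simp add: a_def)
 define f where "f s = ennreal (s powr (a - 1) / exp s)" for s :: real
 have [measurable]: "f \<in> borel_measurable borel" unfolding f_def by measurable
 have G: "(nn_integral lborel (%s. f s * indicator {0<..} s)) = ennreal (Gamma a)"
 proof -
  have "((%s. if s \<in> {0..} then s powr (a - 1) / exp s else 0) has_integral Gamma a) UNIV"
   using Gamma_integral_real[OF a] by (simp only: has_integral_restrict_UNIV)
  then have "(nn_integral lborel (%s. ennreal (if s \<in> {0..} then s powr (a - 1) / exp s else 0))) = ennreal (Gamma a)"
   by (intro nn_integral_has_integral_lborel) auto
  also have "(nn_integral lborel (%s. ennreal (if s \<in> {0..} then s powr (a - 1) / exp s else 0)))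
   = (nn_integral lborel (%s. f s * indicator {0<..} s))"
   by (intro nn_integral_cong) (auto simp: f_def indicator_def order_less_le)
  finally show ?thesis .
 qed
 define g where "g x = t * x\<^sup>2" for x :: real
 have sub: "(nn_integral lborel (%s. f s * indicator {0..g (real (Suc n))} s))
  = (nn_integral lborel (%x. f (g x) * ennreal (2 * t * x) * indicator {0..real (Suc n)} x))" for n
 proof -
  have "(g has_real_derivative 2 * t * x) (at x)" for x
   unfolding g_def by (auto intro!: derivative_eq_intros)
  moreover have "g 0 = 0" by (simp add: g_def)
  ultimately show ?thesis
   using nn_integral_substitution_aux[of f 0 "real (Suc n)" g "%x. 2 * t * x"] t
   by (simp add: continuous_intros)
 qed
 have "(nn_integral lborel (%s. f s * indicator {0<..} s)) = (SUP n. nn_integral lborel (%s. f s * indicator {0..g (real (Suc n))} s))"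
 proof (rule antisym)
  have "(nn_integral lborel (%s. f s * indicator {0<..} s)) = (SUP n. nn_integral lborel (%s. f s * indicator {0..real (Suc n)} s))"
   by (rule nn_integral_greaterThan_SUP) simp
  also have "... <= (SUP n. nn_integral lborel (%s. f s * indicator {0..g (real (Suc n))} s))"
  proof (rule SUP_mono)
   fix n :: nat
   obtain m where m: "real (Suc n) / t <= real m" using real_arch_simple by blast
   have "real (Suc n) <= t * real m" using m t by (simp add: field_simps)
   also have "... <= t * real (Suc m)" using t by simp
   also have "... <= g (real (Suc m))" using t by (simp add: g_def power2_eq_square)
   finally have "real (Suc n) <= g (real (Suc m))" .
   then have "(nn_integral lborel (%s. f s * indicator {0..real (Suc n)} s)) <= (nn_integral lborel (%s. f s * indicator {0..g (real (Suc m))} s))"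
    by (intro nn_integral_mono) (auto simp: indicator_def)
   then show "\<exists>m\<in>UNIV. (nn_integral lborel (%s. f s * indicator {0..real (Suc n)} s)) <= (nn_integral lborel (%s. f s * indicator {0..g (real (Suc m))} s))"
    by blast
  qed
  finally show "(nn_integral lborel (%s. f s * indicator {0<..} s)) <= (SUP n. nn_integral lborel (%s. f s * indicator {0..g (real (Suc n))} s))" .
  show "(SUP n. nn_integral lborel (%s. f s * indicator {0..g (real (Suc n))} s)) <= (nn_integral lborel (%s. f s * indicator {0<..} s))"
  proof (intro SUP_least nn_integral_mono)
   fix n and s :: real
   show "f s * indicator {0..g (real (Suc n))} s <= f s * indicator {0<..} s"
    by (cases "s = 0") (auto simp: indicator_def f_def)
  qed
 qed
 also have "... = (nn_integral lborel (%x. f (g x) * ennreal (2 * t * x) * indicator {0<..} x))"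
  unfolding sub by (rule nn_integral_greaterThan_SUP[symmetric]) (simp add: g_def)
 also have "... = (nn_integral lborel (%x. ennreal (2 * t powr a) * (ennreal (x powr b * exp (- t * x\<^sup>2)) * indicator {0<..} x)))"
 proof (rule nn_integral_cong)
  fix x :: real
  show "f (g x) * ennreal (2 * t * x) * indicator {0<..} x = ennreal (2 * t powr a) * (ennreal (x powr b * exp (- t * x\<^sup>2)) * indicator {0<..} x)"
  proof (cases "x > 0")
   case True
   have "(t * x\<^sup>2) powr (a - 1) = t powr (a - 1) * (x powr 2) powr (a - 1)"
    using True by (simp add: powr_mult powr_numeral)
   also have "(x powr 2) powr (a - 1) = x powr (b - 1)" by (simp add: powr_powr a_def right_diff_distrib add_divide_distrib)
   finally have "(t * x\<^sup>2) powr (a - 1) * (2 * t * x) = 2 * (t powr (a - 1) * t) * (x powr (b - 1) * x)" by simp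
   also have "t powr (a - 1) * t = t powr a" using t powr_mult_base[of t "a - 1"] by (simp add: mult.commute)
   also have "x powr (b - 1) * x = x powr b" using True powr_mult_base[of x "b - 1"] by (simp add: mult.commute)
   finally have e: "(t * x\<^sup>2) powr (a - 1) * (2 * t * x) = 2 * t powr a * x powr b" .
   have "f (g x) * ennreal (2 * t * x) = ennreal ((t * x\<^sup>2) powr (a - 1) * (2 * t * x) / exp (t * x\<^sup>2))"
    using True t by (simp add: f_def g_def ennreal_mult[symmetric])
   also have "... = ennreal (2 * t powr a) * ennreal (x powr b * exp (- t * x\<^sup>2))"
    unfolding e by (simp add: ennreal_mult[symmetric] exp_minus divide_inverse mult.assoc)
   finally show ?thesis using True by simp
  qed simp
 qed
 also have "... = ennreal (2 * t powr a) * (nn_integral lborel (%x. ennreal (x powr b * exp (- t * x\<^sup>2)) * indicator {0<..} x))"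
  by (intro nn_integral_cmult) measurable
 finally have e: "ennreal (Gamma a) = ennreal (2 * t powr a) * (nn_integral lborel (%x. ennreal (x powr b * exp (- t * x\<^sup>2)) * indicator {0<..} x))" (is "_ = _ * ?I")
  unfolding G .
 have pos: "0 < 2 * t powr a" using t by simp
 have "?I = ennreal (1 / (2 * t powr a)) * (ennreal (2 * t powr a) * ?I)"
  using pos by (simp add: mult.assoc[symmetric] ennreal_mult[symmetric])
 also have "... = ennreal (Gamma a / (2 * t powr a))"
  unfolding e[symmetric] using pos Gamma_real_pos[OF a] by (simp add: ennreal_mult[symmetric])
 finally show ?thesis by (simp add: a_def)
qed

text \<open>Polar coordinates from two one-dimensional substitutions with Tonelli in between. At
  fixed r the angle is replaced by t = - r cos th, with the sign that makes it increase on [0, pi];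
  at fixed t the radius is then replaced by v through r = sqrt (v^2 + t^2). A final reflection in t
  removes the sign.\<close>

lemma nn_integral_polar_upper_half_plane:
 fixes H :: "real \<times> real => ennreal"
 assumes [measurable]: "H \<in> borel_measurable borel"
 shows "(nn_integral lborel (%r. (nn_integral lborel (%th. H (r * cos th, r * sin th) * indicator {0..pi} th)) * ennreal r * indicator {0<..} r))
  = (nn_integral lborel (%u. nn_integral lborel (%v. H (u, v) * indicator {0<..} v)))"
proof -
 have [measurable]: "H \<in> borel_measurable (borel \<Otimes>\<^sub>M borel)" unfolding borel_prod by simp
 \<comment> \<open>The factor r / sqrt (r^2 - t^2) is the polar weight r divided by the derivative r
   sin th of the first substitution; in the second one it is the reciprocal of the derivative v /
   r.\<close>
 define F where "F r t = H (- t, sqrt (r\<^sup>2 - t\<^sup>2)) * ennreal (r / sqrt (r\<^sup>2 - t\<^sup>2)) * indicator {0<..} (r\<^sup>2 - t\<^sup>2) * indicator {0<..} r" for r t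
 have Fm [measurable]: "(%(r, t). F r t) \<in> borel_measurable (borel \<Otimes>\<^sub>M borel)" unfolding F_def by measurable
 have [measurable]: "F r \<in> borel_measurable borel" for r unfolding F_def by measurable
 have [measurable]: "(%r. F r t) \<in> borel_measurable borel" for t unfolding F_def by measurable
 have ang: "(nn_integral lborel (%th. H (r * cos th, r * sin th) * indicator {0..pi} th)) * ennreal r = (nn_integral lborel (%t. F r t * indicator {- r..r} t))"
  if r: "r > 0" for r
 proof -
  have "(nn_integral lborel (%t. F r t * indicator {- r * cos 0..- r * cos pi} t))
   = (nn_integral lborel (%th. F r (- r * cos th) * ennreal (r * sin th) * indicator {0..pi} th))"
   using r by (intro nn_integral_substitution_aux) (auto intro!: derivative_eq_intros continuous_intros mult_nonneg_nonneg sin_ge_zero)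
  also have "... = (nn_integral lborel (%th. ennreal r * (H (r * cos th, r * sin th) * indicator {0..pi} th)))"
  proof (rule nn_integral_cong_AE)
   have "AE th in lborel. th ~= (0::real)" "AE th in lborel. th ~= pi" by (rule AE_lborel_singleton)+
   then show "AE th in lborel. F r (- r * cos th) * ennreal (r * sin th) * indicator {0..pi} th
     = ennreal r * (H (r * cos th, r * sin th) * indicator {0..pi} th)"
   proof eventually_elim
    case (elim th)
    show ?case
    proof (cases "th \<in> {0..pi}")
     case True
     then have sp: "sin th > 0" using elim by (intro sin_gt_zero) auto
     have sq: "r\<^sup>2 - (- r * cos th)\<^sup>2 = (r * sin th)\<^sup>2"
      by (simp add: power_mult_distrib sin_squared_eq right_diff_distrib)
     have rs: "r * sin th > 0" using r sp by simp
     then have sr: "sqrt (r\<^sup>2 - (- r * cos th)\<^sup>2) = r * sin th" unfolding sq by simp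
     have pos: "r\<^sup>2 - (- r * cos th)\<^sup>2 > 0" unfolding sq by (rule zero_less_power[OF rs])
     have "F r (- r * cos th) = H (r * cos th, r * sin th) * ennreal (r / (r * sin th))"
      unfolding F_def sr using pos r by simp
     moreover have "ennreal (r / (r * sin th)) * ennreal (r * sin th) = ennreal r"
      using r sp by (simp add: ennreal_mult[symmetric])
     ultimately show ?thesis using True by (simp add: mult.assoc) (simp add: mult.commute)
    qed simp
   qed
  qed
  also have "... = ennreal r * (nn_integral lborel (%th. H (r * cos th, r * sin th) * indicator {0..pi} th))"
   by (intro nn_integral_cmult) measurable
  finally show ?thesis by (simp add: mult.commute)
 qed
 have "(nn_integral lborel (%r. (nn_integral lborel (%th. H (r * cos th, r * sin th) * indicator {0..pi} th)) * ennreal r * indicator {0<..} r))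
  = (nn_integral lborel (%r. nn_integral lborel (%t. F r t)))"
 proof (rule nn_integral_cong)
  fix r :: real
  show "(nn_integral lborel (%th. H (r * cos th, r * sin th) * indicator {0..pi} th)) * ennreal r * indicator {0<..} r = (nn_integral lborel (%t. F r t))"
  proof (cases "r > 0")
   case True
   have "F r t * indicator {- r..r} t = F r t" for t
   proof (cases "t \<in> {- r..r}")
    case False
    then have "\<bar>r\<bar> <= \<bar>t\<bar>" using True by auto
    then have "r\<^sup>2 <= t\<^sup>2" by (simp add: abs_le_square_iff)
    then show ?thesis by (simp add: F_def)
   qed simp
   then show ?thesis using ang[OF True] True by simp
  qed (simp add: F_def)
 qed
 also have "... = (nn_integral lborel (%t. nn_integral lborel (%r. F r t)))"
  by (rule lborel_pair.Fubini') (simp add: case_prod_beta')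
 also have "... = (nn_integral lborel (%t. nn_integral lborel (%v. H (- t, v) * indicator {0<..} v)))"
 proof (rule nn_integral_cong_AE)
  have "AE t in lborel. t ~= (0::real)" by (rule AE_lborel_singleton)
  then show "AE t in lborel. (nn_integral lborel (%r. F r t)) = (nn_integral lborel (%v. H (- t, v) * indicator {0<..} v))"
  proof eventually_elim
   case (elim t)
   define g where "g v = sqrt (v\<^sup>2 + t\<^sup>2)" for v
   have pos: "v\<^sup>2 + t\<^sup>2 > 0" for v using elim by (simp add: add_nonneg_pos)
   have gp: "g v > 0" for v using pos by (simp add: g_def)
   have g0: "g 0 = \<bar>t\<bar>" by (simp add: g_def)
   have sub: "(nn_integral lborel (%r. F r t * indicator {g 0..g (real (Suc n))} r))
    = (nn_integral lborel (%v. F (g v) t * ennreal (v / g v) * indicator {0..real (Suc n)} v))" for n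
   proof (rule nn_integral_substitution_aux)
    show "(g has_real_derivative v / g v) (at v)" for v
     unfolding g_def using pos[of v] by (auto intro!: derivative_eq_intros simp: field_simps)
    show "continuous_on {0..real (Suc n)} (%v. v / g v)"
     unfolding g_def using pos by (intro continuous_intros) (auto simp: less_le)
    show "0 <= v / g v" if "v \<in> {0..real (Suc n)}" for v using that gp[of v] by simp
   qed auto
   have "(nn_integral lborel (%r. F r t)) = (nn_integral lborel (%r. (SUP n. F r t * indicator {g 0..g (real (Suc n))} r)))"
   proof (rule nn_integral_cong)
    fix r
    show "F r t = (SUP n. F r t * indicator {g 0..g (real (Suc n))} r)"
    proof (rule antisym)
     show "F r t <= (SUP n. F r t * indicator {g 0..g (real (Suc n))} r)"
     proof (cases "r > \<bar>t\<bar>")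
      case True
      obtain n where n: "r <= real n" using real_arch_simple by blast
      have "r = sqrt (r\<^sup>2)" using True by simp
      also have "... <= g (real (Suc n))"
      proof -
       have "r\<^sup>2 <= (real (Suc n))\<^sup>2" using n True by (intro power_mono) auto
       then show ?thesis unfolding g_def by (intro real_sqrt_le_mono) (simp add: add_increasing2)
      qed
      finally have "F r t <= F r t * indicator {g 0..g (real (Suc n))} r" using True g0 by simp
      also have "... <= (SUP n. F r t * indicator {g 0..g (real (Suc n))} r)" by (rule SUP_upper) simp
      finally show ?thesis .
     next
      case False
      have "F r t = 0"
      proof (cases "r > 0")
       case True
       then have "\<bar>r\<bar> <= \<bar>t\<bar>" using False by auto
       then have "r\<^sup>2 <= t\<^sup>2" by (simp add: abs_le_square_iff)
       then show ?thesis by (simp add: F_def)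
      qed (simp add: F_def)
      then show ?thesis by simp
     qed
    qed (auto intro!: SUP_least simp: indicator_def)
   qed
   also have "... = (SUP n. nn_integral lborel (%r. F r t * indicator {g 0..g (real (Suc n))} r))"
   proof (intro nn_integral_monotone_convergence_SUP incseq_SucI le_funI)
    fix n r
    have "g (real (Suc n)) <= g (real (Suc (Suc n)))"
     unfolding g_def by (intro real_sqrt_le_mono add_right_mono power_mono) auto
    then show "F r t * indicator {g 0..g (real (Suc n))} r <= F r t * indicator {g 0..g (real (Suc (Suc n)))} r"
     by (auto simp: indicator_def)
   qed measurable
   also have "... = (SUP n. nn_integral lborel (%v. F (g v) t * ennreal (v / g v) * indicator {0..real (Suc n)} v))"
    unfolding sub ..
   also have "... = (nn_integral lborel (%v. F (g v) t * ennreal (v / g v) * indicator {0<..} v))"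
   proof (rule nn_integral_greaterThan_SUP[symmetric])
    have [measurable]: "g \<in> borel_measurable borel" unfolding g_def by measurable
    show "(%v. F (g v) t * ennreal (v / g v)) \<in> borel_measurable borel" by measurable
   qed
   also have "... = (nn_integral lborel (%v. H (- t, v) * indicator {0<..} v))"
   proof (rule nn_integral_cong)
    fix v :: real
    show "F (g v) t * ennreal (v / g v) * indicator {0<..} v = H (- t, v) * indicator {0<..} v"
    proof (cases "v > 0")
     case True
     have sq: "(g v)\<^sup>2 - t\<^sup>2 = v\<^sup>2" using pos[of v] by (simp add: g_def)
     have "F (g v) t = H (- t, v) * ennreal (g v / v)" unfolding F_def sq using True gp[of v] by simp
     moreover have "ennreal (g v / v) * ennreal (v / g v) = 1"
      using True gp[of v] by (simp add: ennreal_mult[symmetric])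
     ultimately show ?thesis using True by (simp add: mult.assoc)
    qed simp
   qed
   finally show ?case .
  qed
 qed
 also have "... = (nn_integral lborel (%u. nn_integral lborel (%v. H (u, v) * indicator {0<..} v)))"
  using nn_integral_real_affine[of "%u. nn_integral lborel (%v. H (u, v) * indicator {0<..} v)" "-1" 0] by simp
 finally show ?thesis .
qed

section \<open>The angular probability measure and its moments\<close>

definition angle_const :: "real => real" where
 "angle_const al = Gamma (al + 1) / (sqrt pi * Gamma (al + 1 / 2))"

text \<open>With respect to this measure the generalized translation is a mean over the
  angle.\<close>

definition angle_measure :: "real => real measure" where
 "angle_measure al = density lborel (%th. ennreal (angle_const al * sin th powr (2 * al)) * indicator {0..pi} th)"

lemma sets_angle_measure [simp, measurable_cong]: "sets (angle_measure al) = sets borel"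
 and space_angle_measure [simp]: "space (angle_measure al) = UNIV"
 by (simp_all add: angle_measure_def)

lemma angle_const_pos: "al > -1/2 ==> angle_const al > 0"
 by (simp add: angle_const_def Gamma_real_pos)

lemma nn_integral_angle_measure:
 assumes "al > -1/2" and [measurable]: "f \<in> borel_measurable borel"
 shows "(nn_integral (angle_measure al) (%th. f th))
  = ennreal (angle_const al) * (nn_integral lborel (%th. f th * ennreal (sin th powr (2 * al)) * indicator {0..pi} th))"
 unfolding angle_measure_def using angle_const_pos[OF assms(1)]
 by (subst nn_integral_density) (auto simp: ennreal_mult nn_integral_cmult[symmetric] mult_ac intro!: nn_integral_cong)

text \<open>A Beta integral evaluated by Gaussians: u^(2k) v^(2 al) exp(- u^2 - v^2) is integrated
  over the upper half plane in polar and in Cartesian coordinates. The radial and the Cartesian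
  factors are Gamma values, so the angular factor I is a quotient of them. The case k = 0 says that
  the measure has mass 1.\<close>

lemma nn_integral_cos_power_angle_measure:
 assumes al: "al > -1/2"
 shows "(nn_integral (angle_measure al) (%th. ennreal (cos th ^ (2 * k)))) = ennreal (pochhammer (1/2) k / pochhammer (al + 1) k)"
proof -
 define I where "I = (nn_integral lborel (%th. ennreal (cos th ^ (2 * k)) * ennreal (sin th powr (2 * al)) * indicator {0..pi} th))"
 define H where "H = (%(u, v). ennreal (u ^ (2 * k) * exp (- u\<^sup>2)) * ennreal (v powr (2 * al) * exp (- v\<^sup>2)))"
 have [measurable]: "H \<in> borel_measurable borel" unfolding H_def borel_prod[symmetric] by measurable
 have "(nn_integral lborel (%r. (nn_integral lborel (%th. H (r * cos th, r * sin th) * indicator {0..pi} th)) * ennreal r * indicator {0<..} r))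
  = (nn_integral lborel (%r. I * (ennreal (r powr (2 * real k + 2 * al + 1) * exp (- 1 * r\<^sup>2)) * indicator {0<..} r)))"
 proof (rule nn_integral_cong)
  fix r :: real
  show "(nn_integral lborel (%th. H (r * cos th, r * sin th) * indicator {0..pi} th)) * ennreal r * indicator {0<..} r
   = I * (ennreal (r powr (2 * real k + 2 * al + 1) * exp (- 1 * r\<^sup>2)) * indicator {0<..} r)"
  proof (cases "r > 0")
   case True
   have pw: "r ^ (2 * k) * r powr (2 * al) = r powr (2 * real k + 2 * al)"
    using True by (simp add: powr_add powr_realpow[symmetric])
   have "H (r * cos th, r * sin th) * indicator {0..pi} th
    = ennreal (r powr (2 * real k + 2 * al) * exp (- r\<^sup>2)) * (ennreal (cos th ^ (2 * k)) * ennreal (sin th powr (2 * al)) * indicator {0..pi} th)" for th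
   proof (cases "th \<in> {0..pi}")
    case t: True
    have e: "exp (- (r * cos th)\<^sup>2) * exp (- (r * sin th)\<^sup>2) = exp (- r\<^sup>2)"
     using sin_cos_squared_add[of th] by (simp add: exp_add[symmetric] power_mult_distrib distrib_left[symmetric] flip: minus_add_distrib)
      (simp add: algebra_simps flip: distrib_left)
    have "H (r * cos th, r * sin th) = ennreal (((r * cos th) ^ (2 * k) * exp (- (r * cos th)\<^sup>2)) * ((r * sin th) powr (2 * al) * exp (- (r * sin th)\<^sup>2)))"
     by (simp add: H_def ennreal_mult)
    also have "((r * cos th) ^ (2 * k) * exp (- (r * cos th)\<^sup>2)) * ((r * sin th) powr (2 * al) * exp (- (r * sin th)\<^sup>2))
     = (r ^ (2 * k) * r powr (2 * al)) * (exp (- (r * cos th)\<^sup>2) * exp (- (r * sin th)\<^sup>2)) * (cos th ^ (2 * k) * sin th powr (2 * al))"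
     by (simp add: power_mult_distrib powr_mult mult_ac)
    finally have "H (r * cos th, r * sin th) = ennreal ((r powr (2 * real k + 2 * al) * exp (- r\<^sup>2)) * (cos th ^ (2 * k) * sin th powr (2 * al)))"
     unfolding pw e .
    also have "... = ennreal (r powr (2 * real k + 2 * al) * exp (- r\<^sup>2)) * (ennreal (cos th ^ (2 * k)) * ennreal (sin th powr (2 * al)))"
     by (subst ennreal_mult, simp, simp, subst (2) ennreal_mult) simp_all
    finally show ?thesis using t by simp
   qed simp
   then have "(nn_integral lborel (%th. H (r * cos th, r * sin th) * indicator {0..pi} th))
    = ennreal (r powr (2 * real k + 2 * al) * exp (- r\<^sup>2)) * I"
    unfolding I_def by (simp add: nn_integral_cmult)
   moreover have "r powr (2 * real k + 2 * al) * exp (- r\<^sup>2) * r = r powr (2 * real k + 2 * al + 1) * exp (- r\<^sup>2)"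
    using True by (simp add: powr_add)
   then have "ennreal (r powr (2 * real k + 2 * al) * exp (- r\<^sup>2)) * ennreal r = ennreal (r powr (2 * real k + 2 * al + 1) * exp (- r\<^sup>2))"
    using True by (simp add: ennreal_mult[symmetric])
   ultimately show ?thesis using True by (simp add: mult_ac)
  qed simp
 qed
 also have "... = I * (nn_integral lborel (%r. ennreal (r powr (2 * real k + 2 * al + 1) * exp (- 1 * r\<^sup>2)) * indicator {0<..} r))"
  by (intro nn_integral_cmult) measurable
 also have "... = I * ennreal (Gamma (al + 1 + real k) / 2)"
 proof -
  have e: "(2 * real k + 2 * al + 1 + 1) / 2 = al + 1 + real k" by simp
  have "-1 < 2 * real k + 2 * al + 1" using al by simp
  from nn_integral_gaussian_powr[OF this, of 1, unfolded e] show ?thesis by simp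
 qed
 finally have L: "(nn_integral lborel (%u. nn_integral lborel (%v. H (u, v) * indicator {0<..} v))) = I * ennreal (Gamma (al + 1 + real k) / 2)"
  by (simp add: nn_integral_polar_upper_half_plane)
 have "(nn_integral lborel (%v. H (u, v) * indicator {0<..} v)) = ennreal (u ^ (2 * k) * exp (- u\<^sup>2)) * ennreal (Gamma (al + 1/2) / 2)" for u
 proof -
  have "(nn_integral lborel (%v. H (u, v) * indicator {0<..} v)) = ennreal (u ^ (2 * k) * exp (- u\<^sup>2)) * (nn_integral lborel (%v. ennreal (v powr (2 * al) * exp (- 1 * v\<^sup>2)) * indicator {0<..} v))"
   unfolding H_def by (simp add: mult.assoc nn_integral_cmult)
  also have "(nn_integral lborel (%v. ennreal (v powr (2 * al) * exp (- 1 * v\<^sup>2)) * indicator {0<..} v)) = ennreal (Gamma (al + 1/2) / 2)"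
   using al by (subst nn_integral_gaussian_powr) (auto simp: field_simps)
  finally show ?thesis .
 qed
 then have "(nn_integral lborel (%u. nn_integral lborel (%v. H (u, v) * indicator {0<..} v)))
  = (nn_integral lborel (%u. ennreal (u ^ (2 * k) * exp (- u\<^sup>2)))) * ennreal (Gamma (al + 1/2) / 2)"
  by (simp add: nn_integral_multc)
 also have "(nn_integral lborel (%u. ennreal (u ^ (2 * k) * exp (- u\<^sup>2)))) = 2 * (nn_integral lborel (%u. ennreal (u ^ (2 * k) * exp (- u\<^sup>2)) * indicator {0<..} u))"
  (is "?A = 2 * ?B")
 proof -
  have "?A = (nn_integral lborel (%u. ennreal (u ^ (2 * k) * exp (- u\<^sup>2)) * indicator {0<..} u + ennreal (u ^ (2 * k) * exp (- u\<^sup>2)) * indicator {..<0} u))"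
  proof (rule nn_integral_cong_AE)
   have "AE u in lborel. u ~= (0::real)" by (rule AE_lborel_singleton)
   then show "AE u in lborel. ennreal (u ^ (2 * k) * exp (- u\<^sup>2))
    = ennreal (u ^ (2 * k) * exp (- u\<^sup>2)) * indicator {0<..} u + ennreal (u ^ (2 * k) * exp (- u\<^sup>2)) * indicator {..<0} u"
    by eventually_elim (auto simp: indicator_def)
  qed
  also have "... = ?B + (nn_integral lborel (%u. ennreal (u ^ (2 * k) * exp (- u\<^sup>2)) * indicator {..<0} u))"
   by (intro nn_integral_add) measurable
  also have "(nn_integral lborel (%u. ennreal (u ^ (2 * k) * exp (- u\<^sup>2)) * indicator {..<0} u)) = ?B"
   using nn_integral_real_affine[of "%u. ennreal (u ^ (2 * k) * exp (- u\<^sup>2)) * indicator {..<0} u" "-1" 0]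
   by (simp add: indicator_def)
  finally show ?thesis by (simp add: mult_2)
 qed
 also have "?B = (nn_integral lborel (%u. ennreal (u powr (2 * real k) * exp (- 1 * u\<^sup>2)) * indicator {0<..} u))"
 proof (rule nn_integral_cong)
  fix u :: real
  show "ennreal (u ^ (2 * k) * exp (- u\<^sup>2)) * indicator {0<..} u = ennreal (u powr (2 * real k) * exp (- 1 * u\<^sup>2)) * indicator {0<..} u"
  proof (cases "u > 0")
   case True
   then show ?thesis using powr_realpow[OF True, of "2 * k"] by simp
  qed simp
 qed
 also have "... = ennreal (Gamma (1/2 + real k) / 2)"
 proof -
  have e: "(2 * real k + 1) / 2 = 1/2 + real k" by simp
  have "-1 < 2 * real k" by (rule less_le_trans[of _ 0]) auto
  from nn_integral_gaussian_powr[OF this, of 1, unfolded e] show ?thesis by simp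
 qed
 finally have R0: "(nn_integral lborel (%u. nn_integral lborel (%v. H (u, v) * indicator {0<..} v)))
   = 2 * ennreal (Gamma (1/2 + real k) / 2) * ennreal (Gamma (al + 1/2) / 2)" .
 have gp: "Gamma (al + 1 + real k) > 0" "Gamma (al + 1/2) > 0" "Gamma (1/2 + real k) > 0" "Gamma (al + 1) > 0"
  using al by (auto intro!: Gamma_real_pos)
 have "ennreal 2 * ennreal (Gamma (1/2 + real k) / 2) = ennreal (2 * (Gamma (1/2 + real k) / 2))"
  by (rule ennreal_mult[symmetric]) (use gp in auto)
 then have "2 * ennreal (Gamma (1/2 + real k) / 2) * ennreal (Gamma (al + 1/2) / 2)
   = ennreal (Gamma (1/2 + real k)) * ennreal (Gamma (al + 1/2) / 2)" by simp
 also have "... = ennreal (Gamma (1/2 + real k) * Gamma (al + 1/2) / 2)"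
  using gp by (simp add: ennreal_mult[symmetric])
 finally have R: "(nn_integral lborel (%u. nn_integral lborel (%v. H (u, v) * indicator {0<..} v))) = ennreal (Gamma (1/2 + real k) * Gamma (al + 1/2) / 2)"
  unfolding R0 .
 have "I = I * ennreal (Gamma (al + 1 + real k) / 2) * ennreal (2 / Gamma (al + 1 + real k))"
  using gp by (simp add: mult.assoc ennreal_mult[symmetric])
 also have "... = ennreal (Gamma (1/2 + real k) * Gamma (al + 1/2) / 2) * ennreal (2 / Gamma (al + 1 + real k))"
  using L R by simp
 also have "... = ennreal (Gamma (1/2 + real k) * Gamma (al + 1/2) / Gamma (al + 1 + real k))"
  using gp by (simp add: ennreal_mult[symmetric])
 finally have I: "I = ennreal (Gamma (1/2 + real k) * Gamma (al + 1/2) / Gamma (al + 1 + real k))" .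
 have nz: "(1/2::real) \<notin> \<int>\<^sub>\<le>\<^sub>0" "al + 1 \<notin> \<int>\<^sub>\<le>\<^sub>0" using al by (auto elim!: nonpos_Ints_cases)
 have "(nn_integral (angle_measure al) (%th. ennreal (cos th ^ (2 * k)))) = ennreal (angle_const al) * I"
  unfolding I_def by (intro nn_integral_angle_measure al) measurable
 also have "... = ennreal (angle_const al * (Gamma (1/2 + real k) * Gamma (al + 1/2) / Gamma (al + 1 + real k)))"
  unfolding I by (rule ennreal_mult'[symmetric]) (use angle_const_pos[OF al] in simp)
 also have "angle_const al * (Gamma (1/2 + real k) * Gamma (al + 1/2) / Gamma (al + 1 + real k)) = pochhammer (1/2) k / pochhammer (al + 1) k"
  using gp unfolding pochhammer_Gamma[OF nz(1)] pochhammer_Gamma[OF nz(2)] angle_const_def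
  by (simp add: Gamma_one_half_real field_simps)
 finally show ?thesis .
qed

lemma prob_space_angle_measure:
 assumes "al > -1/2"
 shows "prob_space (angle_measure al)"
proof (rule prob_spaceI)
 show "emeasure (angle_measure al) (space (angle_measure al)) = 1"
  using nn_integral_cos_power_angle_measure[OF assms, of 0] by simp
qed

lemma integral_cos_power_even:
 assumes "al > -1/2"
 shows "(LINT th|angle_measure al. cos th ^ (2 * k)) = pochhammer (1/2) k / pochhammer (al + 1) k"
proof -
 have "0 <= pochhammer (1/2::real) k / pochhammer (al + 1) k"
  using assms by (intro divide_nonneg_nonneg pochhammer_nonneg) auto
 then show ?thesis
  by (intro integral_eq_nn_integral[THEN trans]) (auto simp: nn_integral_cos_power_angle_measure[OF assms])
qed

lemma integrable_angle_measure_bounded: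
 fixes f :: "real => 'b::{banach, second_countable_topology}"
 assumes "al > -1/2" "f \<in> borel_measurable borel" "!!th. norm (f th) <= B"
 shows "integrable (angle_measure al) f"
proof -
 interpret prob_space "angle_measure al" by (rule prob_space_angle_measure) fact
 show ?thesis using assms by (intro integrable_const_bound[where B=B]) auto
qed

lemma distr_angle_measure_reflect: "distr (angle_measure al) borel (%th. pi - th) = angle_measure al"
proof (rule measure_eqI)
 fix A assume "A \<in> sets (distr (angle_measure al) borel (%th. pi - th))"
 then have [measurable]: "A \<in> sets borel" by simp
 let ?w = "%th. ennreal (angle_const al * sin th powr (2 * al)) * indicator {0..pi} th"
 have "emeasure (distr (angle_measure al) borel (%th. pi - th)) A = (nn_integral lborel (%th. ?w th * indicator A (pi - th)))"
  by (subst nn_integral_indicator[symmetric], simp, subst nn_integral_distr)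
   (auto simp: angle_measure_def nn_integral_density)
 also have "... = (nn_integral lborel (%th. ?w (pi - th) * indicator A th))"
  using nn_integral_real_affine[of "%th. ?w th * indicator A (pi - th)" "-1" pi] by simp
 also have "... = (nn_integral lborel (%th. ?w th * indicator A th))"
  by (intro nn_integral_cong) (auto simp: indicator_def)
 also have "... = emeasure (angle_measure al) A"
  unfolding angle_measure_def by (subst emeasure_density) auto
 finally show "emeasure (distr (angle_measure al) borel (%th. pi - th)) A = emeasure (angle_measure al) A" .
qed simp

lemma integral_cos_power_odd:
 assumes "al > -1/2"
 shows "(LINT th|angle_measure al. cos th ^ (2 * k + 1)) = 0"
proof -
 have "(LINT th|angle_measure al. cos th ^ (2 * k + 1)) = (LINT th|distr (angle_measure al) borel (%th. pi - th). cos th ^ (2 * k + 1))"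
  by (simp only: distr_angle_measure_reflect)
 also have "... = (LINT th|angle_measure al. cos (pi - th) ^ (2 * k + 1))"
  by (intro integral_distr) measurable
 also have "... = - (LINT th|angle_measure al. cos th ^ (2 * k + 1))"
  by (simp flip: Bochner_Integration.integral_minus)
 finally show ?thesis by simp
qed

section \<open>The normalized Bessel function\<close>

text \<open>The Taylor coefficients of \<open>bessel_j\<close> in the variable s^2; the quotient of
  the two Gamma values becomes a reciprocal Pochhammer symbol.\<close>

definition bessel_coeff :: "real => nat => real" where
 "bessel_coeff al k = (-1) ^ k / (4 ^ k * fact k * pochhammer (al + 1) k)"

lemma power_le_pochhammer:
 fixes a b :: real
 assumes "0 <= a" "a <= b"
 shows "a ^ k <= pochhammer b k"
proof (induction k)
 case (Suc k)
 have "a ^ k * a <= pochhammer b k * (b + real k)"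
  using assms Suc order_trans[OF zero_le_power[OF assms(1)] Suc] by (intro mult_mono) auto
 then show ?case by (simp add: pochhammer_Suc mult.commute)
qed simp

text \<open>As al + 1 >= 1/2, the Pochhammer symbol is at least 2^(-k), which cancels half of the
  factor 4^k. The series is therefore dominated by an exponential one, uniformly in al.\<close>

lemma abs_bessel_coeff_le:
 assumes "al > -1/2"
 shows "\<bar>bessel_coeff al k\<bar> <= (1/2) ^ k / fact k"
proof -
 have p: "(1/2) ^ k <= pochhammer (al + 1) k" using assms by (intro power_le_pochhammer) auto
 then have pos: "0 < pochhammer (al + 1) k" by (rule less_le_trans[rotated]) simp
 have "\<bar>bessel_coeff al k\<bar> = 1 / (4 ^ k * fact k * pochhammer (al + 1) k)"
  using pos by (simp add: bessel_coeff_def abs_mult power_abs)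
 also have "... <= 1 / (4 ^ k * fact k * (1/2) ^ k)"
  using p pos by (intro divide_left_mono mult_left_mono) auto
 also have "... = (1/2) ^ k / fact k"
 proof -
  have "(4::real) ^ k * (1/2) ^ k = 2 ^ k" by (simp add: power_mult_distrib[symmetric])
  then have "(4::real) ^ k * fact k * (1/2) ^ k = 2 ^ k * fact k" by (simp add: mult_ac)
  then show ?thesis by (simp add: power_divide)
 qed
 finally show ?thesis .
qed

lemma summable_bessel_coeff:
 assumes "al > -1/2" "0 <= x"
 shows "summable (%k. \<bar>bessel_coeff al k\<bar> * x ^ k)"
proof (rule summable_comparison_test')
 show "summable (%k. inverse (fact k) * (x / 2) ^ k)" by (rule summable_exp)
 fix k :: nat
 have "\<bar>bessel_coeff al k\<bar> * x ^ k <= (1/2) ^ k / fact k * x ^ k"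
  using assms abs_bessel_coeff_le[OF assms(1)] by (intro mult_right_mono) auto
 then show "norm (\<bar>bessel_coeff al k\<bar> * x ^ k) <= inverse (fact k) * (x / 2) ^ k"
  using assms by (simp add: power_divide field_simps abs_mult)
qed

lemma bessel_j_eq_suminf:
 assumes "al > -1/2"
 shows "bessel_j al s = (\<Sum>k. bessel_coeff al k * (s\<^sup>2) ^ k)"
proof -
 have g: "Gamma (al + 1) > 0" using assms by (intro Gamma_real_pos) auto
 have nz: "al + 1 \<notin> \<int>\<^sub>\<le>\<^sub>0" using assms by (auto elim!: nonpos_Ints_cases)
 have t: "Gamma (al + 1) * ((-1) ^ k * s ^ (2 * k) / (2 ^ (2 * k) * fact k * Gamma (al + real k + 1)))
  = bessel_coeff al k * (s\<^sup>2) ^ k" for k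
 proof -
  have gk: "Gamma (al + 1 + real k) > 0" using assms by (intro Gamma_real_pos) auto
  have "Gamma (al + real k + 1) = Gamma (al + 1) * pochhammer (al + 1) k"
   using g gk unfolding pochhammer_Gamma[OF nz] by (simp add: add_ac)
  then show ?thesis using g by (simp add: bessel_coeff_def power_mult)
 qed
 have "summable (%k. \<bar>bessel_coeff al k * (s\<^sup>2) ^ k\<bar>)"
  using summable_bessel_coeff[OF assms, of "s\<^sup>2"] by (simp add: abs_mult)
 then have "summable (%k. bessel_coeff al k * (s\<^sup>2) ^ k)" by (rule summable_rabs_cancel)
 then have "summable (%k. Gamma (al + 1) * ((-1) ^ k * s ^ (2 * k) / (2 ^ (2 * k) * fact k * Gamma (al + real k + 1))))"
  unfolding t .
 then have "summable (%k. (-1) ^ k * s ^ (2 * k) / (2 ^ (2 * k) * fact k * Gamma (al + real k + 1)))"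
  using g by (subst (asm) summable_cmult_iff) simp
 then show ?thesis unfolding bessel_j_def t[symmetric] by (rule suminf_mult[symmetric])
qed

lemma angle_measure_power_series:
 fixes X :: "real => real" and c :: "nat => real"
 assumes al: "al > -1/2" and [measurable]: "X \<in> borel_measurable borel"
  and R: "!!th. \<bar>X th\<bar> <= R" and s: "summable (%n. \<bar>c n\<bar> * R ^ n)"
 shows "(%n. c n * (LINT th|angle_measure al. X th ^ n)) sums (LINT th|angle_measure al. (\<Sum>n. c n * X th ^ n))"
proof -
 interpret prob_space "angle_measure al" by (rule prob_space_angle_measure[OF al])
 have b: "\<bar>c n * X th ^ n\<bar> <= \<bar>c n\<bar> * R ^ n" for n th
  unfolding abs_mult power_abs by (intro mult_left_mono power_mono R) auto
 have i: "integrable (angle_measure al) (%th. c n * X th ^ n)" for n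
  using b by (intro integrable_angle_measure_bounded[OF al, where B="\<bar>c n\<bar> * R ^ n"]) auto
 have "(%n. LINT th|angle_measure al. c n * X th ^ n) sums (LINT th|angle_measure al. (\<Sum>n. c n * X th ^ n))"
 proof (rule sums_integral[OF i])
  show "AE th in angle_measure al. summable (%n. norm (c n * X th ^ n))"
   using b by (intro AE_I2 summable_comparison_test'[OF s]) auto
  show "summable (%n. LINT th|angle_measure al. norm (c n * X th ^ n))"
  proof (rule summable_comparison_test'[OF s])
   fix n :: nat
   have "(LINT th|angle_measure al. norm (c n * X th ^ n)) <= (LINT th|angle_measure al. \<bar>c n\<bar> * R ^ n)"
    using b by (intro integral_mono integrable_norm i) auto
   also have "... = \<bar>c n\<bar> * R ^ n" using prob_space by simp
   finally show "norm (LINT th|angle_measure al. norm (c n * X th ^ n)) <= \<bar>c n\<bar> * R ^ n" by simp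
  qed
 qed
 then show ?thesis by simp
qed

text \<open>Poisson's integral. The cosine series is integrated term by term, and the even moments
  together with (2k)! = 4^k (1/2)_k k! reproduce the Bessel coefficients. It makes the bound by 1
  evident, which the power series does not.\<close>

lemma bessel_j_poisson:
 assumes al: "al > -1/2"
 shows "bessel_j al s = (LINT th|angle_measure al. cos (s * cos th))"
proof -
 define c where "c k = (-1) ^ k / fact (2 * k) * s ^ (2 * k)" for k :: nat
 have cs: "(\<Sum>k. c k * ((cos th)\<^sup>2) ^ k) = cos (s * cos th)" for th
  using sums_unique[OF cos_paired[of "s * cos th"]] by (simp add: c_def power_mult_distrib power_mult[symmetric] mult_ac)
 have sm: "summable (%k. \<bar>c k\<bar> * 1 ^ k)"
 proof -
  have "summable (%n. inverse (fact n) * (s\<^sup>2) ^ n)" by (rule summable_exp)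
  then show ?thesis
  proof (rule summable_comparison_test')
   fix k :: nat
   have "(fact k :: real) <= fact (2 * k)" by (intro fact_mono) simp
   then have "inverse (fact (2 * k)) <= inverse (fact k :: real)" by (intro le_imp_inverse_le) auto
   then have "inverse (fact (2 * k)) * (s\<^sup>2) ^ k <= inverse (fact k) * (s\<^sup>2) ^ k" by (intro mult_right_mono) auto
   then show "norm (\<bar>c k\<bar> * 1 ^ k) <= inverse (fact k) * (s\<^sup>2) ^ k"
    unfolding c_def power_mult[of s 2 k] by (simp add: abs_mult power_abs divide_inverse)
  qed
 qed
 have "(%k. c k * (LINT th|angle_measure al. ((cos th)\<^sup>2) ^ k)) sums (LINT th|angle_measure al. (\<Sum>k. c k * ((cos th)\<^sup>2) ^ k))"
  by (rule angle_measure_power_series[OF al _ _ sm]) (auto simp: abs_square_le_1)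
 moreover have "c k * (LINT th|angle_measure al. ((cos th)\<^sup>2) ^ k) = bessel_coeff al k * (s\<^sup>2) ^ k" for k
 proof -
  have P: "pochhammer (1/2::real) k > 0" by (intro pochhammer_pos) auto
  have I: "(LINT th|angle_measure al. ((cos th)\<^sup>2) ^ k) = pochhammer (1/2) k / pochhammer (al + 1) k"
   using integral_cos_power_even[OF al, of k] by (simp only: power_mult)
  have fd: "fact (2 * k) = 4 ^ k * pochhammer (1/2) k * (fact k :: real)" by (simp add: fact_double power_mult)
  show ?thesis unfolding c_def I fd bessel_coeff_def power_mult[of s 2 k] using P by simp
 qed
 ultimately have "(%k. bessel_coeff al k * (s\<^sup>2) ^ k) sums (LINT th|angle_measure al. cos (s * cos th))"
  unfolding cs by simp
 then show ?thesis unfolding bessel_j_eq_suminf[OF al] by (rule sums_unique[symmetric])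
qed

lemma abs_bessel_j_le_1:
 assumes al: "al > -1/2"
 shows "\<bar>bessel_j al s\<bar> <= 1"
proof -
 interpret prob_space "angle_measure al" by (rule prob_space_angle_measure[OF al])
 have "norm (LINT th|angle_measure al. cos (s * cos th)) <= (LINT th|angle_measure al. norm (cos (s * cos th)))"
  by (rule integral_norm_bound)
 also have "... <= (LINT th|angle_measure al. 1)"
  by (intro integral_mono integrable_angle_measure_bounded[OF al, where B=1]) auto
 finally show ?thesis using prob_space by (simp add: bessel_j_poisson[OF al])
qed

lemma borel_measurable_bessel_j [measurable]:
 "al > -1/2 ==> bessel_j al \<in> borel_measurable borel"
proof -
 assume al: "al > -1/2"
 interpret prob_space "angle_measure al" by (rule prob_space_angle_measure[OF al])
 have "(%s. LINT th|angle_measure al. cos (s * cos th)) \<in> borel_measurable borel" by measurable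
 then show ?thesis using bessel_j_poisson[OF al] by (simp add: fun_eq_iff[symmetric] cong: measurable_cong)
qed

lemma pochhammer_minus_nat:
 "pochhammer (- real k) l = (if l <= k then (-1) ^ l * (fact k / fact (k - l)) else 0)"
proof (cases "l <= k")
 case True
 have "real (k choose l) = (-1) ^ l * pochhammer (- real k) l / fact l"
  by (simp add: binomial_gbinomial gbinomial_pochhammer)
 then have "(-1) ^ l * pochhammer (- real k) l = fact k / fact (k - l)"
  using True by (simp add: binomial_fact field_simps)
 then have "(-1) ^ l * ((-1) ^ l * pochhammer (- real k) l) = (-1) ^ l * (fact k / fact (k - l))" by simp
 then show ?thesis using True by (simp add: mult.assoc[symmetric] power_mult_distrib[symmetric])
next
 case False
 then show ?thesis by (simp add: pochhammer_of_nat_eq_0_iff)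
qed

text \<open>The Chu-Vandermonde identity in the shape in which it arises when (x^2 + y^2 + 2 x y cos
  th)^n is expanded and averaged. The side condition i + l <= n is the vanishing of the Pochhammer
  symbol of - (n - i) at indices l > n - i.\<close>

lemma vandermonde_factorial:
 fixes c :: real
 assumes c: "c > 0" and i: "i <= n"
 shows "(\<Sum>l\<le>n. if l <= i & i + l <= n then fact n / (fact l * fact (i - l) * fact (n - i - l) * pochhammer c l) else 0)
  = real (n choose i) * (pochhammer c n / (pochhammer c i * pochhammer c (n - i)))"
proof -
 define k where "k = n - i"
 have n: "n = i + k" using i by (simp add: k_def)
 have p: "pochhammer c m > 0" for m using c by (rule pochhammer_pos)
 have "(\<Sum>l=0..i. (pochhammer (- real k) l * pochhammer (- real i) l) / (fact l * pochhammer c l))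
   = pochhammer (c - (- real k)) i / pochhammer c i"
  using Vandermonde_pochhammer[of i c "- real k"] c by auto
 moreover have "pochhammer c n = pochhammer c k * pochhammer (c + real k) i"
  using pochhammer_product[of k n c] n by simp
 ultimately have V: "(\<Sum>l=0..i. (pochhammer (- real k) l * pochhammer (- real i) l) / (fact l * pochhammer c l))
   = pochhammer c n / (pochhammer c i * pochhammer c k)"
  using p[of k] p[of i] p[of n] by (simp add: field_simps)
 have "(\<Sum>l\<le>n. if l <= i & i + l <= n then fact n / (fact l * fact (i - l) * fact (n - i - l) * pochhammer c l) else 0)
  = (\<Sum>l=0..i. if l <= k then fact n / (fact l * fact (i - l) * fact (k - l) * pochhammer c l) else 0)"
  using n by (intro sum.mono_neutral_cong_right) auto
 also have "... = (\<Sum>l=0..i. real (n choose i) * ((pochhammer (- real k) l * pochhammer (- real i) l) / (fact l * pochhammer c l)))"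
 proof (intro sum.cong refl)
  fix l assume l: "l \<in> {0..i}"
  have b: "real (n choose i) = fact n / (fact i * fact k)" using n by (simp add: binomial_fact)
  show "(if l <= k then fact n / (fact l * fact (i - l) * fact (k - l) * pochhammer c l) else 0)
   = real (n choose i) * ((pochhammer (- real k) l * pochhammer (- real i) l) / (fact l * pochhammer c l))"
  proof (cases "l <= k")
   case True
   have "pochhammer (- real k) l * pochhammer (- real i) l = (fact k / fact (k - l)) * (fact i / fact (i - l))"
    using True l by (simp add: pochhammer_minus_nat power_mult_distrib[symmetric] mult_ac)
   then show ?thesis using True p[of l] unfolding b by simp
  qed (simp add: pochhammer_minus_nat)
 qed
 also have "... = real (n choose i) * (pochhammer c n / (pochhammer c i * pochhammer c k))"
  unfolding sum_distrib_left[symmetric] V ..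
 finally show ?thesis by (simp add: k_def)
qed

text \<open>Expanding in powers of the cosine, the odd moments vanish and the even ones are known;
  the coefficient of x^(2i) y^(2(n-i)) is then a Vandermonde sum. Its value factors into an n-part
  and parts belonging to i and n - i, which is the shape needed for a Cauchy product of two Bessel
  series.\<close>

lemma integral_angle_measure_power:
 assumes al: "al > -1/2"
 shows "(LINT th|angle_measure al. (x\<^sup>2 + y\<^sup>2 + 2 * x * y * cos th) ^ n)
  = (\<Sum>i\<le>n. real (n choose i) * (pochhammer (al + 1) n / (pochhammer (al + 1) i * pochhammer (al + 1) (n - i)))
    * ((x\<^sup>2) ^ i * (y\<^sup>2) ^ (n - i)))"
proof -
 define c where "c = al + 1"
 have c: "c > 0" using al by (simp add: c_def)
 have p: "pochhammer c m > 0" for m using c by (rule pochhammer_pos)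
 have ic: "integrable (angle_measure al) (%th. a * cos th ^ m)" for a m
  by (intro integrable_angle_measure_bounded[OF al, where B="\<bar>a\<bar>"])
   (auto simp: abs_mult power_abs intro!: mult_left_le power_le_one)
 define g where "g m = real (n choose m) * (2 * x * y) ^ m * (x\<^sup>2 + y\<^sup>2) ^ (n - m) * (LINT th|angle_measure al. cos th ^ m)" for m
 have "(x\<^sup>2 + y\<^sup>2 + 2 * x * y * cos th) ^ n = (\<Sum>m\<le>n. (real (n choose m) * (2 * x * y) ^ m * (x\<^sup>2 + y\<^sup>2) ^ (n - m)) * cos th ^ m)" for th
  using binomial_ring[of "2 * x * y * cos th" "x\<^sup>2 + y\<^sup>2" n] by (simp add: add_ac power_mult_distrib mult_ac)
 then have "(LINT th|angle_measure al. (x\<^sup>2 + y\<^sup>2 + 2 * x * y * cos th) ^ n) = (\<Sum>m\<le>n. g m)"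
  unfolding g_def by (simp add: Bochner_Integration.integral_sum[OF ic])
 also have "... = (\<Sum>m\<in>(%l. 2 * l) ` {l. 2 * l <= n}. g m)"
 proof (rule sum.mono_neutral_right)
  show "\<forall>m\<in>{..n} - (%l. 2 * l) ` {l. 2 * l <= n}. g m = 0"
  proof
   fix m assume m: "m \<in> {..n} - (%l. 2 * l) ` {l. 2 * l <= n}"
   have "odd m"
   proof
    assume "even m"
    then obtain l where "m = 2 * l" by blast
    then show False using m by auto
   qed
   then obtain l where "m = 2 * l + 1" by (auto elim: oddE)
   then show "g m = 0" using integral_cos_power_odd[OF al, of l] by (simp add: g_def)
  qed
 qed auto
 also have "... = (\<Sum>l\<in>{l. 2 * l <= n}. g (2 * l))"
  by (subst sum.reindex) (auto simp: inj_on_def)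
 \<comment> \<open>The index i = j + l is the total power of x^2: l of it comes from (x y)^(2 l) and
   j from the binomial expansion of the remaining factor.\<close>
 also have "... = (\<Sum>l\<in>{l. 2 * l <= n}. \<Sum>i\<le>n. if l <= i & i + l <= n
   then fact n / (fact l * fact (i - l) * fact (n - i - l) * pochhammer c l) * ((x\<^sup>2) ^ i * (y\<^sup>2) ^ (n - i)) else 0)"
 proof (intro sum.cong refl)
  fix l assume "l \<in> {l. 2 * l <= n}"
  then have l: "2 * l <= n" by simp
  have ph: "pochhammer (1/2::real) l > 0" by (intro pochhammer_pos) auto
  have bf: "real (n choose (2 * l)) = fact n / (fact (2 * l) * fact (n - 2 * l))" using l by (simp add: binomial_fact)
  have fd: "fact (2 * l) = 4 ^ l * pochhammer (1/2) l * (fact l :: real)" by (simp add: fact_double power_mult)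
  have xy: "(2 * x * y) ^ (2 * l) = 4 ^ l * ((x\<^sup>2) ^ l * (y\<^sup>2) ^ l)"
   by (simp add: power_mult power_mult_distrib)
  have "g (2 * l) = (fact n / (fact (2 * l) * fact (n - 2 * l))) * (2 * x * y) ^ (2 * l) * (x\<^sup>2 + y\<^sup>2) ^ (n - 2 * l) * (pochhammer (1/2) l / pochhammer c l)"
   unfolding g_def integral_cos_power_even[OF al] bf c_def ..
  also have "... = fact n / (fact l * fact (n - 2 * l) * pochhammer c l) * ((x\<^sup>2) ^ l * (y\<^sup>2) ^ l) * (x\<^sup>2 + y\<^sup>2) ^ (n - 2 * l)"
   unfolding fd xy using ph p[of l] by (simp add: field_simps)
  also have "(x\<^sup>2 + y\<^sup>2) ^ (n - 2 * l) = (\<Sum>j\<le>n - 2 * l. real ((n - 2 * l) choose j) * (x\<^sup>2) ^ j * (y\<^sup>2) ^ (n - 2 * l - j))"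
   by (rule binomial_ring)
  also have "fact n / (fact l * fact (n - 2 * l) * pochhammer c l) * ((x\<^sup>2) ^ l * (y\<^sup>2) ^ l) * ...
   = (\<Sum>j\<in>{0..n - 2 * l}. fact n / (fact l * fact j * fact (n - 2 * l - j) * pochhammer c l) * ((x\<^sup>2) ^ (j + l) * (y\<^sup>2) ^ (n - (j + l))))"
   unfolding sum_distrib_left atMost_atLeast0
  proof (intro sum.cong refl)
   fix j assume "j \<in> {0..n - 2 * l}"
   then have j: "j <= n - 2 * l" by simp
   have e: "n - (j + l) = l + (n - 2 * l - j)" using j l by simp
   have "real ((n - 2 * l) choose j) = fact (n - 2 * l) / (fact j * fact (n - 2 * l - j))" using j by (simp add: binomial_fact)
   then show "fact n / (fact l * fact (n - 2 * l) * pochhammer c l) * ((x\<^sup>2) ^ l * (y\<^sup>2) ^ l) * (real ((n - 2 * l) choose j) * (x\<^sup>2) ^ j * (y\<^sup>2) ^ (n - 2 * l - j))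
    = fact n / (fact l * fact j * fact (n - 2 * l - j) * pochhammer c l) * ((x\<^sup>2) ^ (j + l) * (y\<^sup>2) ^ (n - (j + l)))"
    unfolding e by (simp add: power_add mult_ac)
  qed
  also have "... = (\<Sum>i\<in>{0 + l..n - 2 * l + l}. fact n / (fact l * fact (i - l) * fact (n - i - l) * pochhammer c l) * ((x\<^sup>2) ^ i * (y\<^sup>2) ^ (n - i)))"
   unfolding sum.shift_bounds_cl_nat_ivl
  proof (intro sum.cong refl)
   fix j assume j: "j \<in> {0..n - 2 * l}"
   have "n - 2 * l - j = n - (j + l) - l" using j l by simp
   then show "fact n / (fact l * fact j * fact (n - 2 * l - j) * pochhammer c l) * ((x\<^sup>2) ^ (j + l) * (y\<^sup>2) ^ (n - (j + l)))
    = fact n / (fact l * fact (j + l - l) * fact (n - (j + l) - l) * pochhammer c l) * ((x\<^sup>2) ^ (j + l) * (y\<^sup>2) ^ (n - (j + l)))"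
    by simp
  qed
  also have "... = (\<Sum>i\<le>n. if l <= i & i + l <= n
   then fact n / (fact l * fact (i - l) * fact (n - i - l) * pochhammer c l) * ((x\<^sup>2) ^ i * (y\<^sup>2) ^ (n - i)) else 0)"
   using l by (intro sum.mono_neutral_cong_left) auto
  finally show "g (2 * l) = ..." .
 qed
 also have "... = (\<Sum>l\<le>n. \<Sum>i\<le>n. if l <= i & i + l <= n
   then fact n / (fact l * fact (i - l) * fact (n - i - l) * pochhammer c l) * ((x\<^sup>2) ^ i * (y\<^sup>2) ^ (n - i)) else 0)"
  by (intro sum.mono_neutral_left) (auto intro!: sum.neutral split: if_split_asm)
 also have "... = (\<Sum>i\<le>n. \<Sum>l\<le>n. if l <= i & i + l <= n
   then fact n / (fact l * fact (i - l) * fact (n - i - l) * pochhammer c l) * ((x\<^sup>2) ^ i * (y\<^sup>2) ^ (n - i)) else 0)"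
  by (rule sum.swap)
 also have "... = (\<Sum>i\<le>n. (\<Sum>l\<le>n. if l <= i & i + l <= n
   then fact n / (fact l * fact (i - l) * fact (n - i - l) * pochhammer c l) else 0) * ((x\<^sup>2) ^ i * (y\<^sup>2) ^ (n - i)))"
  unfolding sum_distrib_right by (intro sum.cong refl) auto
 also have "... = (\<Sum>i\<le>n. real (n choose i) * (pochhammer c n / (pochhammer c i * pochhammer c (n - i)))
    * ((x\<^sup>2) ^ i * (y\<^sup>2) ^ (n - i)))"
  by (intro sum.cong refl) (simp add: vandermonde_factorial[OF c])
 finally show ?thesis by (simp add: c_def)
qed

lemma law_of_cosines_nonneg: "0 <= x\<^sup>2 + y\<^sup>2 + 2 * x * y * cos th" for x y th :: real
proof -
 have "x\<^sup>2 + y\<^sup>2 + 2 * x * y * cos th = (x + y * cos th)\<^sup>2 + (y * sin th)\<^sup>2"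
  by (simp add: power2_sum power_mult_distrib sin_squared_eq algebra_simps)
 then show ?thesis by simp
qed

text \<open>The product formula of Gegenbauer type. Averaging the n-th power of the squared third
  side gives, after multiplication by the n-th Bessel coefficient, exactly the n-th term of the
  Cauchy product of the series at x^2 and y^2.\<close>

lemma bessel_j_product:
 assumes al: "al > -1/2"
 shows "(LINT th|angle_measure al. bessel_j al (sqrt (x\<^sup>2 + y\<^sup>2 + 2 * x * y * cos th))) = bessel_j al x * bessel_j al y"
proof -
 define X where "X th = x\<^sup>2 + y\<^sup>2 + 2 * x * y * cos th" for th
 have X0: "0 <= X th" for th unfolding X_def by (rule law_of_cosines_nonneg)
 have XR: "\<bar>X th\<bar> <= (\<bar>x\<bar> + \<bar>y\<bar>)\<^sup>2" for th
 proof -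
  have "2 * x * y * cos th <= 2 * (\<bar>x\<bar> * \<bar>y\<bar>)"
  proof -
   have "x * y * cos th <= \<bar>x * y\<bar> * \<bar>cos th\<bar>" by (metis abs_ge_self abs_mult)
   also have "... <= \<bar>x * y\<bar> * 1" by (intro mult_left_mono) auto
   finally show ?thesis by (simp add: abs_mult)
  qed
  then show ?thesis using X0[of th] by (simp add: X_def power2_sum)
 qed
 have [measurable]: "X \<in> borel_measurable borel" unfolding X_def by measurable
 have sm: "summable (%n. \<bar>bessel_coeff al n\<bar> * ((\<bar>x\<bar> + \<bar>y\<bar>)\<^sup>2) ^ n)"
  by (intro summable_bessel_coeff[OF al]) simp
 have S: "(%n. bessel_coeff al n * (LINT th|angle_measure al. X th ^ n)) sums (LINT th|angle_measure al. (\<Sum>n. bessel_coeff al n * X th ^ n))"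
  by (rule angle_measure_power_series[OF al _ XR sm]) simp
 have co: "bessel_coeff al n * (real (n choose i) * (pochhammer (al + 1) n / (pochhammer (al + 1) i * pochhammer (al + 1) (n - i))))
  = bessel_coeff al i * bessel_coeff al (n - i)" if "i <= n" for n i
 proof -
  have p: "pochhammer (al + 1) m > 0" for m using al by (intro pochhammer_pos) auto
  have "(-1::real) ^ n = (-1) ^ i * (-1) ^ (n - i)" "(4::real) ^ n = 4 ^ i * 4 ^ (n - i)"
   using that by (simp_all add: power_add[symmetric])
  moreover have "real (n choose i) = fact n / (fact i * fact (n - i))" using that by (simp add: binomial_fact)
  ultimately show ?thesis using p[of n] p[of i] p[of "n - i"] by (simp add: bessel_coeff_def)
 qed
 have "bessel_coeff al n * (LINT th|angle_measure al. X th ^ n)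
  = (\<Sum>i\<le>n. (bessel_coeff al i * (x\<^sup>2) ^ i) * (bessel_coeff al (n - i) * (y\<^sup>2) ^ (n - i)))" for n
  unfolding X_def integral_angle_measure_power[OF al] sum_distrib_left
 proof (intro sum.cong refl)
  fix i assume "i \<in> {..n}"
  then show "bessel_coeff al n * (real (n choose i) * (pochhammer (al + 1) n / (pochhammer (al + 1) i * pochhammer (al + 1) (n - i)))
    * ((x\<^sup>2) ^ i * (y\<^sup>2) ^ (n - i))) = (bessel_coeff al i * (x\<^sup>2) ^ i) * (bessel_coeff al (n - i) * (y\<^sup>2) ^ (n - i))"
   using arg_cong[OF co[of i n], of "%a. a * ((x\<^sup>2) ^ i * (y\<^sup>2) ^ (n - i))"]
   by (simp only: atMost_iff mult_ac)
 qed
 moreover have "(%n. \<Sum>i\<le>n. (bessel_coeff al i * (x\<^sup>2) ^ i) * (bessel_coeff al (n - i) * (y\<^sup>2) ^ (n - i)))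
   sums ((\<Sum>k. bessel_coeff al k * (x\<^sup>2) ^ k) * (\<Sum>k. bessel_coeff al k * (y\<^sup>2) ^ k))"
  using summable_bessel_coeff[OF al, of "x\<^sup>2"] summable_bessel_coeff[OF al, of "y\<^sup>2"]
  by (intro Cauchy_product_sums) (simp_all add: abs_mult)
 ultimately have "(LINT th|angle_measure al. (\<Sum>n. bessel_coeff al n * X th ^ n)) = bessel_j al x * bessel_j al y"
  using S by (simp add: bessel_j_eq_suminf[OF al] sums_unique2)
 moreover have "bessel_j al (sqrt (X th)) = (\<Sum>n. bessel_coeff al n * X th ^ n)" for th
  using X0[of th] by (simp add: bessel_j_eq_suminf[OF al])
 ultimately show ?thesis by (simp add: X_def)
qed

section \<open>Weinstein kernel and generalized translation\<close>

definition wconst :: "real => nat => real" where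
 "wconst al d = 1 / ((2 * pi) ^ d * 2 powr (2 * al) * (Gamma (al + 1))\<^sup>2)"

lemma wconst_pos: "al > -1/2 ==> wconst al d > 0"
 unfolding wconst_def
 by (intro divide_pos_pos mult_pos_pos zero_less_power Gamma_real_pos) auto

lemma weinstein_measure_altdef:
 "(wmeas al :: ((real ^ 'd) \<times> real) measure) = density lborel
  (%x. ennreal (wconst al CARD('d) * snd x powr (2 * al + 1)) * indicator {0<..} (snd x))"
 unfolding weinstein_measure_def wconst_def
 by (intro arg_cong2[where f=density] ext refl) (simp add: indicator_def)

lemma sets_weinstein_measure [simp, measurable_cong]: "sets (wmeas al) = sets borel"
 and space_weinstein_measure [simp]: "space (wmeas al) = UNIV"
 by (simp_all add: weinstein_measure_def)

lemma borel_measurable_weinstein_measure [simp]: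
 "borel_measurable (wmeas al) = borel_measurable borel"
 by (intro measurable_cong_sets) auto

lemma borel_measurable_lborel: "borel_measurable lborel = borel_measurable borel"
 by (intro measurable_cong_sets) auto

lemma weinstein_density_measurable [measurable]:
 "(%x::(real ^ 'd) \<times> real. ennreal (C * snd x powr b) * indicator {0<..} (snd x)) \<in> borel_measurable borel"
 unfolding borel_prod[symmetric] by measurable

lemma nn_integral_weinstein_measure:
 fixes f :: "(real ^ 'd) \<times> real => ennreal"
 assumes [measurable]: "f \<in> borel_measurable borel"
 shows "(nn_integral (wmeas al) (%x. f x)) = (nn_integral lborel (%x'. nn_integral lborel (%s. f (x', s) * (ennreal (wconst al CARD('d) * s powr (2 * al + 1)) * indicator {0<..} s))))"
proof -
 let ?w = "%x::(real ^ 'd) \<times> real. ennreal (wconst al CARD('d) * snd x powr (2 * al + 1)) * indicator {0<..} (snd x)"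
 have "(nn_integral (wmeas al) (%x. f x)) = (nn_integral lborel (%x. ?w x * f x))"
  unfolding weinstein_measure_altdef by (intro nn_integral_density) auto
 also have "... = (nn_integral (lborel \<Otimes>\<^sub>M lborel) (%x. ?w x * f x))" by (simp add: lborel_prod)
 also have "... = (nn_integral lborel (%x'. nn_integral lborel (%s. ?w (x', s) * f (x', s))))"
  by (rule lborel.nn_integral_fst[symmetric]) (simp add: lborel_prod)
 finally show ?thesis by (simp add: mult.commute)
qed

lemma AE_weinstein_measure_pos: "AE x in wmeas al. 0 < snd x"
 unfolding weinstein_measure_altdef
 by (subst AE_density[OF weinstein_density_measurable[folded borel_measurable_lborel]]) (auto simp: indicator_def)

lemma sigma_finite_weinstein_measure: "sigma_finite_measure (wmeas al)"
 unfolding weinstein_measure_altdef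
 by (rule sigma_finite_measure.sigma_finite_iff_density_finite[OF lborel.sigma_finite_measure_axioms weinstein_density_measurable[folded borel_measurable_lborel], THEN iffD2])
  (auto simp: indicator_def)

interpretation W: sigma_finite_measure "wmeas al :: ((real ^ 'd) \<times> real) measure"
 by (rule sigma_finite_weinstein_measure)

text \<open>The inverse for the generalized translation: the adjoint of translation by x is
  translation by the reflected point. Only the Euclidean part changes sign, since the translation in
  the last coordinate is its own adjoint.\<close>

definition wreflect :: "(real ^ 'd) \<times> real => (real ^ 'd) \<times> real" where
 "wreflect x = (- fst x, snd x)"

text \<open>The point at which the translation by x samples a function when it is evaluated at y and
  the angle is th. It is the sum in the Euclidean variables, and in the last one the third side of a
  triangle.\<close>

definition wconv :: "(real ^ 'd) \<times> real => (real ^ 'd) \<times> real => real => (real ^ 'd) \<times> real" where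
 "wconv x y th = (fst x + fst y, sqrt ((snd x)\<^sup>2 + (snd y)\<^sup>2 + 2 * snd x * snd y * cos th))"

lemma wreflect_simps [simp]: "fst (wreflect x) = - fst x" "snd (wreflect x) = snd x"
 "wreflect (wreflect x) = x"
 by (simp_all add: wreflect_def)

lemma wconv_commute: "wconv x y th = wconv y x th"
 by (simp add: wconv_def add.commute mult.commute mult.left_commute)

lemma measurable_wreflect [measurable]: "wreflect \<in> borel \<rightarrow>\<^sub>M borel"
 unfolding wreflect_def[abs_def] borel_prod[symmetric] by measurable

lemma measurable_wconv [measurable (raw)]:
 assumes [measurable]: "f \<in> M \<rightarrow>\<^sub>M borel" "g \<in> M \<rightarrow>\<^sub>M borel" "h \<in> borel_measurable M"
 shows "(%w. wconv (f w) (g w) (h w)) \<in> M \<rightarrow>\<^sub>M borel"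
proof -
 have [measurable]: "f \<in> M \<rightarrow>\<^sub>M borel \<Otimes>\<^sub>M borel" "g \<in> M \<rightarrow>\<^sub>M borel \<Otimes>\<^sub>M borel" using assms by (simp_all add: borel_prod)
 show ?thesis unfolding wconv_def borel_prod[symmetric] by measurable
qed

lemma nn_integral_lborel_translate:
 fixes f :: "'a::euclidean_space => ennreal"
 assumes [measurable]: "f \<in> borel_measurable borel"
 shows "(nn_integral lborel (%x. f (c + x))) = (nn_integral lborel (%x. f x))"
 by (subst (2) lborel_distr_plus[of c, symmetric]) (simp add: nn_integral_distr)

lemma nn_integral_lborel_uminus:
 fixes f :: "'a::euclidean_space => ennreal"
 assumes [measurable]: "f \<in> borel_measurable borel"
 shows "(nn_integral lborel (%x. f (- x))) = (nn_integral lborel (%x. f x))"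
proof -
 have "distr lborel borel uminus = (lborel :: 'a measure)"
  by (subst lborel_affine[of "-1" 0]) (auto simp: density_1 one_ennreal_def[symmetric])
 then have "(nn_integral lborel (%x. f x)) = (\<integral>\<^sup>+x. f x \<partial>distr lborel borel uminus)" by metis
 then show ?thesis by (simp add: nn_integral_distr)
qed

lemma nn_integral_wreflect:
 fixes f :: "(real ^ 'd) \<times> real => ennreal"
 assumes [measurable]: "f \<in> borel_measurable borel"
 shows "(nn_integral (wmeas al) (%x. f (wreflect x))) = (nn_integral (wmeas al) (%x. f x))"
proof -
 have [measurable]: "f \<in> borel_measurable (borel \<Otimes>\<^sub>M borel)" by (simp add: borel_prod)
 define F where "F x' = (nn_integral lborel (%s. f (x', s) * (ennreal (wconst al CARD('d) * s powr (2 * al + 1)) * indicator {0<..} s)))" for x'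
 have [measurable]: "F \<in> borel_measurable borel" unfolding F_def by measurable
 have "(nn_integral (wmeas al) (%x. f (wreflect x))) = (nn_integral lborel (%x'. F (- x')))"
 proof -
  have m: "(%x. f (wreflect x)) \<in> borel_measurable borel" by measurable
  show ?thesis unfolding nn_integral_weinstein_measure[OF m] by (simp add: F_def wreflect_def)
 qed
 also have "... = (nn_integral lborel (%x'. F x'))" by (rule nn_integral_lborel_uminus) simp
 finally show ?thesis by (simp add: F_def nn_integral_weinstein_measure)
qed

text \<open>The angle and \<open>y\<close> are polar coordinates of a point of the upper half plane, in which the generalized
 translation becomes a horizontal shift by \<open>x\<close>; this makes its symmetry visible.\<close>

lemma nn_integral_bessel_convolution:
 fixes G :: "real \<times> real => ennreal"
 assumes al: "al > -1/2" and [measurable]: "G \<in> borel_measurable borel"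
 shows "(nn_integral lborel (%y. (nn_integral (angle_measure al) (%th. G (y, sqrt (x\<^sup>2 + y\<^sup>2 + 2 * x * y * cos th))))
    * (ennreal (y powr (2 * al + 1)) * indicator {0<..} y)))
  = ennreal (angle_const al) * (nn_integral lborel (%u. nn_integral lborel (%v. G (sqrt (u\<^sup>2 + v\<^sup>2), sqrt ((u + x)\<^sup>2 + v\<^sup>2)) * ennreal (v powr (2 * al)) * indicator {0<..} v)))"
proof -
 have [measurable]: "G \<in> borel_measurable (borel \<Otimes>\<^sub>M borel)" by (simp add: borel_prod)
 \<comment> \<open>Here u = y cos th and v = y sin th: y is the distance to the origin and the third
   side is the distance to (-x, 0). The weight y^(2 al + 1) sin^(2 al) splits into v^(2 al) and the
   polar factor y.\<close>
 define H where "H = (%(u, v). G (sqrt (u\<^sup>2 + v\<^sup>2), sqrt ((u + x)\<^sup>2 + v\<^sup>2)) * ennreal (v powr (2 * al)))"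
 have [measurable]: "H \<in> borel_measurable borel" unfolding H_def borel_prod[symmetric] by measurable
 then have [measurable]: "H \<in> borel_measurable (borel \<Otimes>\<^sub>M borel)" by (simp add: borel_prod)
 have "(nn_integral lborel (%y. (nn_integral (angle_measure al) (%th. G (y, sqrt (x\<^sup>2 + y\<^sup>2 + 2 * x * y * cos th))))
    * (ennreal (y powr (2 * al + 1)) * indicator {0<..} y)))
  = (nn_integral lborel (%y. ennreal (angle_const al) * ((nn_integral lborel (%th. H (y * cos th, y * sin th) * indicator {0..pi} th)) * ennreal y * indicator {0<..} y)))"
 proof (rule nn_integral_cong)
  fix y :: real
  show "(nn_integral (angle_measure al) (%th. G (y, sqrt (x\<^sup>2 + y\<^sup>2 + 2 * x * y * cos th)))) * (ennreal (y powr (2 * al + 1)) * indicator {0<..} y)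
   = ennreal (angle_const al) * ((nn_integral lborel (%th. H (y * cos th, y * sin th) * indicator {0..pi} th)) * ennreal y * indicator {0<..} y)"
  proof (cases "y > 0")
   case True
   define J where "J = (nn_integral lborel (%th. G (y, sqrt (x\<^sup>2 + y\<^sup>2 + 2 * x * y * cos th)) * ennreal (sin th powr (2 * al)) * indicator {0..pi} th))"
   have A: "(nn_integral (angle_measure al) (%th. G (y, sqrt (x\<^sup>2 + y\<^sup>2 + 2 * x * y * cos th)))) = ennreal (angle_const al) * J"
    unfolding J_def by (intro nn_integral_angle_measure al) measurable
   have "H (y * cos th, y * sin th) * indicator {0..pi} th
    = ennreal (y powr (2 * al)) * (G (y, sqrt (x\<^sup>2 + y\<^sup>2 + 2 * x * y * cos th)) * ennreal (sin th powr (2 * al)) * indicator {0..pi} th)" for th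
   proof -
    have "(y * cos th)\<^sup>2 + (y * sin th)\<^sup>2 = y\<^sup>2" by (simp add: power_mult_distrib sin_squared_eq algebra_simps)
    then have 1: "sqrt ((y * cos th)\<^sup>2 + (y * sin th)\<^sup>2) = y" using True by simp
    have 2: "(y * cos th + x)\<^sup>2 + (y * sin th)\<^sup>2 = x\<^sup>2 + y\<^sup>2 + 2 * x * y * cos th"
     by (simp add: power2_sum power_mult_distrib sin_squared_eq algebra_simps)
    have 3: "ennreal ((y * sin th) powr (2 * al)) = ennreal (y powr (2 * al)) * ennreal (sin th powr (2 * al))"
     by (simp add: powr_mult ennreal_mult)
    show ?thesis unfolding H_def split_conv 1 2 3 by (simp add: mult_ac)
   qed
   then have B: "(nn_integral lborel (%th. H (y * cos th, y * sin th) * indicator {0..pi} th)) = ennreal (y powr (2 * al)) * J"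
    unfolding J_def by (simp add: nn_integral_cmult)
   have C: "ennreal (y powr (2 * al + 1)) = ennreal (y powr (2 * al)) * ennreal y"
    using True by (simp add: powr_add ennreal_mult)
   show ?thesis unfolding A B C using True by (simp add: mult_ac)
  qed simp
 qed
 also have "... = ennreal (angle_const al) * (nn_integral lborel (%y. (nn_integral lborel (%th. H (y * cos th, y * sin th) * indicator {0..pi} th)) * ennreal y * indicator {0<..} y))"
  by (intro nn_integral_cmult) measurable
 also have "... = ennreal (angle_const al) * (nn_integral lborel (%u. nn_integral lborel (%v. H (u, v) * indicator {0<..} v)))"
  by (subst nn_integral_polar_upper_half_plane) auto
 finally show ?thesis by (simp add: H_def)
qed

text \<open>In the half plane picture both sides integrate a function of the distances to (0, 0) and
  to (-x, 0), taken in opposite order. The reflection u |-> - x - u exchanges the two points and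
  preserves the weight, which depends on v only.\<close>

lemma nn_integral_bessel_convolution_symmetric:
 fixes G :: "real \<times> real => ennreal"
 assumes al: "al > -1/2" and [measurable]: "G \<in> borel_measurable borel"
 shows "(nn_integral lborel (%y. (nn_integral (angle_measure al) (%th. G (y, sqrt (x\<^sup>2 + y\<^sup>2 + 2 * x * y * cos th))))
    * (ennreal (y powr (2 * al + 1)) * indicator {0<..} y)))
  = (nn_integral lborel (%y. (nn_integral (angle_measure al) (%th. G (sqrt (x\<^sup>2 + y\<^sup>2 + 2 * x * y * cos th), y)))
    * (ennreal (y powr (2 * al + 1)) * indicator {0<..} y)))"
proof -
 have [measurable]: "G \<in> borel_measurable (borel \<Otimes>\<^sub>M borel)" by (simp add: borel_prod)
 define G' where "G' = (%(a, b). G (b, a))"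
 have G'm: "G' \<in> borel_measurable borel" unfolding G'_def borel_prod[symmetric] by measurable
 define F where "F u = (nn_integral lborel (%v. G (sqrt ((u + x)\<^sup>2 + v\<^sup>2), sqrt (u\<^sup>2 + v\<^sup>2)) * ennreal (v powr (2 * al)) * indicator {0<..} v))" for u
 have [measurable]: "F \<in> borel_measurable borel" unfolding F_def by measurable
 have "(nn_integral lborel (%u. F u)) = (nn_integral lborel (%u. F (- x - u)))"
  using nn_integral_real_affine[of F "-1" "-x"] by simp
 also have "... = (nn_integral lborel (%u. nn_integral lborel (%v. G (sqrt (u\<^sup>2 + v\<^sup>2), sqrt ((u + x)\<^sup>2 + v\<^sup>2)) * ennreal (v powr (2 * al)) * indicator {0<..} v)))"
 proof (rule nn_integral_cong)
  fix u
  have "(- x - u)\<^sup>2 = (u + x)\<^sup>2" "- x - u + x = - u" by (simp_all add: power2_eq_square algebra_simps)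
  then show "F (- x - u) = (nn_integral lborel (%v. G (sqrt (u\<^sup>2 + v\<^sup>2), sqrt ((u + x)\<^sup>2 + v\<^sup>2)) * ennreal (v powr (2 * al)) * indicator {0<..} v))"
   by (simp add: F_def)
 qed
 finally show ?thesis
  unfolding nn_integral_bessel_convolution[OF al assms(2)]
  using nn_integral_bessel_convolution[OF al G'm, of x] by (simp add: G'_def F_def)
qed

text \<open>The source of all adjointness properties of the translation. In the last coordinate it
  is the Bessel symmetry above; in the Euclidean variables it is the shift by
  \<open>- fst x\<close>, which is why the reflected point appears on the right.\<close>

lemma nn_integral_wconv_symmetric:
 fixes G :: "((real ^ 'd) \<times> real) \<times> ((real ^ 'd) \<times> real) => ennreal"
 assumes al: "al > -1/2" and G[measurable]: "G \<in> borel_measurable (borel \<Otimes>\<^sub>M borel)"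
 shows "(nn_integral (wmeas al) (%y. nn_integral (angle_measure al) (%th. G (y, wconv x y th))))
  = (nn_integral (wmeas al) (%y. nn_integral (angle_measure al) (%th. G (wconv (wreflect x) y th, y))))"
proof -
 interpret A: prob_space "angle_measure al" by (rule prob_space_angle_measure[OF al])
 have Gm [measurable]: "(%w. G ((f w, g w), (h w, k w))) \<in> borel_measurable M"
  if [measurable]: "f \<in> M \<rightarrow>\<^sub>M borel" "g \<in> M \<rightarrow>\<^sub>M borel" "h \<in> M \<rightarrow>\<^sub>M borel" "k \<in> M \<rightarrow>\<^sub>M borel" for f g h k and M :: "'z measure"
 proof -
  have "(%w. (f w, g w)) \<in> M \<rightarrow>\<^sub>M borel" "(%w. (h w, k w)) \<in> M \<rightarrow>\<^sub>M borel"
   unfolding borel_prod[symmetric] by measurable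
  then show ?thesis by measurable
 qed
 define C where "C = wconst al CARD('d)"
 have C: "C > 0" unfolding C_def by (rule wconst_pos[OF al])
 define r where "r s th = sqrt ((snd x)\<^sup>2 + s\<^sup>2 + 2 * snd x * s * cos th)" for s th
 have [measurable]: "(%w. r (f w) (g w)) \<in> borel_measurable M" if [measurable]: "f \<in> borel_measurable M" "g \<in> borel_measurable M" for f g and M :: "'z measure"
  unfolding r_def by measurable
 have [measurable]: "(%w. r (f w) (g w)) \<in> borel_measurable M" if [measurable]: "f \<in> borel_measurable M" "g \<in> borel_measurable M" for f g and M :: "'y measure"
  unfolding r_def by measurable
 define F where "F y' = (nn_integral lborel (%s. (nn_integral (angle_measure al) (%th. G ((y', r s th), (fst x + y', s))))
  * (ennreal (s powr (2 * al + 1)) * indicator {0<..} s)))" for y'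
 have Fm [measurable]: "F \<in> borel_measurable borel"
 proof -
  have "(%w. G ((fst (fst w), r (snd (fst w)) (snd w)), (fst x + fst (fst w), snd (fst w)))) \<in> borel_measurable ((borel \<Otimes>\<^sub>M borel) \<Otimes>\<^sub>M angle_measure al)"
  proof -
   have "(%w::(((real ^ 'd) \<times> real) \<times> real). (fst (fst w), r (snd (fst w)) (snd w))) \<in> (borel \<Otimes>\<^sub>M borel) \<Otimes>\<^sub>M angle_measure al \<rightarrow>\<^sub>M borel"
    unfolding borel_prod[symmetric] r_def by measurable
   moreover have "(%w::(((real ^ 'd) \<times> real) \<times> real). (fst x + fst (fst w), snd (fst w))) \<in> (borel \<Otimes>\<^sub>M borel) \<Otimes>\<^sub>M angle_measure al \<rightarrow>\<^sub>M borel"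
    unfolding borel_prod[symmetric] by measurable
   ultimately show ?thesis by measurable
  qed
  then have "(%w. nn_integral (angle_measure al) (%th. G ((fst w, r (snd w) th), (fst x + fst w, snd w)))) \<in> borel_measurable (borel \<Otimes>\<^sub>M borel)"
   using A.borel_measurable_nn_integral[of "%w th. G ((fst w, r (snd w) th), (fst x + fst w, snd w))" "borel \<Otimes>\<^sub>M borel"]
   by (simp add: case_prod_beta')
  then have "(%w. (nn_integral (angle_measure al) (%th. G ((fst w, r (snd w) th), (fst x + fst w, snd w)))) * (ennreal (snd w powr (2 * al + 1)) * indicator {0<..} (snd w))) \<in> borel_measurable (borel \<Otimes>\<^sub>M lborel)"
   by measurable
  then show ?thesis unfolding F_def
   using lborel.borel_measurable_nn_integral[of "%y' s. (nn_integral (angle_measure al) (%th. G ((y', r s th), (fst x + y', s)))) * (ennreal (s powr (2 * al + 1)) * indicator {0<..} s)" borel]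
   by (simp add: case_prod_beta')
 qed
 have wc: "f * (ennreal (C * s powr (2 * al + 1)) * indicator {0<..} s)
  = ennreal C * (f * (ennreal (s powr (2 * al + 1)) * indicator {0<..} s))" for f s
  using C by (simp add: ennreal_mult mult_ac)
 have cm: "(%s. (nn_integral (angle_measure al) (%th. G ((a, r s th), (b, s)))) * (ennreal (s powr (2 * al + 1)) * indicator {0<..} s)) \<in> borel_measurable borel"
  "(%s. (nn_integral (angle_measure al) (%th. G ((a, s), (b, r s th)))) * (ennreal (s powr (2 * al + 1)) * indicator {0<..} s)) \<in> borel_measurable borel" for a b
 proof -
  have 1: "(%w. G ((a, r (fst w) (snd w)), (b, fst w))) \<in> borel_measurable (borel \<Otimes>\<^sub>M angle_measure al)"
    "(%w. G ((a, fst w), (b, r (fst w) (snd w)))) \<in> borel_measurable (borel \<Otimes>\<^sub>M angle_measure al)"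
  proof -
   have "(%w::real \<times> real. (a, r (fst w) (snd w))) \<in> borel \<Otimes>\<^sub>M angle_measure al \<rightarrow>\<^sub>M borel" "(%w::real \<times> real. (b, fst w)) \<in> borel \<Otimes>\<^sub>M angle_measure al \<rightarrow>\<^sub>M borel"
    "(%w::real \<times> real. (b, r (fst w) (snd w))) \<in> borel \<Otimes>\<^sub>M angle_measure al \<rightarrow>\<^sub>M borel" "(%w::real \<times> real. (a, fst w)) \<in> borel \<Otimes>\<^sub>M angle_measure al \<rightarrow>\<^sub>M borel"
    unfolding borel_prod[symmetric] r_def by measurable
   then show "(%w. G ((a, r (fst w) (snd w)), (b, fst w))) \<in> borel_measurable (borel \<Otimes>\<^sub>M angle_measure al)"
    "(%w. G ((a, fst w), (b, r (fst w) (snd w)))) \<in> borel_measurable (borel \<Otimes>\<^sub>M angle_measure al)" by measurable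
  qed
  have "(%s. nn_integral (angle_measure al) (%th. G ((a, r s th), (b, s)))) \<in> borel_measurable borel"
   using 1(1) A.borel_measurable_nn_integral[of "%s th. G ((a, r s th), (b, s))" borel] by (simp add: case_prod_beta')
  then show "(%s. (nn_integral (angle_measure al) (%th. G ((a, r s th), (b, s)))) * (ennreal (s powr (2 * al + 1)) * indicator {0<..} s)) \<in> borel_measurable borel"
   by measurable
  have "(%s. nn_integral (angle_measure al) (%th. G ((a, s), (b, r s th)))) \<in> borel_measurable borel"
   using 1(2) A.borel_measurable_nn_integral[of "%s th. G ((a, s), (b, r s th))" borel] by (simp add: case_prod_beta')
  then show "(%s. (nn_integral (angle_measure al) (%th. G ((a, s), (b, r s th)))) * (ennreal (s powr (2 * al + 1)) * indicator {0<..} s)) \<in> borel_measurable borel"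
   by measurable
 qed
 have mG: "(%y. nn_integral (angle_measure al) (%th. G (y, wconv x y th))) \<in> borel_measurable borel"
  "(%y. nn_integral (angle_measure al) (%th. G (wconv (wreflect x) y th, y))) \<in> borel_measurable borel" by measurable
 have "(nn_integral (wmeas al) (%y. nn_integral (angle_measure al) (%th. G (y, wconv x y th))))
  = (nn_integral lborel (%y'. nn_integral lborel (%s. ennreal C * ((nn_integral (angle_measure al) (%th. G ((y', s), (fst x + y', r s th))))
    * (ennreal (s powr (2 * al + 1)) * indicator {0<..} s)))))"
  unfolding nn_integral_weinstein_measure[OF mG(1)] C_def[symmetric] wc by (simp add: wconv_def r_def)
 also have "... = (nn_integral lborel (%y'. ennreal C * F y'))"
 proof (rule nn_integral_cong)
  fix y' :: "real ^ 'd"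
  have Gy: "(%(s, t). G ((y', s), (fst x + y', t))) \<in> borel_measurable borel"
  proof -
   have "(%w::real \<times> real. (y', fst w)) \<in> borel \<Otimes>\<^sub>M borel \<rightarrow>\<^sub>M borel" "(%w::real \<times> real. (fst x + y', snd w)) \<in> borel \<Otimes>\<^sub>M borel \<rightarrow>\<^sub>M borel"
    unfolding borel_prod[symmetric] by measurable
   then have "(%w. G ((y', fst w), (fst x + y', snd w))) \<in> borel_measurable (borel \<Otimes>\<^sub>M borel)" by measurable
   then show ?thesis by (simp add: borel_prod case_prod_beta')
  qed
  have "(nn_integral lborel (%s. (nn_integral (angle_measure al) (%th. G ((y', s), (fst x + y', r s th)))) * (ennreal (s powr (2 * al + 1)) * indicator {0<..} s))) = F y'"
   using nn_integral_bessel_convolution_symmetric[OF al Gy, of "snd x"] by (simp add: F_def r_def)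
  then show "(nn_integral lborel (%s. ennreal C * ((nn_integral (angle_measure al) (%th. G ((y', s), (fst x + y', r s th))))
    * (ennreal (s powr (2 * al + 1)) * indicator {0<..} s)))) = ennreal C * F y'"
   using cm(2)[of y' "fst x + y'"] by (simp add: nn_integral_cmult)
 qed
 also have "... = (nn_integral lborel (%y'. ennreal C * F (- fst x + y')))"
  by (rule nn_integral_lborel_translate[symmetric]) measurable
 also have "... = (nn_integral lborel (%y'. nn_integral lborel (%s. ennreal C * ((nn_integral (angle_measure al) (%th. G ((- fst x + y', r s th), (y', s))))
    * (ennreal (s powr (2 * al + 1)) * indicator {0<..} s)))))"
  using cm(1) by (intro nn_integral_cong) (simp add: F_def nn_integral_cmult)
 also have "... = (nn_integral (wmeas al) (%y. nn_integral (angle_measure al) (%th. G (wconv (wreflect x) y th, y))))"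
  unfolding nn_integral_weinstein_measure[OF mG(2)] C_def[symmetric] wc by (simp add: wconv_def r_def)
 finally show ?thesis .
qed

definition wkernel :: "real => (real ^ 'd) \<times> real => (real ^ 'd) \<times> real => complex" where
 "wkernel al x xi = exp (- \<i> * of_real (fst x \<bullet> fst xi)) * of_real (bessel_j al (snd x * snd xi))"

lemma weinstein_transform_altdef:
 "weinstein_transform al \<phi> xi = (LINT x|wmeas al. \<phi> x * wkernel al x xi)"
 by (simp add: weinstein_transform_def wkernel_def mult.assoc)

lemma norm_wkernel_le_1:
 assumes "al > -1/2"
 shows "cmod (wkernel al x xi) <= 1"
 using abs_bessel_j_le_1[OF assms, of "snd x * snd xi"]
 by (simp add: wkernel_def norm_mult norm_exp_eq_Re)

lemma borel_measurable_wkernel [measurable (raw)]: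
 assumes "al > -1/2" and f: "f \<in> M \<rightarrow>\<^sub>M borel" "g \<in> M \<rightarrow>\<^sub>M borel"
 shows "(%w. wkernel al (f w) (g w)) \<in> borel_measurable M"
proof -
 note [measurable] = borel_measurable_bessel_j[OF assms(1)]
 have [measurable]: "f \<in> M \<rightarrow>\<^sub>M borel \<Otimes>\<^sub>M borel" "g \<in> M \<rightarrow>\<^sub>M borel \<Otimes>\<^sub>M borel" using f by (simp_all add: borel_prod)
 show ?thesis unfolding wkernel_def by measurable
qed

lemma wkernel_reflect:
 "wkernel al (wreflect x) xi = cnj (wkernel al x xi)"
 "wkernel al x (wreflect xi) = cnj (wkernel al x xi)"
 by (simp_all add: wkernel_def exp_cnj)

text \<open>The kernel is a multiplicative character for the generalized translation: exponentials
  add up and the Bessel factor obeys the product formula. The sign condition allows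
  \<open>snd xi\<close> to be moved inside the square root.\<close>

lemma wkernel_conv:
 assumes al: "al > -1/2" and xi: "0 <= snd xi"
 shows "(LINT th|angle_measure al. wkernel al (wconv x y th) xi) = wkernel al x xi * wkernel al y xi"
proof -
 have s: "sqrt ((snd x)\<^sup>2 + (snd y)\<^sup>2 + 2 * snd x * snd y * cos th) * snd xi
  = sqrt ((snd x * snd xi)\<^sup>2 + (snd y * snd xi)\<^sup>2 + 2 * (snd x * snd xi) * (snd y * snd xi) * cos th)" for th
 proof -
  have "sqrt ((snd x)\<^sup>2 + (snd y)\<^sup>2 + 2 * snd x * snd y * cos th) * snd xi
   = sqrt (((snd x)\<^sup>2 + (snd y)\<^sup>2 + 2 * snd x * snd y * cos th) * (snd xi)\<^sup>2)"
   using xi by (simp add: real_sqrt_mult)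
  also have "((snd x)\<^sup>2 + (snd y)\<^sup>2 + 2 * snd x * snd y * cos th) * (snd xi)\<^sup>2
   = (snd x * snd xi)\<^sup>2 + (snd y * snd xi)\<^sup>2 + 2 * (snd x * snd xi) * (snd y * snd xi) * cos th"
   by (simp add: power2_eq_square algebra_simps)
  finally show ?thesis .
 qed
 have e: "exp (- \<i> * of_real (fst (wconv x y th) \<bullet> fst xi)) = exp (- \<i> * of_real (fst x \<bullet> fst xi)) * exp (- \<i> * of_real (fst y \<bullet> fst xi))" for th
  by (simp add: wconv_def inner_add_left exp_add[symmetric] algebra_simps)
 have "(LINT th|angle_measure al. wkernel al (wconv x y th) xi)
  = (LINT th|angle_measure al. (exp (- \<i> * of_real (fst x \<bullet> fst xi)) * exp (- \<i> * of_real (fst y \<bullet> fst xi))) *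
    complex_of_real (bessel_j al (sqrt ((snd x * snd xi)\<^sup>2 + (snd y * snd xi)\<^sup>2 + 2 * (snd x * snd xi) * (snd y * snd xi) * cos th))))"
  unfolding wkernel_def e by (simp add: wconv_def s)
 also have "... = (exp (- \<i> * of_real (fst x \<bullet> fst xi)) * exp (- \<i> * of_real (fst y \<bullet> fst xi))) *
   complex_of_real (bessel_j al (snd x * snd xi) * bessel_j al (snd y * snd xi))"
  by (simp only: integral_mult_right_zero integral_complex_of_real bessel_j_product[OF al])
 finally show ?thesis by (simp add: wkernel_def)
qed

text \<open>Read as an identity of image measures, the symmetry for nonnegative integrands carries
  over to complex integrable ones.\<close>

lemma distr_wconv_symmetric:
 assumes al: "al > -1/2"
 shows "distr (wmeas al \<Otimes>\<^sub>M angle_measure al) (borel \<Otimes>\<^sub>M borel) (%w. (fst w, wconv x (fst w) (snd w)))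
  = distr (wmeas al \<Otimes>\<^sub>M angle_measure al) (borel \<Otimes>\<^sub>M borel) (%w. (wconv (wreflect x) (fst w) (snd w), fst w))"
  (is "?L = ?R")
proof (rule measure_eqI)
 interpret A: prob_space "angle_measure al" by (rule prob_space_angle_measure[OF al])
 fix E assume "E \<in> sets ?L"
 then have [measurable]: "E \<in> sets (borel \<Otimes>\<^sub>M borel)" by simp
 have "emeasure ?L E = (\<integral>\<^sup>+w. indicator E w \<partial>?L)" by simp
 also have "... = (nn_integral (wmeas al \<Otimes>\<^sub>M angle_measure al) (%w. indicator E (fst w, wconv x (fst w) (snd w))))"
  by (intro nn_integral_distr) measurable
 also have "... = (nn_integral (wmeas al) (%y. nn_integral (angle_measure al) (%th. indicator E (y, wconv x y th))))"
  by (subst A.nn_integral_fst[symmetric]) auto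
 also have "... = (nn_integral (wmeas al) (%y. nn_integral (angle_measure al) (%th. indicator E (wconv (wreflect x) y th, y))))"
  by (rule nn_integral_wconv_symmetric[OF al]) measurable
 also have "... = (nn_integral (wmeas al \<Otimes>\<^sub>M angle_measure al) (%w. indicator E (wconv (wreflect x) (fst w) (snd w), fst w)))"
  by (subst A.nn_integral_fst[symmetric]) auto
 also have "... = (\<integral>\<^sup>+w. indicator E w \<partial>?R)"
  by (intro nn_integral_distr[symmetric]) measurable
 also have "... = emeasure ?R E" by simp
 finally show "emeasure ?L E = emeasure ?R E" .
qed simp

lemma integral_wconv_symmetric:
 fixes G :: "((real ^ 'd) \<times> real) \<times> ((real ^ 'd) \<times> real) => complex"
 assumes al: "al > -1/2" and [measurable]: "G \<in> borel_measurable (borel \<Otimes>\<^sub>M borel)"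
  and i: "integrable (wmeas al \<Otimes>\<^sub>M angle_measure al) (%w. G (fst w, wconv x (fst w) (snd w)))"
 shows "integrable (wmeas al \<Otimes>\<^sub>M angle_measure al) (%w. G (wconv (wreflect x) (fst w) (snd w), fst w))"
  and "(LINT y|wmeas al. LINT th|angle_measure al. G (y, wconv x y th))
   = (LINT y|wmeas al. LINT th|angle_measure al. G (wconv (wreflect x) y th, y))"
proof -
 interpret A: prob_space "angle_measure al" by (rule prob_space_angle_measure[OF al])
 interpret P: pair_sigma_finite "wmeas al :: ((real ^ 'd) \<times> real) measure" "angle_measure al" ..
 let ?P = "wmeas al \<Otimes>\<^sub>M angle_measure al"
 let ?L = "distr ?P (borel \<Otimes>\<^sub>M borel) (%w. (fst w, wconv x (fst w) (snd w)))"
 let ?R = "distr ?P (borel \<Otimes>\<^sub>M borel) (%w. (wconv (wreflect x) (fst w) (snd w), fst w))"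
 have LR: "?L = ?R" by (rule distr_wconv_symmetric[OF al])
 have "integrable ?L G" using i by (subst integrable_distr_eq) measurable
 then have "integrable ?R G" unfolding LR .
 then show iR: "integrable ?P (%w. G (wconv (wreflect x) (fst w) (snd w), fst w))"
  by (subst (asm) integrable_distr_eq) measurable
 have "(LINT y|wmeas al. LINT th|angle_measure al. G (y, wconv x y th)) = (LINT w|?P. G (fst w, wconv x (fst w) (snd w)))"
  using P.integral_fst'[OF i] by simp
 also have "... = (LINT w|?L. G w)" by (intro integral_distr[symmetric]) measurable
 also have "... = (LINT w|?R. G w)" unfolding LR ..
 also have "... = (LINT w|?P. G (wconv (wreflect x) (fst w) (snd w), fst w))" by (intro integral_distr) measurable
 also have "... = (LINT y|wmeas al. LINT th|angle_measure al. G (wconv (wreflect x) y th, y))"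
  using P.integral_fst'[OF iR] by simp
 finally show "(LINT y|wmeas al. LINT th|angle_measure al. G (y, wconv x y th))
   = (LINT y|wmeas al. LINT th|angle_measure al. G (wconv (wreflect x) y th, y))" .
qed

text \<open>In the symmetric form the integrand is evaluated at y itself and no longer depends on
  the angle, whose measure has mass 1. So translations preserve the integral, and in particular null
  sets.\<close>

lemma nn_integral_wconv:
 fixes h :: "(real ^ 'd) \<times> real => ennreal"
 assumes al: "al > -1/2" and [measurable]: "h \<in> borel_measurable borel"
 shows "(nn_integral (wmeas al) (%y. nn_integral (angle_measure al) (%th. h (wconv x y th)))) = (nn_integral (wmeas al) (%y. h y))"
proof -
 interpret A: prob_space "angle_measure al" by (rule prob_space_angle_measure[OF al])
 have "(nn_integral (wmeas al) (%y. nn_integral (angle_measure al) (%th. h (wconv x y th))))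
   = (nn_integral (wmeas al) (%y. nn_integral (angle_measure al) (%th. h y)))"
  using nn_integral_wconv_symmetric[OF al, of "%w. h (snd w)" x] by simp
 then show ?thesis using A.emeasure_space_1 by simp
qed

lemma weinstein_translation_altdef:
 fixes \<phi> :: "(real ^ 'd) \<times> real => complex"
 assumes al: "al > -1/2" and [measurable]: "\<phi> \<in> borel_measurable borel"
 shows "weinstein_translation al x \<phi> y = (LINT th|angle_measure al. \<phi> (wconv x y th))"
proof -
 have am: "angle_measure al = density lborel (%th. ennreal (angle_const al * sin th powr (2 * al) * indicator {0..pi} th))"
  unfolding angle_measure_def by (intro arg_cong2[where f=density] ext refl) (auto simp: indicator_def)
 have "(LINT th|angle_measure al. \<phi> (wconv x y th))
  = (LINT th|lborel. (angle_const al * sin th powr (2 * al) * indicator {0..pi} th) *\<^sub>R \<phi> (wconv x y th))"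
  unfolding am using angle_const_pos[OF al] by (intro integral_density) auto
 also have "... = (LINT th|lborel. of_real (angle_const al) * (indicator {0..pi} th *\<^sub>R (\<phi> (wconv x y th) * of_real (sin th powr (2 * al)))))"
  by (intro Bochner_Integration.integral_cong) (auto simp: scaleR_conv_of_real)
 also have "... = of_real (angle_const al) * (LINT th:{0..pi}|lborel. \<phi> (wconv x y th) * of_real (sin th powr (2 * al)))"
  unfolding set_lebesgue_integral_def by (rule integral_mult_right_zero)
 finally show ?thesis by (simp add: weinstein_translation_def angle_const_def wconv_def)
qed

section \<open>The transform of a Gaussian\<close>

text \<open>The characteristic function of the standard normal distribution, rescaled by c = sqrt (2
  t).\<close>

lemma fourier_gaussian_real:
 fixes t x :: real
 assumes t: "t > 0"
 shows "integrable lborel (%xi::real. complex_of_real (exp (- t * xi\<^sup>2)) * exp (- \<i> * of_real (x * xi)))"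
  and "(LINT xi|lborel. complex_of_real (exp (- t * xi\<^sup>2)) * exp (- \<i> * of_real (x * xi)))
   = of_real (sqrt (pi / t) * exp (- x\<^sup>2 / (4 * t)))"
proof -
 define c where "c = sqrt (2 * t)"
 have c: "c > 0" "c\<^sup>2 = 2 * t" using t by (simp_all add: c_def)
 define f where "f z = complex_of_real (std_normal_density z) * exp (- \<i> * of_real (x / c * z))" for z :: real
 have [measurable]: "f \<in> borel_measurable borel" unfolding f_def by measurable
 have fi: "integrable lborel f"
  by (rule integrable_dominated[of lborel std_normal_density]) (auto simp: f_def norm_mult norm_exp_eq_Re)
 have fv: "(LINT z|lborel. f z) = of_real (exp (- x\<^sup>2 / (4 * t)))"
 proof -
  have "char std_normal_distribution (- x / c) = (LINT z|lborel. f z)"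
  proof -
   have e: "\<i> * complex_of_real (- x / c * z) = - \<i> * complex_of_real (x / c * z)" for z by simp
   have "char std_normal_distribution (- x / c) = (LINT z|lborel. std_normal_density z *\<^sub>R exp (\<i> * complex_of_real (- x / c * z)))"
    unfolding char_def by (rule integral_density) auto
   then show ?thesis unfolding e f_def scaleR_conv_of_real .
  qed
  also have "char std_normal_distribution (- x / c) = of_real (exp (- (- x / c)\<^sup>2 / 2))"
   using char_std_normal_distribution by (simp add: fun_eq_iff)
  finally show ?thesis using c t by (simp add: power_divide)
 qed
 have fc: "f (0 + c * xi) = of_real (1 / sqrt (2 * pi)) * (complex_of_real (exp (- t * xi\<^sup>2)) * exp (- \<i> * of_real (x * xi)))" for xi
 proof -
  have "(c * xi)\<^sup>2 / 2 = t * xi\<^sup>2" using c by (simp add: power_mult_distrib)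
  then show ?thesis using c by (simp add: f_def std_normal_density_def)
 qed
 have "integrable lborel (%xi. f (0 + c * xi))" using fi c by (intro lborel_integrable_real_affine) auto
 then have "integrable lborel (%xi. of_real (sqrt (2 * pi)) * f (0 + c * xi))" by (rule integrable_mult_right)
 moreover have "of_real (sqrt (2 * pi)) * f (0 + c * xi) = complex_of_real (exp (- t * xi\<^sup>2)) * exp (- \<i> * of_real (x * xi))" for xi
 proof -
  have "complex_of_real (sqrt (2 * pi)) * of_real (1 / sqrt (2 * pi)) = 1" by (simp flip: of_real_mult)
  then show ?thesis unfolding fc mult.assoc[symmetric] by simp
 qed
 ultimately show i: "integrable lborel (%xi::real. complex_of_real (exp (- t * xi\<^sup>2)) * exp (- \<i> * of_real (x * xi)))"
  by (simp only:)
 have "(LINT z|lborel. f z) = c *\<^sub>R (LINT xi|lborel. f (0 + c * xi))"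
  using lborel_integral_real_affine[of c f 0] c by simp
 also have "... = of_real (c / sqrt (2 * pi)) * (LINT xi|lborel. complex_of_real (exp (- t * xi\<^sup>2)) * exp (- \<i> * of_real (x * xi)))"
  unfolding fc integral_mult_right_zero by (simp add: scaleR_conv_of_real)
 finally have e: "of_real (exp (- x\<^sup>2 / (4 * t))) = of_real (c / sqrt (2 * pi)) * (LINT xi|lborel. complex_of_real (exp (- t * xi\<^sup>2)) * exp (- \<i> * of_real (x * xi)))"
  unfolding fv .
 have one: "sqrt (pi / t) * (c / sqrt (2 * pi)) = 1"
  using t by (simp add: c_def real_sqrt_divide real_sqrt_mult)
 have "(LINT xi|lborel. complex_of_real (exp (- t * xi\<^sup>2)) * exp (- \<i> * of_real (x * xi)))
  = of_real (sqrt (pi / t)) * (of_real (c / sqrt (2 * pi)) * (LINT xi|lborel. complex_of_real (exp (- t * xi\<^sup>2)) * exp (- \<i> * of_real (x * xi))))"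
  by (simp only: mult.assoc[symmetric] of_real_mult[symmetric] one of_real_1 mult_1)
 then show "(LINT xi|lborel. complex_of_real (exp (- t * xi\<^sup>2)) * exp (- \<i> * of_real (x * xi)))
   = of_real (sqrt (pi / t) * exp (- x\<^sup>2 / (4 * t)))"
  unfolding e[symmetric] by simp
qed

lemma fourier_gaussian:
 fixes x :: "'a::euclidean_space"
 assumes t: "t > 0"
 shows "integrable lborel (%xi::'a. complex_of_real (exp (- t * (norm xi)\<^sup>2)) * exp (- \<i> * of_real (x \<bullet> xi)))"
  and "(LINT xi|lborel. complex_of_real (exp (- t * (norm xi)\<^sup>2)) * exp (- \<i> * of_real (x \<bullet> xi)))
   = of_real (sqrt (pi / t) ^ DIM('a) * exp (- (norm x)\<^sup>2 / (4 * t)))"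
proof -
 interpret P: product_sigma_finite "%_::'a. lborel :: real measure" by standard
 let ?\<Pi> = "\<Pi>\<^sub>M b\<in>Basis. (lborel :: real measure)"
 let ?m = "%f::'a => real. \<Sum>b\<in>Basis. f b *\<^sub>R b"
 define F where "F xi = complex_of_real (exp (- t * (norm xi)\<^sup>2)) * exp (- \<i> * of_real (x \<bullet> xi))" for xi :: 'a
 have [measurable]: "F \<in> borel_measurable borel" unfolding F_def by measurable
 have Fm: "F (?m f) = (\<Prod>b\<in>Basis. complex_of_real (exp (- t * (f b)\<^sup>2)) * exp (- \<i> * of_real ((x \<bullet> b) * f b)))" for f
 proof -
  have n: "(norm (?m f))\<^sup>2 = (\<Sum>b\<in>Basis. (f b)\<^sup>2)"
  proof -
   have "(norm (?m f))\<^sup>2 = (\<Sum>b\<in>Basis. (?m f \<bullet> b) * (?m f \<bullet> b))"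
    unfolding power2_norm_eq_inner by (rule euclidean_inner)
   also have "... = (\<Sum>b\<in>Basis. (f b)\<^sup>2)"
    by (intro sum.cong refl) (simp add: power2_eq_square)
   finally show ?thesis .
  qed
  have i: "x \<bullet> ?m f = (\<Sum>b\<in>Basis. (x \<bullet> b) * f b)" by (simp add: inner_sum_right mult.commute)
  have 1: "complex_of_real (exp (- t * (\<Sum>b\<in>Basis. (f b)\<^sup>2))) = (\<Prod>b\<in>Basis. complex_of_real (exp (- t * (f b)\<^sup>2)))"
   by (simp only: sum_distrib_left exp_sum[OF finite_Basis] of_real_prod)
  have 2: "exp (- \<i> * complex_of_real (\<Sum>b\<in>Basis. (x \<bullet> b) * f b)) = (\<Prod>b\<in>Basis. exp (- \<i> * complex_of_real ((x \<bullet> b) * f b)))"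
   by (simp only: of_real_sum sum_distrib_left exp_sum[OF finite_Basis])
  show ?thesis unfolding F_def n i 1 2 prod.distrib ..
 qed
 have int1: "integrable lborel (%z. complex_of_real (exp (- t * z\<^sup>2)) * exp (- \<i> * of_real ((x \<bullet> b) * z)))" for b
  by (rule fourier_gaussian_real(1)[OF t])
 have mm: "?m \<in> ?\<Pi> \<rightarrow>\<^sub>M borel" by measurable
 have iP: "integrable ?\<Pi> (%f. F (?m f))"
  unfolding Fm by (rule P.product_integrable_prod[OF finite_Basis int1])
 have "integrable (distr ?\<Pi> borel ?m) F" using iP mm by (subst integrable_distr_eq) auto
 then show "integrable lborel (%xi::'a. complex_of_real (exp (- t * (norm xi)\<^sup>2)) * exp (- \<i> * of_real (x \<bullet> xi)))"
  unfolding lborel_eq[symmetric] F_def .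
 have "(LINT xi|lborel. F xi) = (LINT xi|distr ?\<Pi> borel ?m. F xi)" by (simp only: lborel_eq[symmetric])
 also have "... = (LINT f|?\<Pi>. F (?m f))" using mm by (intro integral_distr) auto
 also have "... = (\<Prod>b\<in>Basis. LINT z|lborel. complex_of_real (exp (- t * z\<^sup>2)) * exp (- \<i> * of_real ((x \<bullet> b) * z)))"
  unfolding Fm by (rule P.product_integral_prod[OF finite_Basis int1])
 also have "... = (\<Prod>b\<in>Basis. of_real (sqrt (pi / t) * exp (- (x \<bullet> b)\<^sup>2 / (4 * t))))"
  unfolding fourier_gaussian_real(2)[OF t] ..
 also have "... = of_real (sqrt (pi / t) ^ DIM('a) * exp (- (norm x)\<^sup>2 / (4 * t)))"
 proof -
  have "(norm x)\<^sup>2 = (\<Sum>b\<in>Basis. (x \<bullet> b)\<^sup>2)"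
   unfolding power2_norm_eq_inner using euclidean_inner[of x x] by (simp add: power2_eq_square)
  then have "exp (- (norm x)\<^sup>2 / (4 * t)) = (\<Prod>b\<in>Basis. exp (- (x \<bullet> b)\<^sup>2 / (4 * t)))"
   by (simp add: exp_sum[symmetric] sum_divide_distrib sum_negf)
  then show ?thesis by (simp add: prod.distrib)
 qed
 finally show "(LINT xi|lborel. complex_of_real (exp (- t * (norm xi)\<^sup>2)) * exp (- \<i> * of_real (x \<bullet> xi)))
   = of_real (sqrt (pi / t) ^ DIM('a) * exp (- (norm x)\<^sup>2 / (4 * t)))" unfolding F_def .
qed

lemma integral_gaussian_powr:
 fixes b t :: real
 assumes "b > -1" "t > 0"
 shows "integrable lborel (%s. indicator {0<..} s * (s powr b * exp (- t * s\<^sup>2)))"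
  and "(LINT s|lborel. indicator {0<..} s * (s powr b * exp (- t * s\<^sup>2))) = Gamma ((b + 1) / 2) / (2 * t powr ((b + 1) / 2))"
proof -
 have e: "(nn_integral lborel (%s. ennreal (indicator {0<..} s * (s powr b * exp (- t * s\<^sup>2))))) = ennreal (Gamma ((b + 1) / 2) / (2 * t powr ((b + 1) / 2)))"
  unfolding nn_integral_gaussian_powr[OF assms, symmetric] by (intro nn_integral_cong) (simp add: indicator_def)
 then show i: "integrable lborel (%s. indicator {0<..} s * (s powr b * exp (- t * s\<^sup>2)))"
  by (intro integrableI_nonneg) auto
 have "0 <= Gamma ((b + 1) / 2) / (2 * t powr ((b + 1) / 2))" using assms Gamma_real_pos[of "(b + 1) / 2"] by simp
 then show "(LINT s|lborel. indicator {0<..} s * (s powr b * exp (- t * s\<^sup>2))) = Gamma ((b + 1) / 2) / (2 * t powr ((b + 1) / 2))"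
  using integral_eq_nn_integral[of "%s. indicator {0<..} s * (s powr b * exp (- t * s\<^sup>2))" lborel]
  unfolding e by simp
qed

text \<open>Weber's integral. Integrating the Bessel series term by term, the Gamma moments cancel
  the Pochhammer symbols and an exponential series is left. The integrals of the absolute values
  form the same series at + x^2 / (4 t), which justifies the exchange.\<close>

lemma bessel_transform_gaussian:
 fixes x :: real
 assumes al: "al > -1/2" and t: "t > 0"
 shows "(LINT s|lborel. indicator {0<..} s * (s powr (2 * al + 1) * exp (- t * s\<^sup>2)) * bessel_j al (x * s))
  = Gamma (al + 1) / (2 * t powr (al + 1)) * exp (- x\<^sup>2 / (4 * t))"
proof -
 define w where "w s = indicator {0<..} s * (s powr (2 * al + 1) * exp (- t * s\<^sup>2))" for s
 have w0: "0 <= w s" for s by (simp add: w_def)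
 define f where "f k s = w s * (bessel_coeff al k * ((x * s)\<^sup>2) ^ k)" for k s
 define g where "g k s = indicator {0<..} s * (s powr (2 * al + 1 + 2 * real k) * exp (- t * s\<^sup>2))" for k :: nat and s :: real
 have fg: "f k s = (bessel_coeff al k * (x\<^sup>2) ^ k) * g k s" for k s
 proof (cases "s > 0")
  case True
  have "s powr (2 * al + 1 + 2 * real k) = s powr (2 * al + 1) * (s\<^sup>2) ^ k"
   using powr_realpow[OF True, of "2 * k"] by (simp add: powr_add power_mult)
  then show ?thesis using True by (simp add: f_def g_def w_def power_mult_distrib)
 qed (simp add: f_def g_def w_def)
 have b: "2 * al + 1 + 2 * real k > -1" for k using al by (simp add: add_pos_nonneg)
 have ex: "(2 * al + 1 + 2 * real k + 1) / 2 = al + 1 + real k" for k by simp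
 have gi: "integrable lborel (g k)" "(LINT s|lborel. g k s) = Gamma (al + 1 + real k) / (2 * t powr (al + 1 + real k))" for k
  using integral_gaussian_powr[OF b t, of k] unfolding g_def ex by auto
 have G: "Gamma (al + 1 + real k) = Gamma (al + 1) * pochhammer (al + 1) k" for k
 proof -
  have nz: "al + 1 \<notin> \<int>\<^sub>\<le>\<^sub>0" using al by (auto elim!: nonpos_Ints_cases)
  have "Gamma (al + 1) > 0" using al by (intro Gamma_real_pos) auto
  then show ?thesis unfolding pochhammer_Gamma[OF nz] by simp
 qed
 have P: "pochhammer (al + 1) k > 0" for k using al by (intro pochhammer_pos) auto
 have Gp: "Gamma (al + 1) > 0" using al by (intro Gamma_real_pos) auto
 have tp: "t powr (al + 1 + real k) = t powr (al + 1) * t ^ k" for k using t by (simp add: powr_add powr_realpow)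
 have aux: "a / (b * c * P) * y * (G * P / (2 * (T * u))) = G / (2 * T) * (inverse c * (a * y / (b * u)))"
  if "P ~= 0" for a b c y G P T u :: real
  using that by (simp add: divide_simps)
 have trm: "(LINT s|lborel. f k s) = Gamma (al + 1) / (2 * t powr (al + 1)) * (inverse (fact k) * (- x\<^sup>2 / (4 * t)) ^ k)" for k
 proof -
  have "(- x\<^sup>2 / (4 * t)) ^ k = (-1) ^ k * (x\<^sup>2) ^ k / (4 ^ k * t ^ k)"
  proof -
   have "- x\<^sup>2 / (4 * t) = (-1) * (x\<^sup>2 / (4 * t))" by simp
   then show ?thesis by (simp only: power_mult_distrib power_divide times_divide_eq_right)
  qed
  then show ?thesis unfolding fg integral_mult_right_zero gi(2) G tp bessel_coeff_def by (simp only:) (rule aux, use P[of k] in simp)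
 qed
 have fi: "integrable lborel (f k)" for k unfolding fg using gi(1) by auto
 have norms: "(LINT s|lborel. norm (f k s)) = Gamma (al + 1) / (2 * t powr (al + 1)) * (inverse (fact k) * (x\<^sup>2 / (4 * t)) ^ k)" for k
 proof -
  have g0: "0 <= g k s" for s by (simp add: g_def)
  have "norm (f k s) = (\<bar>bessel_coeff al k\<bar> * (x\<^sup>2) ^ k) * g k s" for s
   unfolding fg using g0[of s] by (simp add: abs_mult)
  moreover have "\<bar>bessel_coeff al k\<bar> = 1 / (4 ^ k * fact k * pochhammer (al + 1) k)"
   using P[of k] by (simp add: bessel_coeff_def abs_mult power_abs)
  ultimately have "(LINT s|lborel. norm (f k s)) = 1 / (4 ^ k * fact k * pochhammer (al + 1) k) * (x\<^sup>2) ^ k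
    * (Gamma (al + 1) * pochhammer (al + 1) k / (2 * (t powr (al + 1) * t ^ k)))"
   by (simp only: integral_mult_right_zero gi(2) G tp)
  also have "... = Gamma (al + 1) / (2 * t powr (al + 1)) * (inverse (fact k) * (1 * (x\<^sup>2) ^ k / (4 ^ k * t ^ k)))"
   by (rule aux) (use P[of k] in simp)
  also have "1 * (x\<^sup>2) ^ k / (4 ^ k * t ^ k) = (x\<^sup>2 / (4 * t)) ^ k" by (simp add: power_divide power_mult_distrib)
  finally show ?thesis .
 qed
 have "(%k. LINT s|lborel. f k s) sums (LINT s|lborel. (\<Sum>k. f k s))"
 proof (rule sums_integral[OF fi])
  show "AE s in lborel. summable (%k. norm (f k s))"
  proof (intro AE_I2)
   fix s
   have "summable (%k. w s * (\<bar>bessel_coeff al k\<bar> * ((x * s)\<^sup>2) ^ k))"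
    by (intro summable_mult summable_bessel_coeff[OF al]) simp
   then show "summable (%k. norm (f k s))" using w0[of s] by (simp add: f_def abs_mult)
  qed
  show "summable (%k. LINT s|lborel. norm (f k s))"
   unfolding norms by (intro summable_mult summable_exp)
 qed
 moreover have "(\<Sum>k. f k s) = w s * bessel_j al (x * s)" for s
 proof -
  have "summable (%k. \<bar>bessel_coeff al k * ((x * s)\<^sup>2) ^ k\<bar>)"
   using summable_bessel_coeff[OF al, of "(x * s)\<^sup>2"] by (simp add: abs_mult)
  then have "summable (%k. bessel_coeff al k * ((x * s)\<^sup>2) ^ k)" by (rule summable_rabs_cancel)
  then show ?thesis unfolding f_def bessel_j_eq_suminf[OF al] by (rule suminf_mult)
 qed
 ultimately have S: "(%k. Gamma (al + 1) / (2 * t powr (al + 1)) * (inverse (fact k) * (- x\<^sup>2 / (4 * t)) ^ k)) sums (LINT s|lborel. w s * bessel_j al (x * s))"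
  unfolding trm by simp
 have "(%k. inverse (fact k) * (- x\<^sup>2 / (4 * t)) ^ k) sums exp (- x\<^sup>2 / (4 * t))"
  using exp_converges[of "- x\<^sup>2 / (4 * t)"] by simp
 then have "(%k. Gamma (al + 1) / (2 * t powr (al + 1)) * (inverse (fact k) * (- x\<^sup>2 / (4 * t)) ^ k)) sums (Gamma (al + 1) / (2 * t powr (al + 1)) * exp (- x\<^sup>2 / (4 * t)))"
  by (rule sums_mult)
 with S show ?thesis unfolding w_def by (rule sums_unique2)
qed

lemma integral_lborel_prod_mult:
 fixes A :: "'a::euclidean_space => complex" and B :: "'b::euclidean_space => complex"
 assumes A: "integrable lborel A" and B: "integrable lborel B"
 shows "integrable lborel (%x. A (fst x) * B (snd x))"
  and "(LINT x|lborel. A (fst x) * B (snd x)) = (LINT x|lborel. A x) * (LINT x|lborel. B x)"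
proof -
 have [measurable]: "A \<in> borel_measurable borel" "B \<in> borel_measurable borel" using A B by auto
 have "integrable (lborel \<Otimes>\<^sub>M lborel) (%x. A (fst x) * B (snd x))"
 proof (rule lborel_pair.Fubini_integrable)
  show "integrable lborel (%x. LINT y|lborel. norm (A (fst (x, y)) * B (snd (x, y))))"
   using A by (simp add: norm_mult)
  show "AE x in lborel. integrable lborel (%y. A (fst (x, y)) * B (snd (x, y)))" using B by simp
 qed measurable
 note i = this
 then show "integrable lborel (%x. A (fst x) * B (snd x))" by (simp add: lborel_prod)
 have "(LINT x|lborel. A (fst x) * B (snd x)) = (LINT x|(lborel \<Otimes>\<^sub>M lborel). A (fst x) * B (snd x))" by (simp add: lborel_prod)
 also have "... = (LINT x|lborel. LINT y|lborel. A x * B y)" using lborel_pair.integral_fst'[OF i] by simp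
 finally show "(LINT x|lborel. A (fst x) * B (snd x)) = (LINT x|lborel. A x) * (LINT x|lborel. B x)" by simp
qed

text \<open>The transform of exp(- t |xi|^2), an unnormalized heat kernel. Its mass turns out to be
  \<open>wconst\<close> and not 1, which is the origin of the constant in the Plancherel
  identity.\<close>

definition wgauss :: "real => real => (real ^ 'd) \<times> real => real" where
 "wgauss al t x = wconst al CARD('d) * sqrt (pi / t) ^ CARD('d) * (Gamma (al + 1) / (2 * t powr (al + 1)))
  * exp (- (norm x)\<^sup>2 / (4 * t))"

lemma weinstein_transform_gaussian:
 fixes x :: "(real ^ 'd) \<times> real"
 assumes al: "al > -1/2" and t: "t > 0"
 shows "integrable (wmeas al) (%xi. complex_of_real (exp (- t * (norm xi)\<^sup>2)) * wkernel al x xi)"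
  and "(LINT xi|wmeas al. complex_of_real (exp (- t * (norm xi)\<^sup>2)) * wkernel al x xi) = of_real (wgauss al t x)"
proof -
 define C where "C = wconst al CARD('d)"
 have C: "C > 0" unfolding C_def by (rule wconst_pos[OF al])
 note [measurable] = borel_measurable_bessel_j[OF al]
 define A where "A xi = complex_of_real (exp (- t * (norm xi)\<^sup>2)) * exp (- \<i> * of_real (fst x \<bullet> xi))" for xi :: "real ^ 'd"
 define B where "B s = C * (indicator {0<..} s * (s powr (2 * al + 1) * exp (- t * s\<^sup>2)) * bessel_j al (snd x * s))" for s
 have Ai: "integrable lborel A" and Av: "(LINT xi|lborel. A xi) = of_real (sqrt (pi / t) ^ CARD('d) * exp (- (norm (fst x))\<^sup>2 / (4 * t)))"
  unfolding A_def using fourier_gaussian[OF t, of "fst x"] by auto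
 have Bi: "integrable lborel B"
 proof -
  have "2 * al + 1 > -1" using al by simp
  note i = integral_gaussian_powr(1)[OF this t]
  have "integrable lborel (%s. indicator {0<..} s * (s powr (2 * al + 1) * exp (- t * s\<^sup>2)) * bessel_j al (snd x * s))"
  proof (rule integrable_dominated[OF i])
   show "AE s in lborel. norm (indicator {0<..} s * (s powr (2 * al + 1) * exp (- t * s\<^sup>2)) * bessel_j al (snd x * s))
    <= norm (indicator {0<..} s * (s powr (2 * al + 1) * exp (- t * s\<^sup>2)))"
    using abs_bessel_j_le_1[OF al] by (intro AE_I2) (simp add: abs_mult mult_left_le)
  qed measurable
  then show ?thesis unfolding B_def by auto
 qed
 have Bv: "(LINT s|lborel. complex_of_real (B s)) = of_real (C * (Gamma (al + 1) / (2 * t powr (al + 1)) * exp (- (snd x)\<^sup>2 / (4 * t))))"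
  unfolding B_def integral_complex_of_real integral_mult_right_zero bessel_transform_gaussian[OF al t] ..
 note AB = integral_lborel_prod_mult[OF Ai integrable_of_real[OF Bi, where 'a=complex]]
 let ?w = "%x::(real ^ 'd) \<times> real. C * snd x powr (2 * al + 1) * indicator {0<..} (snd x)"
 have wm: "wmeas al = density lborel (%x::(real ^ 'd) \<times> real. ennreal (?w x))"
  unfolding weinstein_measure_altdef C_def by (intro arg_cong2[where f=density] ext refl) (auto simp: indicator_def)
 have wmeas: "?w \<in> borel_measurable lborel" unfolding lborel_prod[symmetric] by measurable
 have w0: "0 <= ?w x" for x using C by simp
 have eq: "?w xi *\<^sub>R (complex_of_real (exp (- t * (norm xi)\<^sup>2)) * wkernel al x xi) = A (fst xi) * of_real (B (snd xi))" for xi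
 proof -
  have "(norm xi)\<^sup>2 = (norm (fst xi))\<^sup>2 + (snd xi)\<^sup>2" by (cases xi) (simp add: norm_Pair)
  then show ?thesis
   by (simp add: A_def B_def wkernel_def scaleR_conv_of_real distrib_left exp_add exp_diff exp_minus divide_inverse mult_ac)
 qed
 have km: "(%xi. complex_of_real (exp (- t * (norm xi)\<^sup>2)) * wkernel al x xi) \<in> borel_measurable lborel"
  using al by measurable
 show "integrable (wmeas al) (%xi. complex_of_real (exp (- t * (norm xi)\<^sup>2)) * wkernel al x xi)"
  unfolding wm using AB(1) by (subst integrable_density[OF km wmeas]) (simp_all only: eq w0 AE_I2)
 have "(LINT xi|wmeas al. complex_of_real (exp (- t * (norm xi)\<^sup>2)) * wkernel al x xi) = (LINT xi|lborel. A (fst xi) * of_real (B (snd xi)))"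
  unfolding wm by (subst integral_density[OF km wmeas]) (simp_all only: eq w0 AE_I2)
 also have "... = of_real (sqrt (pi / t) ^ CARD('d) * exp (- (norm (fst x))\<^sup>2 / (4 * t))) * of_real (C * (Gamma (al + 1) / (2 * t powr (al + 1)) * exp (- (snd x)\<^sup>2 / (4 * t))))"
  unfolding AB(2) Av Bv ..
 also have "... = of_real (wgauss al t x)"
 proof -
  have "exp (- (norm x)\<^sup>2 / (4 * t)) = exp (- (norm (fst x))\<^sup>2 / (4 * t)) * exp (- (snd x)\<^sup>2 / (4 * t))"
   by (cases x) (simp add: norm_Pair exp_add[symmetric] add_divide_distrib diff_divide_distrib)
  then show ?thesis by (simp add: wgauss_def C_def)
 qed
 finally show "(LINT xi|wmeas al. complex_of_real (exp (- t * (norm xi)\<^sup>2)) * wkernel al x xi) = of_real (wgauss al t x)" .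
qed

section \<open>Dilations and the Plancherel inequalities\<close>

text \<open>The homogeneous dimension 2 al + d + 2 is made of d + 1 from Lebesgue measure and 2 al +
  1 from the weight.\<close>

lemma nn_integral_weinstein_dilate:
 fixes f :: "(real ^ 'd) \<times> real => ennreal"
 assumes al: "al > -1/2" and c: "c > 0" and [measurable]: "f \<in> borel_measurable borel"
 shows "(nn_integral (wmeas al) (%x. f x))
  = ennreal (c powr (2 * al + real CARD('d) + 2)) * (nn_integral (wmeas al) (%x. f (c *\<^sub>R x)))"
proof -
 define C where "C = wconst al CARD('d)"
 have C: "C > 0" unfolding C_def by (rule wconst_pos[OF al])
 define w where "w x = ennreal (C * snd x powr (2 * al + 1)) * indicator {0<..} (snd x)" for x :: "(real ^ 'd) \<times> real"
 have [measurable]: "w \<in> borel_measurable borel" unfolding w_def by (rule weinstein_density_measurable)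
 have \<mu>: "wmeas al = density lborel w" unfolding weinstein_measure_altdef w_def C_def ..
 have wc: "w (c *\<^sub>R x) = ennreal (c powr (2 * al + 1)) * w x" for x
  using c C by (simp add: w_def indicator_def powr_mult ennreal_mult[symmetric] mult_ac zero_less_mult_iff)
 have D: "DIM((real ^ 'd) \<times> real) = CARD('d) + 1" by simp
 have "c ^ (CARD('d) + 1) = c powr (real CARD('d) + 1)"
  using c powr_realpow[of c "CARD('d) + 1"] by (simp add: add.commute)
 then have ee: "c ^ (CARD('d) + 1) * c powr (2 * al + 1) = c powr (2 * al + real CARD('d) + 2)"
  using c by (simp add: powr_add[symmetric] algebra_simps)
 have lm: "f \<in> borel_measurable lborel" "w \<in> borel_measurable lborel" "(%x. f (c *\<^sub>R x)) \<in> borel_measurable lborel" by measurable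
 have "(nn_integral (wmeas al) (%x. f x)) = (nn_integral lborel (%x. w x * f x))"
  unfolding \<mu> using lm by (intro nn_integral_density)
 also have "... = (\<integral>\<^sup>+x. w x * f x \<partial>density (distr lborel borel (%x. 0 + c *\<^sub>R x)) (%_. ennreal (\<bar>c\<bar> ^ DIM((real ^ 'd) \<times> real))))"
  using c by (subst lborel_affine[of c 0, symmetric]) auto
 also have "... = (nn_integral lborel (%x. ennreal (c ^ (CARD('d) + 1)) * (w (c *\<^sub>R x) * f (c *\<^sub>R x))))"
  using c unfolding D by (subst nn_integral_density) (auto simp: nn_integral_distr)
 also have "... = (nn_integral lborel (%x. ennreal (c powr (2 * al + real CARD('d) + 2)) * (w x * f (c *\<^sub>R x))))"
  using c unfolding wc ee[symmetric] by (simp only: ennreal_mult zero_le_power less_imp_le powr_ge_zero mult.assoc)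
 also have "... = ennreal (c powr (2 * al + real CARD('d) + 2)) * (nn_integral lborel (%x. w x * f (c *\<^sub>R x)))"
  by (intro nn_integral_cmult) measurable
 also have "(nn_integral lborel (%x. w x * f (c *\<^sub>R x))) = (nn_integral (wmeas al) (%x. f (c *\<^sub>R x)))"
  unfolding \<mu> using lm by (intro nn_integral_density[symmetric])
 finally show ?thesis .
qed

lemma weinstein_measure_dilate:
 assumes al: "al > -1/2" and c: "c > 0"
 shows "(wmeas al :: ((real ^ 'd) \<times> real) measure)
  = density (distr (wmeas al) borel (%x. c *\<^sub>R x)) (%_. ennreal (c powr (2 * al + real CARD('d) + 2)))"
  (is "?L = ?R")
proof (rule measure_eqI)
 fix E :: "((real ^ 'd) \<times> real) set" assume "E \<in> sets ?L"
 then have [measurable]: "E \<in> sets borel" by simp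
 have "emeasure ?L E = (\<integral>\<^sup>+x. indicator E x \<partial>?L)" by simp
 also have "... = ennreal (c powr (2 * al + real CARD('d) + 2)) * (\<integral>\<^sup>+x. indicator E (c *\<^sub>R x) \<partial>?L)"
  by (rule nn_integral_weinstein_dilate[OF al c]) measurable
 also have "(\<integral>\<^sup>+x. indicator E (c *\<^sub>R x) \<partial>?L) = (\<integral>\<^sup>+x. indicator E x \<partial>distr ?L borel (%x. c *\<^sub>R x))"
  by (intro nn_integral_distr[symmetric]) measurable
 also have "ennreal (c powr (2 * al + real CARD('d) + 2)) * ... = emeasure ?R E"
  by (subst emeasure_density) (auto simp: nn_integral_cmult)
 finally show "emeasure ?L E = emeasure ?R E" .
qed simp

lemma integral_weinstein_dilate:
 fixes f :: "(real ^ 'd) \<times> real => 'b::{banach, second_countable_topology}"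
 assumes al: "al > -1/2" and c: "c > 0" and f[measurable]: "f \<in> borel_measurable borel"
 shows "integrable (wmeas al) f \<longleftrightarrow> integrable (wmeas al) (%x. f (c *\<^sub>R x))"
  and "(LINT x|wmeas al. f x) = c powr (2 * al + real CARD('d) + 2) *\<^sub>R (LINT x|wmeas al. f (c *\<^sub>R x))"
proof -
 let ?m = "wmeas al :: ((real ^ 'd) \<times> real) measure"
 let ?k = "c powr (2 * al + real CARD('d) + 2)"
 let ?D = "distr ?m borel (%x. c *\<^sub>R x)"
 have fD: "f \<in> borel_measurable ?D" by simp
 have k: "?k ~= 0" using c by simp
 have dm: "(%x. c *\<^sub>R x) \<in> ?m \<rightarrow>\<^sub>M borel" by measurable
 have "integrable (density ?D (%_. ennreal ?k)) f \<longleftrightarrow> integrable ?D (%x. ?k *\<^sub>R f x)"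
  using fD by (intro integrable_density) auto
 also have "... \<longleftrightarrow> integrable ?m (%x. ?k *\<^sub>R f (c *\<^sub>R x))"
  by (intro integrable_distr_eq dm) measurable
 also have "... \<longleftrightarrow> integrable ?m (%x. f (c *\<^sub>R x))"
 proof
  assume "integrable ?m (%x. ?k *\<^sub>R f (c *\<^sub>R x))"
  then have "integrable ?m (%x. (1 / ?k) *\<^sub>R (?k *\<^sub>R f (c *\<^sub>R x)))" by (rule integrable_scaleR_right)
  then show "integrable ?m (%x. f (c *\<^sub>R x))" using c by simp
 qed (rule integrable_scaleR_right)
 finally show "integrable ?m f \<longleftrightarrow> integrable ?m (%x. f (c *\<^sub>R x))"
  unfolding weinstein_measure_dilate[OF al c, symmetric] .
 have "(LINT x|density ?D (%_. ennreal ?k). f x) = (LINT x|?D. ?k *\<^sub>R f x)"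
  using fD by (intro integral_density) auto
 also have "... = (LINT x|?m. ?k *\<^sub>R f (c *\<^sub>R x))"
  by (intro integral_distr dm) measurable
 finally show "(LINT x|?m. f x) = ?k *\<^sub>R (LINT x|?m. f (c *\<^sub>R x))"
  unfolding weinstein_measure_dilate[OF al c, symmetric] by simp
qed

lemma wgauss_nonneg: "al > -1/2 ==> 0 < t ==> 0 <= wgauss al t x"
 unfolding wgauss_def using wconst_pos[of al, THEN less_imp_le] Gamma_real_pos[of "al + 1"] by simp

lemma borel_measurable_wgauss [measurable]: "wgauss al t \<in> borel_measurable borel"
 unfolding wgauss_def by measurable

lemma wgauss_scale:
 fixes x :: "(real ^ 'd) \<times> real"
 assumes c: "c > 0"
 shows "c powr (2 * al + real CARD('d) + 2) * wgauss al (c\<^sup>2) (c *\<^sub>R x) = wgauss al 1 x"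
proof -
 have 1: "(norm (c *\<^sub>R x))\<^sup>2 / (4 * c\<^sup>2) = (norm x)\<^sup>2 / (4 * 1)" using c by (simp add: power_mult_distrib)
 have c2: "c\<^sup>2 = c powr 2" using c by simp
 have 2: "(c\<^sup>2) powr (al + 1) = c powr (2 * al + 2)" unfolding c2 using c by (simp only: powr_powr) (simp add: algebra_simps)
 have 3: "sqrt (pi / c\<^sup>2) = sqrt (pi / 1) / c" using c by (simp add: real_sqrt_divide)
 have 4: "c powr (2 * al + real CARD('d) + 2) = c powr (2 * al + 2) * c ^ CARD('d)"
  using c by (simp add: powr_add powr_realpow mult_ac)
 have 5: "(p * k) * (A * (B / k) * (G / (2 * p)) * e) = A * B * (G / (2 * 1)) * e" if "p ~= 0" "k ~= 0" for p k A B G e :: real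
  using that by (simp add: field_simps)
 have "c powr (2 * al + 2) ~= 0" "c ^ CARD('d) ~= 0" using c by auto
 from 5[OF this] show ?thesis unfolding wgauss_def minus_divide_left[symmetric] 1 2 3 4 power_divide powr_one_eq_one by simp
qed

lemma bessel_j_0: assumes "al > -1/2" shows "bessel_j al 0 = 1"
proof -
 have "(\<Sum>k. (-1) ^ k * (0::real) ^ (2 * k) / (2 ^ (2 * k) * fact k * Gamma (al + real k + 1))) = 1 / Gamma (al + 1)"
  by (subst suminf_finite[of "{0}"]) auto
 moreover have "Gamma (al + 1) > 0" using assms by (intro Gamma_real_pos) simp
 ultimately show ?thesis unfolding bessel_j_def by simp
qed

lemma wkernel_0: "al > -1/2 ==> wkernel al 0 xi = 1"
 by (simp add: wkernel_def bessel_j_0)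

text \<open>At t = 1 the kernel is again a Gaussian, with parameter 1/4, so its mass is a Gaussian
  transform at the origin, where the kernel equals 1. Of the two factors \<open>wconst\<close> in
  the product one cancels against the powers of 2, pi and the Gamma value.\<close>

lemma wgauss_mass:
 assumes al: "al > -1/2"
 shows "integrable (wmeas al) (wgauss al 1 :: (real ^ 'd) \<times> real => real)"
  and "(LINT x|wmeas al. wgauss al 1 (x :: (real ^ 'd) \<times> real)) = wconst al CARD('d)"
proof -
 let ?m = "wmeas al :: ((real ^ 'd) \<times> real) measure"
 define C where "C = wconst al CARD('d)"
 define g where "g = Gamma (al + 1)"
 have g: "g > 0" using al by (simp add: g_def Gamma_real_pos)
 have e: "integrable ?m (%xi. complex_of_real (exp (- (1/4) * (norm xi)\<^sup>2)))"
  "(LINT xi|?m. complex_of_real (exp (- (1/4) * (norm xi)\<^sup>2))) = of_real (wgauss al (1/4) (0 :: (real ^ 'd) \<times> real))"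
  using weinstein_transform_gaussian[OF al, of "1/4" "0 :: (real ^ 'd) \<times> real"] unfolding wkernel_0[OF al] by simp_all
 define A where "A = C * sqrt pi ^ CARD('d) * (g / 2)"
 have G1: "wgauss al 1 x = A * exp (- (1/4) * (norm x)\<^sup>2)" for x :: "(real ^ 'd) \<times> real"
  by (simp add: wgauss_def A_def C_def g_def)
 have ei: "integrable ?m (%xi. exp (- (1/4) * (norm xi)\<^sup>2))" using e(1) by (simp only: complex_of_real_integrable_eq)
 then show "integrable ?m (wgauss al 1)" unfolding G1[abs_def] by (rule integrable_mult_right)
 have "(LINT xi|?m. exp (- (1/4) * (norm xi)\<^sup>2)) = wgauss al (1/4) (0 :: (real ^ 'd) \<times> real)"
  using e(2) by (simp only: integral_complex_of_real of_real_eq_iff)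
 then have "(LINT x|?m. wgauss al 1 x) = A * wgauss al (1/4) (0 :: (real ^ 'd) \<times> real)"
  unfolding G1[abs_def] integral_mult_right_zero by simp
 also have "... = C"
 proof -
  have q: "(1/4::real) powr (al + 1) = 1 / (4 * 2 powr (2 * al))"
  proof -
   have "(4::real) powr (al + 1) = 4 * 4 powr al" by (simp add: powr_add)
   also have "(4::real) powr al = (2 powr 2) powr al" by simp
   also have "... = 2 powr (2 * al)" by (simp only: powr_powr)
   finally show ?thesis by (simp add: powr_divide)
  qed
  have p: "sqrt pi ^ CARD('d) * sqrt (pi / (1/4)) ^ CARD('d) = (2 * pi) ^ CARD('d)"
  proof -
   have "sqrt pi * sqrt (pi / (1/4)) = sqrt ((2 * pi)\<^sup>2)"
    by (simp only: real_sqrt_mult[symmetric]) (simp add: power2_eq_square mult_ac)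
   also have "... = 2 * pi" by (subst real_sqrt_abs) simp
   finally show ?thesis by (metis power_mult_distrib)
  qed
  have D: "C * ((2 * pi) ^ CARD('d) * 2 powr (2 * al) * g\<^sup>2) = 1"
  proof -
   have "(2 * pi) ^ CARD('d) * 2 powr (2 * al) * g\<^sup>2 ~= 0" using g by simp
   then show ?thesis unfolding C_def wconst_def g_def by (metis nonzero_eq_divide_eq)
  qed
  have "A * wgauss al (1/4) (0 :: (real ^ 'd) \<times> real)
   = C * (C * ((sqrt pi ^ CARD('d) * sqrt (pi / (1/4)) ^ CARD('d)) * 2 powr (2 * al) * g\<^sup>2))"
   unfolding wgauss_def A_def q C_def[symmetric] g_def[symmetric] by (simp add: power2_eq_square)
  then show ?thesis unfolding p D by simp
 qed
 finally show "(LINT x|?m. wgauss al 1 x) = wconst al CARD('d)" unfolding C_def .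
qed

lemma integrable_wgauss:
 assumes al: "al > -1/2" and t: "t > 0"
 shows "integrable (wmeas al) (wgauss al t :: (real ^ 'd) \<times> real => real)"
  and "(LINT x|wmeas al. wgauss al t (x :: (real ^ 'd) \<times> real)) = wconst al CARD('d)"
proof -
 let ?k = "sqrt t powr (2 * al + real CARD('d) + 2)"
 have k: "?k > 0" using t by simp
 have e: "wgauss al t (sqrt t *\<^sub>R x) = (1 / ?k) * wgauss al 1 x" for x :: "(real ^ 'd) \<times> real"
 proof -
  have "?k * wgauss al t (sqrt t *\<^sub>R x) = wgauss al 1 x"
   using wgauss_scale[of "sqrt t" al x] t by simp
  moreover have "a = (1 / k) * b" if "k * a = b" "k > 0" for a b k :: real using that by auto
  ultimately show ?thesis using k by blast
 qed
 have s: "sqrt t > 0" using t by simp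
 note I = integral_weinstein_dilate[OF al s, of "wgauss al t :: (real ^ 'd) \<times> real => real", OF borel_measurable_wgauss]
 show "integrable (wmeas al) (wgauss al t :: (real ^ 'd) \<times> real => real)"
  unfolding I(1) e by (intro integrable_mult_right wgauss_mass al)
 show "(LINT x|wmeas al. wgauss al t (x :: (real ^ 'd) \<times> real)) = wconst al CARD('d)"
  unfolding I(2) e integral_mult_right_zero wgauss_mass(2)[OF al] using k
  by (metis (no_types, lifting) less_irrefl mult.assoc mult_1 nonzero_mult_div_cancel_left real_scaleR_def times_divide_eq_right mult_1_right)
qed

lemma nn_integral_le_tendsto:
 fixes u :: "nat => 'a => ennreal"
 assumes [measurable]: "!!n. u n \<in> borel_measurable M"
  and lim: "AE x in M. (%n. u n x) \<longlonglongrightarrow> v x" and le: "!!n. (nn_integral M (%x. u n x)) <= b n" and b: "b \<longlonglongrightarrow> B"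
 shows "(nn_integral M (%x. v x)) <= B"
proof -
 have "AE x in M. v x = liminf (%n. u n x)"
  using lim by eventually_elim (simp add: lim_imp_Liminf)
 then have "(nn_integral M (%x. v x)) = (nn_integral M (%x. liminf (%n. u n x)))" by (rule nn_integral_cong_AE)
 also have "... <= liminf (%n. nn_integral M (%x. u n x))" by (rule nn_integral_liminf) measurable
 also have "... <= liminf b" by (intro Liminf_mono always_eventually allI le)
 also have "... = B" using b by (simp add: lim_imp_Liminf)
 finally show ?thesis .
qed

lemma (in pair_sigma_finite) integrable_pair_mult:
 fixes f :: "'a => complex" and g :: "'b => complex"
 assumes f: "integrable M1 f" and g: "integrable M2 g"
 shows "integrable (M1 \<Otimes>\<^sub>M M2) (%w. f (fst w) * g (snd w))"
proof (rule Fubini_integrable)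
 note [measurable] = borel_measurable_integrable[OF f] borel_measurable_integrable[OF g]
 show "(%w. f (fst w) * g (snd w)) \<in> borel_measurable (M1 \<Otimes>\<^sub>M M2)" by measurable
 show "integrable M1 (%x. LINT y|M2. norm (f (fst (x, y)) * g (snd (x, y))))"
  using f by (simp add: norm_mult)
 show "AE x in M1. integrable M2 (%y. f (fst (x, y)) * g (snd (x, y)))"
  using g by simp
qed

lemma
 fixes h :: "(real ^ 'd) \<times> real => complex"
 assumes al: "al > -1/2" and h: "integrable (wmeas al) h"
 shows integrable_weinstein_transform: "integrable (wmeas al) (%x. h x * wkernel al x xi)"
  and norm_weinstein_transform_le: "cmod (weinstein_transform al h xi) <= (LINT x|wmeas al. cmod (h x))"
  and borel_measurable_weinstein_transform: "weinstein_transform al h \<in> borel_measurable borel"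
proof -
 have [measurable]: "h \<in> borel_measurable borel" using borel_measurable_integrable[OF h] by simp
 have le: "cmod (h x * wkernel al x xi) <= cmod (h x)" for x
  using norm_wkernel_le_1[OF al, of x xi] by (simp add: norm_mult mult_left_le)
 show i: "integrable (wmeas al) (%x. h x * wkernel al x xi)"
  using al le by (intro integrable_dominated[OF h]) auto
 show "cmod (weinstein_transform al h xi) <= (LINT x|wmeas al. cmod (h x))"
  unfolding weinstein_transform_altdef
  using le by (intro order_trans[OF integral_norm_bound] integral_mono integrable_norm i h)
 have "(%w. h (snd w) * wkernel al (snd w) (fst w)) \<in> borel_measurable (borel \<Otimes>\<^sub>M wmeas al)"
  using al by measurable
 then show "weinstein_transform al h \<in> borel_measurable borel"
  unfolding weinstein_transform_altdef[abs_def]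
  using W.borel_measurable_lebesgue_integral[of "%xi x. h x * wkernel al x xi" borel] by (simp add: case_prod_beta')
qed

text \<open>The generalized convolution of h with the Gaussian kernel; for bounded continuous h it
  tends to \<open>wconst\<close> times h as t -> 0.\<close>

definition wgauss_mean :: "real => real => ((real ^ 'd) \<times> real => complex) => (real ^ 'd) \<times> real => complex" where
 "wgauss_mean al t h x = (LINT y|wmeas al. LINT th|angle_measure al. h (wconv x y th) * of_real (wgauss al t y))"

text \<open>A damped inversion formula. The Gaussian factor legitimates Fubini, multiplicativity of
  the kernel turns the xi-integral into a translated \<open>wgauss\<close>, and the symmetry of the
  translation moves the translate from the Gaussian to h.\<close>

lemma weinstein_transform_gauss_inversion:
 fixes h :: "(real ^ 'd) \<times> real => complex"
 assumes al: "al > -1/2" and t: "t > 0" and h: "integrable (wmeas al) h"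
 shows "(LINT xi|wmeas al. of_real (exp (- t * (norm xi)\<^sup>2)) * weinstein_transform al h xi * wkernel al (wreflect x) xi)
  = wgauss_mean al t h x"
proof -
 let ?m = "wmeas al :: ((real ^ 'd) \<times> real) measure"
 let ?\<Theta> = "angle_measure al"
 let ?K = "wkernel al :: (real ^ 'd) \<times> real => _"
 interpret A: prob_space ?\<Theta> by (rule prob_space_angle_measure[OF al])
 interpret WW: pair_sigma_finite ?m ?m ..
 interpret WA: pair_sigma_finite ?m ?\<Theta> ..
 have [measurable]: "h \<in> borel_measurable borel" using borel_measurable_integrable[OF h] by simp
 define e where "e xi = complex_of_real (exp (- t * (norm xi)\<^sup>2))" for xi :: "(real ^ 'd) \<times> real"
 have [measurable]: "e \<in> borel_measurable borel" unfolding e_def by measurable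
 have ei: "integrable ?m e"
 proof -
  have "integrable ?m (%xi. e xi * ?K x xi)" for x
   unfolding e_def by (rule weinstein_transform_gaussian[OF al t])
  from this[of 0] show ?thesis by (simp add: wkernel_0[OF al])
 qed
 have k1: "cmod (?K a xi) <= 1" for a xi by (rule norm_wkernel_le_1[OF al])
 have conv: "(LINT xi|?m. e xi * (?K y xi * ?K (wreflect x) xi)) = (LINT th|?\<Theta>. of_real (wgauss al t (wconv (wreflect x) y th)))" for y
 proof -
  have "(LINT xi|?m. e xi * (?K y xi * ?K (wreflect x) xi))
    = (LINT xi|?m. LINT th|?\<Theta>. e xi * ?K (wconv (wreflect x) y th) xi)"
  proof (rule integral_cong_AE)
   show "AE xi in ?m. e xi * (?K y xi * ?K (wreflect x) xi) = (LINT th|?\<Theta>. e xi * ?K (wconv (wreflect x) y th) xi)"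
    using AE_weinstein_measure_pos[of al]
    by eventually_elim (simp add: wkernel_conv[OF al] mult.commute)
  qed (use al in measurable)
  also have "... = (LINT th|?\<Theta>. LINT xi|?m. e xi * ?K (wconv (wreflect x) y th) xi)"
  proof (rule WA.Fubini_integral[symmetric])
   show "integrable (?m \<Otimes>\<^sub>M ?\<Theta>) (%(xi, th). e xi * ?K (wconv (wreflect x) y th) xi)"
   proof (rule integrable_dominated)
    show "integrable (?m \<Otimes>\<^sub>M ?\<Theta>) (%w. e (fst w) * 1)" by (rule WA.integrable_pair_mult[OF ei]) auto
    show "AE w in ?m \<Otimes>\<^sub>M ?\<Theta>. norm (case w of (xi, th) => e xi * ?K (wconv (wreflect x) y th) xi) <= norm (e (fst w) * 1)"
     by (intro AE_I2) (simp add: split_beta norm_mult mult_left_le k1)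
   qed (use al in measurable)
  qed
  finally show ?thesis unfolding e_def weinstein_transform_gaussian[OF al t] .
 qed
 have "(LINT xi|?m. e xi * weinstein_transform al h xi * ?K (wreflect x) xi)
  = (LINT xi|?m. LINT y|?m. h y * (e xi * (?K y xi * ?K (wreflect x) xi)))"
 proof (rule Bochner_Integration.integral_cong[OF refl])
  fix xi
  have "e xi * weinstein_transform al h xi * ?K (wreflect x) xi = (LINT y|?m. e xi * ?K (wreflect x) xi * (h y * ?K y xi))"
   unfolding weinstein_transform_altdef integral_mult_right_zero by (simp only: mult_ac)
  also have "... = (LINT y|?m. h y * (e xi * (?K y xi * ?K (wreflect x) xi)))"
   by (simp only: mult_ac)
  finally show "e xi * weinstein_transform al h xi * ?K (wreflect x) xi = (LINT y|?m. h y * (e xi * (?K y xi * ?K (wreflect x) xi)))" .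
 qed
 also have "... = (LINT y|?m. LINT xi|?m. h y * (e xi * (?K y xi * ?K (wreflect x) xi)))"
 proof (rule WW.Fubini_integral[symmetric])
  show "integrable (?m \<Otimes>\<^sub>M ?m) (%(xi, y). h y * (e xi * (?K y xi * ?K (wreflect x) xi)))"
  proof (rule integrable_dominated)
   show "integrable (?m \<Otimes>\<^sub>M ?m) (%w. e (fst w) * h (snd w))" by (rule WW.integrable_pair_mult[OF ei h])
   have "cmod (h y * (e xi * (?K y xi * ?K (wreflect x) xi))) <= cmod (e xi * h y)" for xi y
   proof -
    have "cmod (?K y xi) * cmod (?K (wreflect x) xi) <= 1" using k1 by (simp add: mult_le_one)
    then have "cmod (h y) * cmod (e xi) * (cmod (?K y xi) * cmod (?K (wreflect x) xi)) <= cmod (h y) * cmod (e xi)"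
     by (intro mult_left_le) auto
    then show ?thesis by (simp add: norm_mult mult_ac)
   qed
   then show "AE w in ?m \<Otimes>\<^sub>M ?m. norm (case w of (xi, y) => h y * (e xi * (?K y xi * ?K (wreflect x) xi))) <= norm (e (fst w) * h (snd w))"
    by (intro AE_I2) (auto simp: split_beta')
  qed (use al in measurable)
 qed
 also have "... = (LINT y|?m. LINT th|?\<Theta>. h y * of_real (wgauss al t (wconv (wreflect x) y th)))"
  by (simp only: integral_mult_right_zero conv)
 also have "... = (LINT y|?m. LINT th|?\<Theta>. h (wconv (wreflect (wreflect x)) y th) * of_real (wgauss al t y))"
 proof (rule integral_wconv_symmetric(2)[OF al, of "%w. h (fst w) * of_real (wgauss al t (snd w))" "wreflect x", unfolded fst_conv snd_conv])
  have "wgauss al t z <= wgauss al t (0::(real ^ 'd) \<times> real)" for z :: "(real ^ 'd) \<times> real"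
  proof -
   have "exp (- (norm z)\<^sup>2 / (4 * t)) <= 1" using t by simp
   moreover have "0 <= wconst al CARD('d) * sqrt (pi / t) ^ CARD('d) * (Gamma (al + 1) / (2 * t powr (al + 1)))"
    using wconst_pos[OF al, of "CARD('d)", THEN less_imp_le] Gamma_real_pos[of "al + 1"] al t by simp
   ultimately have "wconst al CARD('d) * sqrt (pi / t) ^ CARD('d) * (Gamma (al + 1) / (2 * t powr (al + 1))) * exp (- (norm z)\<^sup>2 / (4 * t))
    <= wconst al CARD('d) * sqrt (pi / t) ^ CARD('d) * (Gamma (al + 1) / (2 * t powr (al + 1))) * 1"
    by (intro mult_left_mono)
   then show ?thesis by (simp add: wgauss_def)
  qed
  note le = this wgauss_nonneg[OF al t]
  show "integrable (?m \<Otimes>\<^sub>M ?\<Theta>) (%w. h (fst w) * of_real (wgauss al t (wconv (wreflect x) (fst w) (snd w))))"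
  proof (rule integrable_dominated)
   show "integrable (?m \<Otimes>\<^sub>M ?\<Theta>) (%w. h (fst w) * of_real (wgauss al t (0::(real ^ 'd) \<times> real)))"
    by (rule WA.integrable_pair_mult[OF h]) auto
  qed (auto simp: norm_mult le intro!: mult_left_mono)
 qed measurable
 finally show ?thesis unfolding wgauss_mean_def e_def by simp
qed

text \<open>The damped inversion formula paired with \<open>cnj (h x)\<close>: the reflected kernel
  is the conjugate one, so the x-integral rebuilds the conjugate transform and |F h|^2 appears under
  the Gaussian.\<close>

lemma wgauss_energy:
 fixes h :: "(real ^ 'd) \<times> real => complex"
 assumes al: "al > -1/2" and t: "t > 0" and h: "integrable (wmeas al) h"
 shows "integrable (wmeas al) (%xi. exp (- t * (norm xi)\<^sup>2) * (cmod (weinstein_transform al h xi))\<^sup>2)"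
  and "of_real (LINT xi|wmeas al. exp (- t * (norm xi)\<^sup>2) * (cmod (weinstein_transform al h xi))\<^sup>2)
   = (LINT x|wmeas al. cnj (h x) * wgauss_mean al t h x)"
proof -
 let ?m = "wmeas al :: ((real ^ 'd) \<times> real) measure"
 let ?K = "wkernel al :: (real ^ 'd) \<times> real => _"
 let ?F = "weinstein_transform al h"
 interpret WW: pair_sigma_finite ?m ?m ..
 have [measurable]: "h \<in> borel_measurable borel" using borel_measurable_integrable[OF h] by simp
 have [measurable]: "?F \<in> borel_measurable borel" by (rule borel_measurable_weinstein_transform[OF al h])
 define L where "L = (LINT x|?m. cmod (h x))"
 have L: "cmod (?F xi) <= L" for xi unfolding L_def by (rule norm_weinstein_transform_le[OF al h])
 have L0: "L >= 0" using order_trans[OF norm_ge_zero L] .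
 define e where "e xi = exp (- t * (norm xi)\<^sup>2)" for xi :: "(real ^ 'd) \<times> real"
 have [measurable]: "e \<in> borel_measurable borel" unfolding e_def by measurable
 have e0: "e xi >= 0" for xi by (simp add: e_def)
 have eci: "integrable ?m (%xi. complex_of_real (e xi))"
  using weinstein_transform_gaussian(1)[OF al t, of 0] by (simp add: wkernel_0[OF al] e_def)
 then have ei: "integrable ?m e" by (simp only: complex_of_real_integrable_eq)
 show "integrable ?m (%xi. exp (- t * (norm xi)\<^sup>2) * (cmod (?F xi))\<^sup>2)"
  unfolding e_def[symmetric]
 proof (rule integrable_dominated)
  show "integrable ?m (%xi. e xi * L\<^sup>2)" using ei by simp
  show "AE xi in ?m. norm (e xi * (cmod (?F xi))\<^sup>2) <= norm (e xi * L\<^sup>2)"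
   using e0 L by (intro AE_I2) (auto simp: abs_mult intro!: mult_left_mono power_mono)
 qed measurable
 have "of_real (LINT xi|?m. e xi * (cmod (?F xi))\<^sup>2) = (LINT xi|?m. LINT x|?m. cnj (h x) * (of_real (e xi) * ?F xi * ?K (wreflect x) xi))"
  unfolding integral_complex_of_real[symmetric]
 proof (rule Bochner_Integration.integral_cong[OF refl])
  fix xi
  have "complex_of_real (e xi * (cmod (?F xi))\<^sup>2) = of_real (e xi) * ?F xi * cnj (?F xi)"
   by (simp only: of_real_mult complex_norm_square mult.assoc)
  also have "cnj (?F xi) = (LINT x|?m. cnj (h x) * ?K (wreflect x) xi)"
   unfolding weinstein_transform_altdef wkernel_reflect complex_cnj_mult[symmetric] by (rule Bochner_Integration.integral_cnj[symmetric])
  also have "of_real (e xi) * ?F xi * ... = (LINT x|?m. of_real (e xi) * ?F xi * (cnj (h x) * ?K (wreflect x) xi))"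
   by (rule integral_mult_right_zero[symmetric])
  also have "... = (LINT x|?m. cnj (h x) * (of_real (e xi) * ?F xi * ?K (wreflect x) xi))"
   by (simp only: mult_ac)
  finally show "complex_of_real (e xi * (cmod (?F xi))\<^sup>2) = (LINT x|?m. cnj (h x) * (of_real (e xi) * ?F xi * ?K (wreflect x) xi))" .
 qed
 also have "... = (LINT x|?m. LINT xi|?m. cnj (h x) * (of_real (e xi) * ?F xi * ?K (wreflect x) xi))"
 proof (rule WW.Fubini_integral[symmetric])
  show "integrable (?m \<Otimes>\<^sub>M ?m) (%(xi, x). cnj (h x) * (of_real (e xi) * ?F xi * ?K (wreflect x) xi))"
  proof (rule integrable_dominated)
   show "integrable (?m \<Otimes>\<^sub>M ?m) (%w. (of_real L * of_real (e (fst w))) * h (snd w))"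
    by (rule WW.integrable_pair_mult[OF _ h]) (rule integrable_mult_right[OF eci])
   have "cmod (cnj (h x) * (of_real (e xi) * ?F xi * ?K (wreflect x) xi)) <= cmod ((of_real L * of_real (e xi)) * h x)" for xi x
   proof -
    have "cmod (?F xi) * cmod (?K (wreflect x) xi) <= L * 1" using L0 L norm_wkernel_le_1[OF al, of "wreflect x" xi] by (intro mult_mono) auto
    then have "(cmod (h x) * e xi) * (cmod (?F xi) * cmod (?K (wreflect x) xi)) <= (cmod (h x) * e xi) * L"
     using e0 by (intro mult_left_mono) auto
    then show ?thesis using e0 L0 by (simp add: norm_mult mult_ac)
   qed
   then show "AE w in ?m \<Otimes>\<^sub>M ?m. norm (case w of (xi, x) => cnj (h x) * (of_real (e xi) * ?F xi * ?K (wreflect x) xi))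
     <= norm ((of_real L * of_real (e (fst w))) * h (snd w))"
    by (intro AE_I2) (auto simp: split_beta')
  qed (use al in measurable)
 qed
 also have "... = (LINT x|?m. cnj (h x) * wgauss_mean al t h x)"
  unfolding integral_mult_right_zero e_def weinstein_transform_gauss_inversion[OF al t h] ..
 finally show "of_real (LINT xi|?m. exp (- t * (norm xi)\<^sup>2) * (cmod (?F xi))\<^sup>2) = (LINT x|?m. cnj (h x) * wgauss_mean al t h x)"
  unfolding e_def .
qed

text \<open>Scaling moves the parameter from the Gaussian into the argument of h, so that as c -> 0
  the fixed kernel \<open>wgauss al 1\<close> serves as the dominating weight.\<close>

lemma wgauss_mean_scale:
 fixes h :: "(real ^ 'd) \<times> real => complex"
 assumes al: "al > -1/2" and c: "c > 0" and [measurable]: "h \<in> borel_measurable borel"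
 shows "wgauss_mean al (c\<^sup>2) h x
  = (LINT y|wmeas al. LINT th|angle_measure al. h (wconv x (c *\<^sub>R y) th) * of_real (wgauss al 1 y))"
proof -
 interpret A: prob_space "angle_measure al" by (rule prob_space_angle_measure[OF al])
 let ?k = "c powr (2 * al + real CARD('d) + 2)"
 have "wgauss_mean al (c\<^sup>2) h x
  = ?k *\<^sub>R (LINT y|wmeas al. LINT th|angle_measure al. h (wconv x (c *\<^sub>R y) th) * of_real (wgauss al (c\<^sup>2) (c *\<^sub>R y)))"
  unfolding wgauss_mean_def by (rule integral_weinstein_dilate(2)[OF al c]) measurable
 also have "... = (LINT y|wmeas al. LINT th|angle_measure al. h (wconv x (c *\<^sub>R y) th) * of_real (?k * wgauss al (c\<^sup>2) (c *\<^sub>R y)))"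
  by (simp only: scaleR_conv_of_real integral_mult_right_zero[symmetric] of_real_mult mult_ac)
 finally show ?thesis unfolding wgauss_scale[OF c] .
qed

lemma wgauss_mean_tendsto:
 fixes h :: "(real ^ 'd) \<times> real => complex"
 assumes al: "al > -1/2" and h: "continuous_on UNIV h" and M: "!!x. cmod (h x) <= M"
 shows "snd x >= 0 ==> (%n. wgauss_mean al ((1 / real (Suc n))\<^sup>2) h x) \<longlonglongrightarrow> of_real (wconst al CARD('d)) * h x"
  and "cmod (wgauss_mean al ((1 / real (Suc n))\<^sup>2) h x) <= M * wconst al CARD('d)"
proof -
 let ?m = "wmeas al :: ((real ^ 'd) \<times> real) measure"
 let ?\<Theta> = "angle_measure al"
 interpret A: prob_space ?\<Theta> by (rule prob_space_angle_measure[OF al])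
 interpret WA: pair_sigma_finite ?m ?\<Theta> ..
 have M0: "M >= 0" using order_trans[OF norm_ge_zero M] .
 have [measurable]: "h \<in> borel_measurable borel" using h by (rule borel_measurable_continuous_onI)
 let ?g = "wgauss al 1 :: (real ^ 'd) \<times> real => real"
 have g0: "?g y >= 0" for y by (rule wgauss_nonneg[OF al]) simp
 have gi: "integrable (?m \<Otimes>\<^sub>M ?\<Theta>) (%w. complex_of_real M * of_real (?g (fst w)) * 1)"
  using wgauss_mass(1)[OF al] by (intro WA.integrable_pair_mult integrable_mult_right integrable_of_real) auto
 have gi': "integrable (?m \<Otimes>\<^sub>M ?\<Theta>) (%w. M * ?g (fst w))"
  using gi by (simp add: of_real_mult[symmetric] complex_of_real_integrable_eq del: of_real_mult)
 let ?I = "%n w. h (wconv x ((1 / real (Suc n)) *\<^sub>R fst w) (snd w)) * of_real (?g (fst w))"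
 have dom: "norm (?I n w) <= M * ?g (fst w)" for n w
  using M g0 by (simp add: norm_mult mult_right_mono)
 have Ii: "integrable (?m \<Otimes>\<^sub>M ?\<Theta>) (?I n)" for n
  using dom[of n] by (intro integrable_dominated[OF gi']) (auto intro!: AE_I2 order_trans[OF _ abs_ge_self])
 have eq: "wgauss_mean al ((1 / real (Suc n))\<^sup>2) h x = (LINT w|(?m \<Otimes>\<^sub>M ?\<Theta>). ?I n w)" for n
  using WA.integral_fst'[OF Ii[of n]] by (subst wgauss_mean_scale[OF al]) auto
 have mass: "(LINT w|(?m \<Otimes>\<^sub>M ?\<Theta>). M * ?g (fst w)) = M * wconst al CARD('d)"
  unfolding WA.integral_fst'[OF gi', symmetric] fst_conv using wgauss_mass(2)[OF al, where 'd='d] A.prob_space by simp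
 show "cmod (wgauss_mean al ((1 / real (Suc n))\<^sup>2) h x) <= M * wconst al CARD('d)"
  unfolding eq mass[symmetric]
  by (intro order_trans[OF integral_norm_bound] integral_mono integrable_norm Ii gi' dom)
 assume x: "snd x >= 0"
 have "(%n. LINT w|(?m \<Otimes>\<^sub>M ?\<Theta>). ?I n w) \<longlonglongrightarrow> (LINT w|(?m \<Otimes>\<^sub>M ?\<Theta>). h x * of_real (?g (fst w)))"
 proof (rule integral_dominated_convergence[OF _ _ gi'])
  show "AE w in ?m \<Otimes>\<^sub>M ?\<Theta>. (%n. ?I n w) \<longlonglongrightarrow> h x * of_real (?g (fst w))"
  proof (rule AE_I2)
   fix w :: "((real ^ 'd) \<times> real) \<times> real"
   have z: "(%n. 1 / real (Suc n)) \<longlonglongrightarrow> 0" by (rule LIMSEQ_Suc[OF lim_1_over_n])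
   have "(%n. wconv x ((1 / real (Suc n)) *\<^sub>R fst w) (snd w)) \<longlonglongrightarrow> wconv x (0 *\<^sub>R fst w) (snd w)"
    unfolding wconv_def by (intro tendsto_intros z)
   \<comment> \<open>The last coordinate of this point is sqrt ((snd x)^2), which is
     \<open>snd x\<close> by the sign assumption.\<close>
   also have "wconv x (0 *\<^sub>R fst w) (snd w) = x" using x by (cases x) (simp add: wconv_def)
   finally have "(%n. h (wconv x ((1 / real (Suc n)) *\<^sub>R fst w) (snd w))) \<longlonglongrightarrow> h x"
    using h by (auto intro: continuous_on_tendsto_compose)
   then show "(%n. ?I n w) \<longlonglongrightarrow> h x * of_real (?g (fst w))" by (intro tendsto_intros)
  qed
  show "AE w in ?m \<Otimes>\<^sub>M ?\<Theta>. norm (?I n w) <= M * ?g (fst w)" for n by (intro AE_I2 dom)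
 qed measurable
 also have "(LINT w|(?m \<Otimes>\<^sub>M ?\<Theta>). h x * of_real (?g (fst w))) = of_real (wconst al CARD('d)) * h x"
 proof -
  have "integrable (?m \<Otimes>\<^sub>M ?\<Theta>) (%w. complex_of_real (?g (fst w)) * 1)"
   using wgauss_mass(1)[OF al] by (intro WA.integrable_pair_mult) auto
  then have "integrable (?m \<Otimes>\<^sub>M ?\<Theta>) (%w. complex_of_real (?g (fst w)))" by simp
  from WA.integral_fst'[OF integrable_mult_right[OF this, of "h x"], symmetric] show ?thesis
   using wgauss_mass(2)[OF al, where 'd='d] A.prob_space by simp
 qed
 finally show "(%n. wgauss_mean al ((1 / real (Suc n))\<^sup>2) h x) \<longlonglongrightarrow> of_real (wconst al CARD('d)) * h x"
  unfolding eq .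
qed

text \<open>With the given normalization of the measure the transform is an isometry only up to this constant,
 which cancels in the square function estimate.\<close>

lemma weinstein_plancherel:
 fixes h :: "(real ^ 'd) \<times> real => complex"
 assumes al: "al > -1/2" and hi: "integrable (wmeas al) h"
  and h: "continuous_on UNIV h" and M: "!!x. cmod (h x) <= M"
 shows "(nn_integral (wmeas al) (%xi. ennreal ((cmod (weinstein_transform al h xi))\<^sup>2)))
  = ennreal (wconst al CARD('d)) * (nn_integral (wmeas al) (%x. ennreal ((cmod (h x))\<^sup>2)))"
proof -
 let ?m = "wmeas al :: ((real ^ 'd) \<times> real) measure"
 let ?F = "weinstein_transform al h"
 define C where "C = wconst al CARD('d)"
 have C: "C > 0" unfolding C_def by (rule wconst_pos[OF al])
 have M0: "M >= 0" using order_trans[OF norm_ge_zero M] .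
 have [measurable]: "h \<in> borel_measurable borel" using h by (rule borel_measurable_continuous_onI)
 have [measurable]: "?F \<in> borel_measurable borel" by (rule borel_measurable_weinstein_transform[OF al hi])
 define t where "t n = (1 / real (Suc n))\<^sup>2" for n
 have t: "t n > 0" for n by (simp add: t_def)
 define e where "e n = (LINT xi|?m. exp (- t n * (norm xi)\<^sup>2) * (cmod (?F xi))\<^sup>2)" for n
 note lim = wgauss_mean_tendsto[OF al h M, folded t_def C_def]
 have Pm: "wgauss_mean al (t n) h \<in> borel_measurable borel" for n
 proof -
  interpret A: prob_space "angle_measure al" by (rule prob_space_angle_measure[OF al])
  show ?thesis unfolding wgauss_mean_def[abs_def] by measurable
 qed
 have "(%n. LINT x|?m. cnj (h x) * wgauss_mean al (t n) h x) \<longlonglongrightarrow> (LINT x|?m. cnj (h x) * (of_real C * h x))"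
 proof (rule integral_dominated_convergence)
  show "integrable ?m (%x. cmod (h x) * (M * C))" using hi by simp
  show "AE x in ?m. (%n. cnj (h x) * wgauss_mean al (t n) h x) \<longlonglongrightarrow> cnj (h x) * (of_real C * h x)"
   using AE_weinstein_measure_pos[of al] by eventually_elim (intro tendsto_intros lim(1), simp)
  show "AE x in ?m. norm (cnj (h x) * wgauss_mean al (t n) h x) <= cmod (h x) * (M * C)" for n
   by (intro AE_I2) (simp add: norm_mult mult_left_mono lim(2))
 qed (use Pm in simp_all)
 also have "(LINT x|?m. cnj (h x) * (of_real C * h x)) = of_real (C * (LINT x|?m. (cmod (h x))\<^sup>2))"
  unfolding integral_mult_right_zero[symmetric] integral_complex_of_real[symmetric]
  by (intro Bochner_Integration.integral_cong refl) (simp only: of_real_mult complex_norm_square mult_ac)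
 also have "(%n. LINT x|?m. cnj (h x) * wgauss_mean al (t n) h x) = (%n. of_real (e n))"
  unfolding e_def wgauss_energy(2)[OF al t hi] ..
 finally have el: "e \<longlonglongrightarrow> C * (LINT x|?m. (cmod (h x))\<^sup>2)" by (simp only: tendsto_of_real_iff)
 have h2: "integrable ?m (%x. (cmod (h x))\<^sup>2)"
 proof (rule integrable_dominated)
  show "integrable ?m (%x. M * cmod (h x))" using hi by simp
  show "AE x in ?m. norm ((cmod (h x))\<^sup>2) <= norm (M * cmod (h x))"
   using M M0 by (intro AE_I2) (simp add: power2_eq_square abs_mult mult_right_mono)
 qed measurable
 have en: "ennreal (e n) = (nn_integral ?m (%xi. ennreal (exp (- t n * (norm xi)\<^sup>2) * (cmod (?F xi))\<^sup>2)))" for n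
  unfolding e_def using wgauss_energy(1)[OF al t hi] by (intro nn_integral_eq_integral[symmetric]) auto
 \<comment> \<open>The damped energies converge to the right-hand side. Fatou bounds the undamped
   energy by their limit, and each of them is at most the undamped energy because the damping factor
   is at most 1.\<close>
 have "(nn_integral ?m (%xi. ennreal ((cmod (?F xi))\<^sup>2))) = ennreal (C * (LINT x|?m. (cmod (h x))\<^sup>2))"
 proof (rule antisym)
  show "(nn_integral ?m (%xi. ennreal ((cmod (?F xi))\<^sup>2))) <= ennreal (C * (LINT x|?m. (cmod (h x))\<^sup>2))"
  proof (rule nn_integral_le_tendsto[OF _ _ eq_refl[OF en[symmetric]] tendsto_ennrealI[OF el]])
   have "t \<longlonglongrightarrow> 0\<^sup>2" unfolding t_def by (intro tendsto_intros LIMSEQ_Suc[OF lim_1_over_n])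
   then have "(%n. exp (- t n * (norm xi)\<^sup>2) * (cmod (?F xi))\<^sup>2) \<longlonglongrightarrow> exp (- 0\<^sup>2 * (norm xi)\<^sup>2) * (cmod (?F xi))\<^sup>2" for xi :: "(real ^ 'd) \<times> real"
    by (intro tendsto_intros)
   then show "AE xi in ?m. (%n. ennreal (exp (- t n * (norm xi)\<^sup>2) * (cmod (?F xi))\<^sup>2)) \<longlonglongrightarrow> ennreal ((cmod (?F xi))\<^sup>2)"
    by (intro AE_I2 tendsto_ennrealI) simp
  qed measurable
  show "ennreal (C * (LINT x|?m. (cmod (h x))\<^sup>2)) <= (nn_integral ?m (%xi. ennreal ((cmod (?F xi))\<^sup>2)))"
  proof (rule LIMSEQ_le_const2[OF tendsto_ennrealI[OF el]], intro exI allI impI)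
   show "ennreal (e n) <= (nn_integral ?m (%xi. ennreal ((cmod (?F xi))\<^sup>2)))" for n
    unfolding en using t[of n] by (intro nn_integral_mono ennreal_leI) (auto intro!: mult_left_le_one_le)
  qed
 qed
 moreover have "(nn_integral ?m (%x. ennreal ((cmod (h x))\<^sup>2))) = ennreal (LINT x|?m. (cmod (h x))\<^sup>2)"
  using h2 by (intro nn_integral_eq_integral) auto
 ultimately show ?thesis using C unfolding C_def[symmetric] by (simp add: ennreal_mult integral_nonneg_AE)
qed

section \<open>The square function\<close>

text \<open>A generalized correlation. With \<eta> a dilated wavelet it is the wavelet transform at
  that scale up to a power of the scale.\<close>

definition wcorr :: "real => ((real ^ 'd) \<times> real => complex) => ((real ^ 'd) \<times> real => complex) => (real ^ 'd) \<times> real => complex" where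
 "wcorr al f \<eta> x = (LINT y|wmeas al. f y * cnj (LINT th|angle_measure al. \<eta> (wconv x y th)))"

lemma norm_integral_angle_measure_le:
 assumes al: "al > -1/2" and M: "!!x. cmod (\<eta> x) <= M"
 shows "cmod (LINT th|angle_measure al. \<eta> (g th)) <= M"
proof -
 interpret A: prob_space "angle_measure al" by (rule prob_space_angle_measure[OF al])
 have "cmod (LINT th|angle_measure al. \<eta> (g th)) <= (LINT th|angle_measure al. M)"
  by (rule norm_integral_le_AE) (auto simp: M)
 then show ?thesis using A.prob_space by simp
qed

text \<open>Once the translation is moved from \<eta> to f, continuity and boundedness are inherited
  from f by dominated convergence against \<eta>. In the transform both factors are taken at the
  reflected frequency because the translation adds the Euclidean parts of its arguments instead of
  subtracting them.\<close>

lemma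
 fixes f \<eta> :: "(real ^ 'd) \<times> real => complex"
 assumes al: "al > -1/2" and f: "integrable (wmeas al) f" and fc: "continuous_on UNIV f" and N: "!!x. cmod (f x) <= N"
  and \<eta>: "integrable (wmeas al) \<eta>" and M: "!!x. cmod (\<eta> x) <= M"
 shows wcorr_symmetric: "wcorr al f \<eta> x = (LINT y|wmeas al. LINT th|angle_measure al. f (wconv (wreflect x) y th) * cnj (\<eta> y))"
  and continuous_wcorr: "continuous_on UNIV (wcorr al f \<eta>)"
  and norm_wcorr_le: "cmod (wcorr al f \<eta> x) <= N * (LINT y|wmeas al. cmod (\<eta> y))"
  and integrable_wcorr: "integrable (wmeas al) (wcorr al f \<eta>)"
  and weinstein_transform_corr: "snd xi > 0 ==> weinstein_transform al (wcorr al f \<eta>) xi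
   = weinstein_transform al f (wreflect xi) * cnj (weinstein_transform al \<eta> (wreflect xi))"
proof -
 let ?m = "wmeas al :: ((real ^ 'd) \<times> real) measure"
 let ?\<Theta> = "angle_measure al"
 let ?K = "wkernel al :: (real ^ 'd) \<times> real => _"
 interpret A: prob_space ?\<Theta> by (rule prob_space_angle_measure[OF al])
 interpret WW: pair_sigma_finite ?m ?m ..
 interpret WA: pair_sigma_finite ?m ?\<Theta> ..
 have [measurable]: "f \<in> borel_measurable borel" "\<eta> \<in> borel_measurable borel"
  using borel_measurable_integrable[OF f] borel_measurable_integrable[OF \<eta>] by simp_all
 have N0: "N >= 0" using order_trans[OF norm_ge_zero N] .
 have M0: "M >= 0" using order_trans[OF norm_ge_zero M] .
 show sym: "wcorr al f \<eta> x = (LINT y|?m. LINT th|?\<Theta>. f (wconv (wreflect x) y th) * cnj (\<eta> y))" for x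
 proof -
  have "wcorr al f \<eta> x = (LINT y|?m. LINT th|?\<Theta>. f y * cnj (\<eta> (wconv x y th)))"
   unfolding wcorr_def integral_mult_right_zero Bochner_Integration.integral_cnj ..
  also have "... = (LINT y|?m. LINT th|?\<Theta>. f (wconv (wreflect x) y th) * cnj (\<eta> y))"
  proof (rule integral_wconv_symmetric(2)[OF al, of "%w. f (fst w) * cnj (\<eta> (snd w))" x, unfolded fst_conv snd_conv])
   show "integrable (?m \<Otimes>\<^sub>M ?\<Theta>) (%w. f (fst w) * cnj (\<eta> (wconv x (fst w) (snd w))))"
   proof (rule integrable_dominated)
    show "integrable (?m \<Otimes>\<^sub>M ?\<Theta>) (%w. f (fst w) * of_real M)" by (rule WA.integrable_pair_mult[OF f]) auto
   qed (auto simp: norm_mult M M0 intro!: AE_I2 mult_left_mono)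
  qed measurable
  finally show ?thesis .
 qed
 have dom: "norm (f (wconv (wreflect x) (fst w) (snd w)) * cnj (\<eta> (fst w))) <= N * cmod (\<eta> (fst w))" for x w
  by (simp add: norm_mult mult_right_mono N)
 have di: "integrable (?m \<Otimes>\<^sub>M ?\<Theta>) (%w. N * cmod (\<eta> (fst w)))"
 proof -
  have "integrable (?m \<Otimes>\<^sub>M ?\<Theta>) (%w. \<eta> (fst w) * 1)" by (rule WA.integrable_pair_mult[OF \<eta>]) auto
  then show ?thesis by simp
 qed
 have pi: "integrable (?m \<Otimes>\<^sub>M ?\<Theta>) (%w. f (wconv (wreflect x) (fst w) (snd w)) * cnj (\<eta> (fst w)))" for x
  using dom[of x] by (intro integrable_dominated[OF di]) (auto intro!: AE_I2 order_trans[OF _ abs_ge_self])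
 have pair: "wcorr al f \<eta> x = (LINT w|(?m \<Otimes>\<^sub>M ?\<Theta>). f (wconv (wreflect x) (fst w) (snd w)) * cnj (\<eta> (fst w)))" for x
  unfolding sym using WA.integral_fst'[OF pi[of x]] by simp
 show cont: "continuous_on UNIV (wcorr al f \<eta>)"
  unfolding continuous_on_sequentially o_def
 proof (intro ballI allI impI)
  fix u :: "nat => (real ^ 'd) \<times> real" and x
  assume "(\<forall>n. u n \<in> UNIV) & u \<longlonglongrightarrow> x"
  then have u: "u \<longlonglongrightarrow> x" by simp
  show "(%n. wcorr al f \<eta> (u n)) \<longlonglongrightarrow> wcorr al f \<eta> x"
   unfolding pair
  proof (rule integral_dominated_convergence[OF _ _ di])
   show "AE w in ?m \<Otimes>\<^sub>M ?\<Theta>. (%n. f (wconv (wreflect (u n)) (fst w) (snd w)) * cnj (\<eta> (fst w)))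
     \<longlonglongrightarrow> f (wconv (wreflect x) (fst w) (snd w)) * cnj (\<eta> (fst w))"
   proof (rule AE_I2)
    fix w :: "((real ^ 'd) \<times> real) \<times> real"
    have "(%n. wconv (wreflect (u n)) (fst w) (snd w)) \<longlonglongrightarrow> wconv (wreflect x) (fst w) (snd w)"
     unfolding wconv_def wreflect_simps by (intro tendsto_intros u)
    then have "(%n. f (wconv (wreflect (u n)) (fst w) (snd w))) \<longlonglongrightarrow> f (wconv (wreflect x) (fst w) (snd w))"
     using fc by (auto intro: continuous_on_tendsto_compose)
    then show "(%n. f (wconv (wreflect (u n)) (fst w) (snd w)) * cnj (\<eta> (fst w)))
     \<longlonglongrightarrow> f (wconv (wreflect x) (fst w) (snd w)) * cnj (\<eta> (fst w))" by (intro tendsto_intros)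
   qed
   show "AE w in ?m \<Otimes>\<^sub>M ?\<Theta>. norm (f (wconv (wreflect (u n)) (fst w) (snd w)) * cnj (\<eta> (fst w))) <= N * cmod (\<eta> (fst w))" for n
    by (intro AE_I2 dom)
  qed measurable
 qed
 then have hm [measurable]: "wcorr al f \<eta> \<in> borel_measurable borel" by (rule borel_measurable_continuous_onI)
 have "(LINT w|(?m \<Otimes>\<^sub>M ?\<Theta>). N * cmod (\<eta> (fst w))) = N * (LINT y|?m. cmod (\<eta> y))"
  unfolding WA.integral_fst'[OF di, symmetric] fst_conv using A.prob_space by simp
 then show "cmod (wcorr al f \<eta> x) <= N * (LINT y|?m. cmod (\<eta> y))"
  unfolding pair using dom[of x] di by (intro order_trans[OF norm_integral_le_AE[OF di]]) auto
 define F where "F = (%(y, x). cnj (\<eta> y) * (LINT th|?\<Theta>. f (wconv (wreflect x) y th)))"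
 have Fm [measurable]: "F \<in> borel_measurable (?m \<Otimes>\<^sub>M ?m)" unfolding F_def by measurable
 have Fi: "integrable (?m \<Otimes>\<^sub>M ?m) F"
 proof (rule integrableI_bounded[OF Fm])
  have "(nn_integral (?m \<Otimes>\<^sub>M ?m) (%w. ennreal (norm (F w)))) = (nn_integral ?m (%y. nn_integral ?m (%x. ennreal (norm (F (y, x))))))"
   by (rule W.nn_integral_fst[symmetric]) measurable
  also have "... <= (nn_integral ?m (%y. ennreal (cmod (\<eta> y)) * (nn_integral ?m (%x. ennreal (cmod (f x))))))"
  proof (rule nn_integral_mono)
   fix y
   have "(nn_integral ?m (%x. ennreal (norm (F (y, x))))) <= (nn_integral ?m (%x. ennreal (cmod (\<eta> y)) * (nn_integral ?\<Theta> (%th. ennreal (cmod (f (wconv y (wreflect x) th)))))))"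
    unfolding F_def split_conv norm_mult complex_mod_cnj wconv_commute[of y]
    by (subst ennreal_mult) (auto intro!: nn_integral_mono mult_left_mono norm_integral_le_nn_integral)
   also have "... = ennreal (cmod (\<eta> y)) * (nn_integral ?m (%x. nn_integral ?\<Theta> (%th. ennreal (cmod (f (wconv y (wreflect x) th))))))"
    by (rule nn_integral_cmult) measurable
   also have "(nn_integral ?m (%x. nn_integral ?\<Theta> (%th. ennreal (cmod (f (wconv y (wreflect x) th))))))
    = (nn_integral ?m (%x. nn_integral ?\<Theta> (%th. ennreal (cmod (f (wconv y x th))))))"
    by (rule nn_integral_wreflect) measurable
   also have "... = (nn_integral ?m (%x. ennreal (cmod (f x))))"
    by (rule nn_integral_wconv[OF al]) measurable
   finally show "(nn_integral ?m (%x. ennreal (norm (F (y, x))))) <= ennreal (cmod (\<eta> y)) * (nn_integral ?m (%x. ennreal (cmod (f x))))" .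
  qed
  also have "... = (nn_integral ?m (%y. ennreal (cmod (\<eta> y)))) * (nn_integral ?m (%x. ennreal (cmod (f x))))"
   by (rule nn_integral_multc) measurable
  also have "... < \<infinity>" using f \<eta> by (simp add: integrable_iff_bounded ennreal_mult_less_top)
  finally show "(nn_integral (?m \<Otimes>\<^sub>M ?m) (%w. ennreal (norm (F w)))) < \<infinity>" .
 qed
 have hF: "wcorr al f \<eta> x = (LINT y|?m. F (y, x))" for x
  unfolding sym F_def split_conv by (simp add: mult.commute)
 show "integrable ?m (wcorr al f \<eta>)"
  unfolding hF[abs_def] using WW.integrable_snd[of "%y x. F (y, x)"] Fi by simp
 assume xi: "snd xi > 0"
 \<comment> \<open>The transform of a translate of f: after a reflection in x the symmetry shifts
   the translation onto the kernel, where multiplicativity pulls out the factor belonging to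
   y.\<close>
 have inner: "(LINT x|?m. (LINT th|?\<Theta>. f (wconv (wreflect x) y th)) * ?K x xi) = ?K y xi * weinstein_transform al f (wreflect xi)" for y
 proof -
  define H where "H x = (LINT th|?\<Theta>. f (wconv y x th)) * ?K (wreflect x) xi" for x
  have Hm: "H \<in> borel_measurable borel" unfolding H_def[abs_def] using al by measurable
  have rd: "distr ?m borel wreflect = ?m"
  proof (rule measure_eqI)
   fix E :: "((real ^ 'd) \<times> real) set" assume "E \<in> sets (distr ?m borel wreflect)"
   then have [measurable]: "E \<in> sets borel" by simp
   have "emeasure (distr ?m borel wreflect) E = (\<integral>\<^sup>+x. indicator E x \<partial>distr ?m borel wreflect)" by simp
   also have "... = (nn_integral ?m (%x. indicator E (wreflect x)))" by (intro nn_integral_distr) measurable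
   also have "... = (nn_integral ?m (%x. indicator E x))" by (rule nn_integral_wreflect) measurable
   finally show "emeasure (distr ?m borel wreflect) E = emeasure ?m E" by simp
  qed simp
  have "(LINT x|?m. (LINT th|?\<Theta>. f (wconv (wreflect x) y th)) * ?K x xi) = (LINT x|?m. H (wreflect x))"
   by (simp add: H_def wconv_commute[of y])
  also have "... = (LINT x|distr ?m borel wreflect. H x)"
   using Hm by (intro integral_distr[symmetric]) measurable
  also have "... = (LINT x|?m. LINT th|?\<Theta>. ?K (wreflect x) xi * f (wconv y x th))"
   unfolding rd H_def by (simp add: mult.commute)
  also have "... = (LINT x|?m. LINT th|?\<Theta>. ?K (wreflect (wconv (wreflect y) x th)) xi * f x)"
  proof (rule integral_wconv_symmetric(2)[OF al, of "%w. ?K (wreflect (fst w)) xi * f (snd w)" y, unfolded fst_conv snd_conv])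
   show "integrable (?m \<Otimes>\<^sub>M ?\<Theta>) (%w. ?K (wreflect (fst w)) xi * f (wconv y (fst w) (snd w)))"
   proof (rule integrable_dominated)
    show "integrable (?m \<Otimes>\<^sub>M ?\<Theta>) (%w. f (wconv y (fst w) (snd w)))"
    proof (rule integrableI_bounded)
     have "(nn_integral (?m \<Otimes>\<^sub>M ?\<Theta>) (%w. ennreal (norm (f (wconv y (fst w) (snd w)))))) = (nn_integral ?m (%x. nn_integral ?\<Theta> (%th. ennreal (norm (f (wconv y x th))))))"
      by (subst A.nn_integral_fst[symmetric]) simp_all
     also have "... = (nn_integral ?m (%x. ennreal (norm (f x))))" by (rule nn_integral_wconv[OF al]) measurable
     finally show "(nn_integral (?m \<Otimes>\<^sub>M ?\<Theta>) (%w. ennreal (norm (f (wconv y (fst w) (snd w)))))) < \<infinity>"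
      using f by (simp add: integrable_iff_bounded)
    qed measurable
    show "AE w in ?m \<Otimes>\<^sub>M ?\<Theta>. norm (?K (wreflect (fst w)) xi * f (wconv y (fst w) (snd w))) <= norm (f (wconv y (fst w) (snd w)))"
     by (intro AE_I2) (simp add: norm_mult mult_left_le_one_le norm_wkernel_le_1[OF al])
   qed (use al in measurable)
  qed (use al in measurable)
  also have "... = (LINT x|?m. cnj (?K (wreflect y) xi) * (f x * cnj (?K x xi)))"
   using xi by (simp add: wkernel_reflect wkernel_conv[OF al] mult_ac)
  also have "... = ?K y xi * weinstein_transform al f (wreflect xi)"
   unfolding integral_mult_right_zero weinstein_transform_altdef wkernel_reflect by simp
  finally show ?thesis .
 qed
 have "weinstein_transform al (wcorr al f \<eta>) xi = (LINT x|?m. LINT y|?m. F (y, x) * ?K x xi)"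
  unfolding weinstein_transform_altdef hF integral_mult_left_zero ..
 also have "... = (LINT y|?m. LINT x|?m. F (y, x) * ?K x xi)"
 proof (rule WW.Fubini_integral)
  show "integrable (?m \<Otimes>\<^sub>M ?m) (%(y, x). F (y, x) * ?K x xi)"
  proof (rule integrable_dominated[OF Fi])
   show "AE w in ?m \<Otimes>\<^sub>M ?m. norm (case w of (y, x) => F (y, x) * ?K x xi) <= norm (F w)"
    by (intro AE_I2) (simp add: split_beta norm_mult mult_left_le norm_wkernel_le_1[OF al])
  qed (use al in measurable)
 qed
 also have "... = (LINT y|?m. cnj (\<eta> y) * (?K y xi * weinstein_transform al f (wreflect xi)))"
  unfolding F_def split_conv mult.assoc integral_mult_right_zero inner ..
 also have "... = (LINT y|?m. weinstein_transform al f (wreflect xi) * cnj (\<eta> y * ?K y (wreflect xi)))"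
  by (simp add: wkernel_reflect mult_ac)
 also have "... = weinstein_transform al f (wreflect xi) * cnj (weinstein_transform al \<eta> (wreflect xi))"
  unfolding integral_mult_right_zero Bochner_Integration.integral_cnj by (simp add: weinstein_transform_altdef)
 finally show "weinstein_transform al (wcorr al f \<eta>) xi
   = weinstein_transform al f (wreflect xi) * cnj (weinstein_transform al \<eta> (wreflect xi))" .
qed

lemma wkernel_scaleR: "wkernel al (a *\<^sub>R x) xi = wkernel al x (a *\<^sub>R xi)"
 by (simp add: wkernel_def mult_ac)

lemma borel_measurable_weinstein_dilation [measurable (raw)]:
 fixes \<phi> :: "(real ^ 'd) \<times> real => complex"
 assumes [measurable]: "\<phi> \<in> borel_measurable borel" "f \<in> borel_measurable M" "g \<in> M \<rightarrow>\<^sub>M borel"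
 shows "(%w. weinstein_dilation al (f w) \<phi> (g w)) \<in> borel_measurable M"
 unfolding weinstein_dilation_def by measurable

text \<open>The dilation is normalized in L^1, so its transform is a pure dilation without a factor;
  admissibility, an integral along rays, then applies directly.\<close>

lemma
 fixes \<phi> :: "(real ^ 'd) \<times> real => complex"
 assumes al: "al > -1/2" and a: "a > 0" and \<phi>: "integrable (wmeas al) \<phi>"
 shows integrable_weinstein_dilation: "integrable (wmeas al) (weinstein_dilation al a \<phi>)"
  and integral_norm_weinstein_dilation: "(LINT x|wmeas al. cmod (weinstein_dilation al a \<phi> x)) = (LINT x|wmeas al. cmod (\<phi> x))"
  and weinstein_transform_dilation: "weinstein_transform al (weinstein_dilation al a \<phi>) xi = weinstein_transform al \<phi> (a *\<^sub>R xi)"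
proof -
 let ?k = "a powr (2 * al + real CARD('d) + 2)"
 have [measurable]: "\<phi> \<in> borel_measurable borel" using borel_measurable_integrable[OF \<phi>] by simp
 have D: "weinstein_dilation al a \<phi> (a *\<^sub>R x) = of_real (1 / ?k) * \<phi> x" for x
  using a by (simp only: weinstein_dilation_def powr_minus_divide) simp
 have k: "?k > 0" using a by simp
 have m: "weinstein_dilation al a \<phi> \<in> borel_measurable borel" by measurable
 show "integrable (wmeas al) (weinstein_dilation al a \<phi>)"
  unfolding integral_weinstein_dilate(1)[OF al a m] D using \<phi> by (rule integrable_mult_right)
 have m1: "(%x. cmod (weinstein_dilation al a \<phi> x)) \<in> borel_measurable borel" by measurable
 show "(LINT x|wmeas al. cmod (weinstein_dilation al a \<phi> x)) = (LINT x|wmeas al. cmod (\<phi> x))"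
  unfolding integral_weinstein_dilate(2)[OF al a m1] D using k by (simp add: norm_mult norm_divide)
 have m2: "(%x. weinstein_dilation al a \<phi> x * wkernel al x xi) \<in> borel_measurable borel" using al by measurable
 have "weinstein_transform al (weinstein_dilation al a \<phi>) xi
   = of_real ?k * (LINT x|wmeas al. of_real (1 / ?k) * (\<phi> x * wkernel al x (a *\<^sub>R xi)))"
  unfolding weinstein_transform_altdef integral_weinstein_dilate(2)[OF al a m2] D wkernel_scaleR scaleR_conv_of_real mult.assoc ..
 also have "... = (of_real ?k * of_real (1 / ?k)) * weinstein_transform al \<phi> (a *\<^sub>R xi)"
  unfolding integral_mult_right_zero weinstein_transform_altdef by (rule mult.assoc[symmetric])
 also have "(of_real ?k * of_real (1 / ?k) :: complex) = 1" using k by (simp only: of_real_mult[symmetric]) simp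
 finally show "weinstein_transform al (weinstein_dilation al a \<phi>) xi = weinstein_transform al \<phi> (a *\<^sub>R xi)" by simp
qed

lemma norm_weinstein_dilation_le:
 fixes \<phi> :: "(real ^ 'd) \<times> real => complex"
 assumes "!!x. cmod (\<phi> x) <= M"
 shows "cmod (weinstein_dilation al a \<phi> x) <= a powr (- (2 * al + real CARD('d) + 2)) * M"
 using assms by (simp add: weinstein_dilation_def norm_mult mult_left_mono)

lemma
 fixes \<eta> :: "(real ^ 'd) \<times> real => complex"
 assumes al: "al > -1/2" and \<eta>: "integrable (wmeas al) \<eta>"
 shows integrable_weinstein_translate: "integrable (wmeas al) (%y. LINT th|angle_measure al. \<eta> (wconv x y th))"
  and integral_norm_weinstein_translate_le: "(LINT y|wmeas al. cmod (LINT th|angle_measure al. \<eta> (wconv x y th))) <= (LINT y|wmeas al. cmod (\<eta> y))"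
proof -
 let ?m = "wmeas al :: ((real ^ 'd) \<times> real) measure"
 let ?\<Theta> = "angle_measure al"
 interpret A: prob_space ?\<Theta> by (rule prob_space_angle_measure[OF al])
 have [measurable]: "\<eta> \<in> borel_measurable borel" using borel_measurable_integrable[OF \<eta>] by simp
 have "(nn_integral ?m (%y. ennreal (cmod (LINT th|?\<Theta>. \<eta> (wconv x y th))))) <= (nn_integral ?m (%y. nn_integral ?\<Theta> (%th. ennreal (cmod (\<eta> (wconv x y th))))))"
  by (intro nn_integral_mono norm_integral_le_nn_integral)
 also have "... = (nn_integral ?m (%y. ennreal (cmod (\<eta> y))))" by (rule nn_integral_wconv[OF al]) measurable
 also have "... = ennreal (LINT y|?m. cmod (\<eta> y))" using \<eta> by (intro nn_integral_eq_integral) auto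
 finally have le: "(nn_integral ?m (%y. ennreal (cmod (LINT th|?\<Theta>. \<eta> (wconv x y th))))) <= ennreal (LINT y|?m. cmod (\<eta> y))" .
 then show i: "integrable ?m (%y. LINT th|?\<Theta>. \<eta> (wconv x y th))"
  by (intro integrableI_bounded) (auto intro: le_less_trans)
 have "ennreal (LINT y|?m. cmod (LINT th|?\<Theta>. \<eta> (wconv x y th))) <= ennreal (LINT y|?m. cmod (\<eta> y))"
  using le i by (subst nn_integral_eq_integral[symmetric]) auto
 then show "(LINT y|?m. cmod (LINT th|?\<Theta>. \<eta> (wconv x y th))) <= (LINT y|?m. cmod (\<eta> y))"
  by (simp add: integral_nonneg_AE)
qed

text \<open>With T the modulus of the translate, |f| T is at most T where |f| <= 1 and at most M
  |f|^p elsewhere. This supplies the dominating function for limits under the correlation.\<close>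

lemma integrable_mult_weinstein_translate:
 fixes f \<eta> :: "(real ^ 'd) \<times> real => complex"
 assumes al: "al > -1/2" and \<eta>: "integrable (wmeas al) \<eta>" and M: "!!x. cmod (\<eta> x) <= M"
  and f[measurable]: "f \<in> borel_measurable borel" and fp: "integrable (wmeas al) (%x. cmod (f x) powr p)" and p: "p >= 1"
 shows "integrable (wmeas al) (%y. cmod (f y) * cmod (LINT th|angle_measure al. \<eta> (wconv x y th)))"
proof -
 let ?m = "wmeas al :: ((real ^ 'd) \<times> real) measure"
 interpret A: prob_space "angle_measure al" by (rule prob_space_angle_measure[OF al])
 have [measurable]: "\<eta> \<in> borel_measurable borel" using borel_measurable_integrable[OF \<eta>] by simp
 define T where "T y = cmod (LINT th|angle_measure al. \<eta> (wconv x y th))" for y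
 have [measurable]: "T \<in> borel_measurable borel" unfolding T_def by measurable
 have T: "integrable ?m T" unfolding T_def using integrable_weinstein_translate[OF al \<eta>] by (rule integrable_norm)
 have T0: "0 <= T y" "T y <= M" for y unfolding T_def using norm_integral_angle_measure_le[OF al M] by auto
 have "integrable ?m (%y. T y + M * cmod (f y) powr p)" using T fp by simp
 then show ?thesis unfolding T_def[symmetric]
 proof (rule integrable_dominated)
  have "cmod (f y) * T y <= T y + M * cmod (f y) powr p" for y
  proof (cases "cmod (f y) <= 1")
   case True
   then have "cmod (f y) * T y <= T y" using T0 by (simp add: mult_left_le_one_le)
   moreover have "0 <= M * cmod (f y) powr p" using order_trans[OF T0(1) T0(2)] by simp
   ultimately show ?thesis by linarith
  next
   case False
   then have "cmod (f y) powr 1 <= cmod (f y) powr p" using p by (intro powr_mono) auto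
   then have "cmod (f y) * T y <= cmod (f y) powr p * M" using T0 False by (intro mult_mono) auto
   then show ?thesis using T0(1)[of y] by (simp add: mult.commute)
  qed
  then show "AE y in ?m. norm (cmod (f y) * T y) <= norm (T y + M * cmod (f y) powr p)"
   using T0(1) by (intro AE_I2) (simp add: abs_mult order_trans[OF _ abs_ge_self])
 qed measurable
qed

lemma wcorr_tendsto:
 fixes f \<eta> :: "(real ^ 'd) \<times> real => complex"
 assumes al: "al > -1/2" and \<eta>: "integrable (wmeas al) \<eta>" and M: "!!x. cmod (\<eta> x) <= M"
  and f: "f \<in> borel_measurable borel" and fn: "!!n. fn n \<in> borel_measurable borel"
  and g: "g \<in> borel_measurable borel" "integrable (wmeas al) (%x. cmod (g x) powr p)" "p >= 1"
  and lim: "AE x in wmeas al. (%n. fn n x) \<longlonglongrightarrow> f x" and le: "!!n x. cmod (fn n x) <= cmod (g x)"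
 shows "(%n. wcorr al (fn n) \<eta> x) \<longlonglongrightarrow> wcorr al f \<eta> x"
proof -
 interpret A: prob_space "angle_measure al" by (rule prob_space_angle_measure[OF al])
 have [measurable]: "\<eta> \<in> borel_measurable borel" using borel_measurable_integrable[OF \<eta>] by simp
 note [measurable] = f fn
 show ?thesis unfolding wcorr_def
 proof (rule integral_dominated_convergence[OF _ _ integrable_mult_weinstein_translate[OF al \<eta> M g]])
  show "AE y in wmeas al. (%n. fn n y * cnj (LINT th|angle_measure al. \<eta> (wconv x y th)))
   \<longlonglongrightarrow> f y * cnj (LINT th|angle_measure al. \<eta> (wconv x y th))"
   using lim by eventually_elim (intro tendsto_intros)
  show "AE y in wmeas al. norm (fn n y * cnj (LINT th|angle_measure al. \<eta> (wconv x y th)))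
   <= cmod (g y) * cmod (LINT th|angle_measure al. \<eta> (wconv x y th))" for n
   by (intro AE_I2) (simp add: norm_mult mult_right_mono le)
 qed measurable
qed

lemma norm_wcorr_le_bounded:
 fixes f \<eta> :: "(real ^ 'd) \<times> real => complex"
 assumes al: "al > -1/2" and \<eta>: "integrable (wmeas al) \<eta>" and N: "AE x in wmeas al. cmod (f x) <= N" "N >= 0"
 shows "cmod (wcorr al f \<eta> x) <= N * (LINT y|wmeas al. cmod (\<eta> y))"
proof -
 have "cmod (wcorr al f \<eta> x) <= (LINT y|wmeas al. N * cmod (LINT th|angle_measure al. \<eta> (wconv x y th)))"
  unfolding wcorr_def
 proof (rule norm_integral_le_AE)
  show "integrable (wmeas al) (%y. N * cmod (LINT th|angle_measure al. \<eta> (wconv x y th)))"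
   by (intro integrable_mult_right integrable_norm integrable_weinstein_translate al \<eta>)
  show "AE y in wmeas al. cmod (f y * cnj (LINT th|angle_measure al. \<eta> (wconv x y th))) <= N * cmod (LINT th|angle_measure al. \<eta> (wconv x y th))"
   using N(1) by eventually_elim (simp add: norm_mult mult_right_mono)
 qed
 also have "... <= N * (LINT y|wmeas al. cmod (\<eta> y))"
  using integral_norm_weinstein_translate_le[OF al \<eta>] N(2) by (simp add: mult_left_mono)
 finally show ?thesis .
qed

lemma borel_measurable_wcorr_dilation:
 fixes f \<phi> :: "(real ^ 'd) \<times> real => complex"
 assumes al: "al > -1/2" and [measurable]: "f \<in> borel_measurable borel" "\<phi> \<in> borel_measurable borel"
 shows "(%w. wcorr al f (weinstein_dilation al (fst w) \<phi>) (snd w)) \<in> borel_measurable (borel \<Otimes>\<^sub>M borel)"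
proof -
 interpret A: prob_space "angle_measure al" by (rule prob_space_angle_measure[OF al])
 show ?thesis unfolding wcorr_def by measurable
qed

text \<open>A measurable function is almost everywhere a limit of continuous ones. Composition with
  the projection onto the disc of radius k enforces the bound without disturbing the limit, because
  the projection is continuous and fixes the values of f.\<close>

lemma continuous_approximation_AE:
 fixes f :: "'a::euclidean_space => complex"
 assumes f: "f \<in> borel_measurable borel" and k: "!!x. cmod (f x) <= k"
 obtains g where "!!n::nat. continuous_on UNIV (g n)" "!!n x. cmod (g n x) <= k" "AE x in lborel. (%n. g n x) \<longlonglongrightarrow> f x"
proof -
 have k0: "k >= 0" using order_trans[OF norm_ge_zero k] .
 have "f \<in> borel_measurable lebesgue" using f by (auto intro: measurable_completion)
 then have "f measurable_on UNIV" by (intro lebesgue_measurable_imp_measurable_on) auto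
 then obtain N g where N: "negligible N" and g: "!!n. continuous_on UNIV (g n)" "!!x. x \<notin> N ==> (%n. g n x) \<longlonglongrightarrow> f x"
  unfolding measurable_on_def by auto
 define P where "P = closest_point (cball (0::complex) k)"
 have P: "continuous_on UNIV P" unfolding P_def using k0 by (intro continuous_on_closest_point) auto
 have Pk: "cmod (P z) <= k" for z
  using closest_point_in_set[of "cball (0::complex) k" z] k0 by (simp add: P_def)
 have Pf: "P (f x) = f x" for x unfolding P_def using k by (intro closest_point_self) simp
 obtain N' where N': "N' \<in> null_sets lborel" "N \<subseteq> N'"
  using N unfolding negligible_iff_null_sets null_sets_completion_iff2 by auto
 show thesis
 proof (rule that)
  show "continuous_on UNIV (%x. P (g n x))" for n
   using continuous_on_compose2[OF P g(1)] by auto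
  show "cmod (P (g n x)) <= k" for n x by (rule Pk)
  show "AE x in lborel. (%n. P (g n x)) \<longlonglongrightarrow> f x"
   using AE_not_in[OF N'(1)]
  proof eventually_elim
   fix x assume "x \<notin> N'"
   then have "(%n. g n x) \<longlonglongrightarrow> f x" using N' g by blast
   then have "(%n. P (g n x)) \<longlonglongrightarrow> P (f x)" using P by (auto intro: continuous_on_tendsto_compose)
   then show "(%n. P (g n x)) \<longlonglongrightarrow> f x" unfolding Pf .
  qed
 qed
qed

text \<open>The Haar measure da/a of the multiplicative group, in which admissibility is
  formulated.\<close>

definition log_measure :: "real measure" where
 "log_measure = density lborel (%a. ennreal (1 / a) * indicator {0<..} a)"

lemma sets_log_measure [simp, measurable_cong]: "sets log_measure = sets borel"
 and space_log_measure [simp]: "space log_measure = UNIV"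
 by (simp_all add: log_measure_def)

lemma nn_integral_log_measure:
 assumes [measurable]: "f \<in> borel_measurable borel"
 shows "(nn_integral log_measure (%a. f a)) = (\<integral>\<^sup>+a\<in>{0<..}. f a * ennreal (1 / a) \<partial>lborel)"
 unfolding log_measure_def by (subst nn_integral_density) (auto simp: mult_ac intro!: nn_integral_cong)

lemma AE_log_measure_pos: "AE a in log_measure. 0 < a"
 unfolding log_measure_def by (subst AE_density) (auto simp: indicator_def)

lemma sigma_finite_log_measure: "sigma_finite_measure log_measure"
 unfolding log_measure_def
 by (rule sigma_finite_measure.sigma_finite_iff_density_finite[OF lborel.sigma_finite_measure_axioms, THEN iffD2])
  (auto simp: indicator_def)

interpretation L: sigma_finite_measure log_measure
 by (rule sigma_finite_log_measure)

text \<open>Plancherel in x at each scale, Tonelli, admissibility in the scale at each frequency,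
  and Plancherel for f. Plancherel is used once for the correlations and once for f, so that its
  constant stands on both sides and can be cancelled.\<close>

lemma square_function_continuous:
 fixes f \<phi> :: "(real ^ 'd) \<times> real => complex"
 assumes al: "al > -1/2" and \<phi>: "integrable (wmeas al) \<phi>" and M: "!!x. cmod (\<phi> x) <= M"
  and c: "AE xi in wmeas al. (\<integral>\<^sup>+ a\<in>{0<..}. ennreal ((cmod (weinstein_transform al \<phi> (a *\<^sub>R xi)))\<^sup>2 / a) \<partial>lborel) = ennreal c"
  and f: "integrable (wmeas al) f" and fc: "continuous_on UNIV f" and N: "!!x. cmod (f x) <= N"
 shows "(nn_integral log_measure (%a. nn_integral (wmeas al) (%x. ennreal ((cmod (wcorr al f (weinstein_dilation al a \<phi>) x))\<^sup>2))))
  <= ennreal c * (nn_integral (wmeas al) (%x. ennreal ((cmod (f x))\<^sup>2)))"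
proof -
 let ?m = "wmeas al :: ((real ^ 'd) \<times> real) measure"
 let ?F = "weinstein_transform al :: _ => (real ^ 'd) \<times> real => complex"
 define C where "C = wconst al CARD('d)"
 have C: "C > 0" unfolding C_def by (rule wconst_pos[OF al])
 interpret LW: pair_sigma_finite log_measure ?m ..
 have [measurable]: "f \<in> borel_measurable borel" "\<phi> \<in> borel_measurable borel"
  using borel_measurable_integrable[OF f] borel_measurable_integrable[OF \<phi>] by simp_all
 have [measurable]: "?F f \<in> borel_measurable borel" "?F \<phi> \<in> borel_measurable borel"
  by (intro borel_measurable_weinstein_transform al f \<phi>)+
 define S where "S = (%a. wcorr al f (weinstein_dilation al a \<phi>))"
 have [measurable]: "(%w. S (fst w) (snd w)) \<in> borel_measurable (log_measure \<Otimes>\<^sub>M ?m)"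
  unfolding S_def using borel_measurable_wcorr_dilation[OF al, of f \<phi>] by measurable
 have "ennreal C * (nn_integral log_measure (%a. nn_integral ?m (%x. ennreal ((cmod (S a x))\<^sup>2))))
  = (nn_integral log_measure (%a. ennreal C * (nn_integral ?m (%x. ennreal ((cmod (S a x))\<^sup>2)))))"
 proof (rule nn_integral_cmult[symmetric])
  have "(%w. ennreal ((cmod (S (fst w) (snd w)))\<^sup>2)) \<in> borel_measurable (log_measure \<Otimes>\<^sub>M ?m)" by measurable
  from W.borel_measurable_nn_integral_fst[OF this]
  show "(%a. nn_integral ?m (%x. ennreal ((cmod (S a x))\<^sup>2))) \<in> borel_measurable log_measure" by simp
 qed
 also have "... <= (nn_integral log_measure (%a. nn_integral ?m (%xi. ennreal ((cmod (?F f xi))\<^sup>2) * ennreal ((cmod (?F \<phi> (a *\<^sub>R xi)))\<^sup>2))))"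
 proof (rule nn_integral_mono_AE)
  show "AE a in log_measure. ennreal C * (nn_integral ?m (%x. ennreal ((cmod (S a x))\<^sup>2)))
   <= (nn_integral ?m (%xi. ennreal ((cmod (?F f xi))\<^sup>2) * ennreal ((cmod (?F \<phi> (a *\<^sub>R xi)))\<^sup>2)))"
   using AE_log_measure_pos
  proof eventually_elim
   fix a :: real assume a: "0 < a"
   note D = integrable_weinstein_dilation[OF al a \<phi>] norm_weinstein_dilation_le[OF M, of al a]
   note cf = wcorr_symmetric[OF al f fc N D] continuous_wcorr[OF al f fc N D] norm_wcorr_le[OF al f fc N D]
    integrable_wcorr[OF al f fc N D] weinstein_transform_corr[OF al f fc N D]
   have "ennreal C * (nn_integral ?m (%x. ennreal ((cmod (S a x))\<^sup>2))) <= (nn_integral ?m (%xi. ennreal ((cmod (?F (S a) xi))\<^sup>2)))"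
    unfolding C_def S_def by (rule eq_refl[OF weinstein_plancherel[OF al cf(4,2,3), symmetric]])
   also have "... = (nn_integral ?m (%xi. ennreal ((cmod (?F f (wreflect xi)))\<^sup>2) * ennreal ((cmod (?F \<phi> (a *\<^sub>R wreflect xi)))\<^sup>2)))"
   proof (rule nn_integral_cong_AE)
    show "AE xi in ?m. ennreal ((cmod (?F (S a) xi))\<^sup>2) = ennreal ((cmod (?F f (wreflect xi)))\<^sup>2) * ennreal ((cmod (?F \<phi> (a *\<^sub>R wreflect xi)))\<^sup>2)"
     using AE_weinstein_measure_pos[of al]
    proof eventually_elim
     fix xi :: "(real ^ 'd) \<times> real" assume "0 < snd xi"
     then show "ennreal ((cmod (?F (S a) xi))\<^sup>2) = ennreal ((cmod (?F f (wreflect xi)))\<^sup>2) * ennreal ((cmod (?F \<phi> (a *\<^sub>R wreflect xi)))\<^sup>2)"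
      unfolding S_def cf(5)[OF \<open>0 < snd xi\<close>] weinstein_transform_dilation[OF al a \<phi>]
      by (simp only: norm_mult complex_mod_cnj power_mult_distrib ennreal_mult zero_le_power2)
    qed
   qed
   also have "... = (nn_integral ?m (%xi. ennreal ((cmod (?F f xi))\<^sup>2) * ennreal ((cmod (?F \<phi> (a *\<^sub>R xi)))\<^sup>2)))"
    by (rule nn_integral_wreflect) measurable
   finally show "ennreal C * (nn_integral ?m (%x. ennreal ((cmod (S a x))\<^sup>2)))
    <= (nn_integral ?m (%xi. ennreal ((cmod (?F f xi))\<^sup>2) * ennreal ((cmod (?F \<phi> (a *\<^sub>R xi)))\<^sup>2)))" .
  qed
 qed
 also have "... = (nn_integral ?m (%xi. nn_integral log_measure (%a. ennreal ((cmod (?F f xi))\<^sup>2) * ennreal ((cmod (?F \<phi> (a *\<^sub>R xi)))\<^sup>2))))"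
  by (rule LW.Fubini'[symmetric]) measurable
 also have "... = (nn_integral ?m (%xi. ennreal ((cmod (?F f xi))\<^sup>2) * ennreal c))"
 proof (rule nn_integral_cong_AE)
  show "AE xi in ?m. (nn_integral log_measure (%a. ennreal ((cmod (?F f xi))\<^sup>2) * ennreal ((cmod (?F \<phi> (a *\<^sub>R xi)))\<^sup>2))) = ennreal ((cmod (?F f xi))\<^sup>2) * ennreal c"
   using c
  proof eventually_elim
   fix xi :: "(real ^ 'd) \<times> real"
   assume e: "(\<integral>\<^sup>+ a\<in>{0<..}. ennreal ((cmod (?F \<phi> (a *\<^sub>R xi)))\<^sup>2 / a) \<partial>lborel) = ennreal c"
   have "(nn_integral log_measure (%a. ennreal ((cmod (?F \<phi> (a *\<^sub>R xi)))\<^sup>2))) = (\<integral>\<^sup>+ a\<in>{0<..}. ennreal ((cmod (?F \<phi> (a *\<^sub>R xi)))\<^sup>2 / a) \<partial>lborel)"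
    by (subst nn_integral_log_measure) (auto simp: indicator_def ennreal_mult[symmetric] intro!: nn_integral_cong)
   then show "(nn_integral log_measure (%a. ennreal ((cmod (?F f xi))\<^sup>2) * ennreal ((cmod (?F \<phi> (a *\<^sub>R xi)))\<^sup>2))) = ennreal ((cmod (?F f xi))\<^sup>2) * ennreal c"
    unfolding e by (simp add: nn_integral_cmult)
  qed
 qed
 also have "... = (nn_integral ?m (%xi. ennreal ((cmod (?F f xi))\<^sup>2))) * ennreal c"
  by (rule nn_integral_multc) measurable
 also have "... = (ennreal C * (nn_integral ?m (%x. ennreal ((cmod (f x))\<^sup>2)))) * ennreal c"
  unfolding C_def weinstein_plancherel[OF al f fc N] ..
 finally have "ennreal C * (nn_integral log_measure (%a. nn_integral ?m (%x. ennreal ((cmod (S a x))\<^sup>2))))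
  <= ennreal C * (ennreal c * (nn_integral ?m (%x. ennreal ((cmod (f x))\<^sup>2))))" by (simp only: mult_ac)
 then show ?thesis using C unfolding S_def by (subst (asm) ennreal_mult_le_mult_iff) auto
qed

text \<open>Dominated almost everywhere convergence of the functions gives pointwise convergence of
  the correlations at every positive scale, and Fatou does the rest. It is used twice in the
  extension of the estimate to all of L^2.\<close>

lemma square_function_Fatou:
 fixes f g \<phi> :: "(real ^ 'd) \<times> real => complex" and fn :: "nat => (real ^ 'd) \<times> real => complex"
 assumes al: "al > -1/2" and \<phi>: "integrable (wmeas al) \<phi>" and M: "!!x. cmod (\<phi> x) <= M"
  and f: "f \<in> borel_measurable borel" and fn: "!!n. fn n \<in> borel_measurable borel"
  and g: "g \<in> borel_measurable borel" "integrable (wmeas al) (%x. cmod (g x) powr p)" "p >= 1"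
  and lim: "AE x in wmeas al. (%n. fn n x) \<longlonglongrightarrow> f x" and le: "!!n x. cmod (fn n x) <= cmod (g x)"
  and b: "!!n. (nn_integral (log_measure \<Otimes>\<^sub>M wmeas al) (%w. ennreal ((cmod (wcorr al (fn n) (weinstein_dilation al (fst w) \<phi>) (snd w)))\<^sup>2))) <= b n"
  and B: "b \<longlonglongrightarrow> B"
 shows "(nn_integral (log_measure \<Otimes>\<^sub>M wmeas al) (%w. ennreal ((cmod (wcorr al f (weinstein_dilation al (fst w) \<phi>) (snd w)))\<^sup>2))) <= B"
proof -
 let ?m = "wmeas al :: ((real ^ 'd) \<times> real) measure"
 have \<phi>m: "\<phi> \<in> borel_measurable borel" using borel_measurable_integrable[OF \<phi>] by simp
 have sm: "(%w. wcorr al h (weinstein_dilation al (fst w) \<phi>) (snd w)) \<in> borel_measurable (log_measure \<Otimes>\<^sub>M ?m)"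
  if "h \<in> borel_measurable borel" for h :: "(real ^ 'd) \<times> real => complex"
  using borel_measurable_wcorr_dilation[OF al that \<phi>m]
  by (subst measurable_cong_sets[where M'="borel \<Otimes>\<^sub>M borel" and N'=borel]) (auto intro!: sets_pair_measure_cong)
 show ?thesis
 proof (rule nn_integral_le_tendsto[OF _ _ b B])
  show "(%w. ennreal ((cmod (wcorr al (fn n) (weinstein_dilation al (fst w) \<phi>) (snd w)))\<^sup>2)) \<in> borel_measurable (log_measure \<Otimes>\<^sub>M ?m)" for n
   using sm[OF fn[of n]] by measurable
  interpret LW: pair_sigma_finite log_measure ?m ..
  have "AE w in log_measure \<Otimes>\<^sub>M ?m. fst w > 0"
   by (intro LW.AE_pair_measure) (measurable, use AE_log_measure_pos in \<open>auto elim: eventually_mono\<close>)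
  then show "AE w in log_measure \<Otimes>\<^sub>M ?m. (%n. ennreal ((cmod (wcorr al (fn n) (weinstein_dilation al (fst w) \<phi>) (snd w)))\<^sup>2))
   \<longlonglongrightarrow> ennreal ((cmod (wcorr al f (weinstein_dilation al (fst w) \<phi>) (snd w)))\<^sup>2)"
  proof eventually_elim
   fix w :: "real \<times> (real ^ 'd) \<times> real" assume "fst w > 0"
   from wcorr_tendsto[OF al integrable_weinstein_dilation[OF al this \<phi>] norm_weinstein_dilation_le[OF M] f fn g lim le]
   show "(%n. ennreal ((cmod (wcorr al (fn n) (weinstein_dilation al (fst w) \<phi>) (snd w)))\<^sup>2))
    \<longlonglongrightarrow> ennreal ((cmod (wcorr al f (weinstein_dilation al (fst w) \<phi>) (snd w)))\<^sup>2)"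
    by (intro tendsto_intros)
  qed
 qed
qed

text \<open>Three layers: continuous functions below a multiple of a Gaussian E, measurable
  functions below a multiple of E, and general f by cutting where |f| > n E. Since E is bounded,
  integrable, continuous and positive, the first layer meets the assumptions of the continuous case
  and the cuts exhaust f.\<close>

lemma square_function_L2:
 fixes f \<phi> :: "(real ^ 'd) \<times> real => complex"
 assumes al: "al > -1/2" and \<phi>: "integrable (wmeas al) \<phi>" and M: "!!x. cmod (\<phi> x) <= M"
  and c: "AE xi in wmeas al. (\<integral>\<^sup>+ a\<in>{0<..}. ennreal ((cmod (weinstein_transform al \<phi> (a *\<^sub>R xi)))\<^sup>2 / a) \<partial>lborel) = ennreal c"
  and f: "f \<in> borel_measurable borel" and f2: "integrable (wmeas al) (%x. (cmod (f x))\<^sup>2)"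
 shows "(nn_integral (log_measure \<Otimes>\<^sub>M wmeas al) (%w. ennreal ((cmod (wcorr al f (weinstein_dilation al (fst w) \<phi>) (snd w)))\<^sup>2)))
  <= ennreal c * (nn_integral (wmeas al) (%x. ennreal ((cmod (f x))\<^sup>2)))"
proof -
 let ?m = "wmeas al :: ((real ^ 'd) \<times> real) measure"
 have \<phi>m: "\<phi> \<in> borel_measurable borel" using borel_measurable_integrable[OF \<phi>] by simp
 define S where "S h = (%w. wcorr al h (weinstein_dilation al (fst w) \<phi>) (snd w))" for h
 have sm [measurable]: "S h \<in> borel_measurable (log_measure \<Otimes>\<^sub>M ?m)" if "h \<in> borel_measurable borel" for h
  unfolding S_def using borel_measurable_wcorr_dilation[OF al that \<phi>m]
  by (subst measurable_cong_sets[where M'="borel \<Otimes>\<^sub>M borel" and N'=borel]) (auto intro!: sets_pair_measure_cong)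
 define E where "E x = exp (- 1 * (norm x)\<^sup>2)" for x :: "(real ^ 'd) \<times> real"
 have [measurable]: "E \<in> borel_measurable borel" unfolding E_def by measurable
 have E: "E x > 0" "E x <= 1" for x by (simp_all add: E_def)
 have Ec: "continuous_on UNIV E" unfolding E_def by (intro continuous_intros)
 have "integrable ?m (%xi. complex_of_real (E xi))"
  using weinstein_transform_gaussian(1)[OF al, of 1 0] by (simp add: wkernel_0[OF al] E_def)
 then have Ei: "integrable ?m E" by (simp only: complex_of_real_integrable_eq)
 have dom: "integrable ?m (%x. cmod (of_real (k * E x)) powr 2)" for k
 proof (rule integrable_dominated[of ?m "%x. k\<^sup>2 * E x"])
  show "AE x in ?m. norm (cmod (of_real (k * E x)) powr 2) <= norm (k\<^sup>2 * E x)"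
  proof (rule AE_I2)
   fix x
   have "(E x)\<^sup>2 <= E x" using E[of x] by (simp add: power2_eq_square mult_left_le)
   then show "norm (cmod (of_real (k * E x)) powr 2) <= norm (k\<^sup>2 * E x)"
    using E[of x] by (simp only: norm_of_real) (simp add: abs_mult power_mult_distrib mult_left_mono)
  qed
 qed (use Ei in auto)
 have cont: "(nn_integral (log_measure \<Otimes>\<^sub>M ?m) (%w. ennreal ((cmod (S h w))\<^sup>2))) <= ennreal c * (nn_integral ?m (%x. ennreal ((cmod (h x))\<^sup>2)))"
  if h: "continuous_on UNIV h" "!!x. cmod (h x) <= k * E x" for h k
 proof -
  have [measurable]: "h \<in> borel_measurable borel" using h(1) by (rule borel_measurable_continuous_onI)
  have k0: "k >= 0" using order_trans[OF norm_ge_zero h(2)[of 0]] by (simp add: E_def)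
  have hi: "integrable ?m h"
  proof (rule integrable_dominated[of ?m "%x. k * E x"])
   show "AE x in ?m. norm (h x) <= norm (k * E x)" by (intro AE_I2) (auto intro: order_trans[OF h(2) abs_ge_self])
  qed (use Ei in auto)
  have hk: "cmod (h x) <= k" for x using order_trans[OF h(2)] E(2)[of x] k0 by (simp add: mult_left_le)
  have "(%w. ennreal ((cmod (S h w))\<^sup>2)) \<in> borel_measurable (log_measure \<Otimes>\<^sub>M ?m)" by measurable
  from W.nn_integral_fst[OF this, symmetric]
  have "(nn_integral (log_measure \<Otimes>\<^sub>M ?m) (%w. ennreal ((cmod (S h w))\<^sup>2))) = (nn_integral log_measure (%a. nn_integral ?m (%x. ennreal ((cmod (wcorr al h (weinstein_dilation al a \<phi>) x))\<^sup>2))))"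
   by (simp add: S_def)
  then show ?thesis using square_function_continuous[OF al \<phi> M c hi h(1) hk] by simp
 qed
 have bdd: "(nn_integral (log_measure \<Otimes>\<^sub>M ?m) (%w. ennreal ((cmod (S h w))\<^sup>2))) <= ennreal c * (nn_integral ?m (%x. ennreal ((cmod (h x))\<^sup>2)))"
  if h[measurable]: "h \<in> borel_measurable borel" and hk: "!!x. cmod (h x) <= k * E x" for h k
 proof -
  \<comment> \<open>Approximating the bounded quotient h / E and multiplying by E afterwards keeps
    every approximant below k E.\<close>
  have k: "cmod (h x / of_real (E x)) <= k" for x
   using hk[of x] E[of x] by (simp add: norm_divide pos_divide_le_eq)
  have hm: "(%x. h x / of_real (E x)) \<in> borel_measurable borel" by measurable
  obtain g where
   g: "!!n::nat. continuous_on UNIV (g n)" "!!n x. cmod (g n x) <= k" "AE x in lborel. (%n. g n x) \<longlonglongrightarrow> h x / of_real (E x)"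
   by (rule continuous_approximation_AE[OF hm k]) (rule that)
  have [measurable]: "g n \<in> borel_measurable borel" for n using g(1) by (rule borel_measurable_continuous_onI)
  define u where "u n x = g n x * of_real (E x)" for n x
  have [measurable]: "u n \<in> borel_measurable borel" for n unfolding u_def by measurable
  have uk: "cmod (u n x) <= k * E x" for n x using g(2)[of n x] E[of x] by (simp add: u_def norm_mult)
  have uc: "continuous_on UNIV (u n)" for n unfolding u_def by (intro continuous_intros g(1) Ec)
  have ul: "AE x in ?m. (%n. u n x) \<longlonglongrightarrow> h x"
  proof -
   have "AE x in lborel. (%n. u n x) \<longlonglongrightarrow> h x"
    using g(3)
   proof eventually_elim
    fix x assume "(%n. g n x) \<longlonglongrightarrow> h x / of_real (E x)"
    then have "(%n. u n x) \<longlonglongrightarrow> h x / of_real (E x) * of_real (E x)" unfolding u_def by (intro tendsto_intros)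
    then show "(%n. u n x) \<longlonglongrightarrow> h x" using E(1)[of x] by simp
   qed
   then show ?thesis unfolding weinstein_measure_altdef
    by (subst AE_density[OF weinstein_density_measurable[folded borel_measurable_lborel]]) (auto elim: eventually_mono)
  qed
  have bl: "(%n. ennreal c * (nn_integral ?m (%x. ennreal ((cmod (u n x))\<^sup>2)))) \<longlonglongrightarrow> ennreal c * (nn_integral ?m (%x. ennreal ((cmod (h x))\<^sup>2)))"
  proof (intro ennreal_tendsto_cmult nn_integral_dominated_convergence[where w="%x. ennreal (cmod (of_real (k * E x)) powr 2)"])
   show "(nn_integral ?m (%x. ennreal (cmod (of_real (k * E x)) powr 2))) < \<infinity>"
    using dom[of k] by (simp add: nn_integral_eq_integral)
   show "AE x in ?m. ennreal ((cmod (u n x))\<^sup>2) <= ennreal (cmod (of_real (k * E x)) powr 2)" for n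
   proof (intro AE_I2 ennreal_leI)
    fix x
    have "(cmod (u n x))\<^sup>2 <= (k * E x)\<^sup>2" by (intro power_mono uk) simp
    then show "(cmod (u n x))\<^sup>2 <= cmod (of_real (k * E x)) powr 2" by (simp only: norm_of_real) simp
   qed
   show "AE x in ?m. (%n. ennreal ((cmod (u n x))\<^sup>2)) \<longlonglongrightarrow> ennreal ((cmod (h x))\<^sup>2)"
    using ul by eventually_elim (intro tendsto_intros)
  qed simp_all
  show ?thesis unfolding S_def
  proof (rule square_function_Fatou[OF al \<phi> M h _ _ dom[of k] _ ul _ _ bl])
   show "cmod (u n x) <= cmod (complex_of_real (k * E x))" for n x
    using order_trans[OF uk abs_ge_self] by (simp only: norm_of_real)
   show "(nn_integral (log_measure \<Otimes>\<^sub>M ?m) (%w. ennreal ((cmod (wcorr al (u n) (weinstein_dilation al (fst w) \<phi>) (snd w)))\<^sup>2)))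
    <= ennreal c * (nn_integral ?m (%x. ennreal ((cmod (u n x))\<^sup>2)))" for n
    using cont[OF uc uk, of n] unfolding S_def .
  qed simp_all
 qed
 define v where "v n x = (if cmod (f x) <= real n * E x then f x else 0)" for n x
 note [measurable] = f
 have [measurable]: "v n \<in> borel_measurable borel" for n unfolding v_def by measurable
 show ?thesis
 proof (rule square_function_Fatou[OF al \<phi> M f, of v f 2 "%n. ennreal c * (nn_integral ?m (%x. ennreal ((cmod (f x))\<^sup>2)))"])
  show "integrable ?m (%x. cmod (f x) powr 2)" using f2 by simp
  show "AE x in ?m. (%n. v n x) \<longlonglongrightarrow> f x"
  proof (rule AE_I2)
   fix x
   obtain m where m: "cmod (f x) / E x <= real m" using real_arch_simple by blast
   have "eventually (%n. v n x = f x) sequentially"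
   proof (rule eventually_sequentiallyI[of m])
    fix n assume "m <= n"
    then have "cmod (f x) / E x <= real n" using m by simp
    then show "v n x = f x" using E(1)[of x] by (simp add: v_def pos_divide_le_eq)
   qed
   then show "(%n. v n x) \<longlonglongrightarrow> f x" by (rule tendsto_eventually)
  qed
  fix n
  have "(nn_integral (log_measure \<Otimes>\<^sub>M ?m) (%w. ennreal ((cmod (S (v n) w))\<^sup>2))) <= ennreal c * (nn_integral ?m (%x. ennreal ((cmod (v n x))\<^sup>2)))"
   using E(1) by (intro bdd[of "v n" "real n"]) (auto simp: v_def less_imp_le)
  also have "... <= ennreal c * (nn_integral ?m (%x. ennreal ((cmod (f x))\<^sup>2)))"
   by (intro mult_left_mono nn_integral_mono ennreal_leI) (auto simp: v_def)
  finally show "(nn_integral (log_measure \<Otimes>\<^sub>M ?m) (%w. ennreal ((cmod (wcorr al (v n) (weinstein_dilation al (fst w) \<phi>) (snd w)))\<^sup>2)))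
    <= ennreal c * (nn_integral ?m (%x. ennreal ((cmod (f x))\<^sup>2)))" unfolding S_def .
 qed (auto simp: v_def)
qed

section \<open>Marcinkiewicz interpolation for exponents above 2\<close>

lemma nn_integral_powr_Icc:
 fixes b R :: real
 assumes b: "b > -1" and R: "R >= 0"
 shows "(nn_integral lborel (%t. ennreal (t powr b) * indicator {0..R} t)) = ennreal (R powr (b + 1) / (b + 1))"
proof -
 have "((%t. t powr b) has_integral (R powr (b + 1) / (b + 1))) {0..R}"
  using has_integral_powr_from_0[OF b R] .
 from nn_integral_has_integral_lebesgue[OF _ this]
 have "(nn_integral lborel (%t. ennreal (indicator {0..R} t * t powr b))) = ennreal (R powr (b + 1) / (b + 1))" by simp
 also have "(%t. ennreal (indicator {0..R} t * t powr b)) = (%t. ennreal (t powr b) * indicator {0..R} t)"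
  by (auto simp: indicator_def)
 finally show ?thesis .
qed

text \<open>Tonelli for u^(b+1) / (b+1) written as the integral of t^b over [0, u]. The weight h
  allows two uses: with h = 1 for the distribution function of the square function, and with h =
  |f|^2 for the truncated second moments of f.\<close>

lemma nn_integral_layer_cake:
 fixes u :: "'a => real" and b :: real
 assumes M: "sigma_finite_measure M" and b: "b > -1" and u[measurable]: "u \<in> borel_measurable M" and u0: "!!x. 0 <= u x"
  and h[measurable]: "h \<in> borel_measurable M"
 shows "(nn_integral M (%x. h x * ennreal (u x powr (b + 1) / (b + 1))))
  = (\<integral>\<^sup>+t\<in>{0..}. ennreal (t powr b) * (nn_integral M (%x. h x * indicator {x. t <= u x} x)) \<partial>lborel)"
proof -
 interpret M: sigma_finite_measure M by (rule M)
 interpret P: pair_sigma_finite lborel M ..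
 have "(nn_integral M (%x. h x * ennreal (u x powr (b + 1) / (b + 1))))
  = (nn_integral M (%x. nn_integral lborel (%t. h x * (ennreal (t powr b) * indicator {0..} t * (if t <= u x then 1 else 0)))))"
 proof (rule nn_integral_cong)
  fix x
  have "(nn_integral lborel (%t. h x * (ennreal (t powr b) * indicator {0..} t * (if t <= u x then 1 else 0))))
   = h x * (nn_integral lborel (%t. ennreal (t powr b) * indicator {0..u x} t))"
   by (subst nn_integral_cmult[symmetric]) (auto intro!: nn_integral_cong simp: indicator_def)
  then show "h x * ennreal (u x powr (b + 1) / (b + 1)) = (nn_integral lborel (%t. h x * (ennreal (t powr b) * indicator {0..} t * (if t <= u x then 1 else 0))))"
   unfolding nn_integral_powr_Icc[OF b u0] by simp
 qed
 also have "... = (nn_integral lborel (%t. nn_integral M (%x. h x * (ennreal (t powr b) * indicator {0..} t * (if t <= u x then 1 else 0)))))"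
  by (rule P.Fubini') measurable
 also have "... = (\<integral>\<^sup>+t\<in>{0..}. ennreal (t powr b) * (nn_integral M (%x. h x * indicator {x. t <= u x} x)) \<partial>lborel)"
 proof (rule nn_integral_cong)
  fix t :: real
  have "(nn_integral M (%x. h x * (ennreal (t powr b) * indicator {0..} t * (if t <= u x then 1 else 0))))
   = (nn_integral M (%x. (ennreal (t powr b) * indicator {0..} t) * (h x * (if t <= u x then 1 else 0))))"
   by (simp only: mult_ac)
  also have "... = (ennreal (t powr b) * indicator {0..} t) * (nn_integral M (%x. h x * (if t <= u x then 1 else 0)))"
   by (rule nn_integral_cmult) measurable
  finally show "(nn_integral M (%x. h x * (ennreal (t powr b) * indicator {0..} t * (if t <= u x then 1 else 0))))
   = ennreal (t powr b) * (nn_integral M (%x. h x * indicator {x. t <= u x} x)) * indicator {0..} t"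
   by (simp add: indicator_def of_bool_def mult_ac)
 qed
 finally show ?thesis .
qed

lemma wcorr_add:
 fixes f g \<eta> :: "(real ^ 'd) \<times> real => complex"
 assumes al: "al > -1/2" and \<eta>: "integrable (wmeas al) \<eta>" and M: "!!x. cmod (\<eta> x) <= M"
  and f: "f \<in> borel_measurable borel" "integrable (wmeas al) (%x. cmod (f x) powr p)" "p >= 1"
  and g: "g \<in> borel_measurable borel" "integrable (wmeas al) (%x. cmod (g x) powr q)" "q >= 1"
 shows "wcorr al (%y. f y + g y) \<eta> x = wcorr al f \<eta> x + wcorr al g \<eta> x"
proof -
 interpret A: prob_space "angle_measure al" by (rule prob_space_angle_measure[OF al])
 have [measurable]: "\<eta> \<in> borel_measurable borel" using borel_measurable_integrable[OF \<eta>] by simp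
 have i: "integrable (wmeas al) (%y. h y * cnj (LINT th|angle_measure al. \<eta> (wconv x y th)))"
  if [measurable]: "h \<in> borel_measurable borel" and h: "integrable (wmeas al) (%x. cmod (h x) powr r)" "r >= 1" for h r
  by (rule integrable_dominated[OF integrable_mult_weinstein_translate[OF al \<eta> M that]])
   (auto simp: norm_mult)
 show ?thesis unfolding wcorr_def distrib_right
  by (rule Bochner_Integration.integral_add[OF i[OF f] i[OF g]])
qed

text \<open>Marcinkiewicz interpolation between the L^2 estimate and the sup bound. For the level t
  the function is split at height t / B: the small part contributes at most t / 2, so the level set
  is controlled by the L^2 estimate for the large part. Integration over t gives the p-th powers,
  with a constant that blows up as p -> 2.\<close>

lemma square_function_Lp:
 fixes f \<phi> :: "(real ^ 'd) \<times> real => complex"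
 assumes al: "al > -1/2" and \<phi>: "integrable (wmeas al) \<phi>" and M: "!!x. cmod (\<phi> x) <= M"
  and c: "AE xi in wmeas al. (\<integral>\<^sup>+ a\<in>{0<..}. ennreal ((cmod (weinstein_transform al \<phi> (a *\<^sub>R xi)))\<^sup>2 / a) \<partial>lborel) = ennreal c" "c >= 0"
  and p: "p > 2" and f: "f \<in> borel_measurable borel" and fp: "integrable (wmeas al) (%x. cmod (f x) powr p)"
 shows "(nn_integral (log_measure \<Otimes>\<^sub>M wmeas al) (%w. ennreal (cmod (wcorr al f (weinstein_dilation al (fst w) \<phi>) (snd w)) powr p)))
  <= ennreal (p * (4 * c) * (2 * ((LINT x|wmeas al. cmod (\<phi> x)) + 1)) powr (p - 2) / (p - 2)) * (nn_integral (wmeas al) (%x. ennreal (cmod (f x) powr p)))"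
proof -
 let ?m = "wmeas al :: ((real ^ 'd) \<times> real) measure"
 interpret LW: pair_sigma_finite log_measure ?m ..
 let ?Y = "log_measure \<Otimes>\<^sub>M ?m"
 have Y: "sigma_finite_measure ?Y" by unfold_locales
 have \<phi>m: "\<phi> \<in> borel_measurable borel" using borel_measurable_integrable[OF \<phi>] by simp
 define S where "S h = (%w. wcorr al h (weinstein_dilation al (fst w) \<phi>) (snd w))" for h
 have sm [measurable]: "S h \<in> borel_measurable ?Y" if "h \<in> borel_measurable borel" for h
  unfolding S_def using borel_measurable_wcorr_dilation[OF al that \<phi>m]
  by (subst measurable_cong_sets[where M'="borel \<Otimes>\<^sub>M borel" and N'=borel]) (auto intro!: sets_pair_measure_cong)
 note [measurable] = f
 define A where "A = (LINT x|?m. cmod (\<phi> x))"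
 have A0: "A >= 0" unfolding A_def by (intro integral_nonneg_AE) auto
 \<comment> \<open>The correlation of a function bounded by t / B is at most (t / B) A <= t / 2; the
   + 1 keeps B positive also when A = 0.\<close>
 define B where "B = 2 * (A + 1)"
 have B0: "B > 0" unfolding B_def using A0 by simp
 have pos: "AE w in ?Y. fst w > 0"
  by (intro LW.AE_pair_measure) (measurable, use AE_log_measure_pos in \<open>auto elim: eventually_mono\<close>)
 have level: "(nn_integral ?Y (%w. 1 * indicator {w. t <= cmod (S f w)} w)) <= ennreal (4 * c / t\<^sup>2) * (nn_integral ?m (%x. ennreal ((cmod (f x))\<^sup>2) * indicator {x. t <= B * cmod (f x)} x))"
  if t: "t > 0" for t
 proof -
  define f1 where "f1 x = (if t <= B * cmod (f x) then f x else 0)" for x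
  define f2 where "f2 x = (if t <= B * cmod (f x) then 0 else f x)" for x
  have f1m [measurable]: "f1 \<in> borel_measurable borel" unfolding f1_def by measurable
  have f2m [measurable]: "f2 \<in> borel_measurable borel" unfolding f2_def by measurable
  have f12: "f = (%x. f1 x + f2 x)" by (auto simp: f1_def f2_def)
  have f1p: "integrable ?m (%x. cmod (f1 x) powr p)" and f2p: "integrable ?m (%x. cmod (f2 x) powr p)"
   by (rule integrable_dominated[OF fp]; auto simp: f1_def f2_def intro!: AE_I2)+
  \<comment> \<open>Where f1 does not vanish, |f| is at least t / B, and since p > 2 this bounds
    |f|^2 by a constant times |f|^p.\<close>
  have f1s: "integrable ?m (%x. (cmod (f1 x))\<^sup>2)"
  proof (rule integrable_dominated)
   show "integrable ?m (%x. (t / B) powr (2 - p) * cmod (f x) powr p)" using fp by simp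
   show "AE x in ?m. norm ((cmod (f1 x))\<^sup>2) <= norm ((t / B) powr (2 - p) * cmod (f x) powr p)"
   proof (rule AE_I2)
    fix x
    show "norm ((cmod (f1 x))\<^sup>2) <= norm ((t / B) powr (2 - p) * cmod (f x) powr p)"
    proof (cases "t <= B * cmod (f x)")
     case True
     then have tb: "t / B <= cmod (f x)" using B0 by (simp add: pos_divide_le_eq mult.commute)
     have tb0: "t / B > 0" using t B0 by simp
     have "cmod (f x) powr (2 - p) <= (t / B) powr (2 - p)" using p tb tb0 by (intro powr_mono2') auto
     then have "cmod (f x) powr (2 - p) * cmod (f x) powr p <= (t / B) powr (2 - p) * cmod (f x) powr p"
      by (intro mult_right_mono) auto
     moreover have "cmod (f x) powr (2 - p) * cmod (f x) powr p = (cmod (f x))\<^sup>2"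
      using tb tb0 by (simp add: powr_add[symmetric])
     ultimately show ?thesis by (simp add: f1_def True)
    qed (simp add: f1_def)
   qed
  qed measurable
  \<comment> \<open>Chebyshev's inequality in pointwise form: on the level set the large part must
    contribute at least t / 2.\<close>
  have pt: "AE w in ?Y. 1 * indicator {w. t <= cmod (S f w)} w <= ennreal (4 / t\<^sup>2) * ennreal ((cmod (S f1 w))\<^sup>2)"
   using pos
  proof eventually_elim
   fix w :: "real \<times> (real ^ 'd) \<times> real" assume a: "fst w > 0"
   note D = integrable_weinstein_dilation[OF al a \<phi>]
   show "1 * indicator {w. t <= cmod (S f w)} w <= ennreal (4 / t\<^sup>2) * ennreal ((cmod (S f1 w))\<^sup>2)"
   proof (cases "t <= cmod (S f w)")
    case True
    have p1: "p >= 1" using p by simp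
    have "S f w = S f1 w + S f2 w"
     unfolding S_def by (subst f12) (rule wcorr_add[OF al D norm_weinstein_dilation_le[OF M] f1m f1p p1 f2m f2p p1])
    moreover have "cmod (S f2 w) <= t / 2"
    proof -
     have "cmod (S f2 w) <= t / B * A"
      unfolding S_def A_def integral_norm_weinstein_dilation[OF al a \<phi>, symmetric]
     proof (rule norm_wcorr_le_bounded[OF al D])
      show "AE x in ?m. cmod (f2 x) <= t / B"
       using t B0 by (intro AE_I2) (auto simp: f2_def pos_le_divide_eq mult.commute)
     qed (use t B0 in simp)
     also have "t / B * A <= t / B * (B / 2)" using t B0 by (intro mult_left_mono) (auto simp: B_def)
     also have "... = t / 2" using B0 by simp
     finally show ?thesis .
    qed
    ultimately have "t / 2 <= cmod (S f1 w)" using True norm_triangle_ineq[of "S f1 w" "S f2 w"] by simp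
    then have "(t / 2)\<^sup>2 <= (cmod (S f1 w))\<^sup>2" using t by (intro power_mono) auto
    then have "1 <= 4 / t\<^sup>2 * (cmod (S f1 w))\<^sup>2" using t by (simp add: power_divide pos_le_divide_eq)
    then have "ennreal 1 <= ennreal (4 / t\<^sup>2 * (cmod (S f1 w))\<^sup>2)" by (rule ennreal_leI)
    then show ?thesis using True by (simp add: ennreal_mult[symmetric])
   qed simp
  qed
  have "(nn_integral ?Y (%w. 1 * indicator {w. t <= cmod (S f w)} w)) <= (nn_integral ?Y (%w. ennreal (4 / t\<^sup>2) * ennreal ((cmod (S f1 w))\<^sup>2)))"
   by (rule nn_integral_mono_AE[OF pt])
  also have "... = ennreal (4 / t\<^sup>2) * (nn_integral ?Y (%w. ennreal ((cmod (S f1 w))\<^sup>2)))"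
   by (rule nn_integral_cmult) measurable
  also have "... <= ennreal (4 / t\<^sup>2) * (ennreal c * (nn_integral ?m (%x. ennreal ((cmod (f1 x))\<^sup>2))))"
   unfolding S_def by (intro mult_left_mono square_function_L2[OF al \<phi> M c(1) f1m f1s]) simp
  also have "(nn_integral ?m (%x. ennreal ((cmod (f1 x))\<^sup>2))) = (nn_integral ?m (%x. ennreal ((cmod (f x))\<^sup>2) * indicator {x. t <= B * cmod (f x)} x))"
   by (intro nn_integral_cong) (auto simp: f1_def)
  also have "ennreal (4 / t\<^sup>2) * (ennreal c * ...) = ennreal (4 * c / t\<^sup>2) * ..."
   using c(2) by (simp add: mult.assoc[symmetric] ennreal_mult[symmetric])
  finally show ?thesis .
 qed
 have eqp: "(nn_integral ?Y (%w. ennreal (cmod (S f w) powr p))) = ennreal p * (nn_integral ?Y (%w. 1 * ennreal (cmod (S f w) powr ((p - 1) + 1) / ((p - 1) + 1))))"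
  using p by (subst nn_integral_cmult[symmetric]) (auto simp: ennreal_mult[symmetric])
 have "(nn_integral ?Y (%w. 1 * ennreal (cmod (S f w) powr ((p - 1) + 1) / ((p - 1) + 1))))
  = (\<integral>\<^sup>+t\<in>{0..}. ennreal (t powr (p - 1)) * (nn_integral ?Y (%w. 1 * indicator {w. t <= cmod (S f w)} w)) \<partial>lborel)"
  using p by (intro nn_integral_layer_cake[OF Y, of "p - 1" "%w. cmod (S f w)" "%_. 1"]) auto
 also have "... <= (nn_integral lborel (%t. ennreal (4 * c) * (ennreal (t powr (p - 3)) * (nn_integral ?m (%x. ennreal ((cmod (f x))\<^sup>2) * indicator {x. t <= B * cmod (f x)} x)) * indicator {0..} t)))"
 proof (rule nn_integral_mono)
  fix t :: real
  consider "t < 0" | "t = 0" | "t > 0" by linarith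
  then show "ennreal (t powr (p - 1)) * (nn_integral ?Y (%w. 1 * indicator {w. t <= cmod (S f w)} w)) * indicator {0..} t
   <= ennreal (4 * c) * (ennreal (t powr (p - 3)) * (nn_integral ?m (%x. ennreal ((cmod (f x))\<^sup>2) * indicator {x. t <= B * cmod (f x)} x)) * indicator {0..} t)"
  proof cases
   case 3
   define J where "J = (nn_integral ?m (%x. ennreal ((cmod (f x))\<^sup>2) * indicator {x. t <= B * cmod (f x)} x))"
   have e: "t powr (p - 1) * (4 * c / t\<^sup>2) = 4 * c * t powr (p - 3)"
   proof -
    have "t powr (p - 1) = t powr (p - 3) * t\<^sup>2" using 3 powr_add[of t "p - 3" 2] by simp
    then show ?thesis using 3 by simp
   qed
   have "ennreal (t powr (p - 1)) * (nn_integral ?Y (%w. 1 * indicator {w. t <= cmod (S f w)} w)) <= ennreal (t powr (p - 1)) * (ennreal (4 * c / t\<^sup>2) * J)"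
    unfolding J_def by (intro mult_left_mono level 3) simp
   also have "... = ennreal (4 * c * t powr (p - 3)) * J"
    unfolding e[symmetric] mult.assoc[symmetric] using c(2) by (simp only: ennreal_mult[symmetric] powr_ge_zero divide_nonneg_nonneg mult_nonneg_nonneg zero_le_numeral zero_le_power2 mult.assoc)
   also have "... = ennreal (4 * c) * (ennreal (t powr (p - 3)) * J)"
    using c(2) by (simp add: ennreal_mult mult.assoc)
   finally show ?thesis using 3 by (simp add: J_def)
  qed (use p in auto)
 qed
 also have "... = ennreal (4 * c) * (\<integral>\<^sup>+t\<in>{0..}. ennreal (t powr (p - 3)) * (nn_integral ?m (%x. ennreal ((cmod (f x))\<^sup>2) * indicator {x. t <= B * cmod (f x)} x)) \<partial>lborel)"
 proof (rule nn_integral_cmult)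
  have "(%w. ennreal ((cmod (f (snd w)))\<^sup>2) * (if fst w <= B * cmod (f (snd w)) then 1 else 0)) \<in> borel_measurable (lborel \<Otimes>\<^sub>M ?m)" by measurable
  from W.borel_measurable_nn_integral_fst[OF this]
  have [measurable]: "(%t. nn_integral ?m (%x. ennreal ((cmod (f x))\<^sup>2) * indicator {x. t <= B * cmod (f x)} x)) \<in> borel_measurable lborel"
   by (simp add: indicator_def of_bool_def)
  show "(%t. ennreal (t powr (p - 3)) * (nn_integral ?m (%x. ennreal ((cmod (f x))\<^sup>2) * indicator {x. t <= B * cmod (f x)} x)) * indicator {0..} t) \<in> borel_measurable lborel"
   by measurable
 qed
 finally have le: "(nn_integral ?Y (%w. 1 * ennreal (cmod (S f w) powr ((p - 1) + 1) / ((p - 1) + 1))))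
  <= ennreal (4 * c) * (\<integral>\<^sup>+t\<in>{0..}. ennreal (t powr (p - 3)) * (nn_integral ?m (%x. ennreal ((cmod (f x))\<^sup>2) * indicator {x. t <= B * cmod (f x)} x)) \<partial>lborel)" .
 \<comment> \<open>The level bound has lowered the exponent p - 1 by 2. The remaining t-integral is
   a layer cake read backwards; its exponent p - 3 exceeds -1 exactly when p > 2, and it produces
   the factor 1 / (p - 2).\<close>
 have "(\<integral>\<^sup>+t\<in>{0..}. ennreal (t powr (p - 3)) * (nn_integral ?m (%x. ennreal ((cmod (f x))\<^sup>2) * indicator {x. t <= B * cmod (f x)} x)) \<partial>lborel)
  = (nn_integral ?m (%x. ennreal ((cmod (f x))\<^sup>2) * ennreal ((B * cmod (f x)) powr ((p - 3) + 1) / ((p - 3) + 1))))"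
  using p B0 by (intro nn_integral_layer_cake[OF sigma_finite_weinstein_measure, where b="p - 3" and u="%x. B * cmod (f x)" and h="%x. ennreal ((cmod (f x))\<^sup>2)", symmetric]) auto
 also have "... = (nn_integral ?m (%x. ennreal (B powr (p - 2) / (p - 2)) * ennreal (cmod (f x) powr p)))"
 proof (rule nn_integral_cong)
  fix x
  have "cmod (f x) powr p = (cmod (f x))\<^sup>2 * cmod (f x) powr (p - 2)"
  proof (cases "f x = 0")
   case False
   then show ?thesis using powr_add[of "cmod (f x)" 2 "p - 2"] by simp
  qed simp
  then have "(cmod (f x))\<^sup>2 * ((B * cmod (f x)) powr (p - 2) / (p - 2)) = B powr (p - 2) / (p - 2) * cmod (f x) powr p"
   using B0 by (simp add: powr_mult)
  then show "ennreal ((cmod (f x))\<^sup>2) * ennreal ((B * cmod (f x)) powr ((p - 3) + 1) / ((p - 3) + 1)) = ennreal (B powr (p - 2) / (p - 2)) * ennreal (cmod (f x) powr p)"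
   using p by (simp add: ennreal_mult[symmetric])
 qed
 also have "... = ennreal (B powr (p - 2) / (p - 2)) * (nn_integral ?m (%x. ennreal (cmod (f x) powr p)))"
  by (rule nn_integral_cmult) measurable
 finally have "(nn_integral ?Y (%w. ennreal (cmod (S f w) powr p)))
  <= ennreal p * (ennreal (4 * c) * (ennreal (B powr (p - 2) / (p - 2)) * (nn_integral ?m (%x. ennreal (cmod (f x) powr p)))))"
  using mult_left_mono[OF le, of "ennreal p"] unfolding eqp by simp
 also have "... = ennreal (p * (4 * c) * B powr (p - 2) / (p - 2)) * (nn_integral ?m (%x. ennreal (cmod (f x) powr p)))"
  using p c(2) by (simp add: ennreal_mult[symmetric] mult.assoc[symmetric])
 finally show ?thesis unfolding S_def B_def A_def .
qed

section \<open>Mapping properties of the wavelet transform\<close>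

lemma sets_weinstein_measure_X [simp, measurable_cong]:
 "sets (weinstein_measure_X al :: (real \<times> (real ^ 'd) \<times> real) measure) = sets (borel \<Otimes>\<^sub>M borel)"
 unfolding weinstein_measure_X_def by (intro sets_pair_measure_cong) auto

lemma sigma_finite_weinstein_measure_X:
 "sigma_finite_measure (weinstein_measure_X al :: (real \<times> (real ^ 'd) \<times> real) measure)"
proof -
 have "sigma_finite_measure (density lborel (%a::real. ennreal (1 / a powr (2 * al + real CARD('d) + 3)) * indicator {0<..} a))"
  by (rule sigma_finite_measure.sigma_finite_iff_density_finite[OF lborel.sigma_finite_measure_axioms, THEN iffD2])
   (auto simp: indicator_def)
 then show ?thesis unfolding weinstein_measure_X_def
  by (intro sigma_finite_pair_measure sigma_finite_weinstein_measure)
qed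

text \<open>Separates the measure on the space of scales and points into da/a and the weight a^(-2s)
  with s = al + 1 + d/2. At p = 2 this weight is compensated by the factor a^s in the wavelet
  transform.\<close>

lemma nn_integral_weinstein_measure_X:
 fixes F :: "real \<times> (real ^ 'd) \<times> real => ennreal"
 assumes [measurable]: "F \<in> borel_measurable (borel \<Otimes>\<^sub>M borel)"
 shows "(\<integral>\<^sup>+w. F w \<partial>weinstein_measure_X al)
  = (nn_integral (log_measure \<Otimes>\<^sub>M wmeas al) (%w. ennreal (fst w powr (- (2 * al + real CARD('d) + 2))) * F w))"
proof -
 let ?m = "wmeas al :: ((real ^ 'd) \<times> real) measure"
 let ?d = "%a::real. ennreal (1 / a powr (2 * al + real CARD('d) + 3)) * indicator {0<..} a"
 have Fm: "F \<in> borel_measurable (density lborel ?d \<Otimes>\<^sub>M ?m)" "(%w. ennreal (fst w powr (- (2 * al + real CARD('d) + 2))) * F w) \<in> borel_measurable (log_measure \<Otimes>\<^sub>M ?m)"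
  by measurable
 have I: "(%a. nn_integral ?m (%x. F (a, x))) \<in> borel_measurable borel" by measurable
 have Im: "(%a. nn_integral ?m (%x. ennreal (fst (a, x) powr (- (2 * al + real CARD('d) + 2))) * F (a, x))) \<in> borel_measurable borel" by measurable
 have "(\<integral>\<^sup>+w. F w \<partial>weinstein_measure_X al) = (nn_integral lborel (%a. ?d a * (nn_integral ?m (%x. F (a, x)))))"
  unfolding weinstein_measure_X_def W.nn_integral_fst[OF Fm(1), symmetric] using I by (intro nn_integral_density) auto
 also have "... = (\<integral>\<^sup>+a\<in>{0<..}. (nn_integral ?m (%x. ennreal (fst (a, x) powr (- (2 * al + real CARD('d) + 2))) * F (a, x))) * ennreal (1 / a) \<partial>lborel)"
 proof (rule nn_integral_cong)
  fix a :: real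
  show "?d a * (nn_integral ?m (%x. F (a, x))) = (nn_integral ?m (%x. ennreal (fst (a, x) powr (- (2 * al + real CARD('d) + 2))) * F (a, x))) * ennreal (1 / a) * indicator {0<..} a"
  proof (cases "a > 0")
   case True
   have "a powr (2 * al + real CARD('d) + 3) = a powr (2 * al + real CARD('d) + 2) * a"
    using True powr_add[of a "2 * al + real CARD('d) + 2" 1] by (simp add: add.assoc)
   then have "1 / a powr (2 * al + real CARD('d) + 3) = a powr (- (2 * al + real CARD('d) + 2)) * (1 / a)"
    unfolding powr_minus_divide by simp
   then have "ennreal (1 / a powr (2 * al + real CARD('d) + 3)) = ennreal (a powr (- (2 * al + real CARD('d) + 2))) * ennreal (1 / a)"
    using True by (simp only: ennreal_mult powr_ge_zero divide_nonneg_nonneg zero_le_one less_imp_le)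
   moreover have "(nn_integral ?m (%x. ennreal (a powr (- (2 * al + real CARD('d) + 2))) * F (a, x))) = ennreal (a powr (- (2 * al + real CARD('d) + 2))) * (nn_integral ?m (%x. F (a, x)))"
    by (rule nn_integral_cmult) measurable
   ultimately show ?thesis using True by (simp only: fst_conv indicator_simps greaterThan_iff mult_1_right mult_ac)
  qed simp
 qed
 also have "... = (nn_integral (log_measure \<Otimes>\<^sub>M ?m) (%w. ennreal (fst w powr (- (2 * al + real CARD('d) + 2))) * F w))"
  unfolding W.nn_integral_fst[OF Fm(2), symmetric] by (rule nn_integral_log_measure[OF Im, symmetric])
 finally show ?thesis .
qed

lemma AE_weinstein_measure_X_pos: "AE z in (weinstein_measure_X al :: (real \<times> (real ^ 'd) \<times> real) measure). 0 < fst z"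
proof -
 have "(nn_integral (weinstein_measure_X al :: (real \<times> (real ^ 'd) \<times> real) measure) (%z. indicator {z. \<not> 0 < fst z} z))
  = (nn_integral (log_measure \<Otimes>\<^sub>M (wmeas al :: ((real ^ 'd) \<times> real) measure)) (%w. ennreal (fst w powr (- (2 * al + real CARD('d) + 2))) * indicator {z. \<not> 0 < fst z} w))"
  by (rule nn_integral_weinstein_measure_X) measurable
 also have "... = 0"
 proof -
  interpret LW: pair_sigma_finite log_measure "wmeas al :: ((real ^ 'd) \<times> real) measure" ..
  have "AE w in log_measure \<Otimes>\<^sub>M (wmeas al :: ((real ^ 'd) \<times> real) measure). fst w > 0"
   by (intro LW.AE_pair_measure) (measurable, use AE_log_measure_pos in \<open>auto elim: eventually_mono\<close>)
  then have "AE w in log_measure \<Otimes>\<^sub>M (wmeas al :: ((real ^ 'd) \<times> real) measure).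
    ennreal (fst w powr (- (2 * al + real CARD('d) + 2))) * indicator {z. \<not> 0 < fst z} w = 0"
   by eventually_elim simp
  then show ?thesis by (subst nn_integral_cong_AE[where v="%_. 0"]) auto
 qed
 finally show ?thesis by (subst (asm) nn_integral_0_iff_AE) (auto simp: indicator_def)
qed

lemma weinstein_atom_altdef:
 fixes \<phi> :: "(real ^ 'd) \<times> real => complex"
 assumes "al > -1/2" and [measurable]: "\<phi> \<in> borel_measurable borel"
 shows "weinstein_atom al \<phi> a x y = of_real (a powr (al + 1 + real CARD('d) / 2))
  * (LINT th|angle_measure al. weinstein_dilation al a \<phi> (wconv x y th))"
 unfolding weinstein_atom_def by (subst weinstein_translation_altdef[OF assms(1)]) simp_all

lemma weinstein_cwt_altdef:
 fixes \<phi> :: "(real ^ 'd) \<times> real => complex"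
 assumes al: "al > -1/2" and \<phi>: "\<phi> \<in> borel_measurable borel"
 shows "weinstein_cwt al \<phi> f z = of_real (fst z powr (al + 1 + real CARD('d) / 2)) * wcorr al f (weinstein_dilation al (fst z) \<phi>) (snd z)"
proof -
 have "weinstein_cwt al \<phi> f z = (LINT y|wmeas al. of_real (fst z powr (al + 1 + real CARD('d) / 2)) * (f y * cnj (LINT th|angle_measure al. weinstein_dilation al (fst z) \<phi> (wconv (snd z) y th))))"
  unfolding weinstein_cwt_def weinstein_atom_altdef[OF assms] by (simp add: split_beta mult_ac)
 then show ?thesis unfolding wcorr_def integral_mult_right_zero .
qed

lemma borel_measurable_weinstein_cwt:
 fixes f \<phi> :: "(real ^ 'd) \<times> real => complex"
 assumes al: "al > -1/2" and f: "f \<in> borel_measurable borel" and \<phi>: "\<phi> \<in> borel_measurable borel"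
 shows "weinstein_cwt al \<phi> f \<in> borel_measurable (weinstein_measure_X al)"
 unfolding weinstein_cwt_altdef[OF al \<phi>, abs_def]
 using borel_measurable_wcorr_dilation[OF al f \<phi>] by measurable

lemma borel_measurable_weinstein_atom:
 fixes \<phi> :: "(real ^ 'd) \<times> real => complex"
 assumes al: "al > -1/2" and \<phi>[measurable]: "\<phi> \<in> borel_measurable borel"
 shows "(%w. weinstein_atom al \<phi> (fst (fst w)) (snd (fst w)) (snd w)) \<in> borel_measurable ((borel \<Otimes>\<^sub>M borel) \<Otimes>\<^sub>M borel)"
proof -
 interpret A: prob_space "angle_measure al" by (rule prob_space_angle_measure[OF al])
 show ?thesis unfolding weinstein_atom_altdef[OF al \<phi>] by measurable
qed

lemma borel_measurable_weinstein_atom_section: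
 fixes \<phi> :: "(real ^ 'd) \<times> real => complex"
 assumes al: "al > -1/2" and \<phi>: "\<phi> \<in> borel_measurable borel"
 shows "weinstein_atom al \<phi> c x \<in> borel_measurable borel"
proof -
 have "(%y. (((c, x), y) :: (real \<times> (real ^ 'd) \<times> real) \<times> (real ^ 'd) \<times> real)) \<in> borel \<rightarrow>\<^sub>M (borel \<Otimes>\<^sub>M borel) \<Otimes>\<^sub>M borel" by measurable
 from measurable_compose[OF this borel_measurable_weinstein_atom[OF al \<phi>]] show ?thesis by simp
qed

text \<open>With s = al + 1 + d/2 the atom has sup norm of order a^(-s) and L^1 norm of order a^s.
  Interpolating between these opposite powers is what produces the scale weights of all later
  bounds.\<close>

lemma
 fixes \<phi> :: "(real ^ 'd) \<times> real => complex"
 assumes al: "al > -1/2" and \<phi>: "integrable (wmeas al) \<phi>" and M: "!!x. cmod (\<phi> x) <= M" and a: "a > 0"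
 shows norm_weinstein_atom_le: "cmod (weinstein_atom al \<phi> a x y) <= a powr (- (al + 1 + real CARD('d) / 2)) * M"
  and nn_integral_norm_weinstein_atom_le: "(nn_integral (wmeas al) (%y. ennreal (cmod (weinstein_atom al \<phi> a x y))))
   <= ennreal (a powr (al + 1 + real CARD('d) / 2) * (LINT x|wmeas al. cmod (\<phi> x)))"
proof -
 let ?m = "wmeas al :: ((real ^ 'd) \<times> real) measure"
 let ?s = "al + 1 + real CARD('d) / 2"
 have m [measurable]: "\<phi> \<in> borel_measurable borel" using borel_measurable_integrable[OF \<phi>] by simp
 interpret A: prob_space "angle_measure al" by (rule prob_space_angle_measure[OF al])
 note D = integrable_weinstein_dilation[OF al a \<phi>]
 define T where "T y = (LINT th|angle_measure al. weinstein_dilation al a \<phi> (wconv x y th))" for y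
 have Ti: "integrable ?m T" unfolding T_def by (rule integrable_weinstein_translate[OF al D])
 have at: "cmod (weinstein_atom al \<phi> a x y) = a powr ?s * cmod (T y)" for y
  unfolding weinstein_atom_altdef[OF al m] T_def by (simp add: norm_mult)
 have "cmod (T y) <= a powr (- (2 * al + real CARD('d) + 2)) * M"
  unfolding T_def by (rule norm_integral_angle_measure_le[OF al norm_weinstein_dilation_le[OF M]])
 then have "a powr ?s * cmod (T y) <= a powr ?s * (a powr (- (2 * al + real CARD('d) + 2)) * M)"
  by (intro mult_left_mono) auto
 also have "... = a powr (?s + (- (2 * al + real CARD('d) + 2))) * M" unfolding powr_add by simp
 also have "?s + (- (2 * al + real CARD('d) + 2)) = - ?s" by simp
 finally show "cmod (weinstein_atom al \<phi> a x y) <= a powr (- ?s) * M" unfolding at .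
 have "(nn_integral ?m (%y. ennreal (cmod (weinstein_atom al \<phi> a x y)))) = ennreal (LINT y|?m. a powr ?s * cmod (T y))"
  unfolding at using Ti by (intro nn_integral_eq_integral) auto
 also have "... <= ennreal (a powr ?s * (LINT x|?m. cmod (\<phi> x)))"
  using integral_norm_weinstein_translate_le[OF al D, of x] unfolding T_def integral_norm_weinstein_dilation[OF al a \<phi>]
  by (intro ennreal_leI) (simp add: mult_left_mono)
 finally show "(nn_integral ?m (%y. ennreal (cmod (weinstein_atom al \<phi> a x y)))) <= ennreal (a powr ?s * (LINT x|?m. cmod (\<phi> x)))" .
qed

lemma enn2real_inverse_conjugate:
 assumes "inverse p + inverse q = (1 :: ennreal)"
 shows "enn2real (inverse p) + enn2real (inverse q) = 1" "0 <= enn2real (inverse p)" "enn2real (inverse p) <= 1"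
proof -
 have "enn2real (inverse p) + enn2real (inverse q) = 1"
  using assms
 proof (cases rule: conjugate_exponent_cases)
  case (finite P Q)
  then show ?thesis by (simp add: inverse_ennreal inverse_eq_divide)
 qed auto
 moreover have "0 <= enn2real (inverse p)" "0 <= enn2real (inverse q)" by (simp_all only: enn2real_nonneg)
 ultimately show "enn2real (inverse p) + enn2real (inverse q) = 1" "0 <= enn2real (inverse p)" "enn2real (inverse p) <= 1" by linarith+
qed

text \<open>Hoelder against the interpolated L^q norm of the atom. The powers -s and s enter with
  the proportions 1/p and 1 - 1/p, hence the exponent s (1 - 2/p); with e in place of 1/p the
  formula includes both endpoints.\<close>

lemma norm_weinstein_cwt_le:
 fixes \<phi> :: "(real ^ 'd) \<times> real => complex"
 assumes al: "al > -1/2" and \<phi>: "integrable (wmeas al) \<phi>" and M: "!!x. cmod (\<phi> x) <= M" "M > 0"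
  and A: "(LINT x|wmeas al. cmod (\<phi> x)) <= A" "A > 0"
  and pq: "inverse p + inverse q = 1" and f: "f \<in> Lp_space p (wmeas al)" and a: "fst z > 0"
 defines "e \<equiv> enn2real (inverse p)"
 shows "cmod (weinstein_cwt al \<phi> f z) <= fst z powr ((al + 1 + real CARD('d) / 2) * (1 - 2 * e)) * (M powr e * A powr (1 - e)) * Lp_norm p (wmeas al) f"
proof -
 let ?m = "wmeas al :: ((real ^ 'd) \<times> real) measure"
 let ?s = "al + 1 + real CARD('d) / 2"
 define c where "c = fst z"
 have c: "c > 0" using a by (simp add: c_def)
 have m [measurable]: "\<phi> \<in> borel_measurable borel" using borel_measurable_integrable[OF \<phi>] by simp
 have e: "1 - enn2real (inverse q) = e" "enn2real (inverse q) = 1 - e"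
  using enn2real_inverse_conjugate(1)[OF pq] unfolding e_def by linarith+
 let ?at = "weinstein_atom al \<phi> c (snd z)"
 have am: "?at \<in> borel_measurable ?m" using borel_measurable_weinstein_atom_section[OF al m] by simp
 have "(nn_integral ?m (%y. ennreal (cmod (?at y)))) <= ennreal (c powr ?s * A)"
  using A by (intro order_trans[OF nn_integral_norm_weinstein_atom_le[OF al \<phi> M(1) c]] ennreal_leI) (simp add: mult_left_mono)
 from bounded_integrable_in_Lp[OF conjugate_exponent_ge_1(2)[OF pq] am _ _ _ this, of "c powr (- ?s) * M"]
 have at: "?at \<in> Lp_space q ?m" "Lp_norm q ?m ?at <= (c powr (- ?s) * M) powr e * (c powr ?s * A) powr (1 - e)"
  using norm_weinstein_atom_le[OF al \<phi> M(1) c] c M(2) A(2) unfolding e by auto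
 have "(c powr (- ?s) * M) powr e * (c powr ?s * A) powr (1 - e) = (c powr (- ?s * e) * c powr (?s * (1 - e))) * (M powr e * A powr (1 - e))"
  using c M(2) A(2) by (simp only: powr_mult powr_powr mult_ac)
 also have "c powr (- ?s * e) * c powr (?s * (1 - e)) = c powr (?s * (1 - 2 * e))"
 proof -
  have "- s * e + s * (1 - e) = s * (1 - 2 * e)" for s :: real by (simp add: algebra_simps)
  then show ?thesis unfolding powr_add[symmetric] by (simp only:)
 qed
 finally have le: "Lp_norm q ?m ?at <= c powr (?s * (1 - 2 * e)) * (M powr e * A powr (1 - e))" using at(2) by simp
 have "cmod (weinstein_cwt al \<phi> f z) <= Lp_norm p ?m f * Lp_norm q ?m ?at"
  using Lp_pairing(2)[OF pq f at(1)] unfolding weinstein_cwt_def c_def by (simp add: split_beta)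
 also have "... <= Lp_norm p ?m f * (c powr (?s * (1 - 2 * e)) * (M powr e * A powr (1 - e)))"
  by (intro mult_left_mono le Lp_norm_nonneg)
 finally show ?thesis unfolding c_def by (simp only: mult_ac)
qed

lemma nn_integral_weinstein_cwt_powr:
 fixes \<phi> :: "(real ^ 'd) \<times> real => complex"
 assumes al: "al > -1/2" and \<phi>: "integrable (wmeas al) \<phi>" and M: "!!x. cmod (\<phi> x) <= M"
  and wavelet: "weinstein_wavelet al \<phi>" and P: "2 <= P"
 shows "\<exists>K\<ge>0. \<forall>f \<in> Lp_space (ennreal P) (wmeas al).
  (\<integral>\<^sup>+z. ennreal ((fst z powr (- ((al + 1 + real CARD('d) / 2) * (1 - 2 / P))) * cmod (weinstein_cwt al \<phi> f z)) powr P) \<partial>weinstein_measure_X al)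
   <= ennreal (K * Lp_norm (ennreal P) (wmeas al) f powr P)"
proof -
 let ?m = "wmeas al :: ((real ^ 'd) \<times> real) measure"
 define s where "s = al + 1 + real CARD('d) / 2"
 define w where "w = s * (1 - 2 / P)"
 have m [measurable]: "\<phi> \<in> borel_measurable borel" using borel_measurable_integrable[OF \<phi>] by simp
 interpret LW: pair_sigma_finite log_measure ?m ..
 have pos: "AE w in log_measure \<Otimes>\<^sub>M ?m. fst w > 0"
  by (intro LW.AE_pair_measure) (measurable, use AE_log_measure_pos in \<open>auto elim: eventually_mono\<close>)
 obtain c where c: "0 < c" "AE xi in ?m. (\<integral>\<^sup>+ a\<in>{0<..}. ennreal ((cmod (weinstein_transform al \<phi> (a *\<^sub>R xi)))\<^sup>2 / a) \<partial>lborel) = ennreal c"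
  using wavelet unfolding weinstein_wavelet_def by blast
 have c0: "0 <= c" using c(1) by simp
 define A where "A = (LINT x|?m. cmod (\<phi> x))"
 \<comment> \<open>The interpolation constant is singular at P = 2, where the L^2 estimate is used
   instead.\<close>
 define K where "K = (if P = 2 then c else P * (4 * c) * (2 * (A + 1)) powr (P - 2) / (P - 2))"
 have K: "K >= 0" using P c by (simp add: K_def)
 show ?thesis
 proof (intro exI[of _ K] conjI K ballI)
  fix f assume "f \<in> Lp_space (ennreal P) ?m"
  then have f: "f \<in> borel_measurable borel" "integrable ?m (%x. cmod (f x) powr P)" and fL: "f \<in> Lp_space (ennreal P) ?m"
   using P by (auto simp: Lp_space_ennreal)
  have [measurable]: "(%w. wcorr al f (weinstein_dilation al (fst w) \<phi>) (snd w)) \<in> borel_measurable (borel \<Otimes>\<^sub>M borel)"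
   by (rule borel_measurable_wcorr_dilation[OF al f(1) m])
  have "(\<integral>\<^sup>+z. ennreal ((fst z powr (- w) * cmod (weinstein_cwt al \<phi> f z)) powr P) \<partial>weinstein_measure_X al)
   = (nn_integral (log_measure \<Otimes>\<^sub>M ?m) (%z. ennreal (fst z powr (- (2 * al + real CARD('d) + 2))) * ennreal ((fst z powr (- w) * cmod (weinstein_cwt al \<phi> f z)) powr P)))"
   unfolding weinstein_cwt_altdef[OF al m] by (rule nn_integral_weinstein_measure_X) measurable
  also have "... = (nn_integral (log_measure \<Otimes>\<^sub>M ?m) (%z. ennreal (cmod (wcorr al f (weinstein_dilation al (fst z) \<phi>) (snd z)) powr P)))"
  proof (rule nn_integral_cong_AE)
   show "AE z in log_measure \<Otimes>\<^sub>M ?m. ennreal (fst z powr (- (2 * al + real CARD('d) + 2))) * ennreal ((fst z powr (- w) * cmod (weinstein_cwt al \<phi> f z)) powr P)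
    = ennreal (cmod (wcorr al f (weinstein_dilation al (fst z) \<phi>) (snd z)) powr P)"
    using pos
   proof eventually_elim
    fix z :: "real \<times> (real ^ 'd) \<times> real" assume a: "fst z > 0"
    define u where "u = cmod (wcorr al f (weinstein_dilation al (fst z) \<phi>) (snd z))"
    \<comment> \<open>By the choice of w one has (s - w) P = 2 s, so the weight, the factor a^s of
      the transform and the density a^(-2s) of the measure cancel completely.\<close>
    have "- (2 * s) + (- w + s) * P = 0" using P by (simp add: w_def field_simps)
    then have "fst z powr (- (2 * s)) * (fst z powr (- w + s)) powr P = 1"
     using a by (simp only: powr_powr powr_add[symmetric]) simp
    then have 1: "fst z powr (- (2 * s)) * (fst z powr (- w) * (fst z powr s * u)) powr P = u powr P"
     by (simp only: mult.assoc[symmetric] powr_mult powr_add)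
    have 2: "2 * al + real CARD('d) + 2 = 2 * s" by (simp add: s_def)
    have 3: "cmod (weinstein_cwt al \<phi> f z) = fst z powr s * u"
     unfolding weinstein_cwt_altdef[OF al m] s_def u_def by (simp add: norm_mult)
    show "ennreal (fst z powr (- (2 * al + real CARD('d) + 2))) * ennreal ((fst z powr (- w) * cmod (weinstein_cwt al \<phi> f z)) powr P)
     = ennreal (cmod (wcorr al f (weinstein_dilation al (fst z) \<phi>) (snd z)) powr P)"
     unfolding 2 3 u_def[symmetric] 1[symmetric] by (simp only: ennreal_mult powr_ge_zero)
   qed
  qed
  also have "... <= ennreal K * (nn_integral ?m (%x. ennreal (cmod (f x) powr P)))"
  proof (cases "P = 2")
   case True
   then show ?thesis using square_function_L2[OF al \<phi> M c(2) f(1)] f(2) by (simp add: K_def)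
  next
   case False
   then show ?thesis using square_function_Lp[OF al \<phi> M c(2) c0 _ f] P by (simp add: K_def A_def)
  qed
  also have "... = ennreal (K * Lp_norm (ennreal P) ?m f powr P)"
   using P K by (subst Lp_nn_integral[OF _ fL]) (simp_all add: ennreal_mult)
  finally show "(\<integral>\<^sup>+z. ennreal ((fst z powr (- ((al + 1 + real CARD('d) / 2) * (1 - 2 / P))) * cmod (weinstein_cwt al \<phi> f z)) powr P) \<partial>weinstein_measure_X al)
   <= ennreal (K * Lp_norm (ennreal P) ?m f powr P)" unfolding w_def s_def .
 qed
qed

definition cwt_product_bounded ::
 "real => ((real ^ 'd) \<times> real => complex) => ((real ^ 'd) \<times> real => complex) => ennreal => ennreal => ennreal => bool" where
 "cwt_product_bounded al \<phi> \<psi> p q R \<longleftrightarrow> (\<exists>Q\<ge>0. \<forall>f \<in> Lp_space p (wmeas al). \<forall>g \<in> Lp_space q (wmeas al).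
  (%z. weinstein_cwt al \<phi> f z * cnj (weinstein_cwt al \<psi> g z)) \<in> Lp_space R (weinstein_measure_X al) &
  Lp_norm R (weinstein_measure_X al) (%z. weinstein_cwt al \<phi> f z * cnj (weinstein_cwt al \<psi> g z))
   <= Q * Lp_norm p (wmeas al) f * Lp_norm q (wmeas al) g)"

lemma norm_weinstein_cwt_le_ex:
 fixes \<phi> :: "(real ^ 'd) \<times> real => complex"
 assumes al: "al > -1/2" and \<phi>: "integrable (wmeas al) \<phi>" and M: "!!x. cmod (\<phi> x) <= M"
  and pq: "inverse p + inverse q = 1"
 shows "\<exists>B>0. \<forall>f \<in> Lp_space p (wmeas al). \<forall>z. fst z > 0 -->
  cmod (weinstein_cwt al \<phi> f z) <= fst z powr ((al + 1 + real CARD('d) / 2) * (1 - 2 * enn2real (inverse p))) * B * Lp_norm p (wmeas al) f"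
proof -
 define M' where "M' = max 1 M"
 have M': "cmod (\<phi> x) <= M'" "M' > 0" for x using M[of x] by (auto simp: M'_def)
 define A where "A = max 1 (LINT x|wmeas al. cmod (\<phi> x))"
 have A: "(LINT x|wmeas al. cmod (\<phi> x)) <= A" "A > 0" by (auto simp: A_def)
 show ?thesis
  by (intro exI[of _ "M' powr enn2real (inverse p) * A powr (1 - enn2real (inverse p))"] conjI ballI allI impI norm_weinstein_cwt_le[OF al \<phi> M' A pq])
   (use M' A in auto)
qed

text \<open>Since 1 - 2/p and 1 - 2/q are opposite, so are the powers of the scale in the two
  pointwise bounds, and the product is bounded uniformly in the scale.\<close>

lemma cwt_product_bounded_infinity:
 fixes \<phi> \<psi> :: "(real ^ 'd) \<times> real => complex"
 assumes al: "al > -1/2" and \<phi>: "integrable (wmeas al) \<phi>" and M: "!!x. cmod (\<phi> x) <= M"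
  and \<psi>: "integrable (wmeas al) \<psi>" and N: "!!x. cmod (\<psi> x) <= N"
  and pq: "inverse p + inverse q = 1"
 shows "cwt_product_bounded al \<phi> \<psi> p q top"
proof -
 let ?m = "wmeas al :: ((real ^ 'd) \<times> real) measure"
 let ?s = "al + 1 + real CARD('d) / 2"
 have m: "\<phi> \<in> borel_measurable borel" "\<psi> \<in> borel_measurable borel"
  using borel_measurable_integrable[OF \<phi>] borel_measurable_integrable[OF \<psi>] by simp_all
 have qp: "inverse q + inverse p = 1" using pq by (simp add: add.commute)
 obtain B1 where B1': "B1 > 0" "\<forall>f \<in> Lp_space p ?m. \<forall>z. fst z > 0 -->
  cmod (weinstein_cwt al \<phi> f z) <= fst z powr (?s * (1 - 2 * enn2real (inverse p))) * B1 * Lp_norm p ?m f"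
  using norm_weinstein_cwt_le_ex[OF al \<phi> M pq] by blast
 note B1 = B1'(1) B1'(2)[rule_format]
 obtain B2 where B2': "B2 > 0" "\<forall>f \<in> Lp_space q ?m. \<forall>z. fst z > 0 -->
  cmod (weinstein_cwt al \<psi> f z) <= fst z powr (?s * (1 - 2 * enn2real (inverse q))) * B2 * Lp_norm q ?m f"
  using norm_weinstein_cwt_le_ex[OF al \<psi> N qp] by blast
 note B2 = B2'(1) B2'(2)[rule_format]
 show ?thesis unfolding cwt_product_bounded_def
 proof (intro exI[of _ "B1 * B2"] conjI ballI)
  fix f g assume f: "f \<in> Lp_space p ?m" and g: "g \<in> Lp_space q ?m"
  let ?h = "%z. weinstein_cwt al \<phi> f z * cnj (weinstein_cwt al \<psi> g z)"
  have hm: "?h \<in> borel_measurable (weinstein_measure_X al)"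
   using Lp_space_measurable[OF f] Lp_space_measurable[OF g] m
   by (intro borel_measurable_times borel_measurable_cnj_comp borel_measurable_weinstein_cwt[OF al]) simp_all
  have e: "?s * (1 - 2 * enn2real (inverse p)) + ?s * (1 - 2 * enn2real (inverse q)) = 0"
  proof -
   have "enn2real (inverse q) = 1 - enn2real (inverse p)" using enn2real_inverse_conjugate(1)[OF pq] by linarith
   moreover have "s * (1 - 2 * e) + s * (1 - 2 * (1 - e)) = 0" for s e :: real by (simp add: algebra_simps)
   ultimately show ?thesis by (simp only:)
  qed
  have b: "AE z in weinstein_measure_X al. cmod (?h z) <= B1 * B2 * Lp_norm p ?m f * Lp_norm q ?m g"
   using AE_weinstein_measure_X_pos
  proof eventually_elim
   fix z :: "real \<times> (real ^ 'd) \<times> real" assume a: "0 < fst z"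
   have "cmod (?h z) <= (fst z powr (?s * (1 - 2 * enn2real (inverse p))) * B1 * Lp_norm p ?m f) * (fst z powr (?s * (1 - 2 * enn2real (inverse q))) * B2 * Lp_norm q ?m g)"
    unfolding norm_mult complex_mod_cnj using B1 Lp_norm_nonneg[of p ?m f] by (intro mult_mono B1(2)[OF f a] B2(2)[OF g a]) auto
   also have "... = (fst z powr (?s * (1 - 2 * enn2real (inverse p))) * fst z powr (?s * (1 - 2 * enn2real (inverse q)))) * (B1 * B2 * Lp_norm p ?m f * Lp_norm q ?m g)"
    by (simp only: mult_ac)
   also have "... = B1 * B2 * Lp_norm p ?m f * Lp_norm q ?m g"
    unfolding powr_add[symmetric] e using a by simp
   finally show "cmod (?h z) <= B1 * B2 * Lp_norm p ?m f * Lp_norm q ?m g" .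
  qed
  show "?h \<in> Lp_space top (weinstein_measure_X al)" by (rule Lp_space_inftyI[OF hm b])
  show "Lp_norm top (weinstein_measure_X al) ?h <= B1 * B2 * Lp_norm p ?m f * Lp_norm q ?m g"
   using B1 B2 Lp_norm_nonneg[of p ?m f] Lp_norm_nonneg[of q ?m g] by (intro Lp_norm_infty_le[OF hm b]) auto
 qed (use B1 B2 in auto)
qed

text \<open>P of the R powers of u are kept for integration; the other R - P, and all powers of v,
  are replaced by their bounds.\<close>

lemma powr_interpolation_le:
 fixes u v a b :: real
 assumes "0 <= u" "u <= a" "0 <= v" "v <= b" "0 < P" "P <= R"
 shows "(u * v) powr R <= a powr (R - P) * b powr R * u powr P"
proof (cases "u = 0")
 case False
 have "(u * v) powr R = u powr (R - P) * u powr P * v powr R"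
  using assms by (simp add: powr_mult powr_add[symmetric])
 also have "... <= a powr (R - P) * u powr P * b powr R"
  using assms by (intro mult_mono powr_mono2) auto
 finally show ?thesis by (simp add: mult_ac)
qed (use assms in auto)

lemma cwt_product_bounded_ge_2:
 fixes \<phi> \<psi> :: "(real ^ 'd) \<times> real => complex"
 assumes al: "al > -1/2" and \<phi>: "integrable (wmeas al) \<phi>" and M: "!!x. cmod (\<phi> x) <= M"
  and \<psi>: "integrable (wmeas al) \<psi>" and N: "!!x. cmod (\<psi> x) <= N"
  and wavelet: "weinstein_wavelet al \<phi>" and P: "2 <= P" "P <= R"
  and pq: "inverse (ennreal P) + inverse q = 1"
 shows "cwt_product_bounded al \<phi> \<psi> (ennreal P) q (ennreal R)"
proof -
 let ?m = "wmeas al :: ((real ^ 'd) \<times> real) measure"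
 let ?X = "weinstein_measure_X al :: (real \<times> (real ^ 'd) \<times> real) measure"
 let ?s = "al + 1 + real CARD('d) / 2"
 have m: "\<phi> \<in> borel_measurable borel" "\<psi> \<in> borel_measurable borel"
  using borel_measurable_integrable[OF \<phi>] borel_measurable_integrable[OF \<psi>] by simp_all
 have qp: "inverse q + inverse (ennreal P) = 1" using pq by (simp add: add.commute)
 have iP: "enn2real (inverse (ennreal P)) = 1 / P" using P by (simp add: inverse_ennreal inverse_eq_divide)
 have iq: "enn2real (inverse q) = 1 - 1 / P" using enn2real_inverse_conjugate(1)[OF pq] iP by simp
 define w where "w = ?s * (1 - 2 / P)"
 have w1: "?s * (1 - 2 * (1 / P)) = w" by (simp add: w_def)
 have w2: "?s * (1 - 2 * (1 - 1 / P)) = - w"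
 proof -
  have "s * (1 - 2 * (1 - 1 / P)) = - (s * (1 - 2 / P))" for s :: real by (simp add: algebra_simps)
  then show ?thesis unfolding w_def .
 qed
 obtain B1 where B1': "B1 > 0" "\<forall>f \<in> Lp_space (ennreal P) ?m. \<forall>z. fst z > 0 -->
  cmod (weinstein_cwt al \<phi> f z) <= fst z powr w * B1 * Lp_norm (ennreal P) ?m f"
  using norm_weinstein_cwt_le_ex[OF al \<phi> M pq] unfolding iP w1 by blast
 note B1 = B1'(1) B1'(2)[rule_format]
 obtain B2 where B2': "B2 > 0" "\<forall>f \<in> Lp_space q ?m. \<forall>z. fst z > 0 -->
  cmod (weinstein_cwt al \<psi> f z) <= fst z powr (- w) * B2 * Lp_norm q ?m f"
  using norm_weinstein_cwt_le_ex[OF al \<psi> N qp] unfolding iq w2 by blast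
 note B2 = B2'(1) B2'(2)[rule_format]
 obtain K where K': "K >= 0" "\<forall>f \<in> Lp_space (ennreal P) ?m.
  (nn_integral ?X (%z. ennreal ((fst z powr (- w) * cmod (weinstein_cwt al \<phi> f z)) powr P))) <= ennreal (K * Lp_norm (ennreal P) ?m f powr P)"
  using nn_integral_weinstein_cwt_powr[OF al \<phi> M wavelet P(1)] unfolding w_def by blast
 note K = K'(1) K'(2)[rule_format]
 \<comment> \<open>The R-th root of the collected constants: K from the weighted L^P estimate, B1
   from the R - P powers of the first factor that are bounded pointwise, B2 from the second
   factor.\<close>
 define Q where "Q = K powr (1 / R) * B1 powr (1 - P / R) * B2"
 have R: "R > 0" using P by simp
 show ?thesis unfolding cwt_product_bounded_def
 proof (intro exI[of _ Q] conjI ballI)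
  show "0 <= Q" using B2 by (simp add: Q_def)
  fix f g assume f: "f \<in> Lp_space (ennreal P) ?m" and g: "g \<in> Lp_space q ?m"
  let ?h = "%z. weinstein_cwt al \<phi> f z * cnj (weinstein_cwt al \<psi> g z)"
  define F where "F = Lp_norm (ennreal P) ?m f"
  define G where "G = Lp_norm q ?m g"
  have FG: "F >= 0" "G >= 0" unfolding F_def G_def by (rule Lp_norm_nonneg)+
  have wm [measurable]: "weinstein_cwt al \<phi> f \<in> borel_measurable ?X" "weinstein_cwt al \<psi> g \<in> borel_measurable ?X"
   using Lp_space_measurable[OF f] Lp_space_measurable[OF g] m by (auto intro: borel_measurable_weinstein_cwt[OF al])
  have hm: "?h \<in> borel_measurable ?X" by (intro borel_measurable_times borel_measurable_cnj_comp wm)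
  have "AE z in ?X. cmod (?h z) powr R <= ((B1 * F) powr (R - P) * (B2 * G) powr R) * (fst z powr (- w) * cmod (weinstein_cwt al \<phi> f z)) powr P"
   using AE_weinstein_measure_X_pos
  proof eventually_elim
   fix z :: "real \<times> (real ^ 'd) \<times> real" assume a: "0 < fst z"
   have z1: "fst z powr w * fst z powr (- w) = 1" using a by (simp add: powr_minus)
   define u where "u = fst z powr (- w) * cmod (weinstein_cwt al \<phi> f z)"
   define v where "v = fst z powr w * cmod (weinstein_cwt al \<psi> g z)"
   \<comment> \<open>The opposite weights on u and v turn both scale-dependent bounds into constants
     and leave the product of the transforms unchanged.\<close>
   have cancel: "x * (y * B * C) = B * C" if "y * x = 1" for x y B C :: real
   proof -
    have "x * (y * B * C) = (y * x) * (B * C)" by (simp only: mult_ac)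
    then show ?thesis using that by simp
   qed
   have "u <= fst z powr (- w) * (fst z powr w * B1 * F)" unfolding u_def F_def by (intro mult_left_mono B1(2)[OF f a]) simp
   then have u: "u <= B1 * F" unfolding cancel[OF z1] .
   have "v <= fst z powr w * (fst z powr (- w) * B2 * G)" unfolding v_def G_def by (intro mult_left_mono B2(2)[OF g a]) simp
   then have v: "v <= B2 * G" unfolding cancel[OF z1[unfolded mult.commute[of "fst z powr w"]]] .
   have "cmod (?h z) = (fst z powr w * fst z powr (- w)) * cmod (?h z)" unfolding z1 by simp
   also have "... = u * v" unfolding norm_mult complex_mod_cnj u_def v_def by (simp only: mult_ac)
   finally have "cmod (?h z) powr R = (u * v) powr R" by simp
   also have "... <= (B1 * F) powr (R - P) * (B2 * G) powr R * u powr P"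
    using P u v by (intro powr_interpolation_le) (auto simp: u_def v_def)
   finally show "cmod (?h z) powr R <= ((B1 * F) powr (R - P) * (B2 * G) powr R) * (fst z powr (- w) * cmod (weinstein_cwt al \<phi> f z)) powr P"
    unfolding u_def .
  qed
  then have "(nn_integral ?X (%z. ennreal (cmod (?h z) powr R)))
   <= (nn_integral ?X (%z. ennreal ((B1 * F) powr (R - P) * (B2 * G) powr R) * ennreal ((fst z powr (- w) * cmod (weinstein_cwt al \<phi> f z)) powr P)))"
   by (intro nn_integral_mono_AE) (auto elim!: eventually_mono simp: ennreal_mult[symmetric] intro!: ennreal_leI)
  also have "... = ennreal ((B1 * F) powr (R - P) * (B2 * G) powr R) * (nn_integral ?X (%z. ennreal ((fst z powr (- w) * cmod (weinstein_cwt al \<phi> f z)) powr P)))"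
   by (rule nn_integral_cmult) measurable
  also have "... <= ennreal ((B1 * F) powr (R - P) * (B2 * G) powr R) * ennreal (K * F powr P)"
   unfolding F_def by (intro mult_left_mono K(2)[OF f]) simp
  also have "... = ennreal ((Q * F * G) powr R)"
  proof -
   have kr: "(K powr (1 / R)) powr R = K" using K(1) R by (simp add: powr_powr)
   have br: "(B1 powr (1 - P / R)) powr R = B1 powr (R - P)" using R by (simp add: powr_powr left_diff_distrib)
   have ff: "F powr (R - P) * F powr P = F powr R" by (simp add: powr_add[symmetric])
   have "(Q * F * G) powr R = K * B1 powr (R - P) * B2 powr R * (F powr (R - P) * F powr P) * G powr R"
    unfolding Q_def ff powr_mult kr br ..
   also have "... = ((B1 * F) powr (R - P) * (B2 * G) powr R) * (K * F powr P)"
    unfolding powr_mult by (simp only: mult_ac)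
   finally show ?thesis using K(1) by (simp add: ennreal_mult)
  qed
  finally have le: "(nn_integral ?X (%z. ennreal (cmod (?h z) powr R))) <= ennreal ((Q * F * G) powr R)" .
  have "1 <= R" "0 <= Q * F * G" using P B2 FG by (auto simp: Q_def)
  from Lp_nn_integralI[OF this(1) hm le this(2)]
  show "?h \<in> Lp_space (ennreal R) ?X" "Lp_norm (ennreal R) ?X ?h <= Q * Lp_norm (ennreal P) ?m f * Lp_norm q ?m g"
   unfolding F_def G_def .
 qed
qed

lemma cwt_product_bounded_swap:
 fixes \<phi> \<psi> :: "(real ^ 'd) \<times> real => complex"
 assumes "cwt_product_bounded al \<psi> \<phi> q p R" "1 <= R"
 shows "cwt_product_bounded al \<phi> \<psi> p q R"
proof -
 obtain Q where Q: "Q >= 0" "!!f g. f \<in> Lp_space q (wmeas al) ==> g \<in> Lp_space p (wmeas al) ==>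
  (%z. weinstein_cwt al \<psi> f z * cnj (weinstein_cwt al \<phi> g z)) \<in> Lp_space R (weinstein_measure_X al) &
  Lp_norm R (weinstein_measure_X al) (%z. weinstein_cwt al \<psi> f z * cnj (weinstein_cwt al \<phi> g z))
   <= Q * Lp_norm q (wmeas al) f * Lp_norm p (wmeas al) g"
  using assms(1) unfolding cwt_product_bounded_def by blast
 show ?thesis unfolding cwt_product_bounded_def
 proof (intro exI[of _ Q] conjI ballI Q(1))
  fix f g :: "(real ^ 'd) \<times> real => complex"
  assume f: "f \<in> Lp_space p (wmeas al)" and g: "g \<in> Lp_space q (wmeas al)"
  let ?h = "%z. weinstein_cwt al \<psi> g z * cnj (weinstein_cwt al \<phi> f z)"
  have e: "(%z. weinstein_cwt al \<phi> f z * cnj (weinstein_cwt al \<psi> g z)) = (%z. cnj (?h z))" by (simp add: mult.commute)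
  note h = Q(2)[OF g f]
  show "(%z. weinstein_cwt al \<phi> f z * cnj (weinstein_cwt al \<psi> g z)) \<in> Lp_space R (weinstein_measure_X al)"
   unfolding e using h by (intro Lp_space_cnj) auto
  show "Lp_norm R (weinstein_measure_X al) (%z. weinstein_cwt al \<phi> f z * cnj (weinstein_cwt al \<psi> g z))
   <= Q * Lp_norm p (wmeas al) f * Lp_norm q (wmeas al) g"
   unfolding e Lp_norm_cnj using h by (simp add: mult_ac)
 qed
qed

text \<open>One of p and q is at least 2, and the estimate with that exponent first covers the case,
  up to conjugation of the product. The role of r <= p is to give q <= r', so that the swapped
  estimate stays in its range. If r' is infinite the pointwise bounds suffice for all p.\<close>

theorem cwt_product_bounded:
 fixes \<phi> \<psi> :: "(real ^ 'd) \<times> real => complex" and r r' :: ennreal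
 assumes al: "al > -1/2" and \<phi>: "integrable (wmeas al) \<phi>" and M: "!!x. cmod (\<phi> x) <= M"
  and \<psi>: "integrable (wmeas al) \<psi>" and N: "!!x. cmod (\<psi> x) <= N"
  and wavelet: "weinstein_wavelet al \<phi>" "weinstein_wavelet al \<psi>"
  and rr': "inverse r + inverse r' = 1" and p: "r <= p" "p <= r'"
  and pq: "inverse p + inverse q = 1"
 shows "cwt_product_bounded al \<phi> \<psi> p q r'"
proof (cases "r' = top")
 case True
 then show ?thesis using cwt_product_bounded_infinity[OF al \<phi> M \<psi> N pq] by simp
next
 case False
 have r1: "1 <= r'" using conjugate_exponent_ge_1[OF rr'] by simp
 obtain R where R: "r' = ennreal R" "1 <= R" using r1 False by (cases rule: exponent_ge_1_cases) auto
 from pq show ?thesis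
 proof (cases rule: conjugate_exponent_cases)
  case one
  have "r = 1" using one p(1) conjugate_exponent_ge_1(1)[OF rr'] by (intro antisym) auto
  from rr' have "r' = top" by (cases rule: conjugate_exponent_cases) (use \<open>r = 1\<close> in auto)
  then show ?thesis using False by simp
 next
  case infinity
  then show ?thesis using p(2) False by (simp add: top_unique)
 next
  case (finite P Q)
  have PR: "P <= R" using p(2) finite R by (simp add: ennreal_le_iff)
  show ?thesis
  proof (cases "P >= 2")
   case True
   show ?thesis unfolding finite(4) R(1)
    by (rule cwt_product_bounded_ge_2[OF al \<phi> M \<psi> N wavelet(1) True PR]) (use pq finite in simp)
  next
   case nge: False
   have "1 / 2 <= 1 / P" using finite(1) nge by (intro divide_left_mono) auto
   then have "1 / Q <= 1 / 2" using finite(3) by linarith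
   then have Q2: "2 <= Q" using finite by (simp add: divide_simps split: if_splits)
   \<comment> \<open>Conjugation reverses the order of exponents: r <= p becomes q <= r'.\<close>
   from rr' have QR: "Q <= R"
   proof (cases rule: conjugate_exponent_cases)
    case one
    then show ?thesis using False by simp
   next
    case infinity
    then show ?thesis using p(1) finite by (simp add: top_unique)
   next
    case c: (finite \<rho> R')
    have "R' = R" using c R by simp
    have "\<rho> <= P" using p(1) c finite by (simp add: ennreal_le_iff)
    then have "1 / P <= 1 / \<rho>" using c by (intro divide_left_mono) auto
    then have "1 / R' <= 1 / Q" using c(3) finite(3) by linarith
    then have "1 / R <= 1 / Q" unfolding \<open>R' = R\<close> .
    then show ?thesis using finite R by (simp add: divide_simps split: if_splits)
   qed
   show ?thesis unfolding finite(5) R(1)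
    by (rule cwt_product_bounded_swap, rule cwt_product_bounded_ge_2[OF al \<psi> N \<phi> M wavelet(2) Q2 QR])
     (use pq finite R in \<open>auto simp: add.commute\<close>)
  qed
 qed
qed

section \<open>Compactness\<close>

lemma weinstein_atom_in_Lp:
 fixes \<phi> :: "(real ^ 'd) \<times> real => complex"
 assumes al: "al > -1/2" and \<phi>: "integrable (wmeas al) \<phi>" and M: "!!x. cmod (\<phi> x) <= M"
  and q: "1 <= q" and c: "c > 0"
 shows "weinstein_atom al \<phi> c x \<in> Lp_space q (wmeas al)"
proof -
 have m [measurable]: "\<phi> \<in> borel_measurable borel" using borel_measurable_integrable[OF \<phi>] by simp
 have am: "weinstein_atom al \<phi> c x \<in> borel_measurable (wmeas al)"
  using borel_measurable_weinstein_atom_section[OF al m] by simp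
 let ?A = "c powr (- (al + 1 + real CARD('d) / 2)) * max 1 M"
 let ?B = "max 1 (c powr (al + 1 + real CARD('d) / 2) * (LINT x|wmeas al. cmod (\<phi> x)))"
 have "AE y in wmeas al. cmod (weinstein_atom al \<phi> c x y) <= ?A"
  by (intro AE_I2 order_trans[OF norm_weinstein_atom_le[OF al \<phi> M c]] mult_left_mono) auto
 moreover have "(nn_integral (wmeas al) (%y. ennreal (cmod (weinstein_atom al \<phi> c x y)))) <= ennreal ?B"
  by (intro order_trans[OF nn_integral_norm_weinstein_atom_le[OF al \<phi> M c]] ennreal_leI) simp
 moreover have "?A > 0" "?B > 0" using c by auto
 ultimately show ?thesis by (intro bounded_integrable_in_Lp(1)[OF q am, of ?A ?B])
qed

lemma weinstein_cwt_add:
 fixes \<phi> :: "(real ^ 'd) \<times> real => complex"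
 assumes al: "al > -1/2" and \<phi>: "integrable (wmeas al) \<phi>" and M: "!!x. cmod (\<phi> x) <= M"
  and pq: "inverse p + inverse q = 1" and fg: "f \<in> Lp_space p (wmeas al)" "g \<in> Lp_space p (wmeas al)"
  and z: "fst z > 0"
 shows "weinstein_cwt al \<phi> (%x. f x + g x) z = weinstein_cwt al \<phi> f z + weinstein_cwt al \<phi> g z"
 unfolding weinstein_cwt_def split_beta distrib_right
 by (intro Bochner_Integration.integral_add Lp_pairing(1)[OF pq] fg weinstein_atom_in_Lp[OF al \<phi> M _ z] conjugate_exponent_ge_1(2)[OF pq])

lemma weinstein_cwt_cmult: "weinstein_cwt al \<phi> (%x. c * f x) z = c * weinstein_cwt al \<phi> f z"
 by (simp add: weinstein_cwt_def split_beta mult.assoc)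

text \<open>The transform involves values of the wavelet along curves, so it is not immediate that
  null sets do not matter. The function h marks where the dilated wavelets differ; its integral is
  0, hence by invariance of the integral under translation its angular mean vanishes for almost
  every y.\<close>

lemma weinstein_cwt_cong_AE:
 fixes \<phi> \<phi>' :: "(real ^ 'd) \<times> real => complex"
 assumes al: "al > -1/2" and m: "\<phi> \<in> borel_measurable borel" "\<phi>' \<in> borel_measurable borel"
  and eq: "AE x in wmeas al. \<phi> x = \<phi>' x" and f: "f \<in> borel_measurable borel" and z: "fst z > 0"
 shows "weinstein_cwt al \<phi> f z = weinstein_cwt al \<phi>' f z"
proof -
 note [measurable] = m f
 interpret A: prob_space "angle_measure al" by (rule prob_space_angle_measure[OF al])
 let ?D = "weinstein_dilation al (fst z)"
 define h where "h u = (if ?D \<phi> u = ?D \<phi>' u then 0 else 1 :: ennreal)" for u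
 have [measurable]: "h \<in> borel_measurable borel" unfolding h_def by measurable
 have hz: "AE x in wmeas al. h (fst z *\<^sub>R x) = 0"
  using eq by eventually_elim (use z in \<open>simp add: h_def weinstein_dilation_def\<close>)
 have "(nn_integral (wmeas al) (%u. h u)) = ennreal (fst z powr (2 * al + real CARD('d) + 2)) * (nn_integral (wmeas al) (%x. h (fst z *\<^sub>R x)))"
  by (rule nn_integral_weinstein_dilate[OF al z]) measurable
 also have "(nn_integral (wmeas al) (%x. h (fst z *\<^sub>R x))) = 0"
  using hz by (subst nn_integral_cong_AE[OF hz]) simp
 finally have "(nn_integral (wmeas al) (%y. nn_integral (angle_measure al) (%th. h (wconv (snd z) y th)))) = 0"
  by (simp add: nn_integral_wconv[OF al])
 then have "AE y in wmeas al. (nn_integral (angle_measure al) (%th. h (wconv (snd z) y th))) = 0"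
  by (subst (asm) nn_integral_0_iff_AE) simp_all
 then have "AE y in wmeas al. (LINT th|angle_measure al. ?D \<phi> (wconv (snd z) y th)) = (LINT th|angle_measure al. ?D \<phi>' (wconv (snd z) y th))"
 proof eventually_elim
  fix y assume "(nn_integral (angle_measure al) (%th. h (wconv (snd z) y th))) = 0"
  then have "AE th in angle_measure al. h (wconv (snd z) y th) = 0"
   by (subst (asm) nn_integral_0_iff_AE) simp_all
  then have "AE th in angle_measure al. ?D \<phi> (wconv (snd z) y th) = ?D \<phi>' (wconv (snd z) y th)"
   by eventually_elim (simp add: h_def split: if_splits)
  then show "(LINT th|angle_measure al. ?D \<phi> (wconv (snd z) y th)) = (LINT th|angle_measure al. ?D \<phi>' (wconv (snd z) y th))"
   by (intro integral_cong_AE) simp_all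
 qed
 then have "wcorr al f (?D \<phi>) (snd z) = wcorr al f (?D \<phi>') (snd z)"
  unfolding wcorr_def by (intro integral_cong_AE) (measurable, auto elim: eventually_mono)
 then show ?thesis unfolding weinstein_cwt_altdef[OF al m(1)] weinstein_cwt_altdef[OF al m(2)] by simp
qed

text \<open>The estimates use a bound that holds at every point, whereas an element of L^infinity is
  bounded only almost everywhere. Setting the value to 0 where the essential bound fails changes
  neither the class nor the transform.\<close>

lemma bounded_wavelet_representative:
 fixes \<phi> :: "(real ^ 'd) \<times> real => complex"
 assumes \<phi>: "\<phi> \<in> Lp_space 1 (wmeas al)" "\<phi> \<in> Lp_space top (wmeas al)" and wavelet: "weinstein_wavelet al \<phi>"
  and al: "al > -1/2"
 obtains \<phi>' N where "integrable (wmeas al) \<phi>'" "!!x. cmod (\<phi>' x) <= N" "weinstein_wavelet al \<phi>'"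
  "AE x in wmeas al. \<phi> x = \<phi>' x"
proof -
 let ?m = "wmeas al :: ((real ^ 'd) \<times> real) measure"
 define N where "N = Lp_norm top ?m \<phi>"
 define \<phi>' where "\<phi>' x = (if cmod (\<phi> x) <= N then \<phi> x else 0)" for x
 have m [measurable]: "\<phi> \<in> borel_measurable borel" using Lp_space_measurable[OF \<phi>(1)] by simp
 have [measurable]: "\<phi>' \<in> borel_measurable borel" unfolding \<phi>'_def by measurable
 have ae: "AE x in ?m. \<phi> x = \<phi>' x"
  using Lp_space_infty_AE[OF \<phi>(2)] by eventually_elim (simp add: \<phi>'_def N_def)
 have \<phi>i: "integrable ?m \<phi>" using \<phi>(1) by (auto simp: Lp_space_1)
 have F: "weinstein_transform al \<phi>' xi = weinstein_transform al \<phi> xi" for xi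
  unfolding weinstein_transform_altdef
 proof (rule integral_cong_AE)
  show "AE x in ?m. \<phi>' x * wkernel al x xi = \<phi> x * wkernel al x xi" using ae by eventually_elim simp
 qed (use al in measurable)
 show thesis
 proof (rule that[OF _ _ _ ae])
  show "integrable ?m \<phi>'" by (rule integrable_cong_AE_imp[OF \<phi>i]) (use ae in \<open>auto elim: eventually_mono\<close>)
  show "cmod (\<phi>' x) <= N" for x using Lp_norm_nonneg[of top ?m \<phi>] by (simp add: \<phi>'_def N_def)
  show "weinstein_wavelet al \<phi>'" using wavelet unfolding weinstein_wavelet_def F .
 qed
qed

lemma conjugate_exponent_exists:
 fixes p :: ennreal
 assumes "1 <= p"
 obtains q where "inverse p + inverse q = 1"
 using assms
proof (cases rule: exponent_ge_1_cases)
 case infinity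
 then show thesis using that[of 1] by simp
next
 case (finite P)
 show thesis
 proof (cases "P = 1")
  case True
  then show thesis using that[of top] finite by simp
 next
  case False
  then have "1 < P" using finite by simp
  then have "inverse (ennreal P) + inverse (ennreal (P / (P - 1))) = ennreal (inverse P + inverse (P / (P - 1)))"
   by (simp add: inverse_ennreal)
  also have "inverse P + inverse (P / (P - 1)) = 1" using \<open>1 < P\<close> by (simp add: field_simps)
  finally show thesis using that finite by simp
 qed
qed

lemma conjugate_exponent_unique:
 assumes "inverse p + inverse q = (1 :: ennreal)" "inverse p + inverse q' = 1"
 shows "q = q'"
proof -
 have e: "enn2real (inverse q) = enn2real (inverse q')"
  using enn2real_inverse_conjugate(1)[OF assms(1)] enn2real_inverse_conjugate(1)[OF assms(2)] by simp
 from conjugate_exponent_ge_1(2)[OF assms(1)] show ?thesis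
 proof (cases rule: exponent_ge_1_cases)
  case infinity
  from conjugate_exponent_ge_1(2)[OF assms(2)] show ?thesis
   by (cases rule: exponent_ge_1_cases) (use e infinity in \<open>auto simp: inverse_ennreal\<close>)
 next
  case (finite Q)
  from conjugate_exponent_ge_1(2)[OF assms(2)] show ?thesis
   by (cases rule: exponent_ge_1_cases) (use e finite in \<open>auto simp: inverse_ennreal\<close>)
 qed
qed

text \<open>The product estimate and Hoelder bound the form by the L^r norm of the symbol, so
  replacing \<sigma> by \<open>\<sigma>n n\<close> costs Q times an L^r distance tending to 0. For
  the truncated symbol the form is that of a kernel operator with slices bounded in L^1 and
  L^infinity.\<close>

lemma compact_localization_form:
 fixes \<phi> \<psi> :: "(real ^ 'd) \<times> real => complex" and \<sigma> :: "real \<times> (real ^ 'd) \<times> real => complex"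
 assumes al: "al > -1/2" and \<phi>: "integrable (wmeas al) \<phi>" and M: "!!x. cmod (\<phi> x) <= M"
  and \<psi>: "integrable (wmeas al) \<psi>" and N: "!!x. cmod (\<psi> x) <= N"
  and r: "r = ennreal R" "1 <= R" and rr': "inverse r + inverse r' = 1" and \<sigma>: "\<sigma> \<in> Lp_space r (weinstein_measure_X al)"
  and pq: "inverse p + inverse q = 1" and product: "cwt_product_bounded al \<phi> \<psi> p q r'"
 shows "f \<in> Lp_space p (wmeas al) ==> g \<in> Lp_space q (wmeas al) ==>
   integrable (weinstein_measure_X al) (%z. \<sigma> z * weinstein_cwt al \<phi> f z * cnj (weinstein_cwt al \<psi> g z))"
  and "\<exists>T. compact_op_Lp p (wmeas al) T &
   (\<forall>f \<in> Lp_space p (wmeas al). \<forall>g \<in> Lp_space q (wmeas al).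
    (LINT x|wmeas al. T f x * cnj (g x)) = (LINT z|weinstein_measure_X al. \<sigma> z * weinstein_cwt al \<phi> f z * cnj (weinstein_cwt al \<psi> g z)))"
proof -
 let ?m = "wmeas al :: ((real ^ 'd) \<times> real) measure"
 let ?X = "weinstein_measure_X al :: (real \<times> (real ^ 'd) \<times> real) measure"
 let ?\<Phi> = "weinstein_cwt al \<phi>" and ?\<Psi> = "weinstein_cwt al \<psi>"
 define s where "s = al + 1 + real CARD('d) / 2"
 have s: "s > 0" using al by (simp add: s_def add_pos_nonneg)
 have m [measurable]: "\<phi> \<in> borel_measurable borel" "\<psi> \<in> borel_measurable borel"
  using borel_measurable_integrable[OF \<phi>] borel_measurable_integrable[OF \<psi>] by simp_all
 have r1: "1 <= r" by (rule conjugate_exponent_ge_1(1)[OF rr'])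
 obtain Q where Q: "Q >= 0" and Qb: "\<forall>f \<in> Lp_space p ?m. \<forall>g \<in> Lp_space q ?m. (%z. ?\<Phi> f z * cnj (?\<Psi> g z)) \<in> Lp_space r' ?X
  & Lp_norm r' ?X (%z. ?\<Phi> f z * cnj (?\<Psi> g z)) <= Q * Lp_norm p ?m f * Lp_norm q ?m g"
  using product unfolding cwt_product_bounded_def by blast
 let ?B = "%\<tau> f g z. \<tau> z * ?\<Phi> f z * cnj (?\<Psi> g z)"
 let ?I = "%\<tau> f g. LINT z|?X. ?B \<tau> f g z"
 have form: "integrable ?X (?B \<tau> f g)"
   "cmod (?I \<tau> f g) <= (Q * Lp_norm r ?X \<tau>) * Lp_norm p ?m f * Lp_norm q ?m g"
  if f: "f \<in> Lp_space p ?m" and g: "g \<in> Lp_space q ?m" and \<tau>: "\<tau> \<in> Lp_space r ?X" for f g \<tau>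
 proof -
  note h = Qb[rule_format, OF f g]
  note H = Lp_Holder[OF rr' \<tau> h[THEN conjunct1]]
  show "integrable ?X (?B \<tau> f g)" using H(1) by (simp only: mult.assoc)
  have "cmod (?I \<tau> f g) <= Lp_norm r ?X \<tau> * Lp_norm r' ?X (%z. ?\<Phi> f z * cnj (?\<Psi> g z))"
   using order_trans[OF integral_norm_bound H(2)] by (simp only: mult.assoc)
  also have "... <= Lp_norm r ?X \<tau> * (Q * Lp_norm p ?m f * Lp_norm q ?m g)"
   by (intro mult_left_mono h[THEN conjunct2] Lp_norm_nonneg)
  finally show "cmod (?I \<tau> f g) <= (Q * Lp_norm r ?X \<tau>) * Lp_norm p ?m f * Lp_norm q ?m g"
   by (simp only: mult_ac)
 qed
 show "integrable ?X (?B \<sigma> f g)" if "f \<in> Lp_space p ?m" "g \<in> Lp_space q ?m" for f g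
  by (rule form(1)[OF that \<sigma>])
 define I where "I n = {1 / real (Suc n) .. real (Suc n)}" for n
 \<comment> \<open>Besides extreme scales, small values of the symbol are cut off: where |\<sigma>|
   > 1/(n+1) one has |\<sigma>| <= (n+1)^(R-1) |\<sigma>|^R, which makes the truncation
   integrable.\<close>
 define \<sigma>n where "\<sigma>n n z = (if fst z \<in> I n & 1 / real (Suc n) < cmod (\<sigma> z) then \<sigma> z else 0)" for n z
 have \<sigma>m [measurable]: "\<sigma> \<in> borel_measurable ?X" by (rule Lp_space_measurable[OF \<sigma>])
 have \<sigma>R: "integrable ?X (%z. cmod (\<sigma> z) powr R)" using \<sigma> r by (auto simp: Lp_space_ennreal)
 have \<sigma>nm [measurable]: "\<sigma>n n \<in> borel_measurable ?X" for n unfolding \<sigma>n_def I_def by measurable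
 have \<sigma>ni: "integrable ?X (\<sigma>n n)" for n
 proof (rule integrable_dominated)
  show "integrable ?X (%z. (1 / real (Suc n)) powr (1 - R) * cmod (\<sigma> z) powr R)" using \<sigma>R by simp
  show "AE z in ?X. norm (\<sigma>n n z) <= norm ((1 / real (Suc n)) powr (1 - R) * cmod (\<sigma> z) powr R)"
  proof (rule AE_I2)
   fix z
   show "norm (\<sigma>n n z) <= norm ((1 / real (Suc n)) powr (1 - R) * cmod (\<sigma> z) powr R)"
   proof (cases "1 / real (Suc n) < cmod (\<sigma> z)")
    case True
    then have p0: "0 < cmod (\<sigma> z)" by (rule order.strict_trans[rotated]) simp
    have "cmod (\<sigma> z) powr (1 - R) <= (1 / real (Suc n)) powr (1 - R)" using True r by (intro powr_mono2') auto
    then have "cmod (\<sigma> z) powr (1 - R) * cmod (\<sigma> z) powr R <= (1 / real (Suc n)) powr (1 - R) * cmod (\<sigma> z) powr R"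
     by (intro mult_right_mono) auto
    moreover have "cmod (\<sigma> z) powr (1 - R) * cmod (\<sigma> z) powr R = cmod (\<sigma> z)" using p0 by (simp add: powr_add[symmetric])
    ultimately show ?thesis by (simp add: \<sigma>n_def)
   qed (simp add: \<sigma>n_def)
  qed
 qed measurable
 have dm: "(%z. \<sigma> z - \<sigma>n n z) \<in> Lp_space r ?X" for n
  by (rule Lp_space_mono(1)[OF r1 \<sigma>]) (measurable, auto simp: \<sigma>n_def)
 have \<sigma>nL: "\<sigma>n n \<in> Lp_space r ?X" for n
  by (rule Lp_space_mono(1)[OF r1 \<sigma>]) (measurable, auto simp: \<sigma>n_def)
 have lim: "(%n. Lp_norm r ?X (%z. \<sigma> z - \<sigma>n n z)) \<longlonglongrightarrow> 0"
 proof -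
  have "(%n. LINT z|?X. cmod (\<sigma> z - \<sigma>n n z) powr R) \<longlonglongrightarrow> (LINT z|?X. 0)"
  proof (rule integral_dominated_convergence[OF _ _ \<sigma>R])
   show "AE z in ?X. (%n. cmod (\<sigma> z - \<sigma>n n z) powr R) \<longlonglongrightarrow> 0"
    using AE_weinstein_measure_X_pos
   proof eventually_elim
    fix z :: "real \<times> (real ^ 'd) \<times> real" assume a: "0 < fst z"
    have "eventually (%n. \<sigma>n n z = \<sigma> z) sequentially"
    proof (cases "\<sigma> z = 0")
     case False
     then have c: "0 < cmod (\<sigma> z)" by simp
     have "(%n. 1 / real (Suc n)) \<longlonglongrightarrow> 0" by (rule LIMSEQ_Suc[OF lim_1_over_n])
     then have "eventually (%n. 1 / real (Suc n) < fst z) sequentially" "eventually (%n. 1 / real (Suc n) < cmod (\<sigma> z)) sequentially"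
      using a c by (auto intro: order_tendstoD(2))
     moreover have "eventually (%n. fst z < real (Suc n)) sequentially"
     proof -
      obtain k where "fst z < real k" using reals_Archimedean2 by blast
      then show ?thesis by (intro eventually_sequentiallyI[of k]) auto
     qed
     ultimately show ?thesis by eventually_elim (auto simp: \<sigma>n_def I_def)
    qed (simp add: \<sigma>n_def)
    then have "eventually (%n. cmod (\<sigma> z - \<sigma>n n z) powr R = 0) sequentially" by eventually_elim simp
    then show "(%n. cmod (\<sigma> z - \<sigma>n n z) powr R) \<longlonglongrightarrow> 0" by (rule tendsto_eventually)
   qed
   show "AE z in ?X. norm (cmod (\<sigma> z - \<sigma>n n z) powr R) <= cmod (\<sigma> z) powr R" for n
    using r by (intro AE_I2) (auto simp: \<sigma>n_def)
  qed measurable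
  then have "(%n. (LINT z|?X. cmod (\<sigma> z - \<sigma>n n z) powr R) powr (1 / R)) \<longlonglongrightarrow> 0"
   using r by (intro tendsto_zero_powrI[of _ _ _ "1 / R"]) auto
  then show ?thesis using r by (simp add: Lp_norm_ennreal)
 qed
 \<comment> \<open>Cutting the atoms to the scales in \<open>I n\<close> makes the kernel bounds
   hold for every z and does not affect the form, since the truncated symbol vanishes at all other
   scales.\<close>
 define K where "K \<eta> n = (%(z, y). if fst z \<in> I n then weinstein_atom al \<eta> (fst z) (snd z) y else 0)" for \<eta> :: "(real ^ 'd) \<times> real => complex" and n
 have Km: "K \<eta> n \<in> borel_measurable (?X \<Otimes>\<^sub>M ?m)" if "\<eta> \<in> borel_measurable borel" for \<eta> n
 proof -
  note [measurable] = borel_measurable_weinstein_atom[OF al that]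
  have "(%w. if fst (fst w) \<in> I n then weinstein_atom al \<eta> (fst (fst w)) (snd (fst w)) (snd w) else 0) \<in> borel_measurable ((borel \<Otimes>\<^sub>M borel) \<Otimes>\<^sub>M borel)"
   unfolding I_def by measurable
  then show ?thesis unfolding K_def
   by (subst measurable_cong_sets[where M'="(borel \<Otimes>\<^sub>M borel) \<Otimes>\<^sub>M borel" and N'=borel]) (auto intro!: sets_pair_measure_cong simp: split_beta')
 qed
 have Kb: "cmod (K \<eta> n (z, y)) <= real (Suc n) powr s * max B (LINT x|?m. cmod (\<eta> x))"
   "(nn_integral ?m (%y. ennreal (cmod (K \<eta> n (z, y))))) <= ennreal (real (Suc n) powr s * max B (LINT x|?m. cmod (\<eta> x)))"
  if \<eta>: "integrable ?m \<eta>" and B: "!!x. cmod (\<eta> x) <= B" for \<eta> B n z y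
 proof -
  have B0: "B >= 0" using order_trans[OF norm_ge_zero B] .
  show "cmod (K \<eta> n (z, y)) <= real (Suc n) powr s * max B (LINT x|?m. cmod (\<eta> x))"
  proof (cases "fst z \<in> I n")
   case True
   then have z: "1 / real (Suc n) <= fst z" by (simp add: I_def)
   have "0 < fst z" by (rule less_le_trans[OF _ z]) simp
   from norm_weinstein_atom_le[OF al \<eta> B this, of "snd z" y]
   have "cmod (K \<eta> n (z, y)) <= fst z powr (- s) * B" using True by (simp add: K_def s_def)
   also have "... <= (1 / real (Suc n)) powr (- s) * max B (LINT x|?m. cmod (\<eta> x))"
    using z s B0 by (intro mult_mono powr_mono2') auto
   \<comment> \<open>The interval \<open>I n\<close> is symmetric under inversion of the scale, so
     the sup bound a^(-s) and the L^1 bound a^s have the same maximum on it.\<close>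
   also have "(1 / real (Suc n)) powr (- s) = real (Suc n) powr s" by (simp add: powr_divide powr_minus_divide)
   finally show ?thesis .
  qed (use B0 in \<open>simp add: K_def le_max_iff_disj\<close>)
  show "(nn_integral ?m (%y. ennreal (cmod (K \<eta> n (z, y))))) <= ennreal (real (Suc n) powr s * max B (LINT x|?m. cmod (\<eta> x)))"
  proof (cases "fst z \<in> I n")
   case True
   then have z: "1 / real (Suc n) <= fst z" "fst z <= real (Suc n)" by (simp_all add: I_def)
   have z0: "0 < fst z" by (rule less_le_trans[OF _ z(1)]) simp
   have "(nn_integral ?m (%y. ennreal (cmod (K \<eta> n (z, y))))) <= ennreal (fst z powr s * (LINT x|?m. cmod (\<eta> x)))"
    using nn_integral_norm_weinstein_atom_le[OF al \<eta> B z0, of "snd z"] True by (simp add: K_def s_def)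
   also have "... <= ennreal (real (Suc n) powr s * max B (LINT x|?m. cmod (\<eta> x)))"
    using z z0 s by (intro ennreal_leI mult_mono powr_mono2) (auto simp: integral_nonneg_AE)
   finally show ?thesis .
  qed (simp add: K_def)
 qed
 define A where "A n = real (Suc n) powr s * max (max M (LINT x|?m. cmod (\<phi> x))) (max N (LINT x|?m. cmod (\<psi> x)))" for n
 have A0: "0 <= A n" for n
  using order_trans[OF norm_ge_zero M] by (simp add: A_def le_max_iff_disj)
 have A: "real (Suc n) powr s * max M (LINT x|?m. cmod (\<phi> x)) <= A n" "real (Suc n) powr s * max N (LINT x|?m. cmod (\<psi> x)) <= A n" for n
  unfolding A_def by (intro mult_left_mono; simp)+
 \<comment> \<open>The transform pairs f with the conjugated atom, whereas the kernel operator
   integrates f against its first kernel without conjugation.\<close>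
 define K1 where "K1 n w = cnj (K \<phi> n w)" for n w
 have K1m: "K1 n \<in> borel_measurable (?X \<Otimes>\<^sub>M ?m)" for n
  unfolding K1_def by (intro borel_measurable_cnj_comp Km m)
 have K1b: "cmod (K1 n (z, y)) <= A n" "(nn_integral ?m (%y. ennreal (cmod (K1 n (z, y))))) <= ennreal (A n)" for n z y
  unfolding K1_def complex_mod_cnj using Kb[OF \<phi> M] A(1) by (blast intro: order_trans ennreal_leI)+
 have K2b: "cmod (K \<psi> n (z, y)) <= A n" "(nn_integral ?m (%y. ennreal (cmod (K \<psi> n (z, y))))) <= ennreal (A n)" for n z y
  using Kb[OF \<psi> N] A(2) by (blast intro: order_trans ennreal_leI)+
 define S where "S n f x = (LINT z|?X. \<sigma>n n z * (LINT y|?m. f y * K1 n (z, y)) * K \<psi> n (z, x))" for n f x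
 have KO: "f \<in> Lp_space p ?m ==> S n f \<in> Lp_space p ?m"
  "f \<in> Lp_space p ?m ==> g \<in> Lp_space q ?m ==> (LINT x|?m. S n f x * cnj (g x)) =
   (LINT z|?X. \<sigma>n n z * (LINT y|?m. f y * K1 n (z, y)) * (LINT x|?m. K \<psi> n (z, x) * cnj (g x)))"
  "finite_rank_approximable p ?m (S n)" for n f g
 proof -
  note KO' = kernel_operator[OF sigma_finite_weinstein_measure_X sigma_finite_weinstein_measure pq \<sigma>ni[of n] K1m[of n] Km[OF m(2), of n] A0[of n]
   K1b(1)[where n=n] K1b(2)[where n=n] K2b(1)[where n=n] K2b(2)[where n=n], folded S_def]
  show "f \<in> Lp_space p ?m ==> S n f \<in> Lp_space p ?m" by (rule KO'(1))
  show "f \<in> Lp_space p ?m ==> g \<in> Lp_space q ?m ==> (LINT x|?m. S n f x * cnj (g x)) =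
   (LINT z|?X. \<sigma>n n z * (LINT y|?m. f y * K1 n (z, y)) * (LINT x|?m. K \<psi> n (z, x) * cnj (g x)))" by (rule KO'(2))
  show "finite_rank_approximable p ?m (S n)" by (rule KO'(3))
 qed
 have Sform: "(LINT x|?m. S n f x * cnj (g x)) = ?I (\<sigma>n n) f g"
  if f: "f \<in> Lp_space p ?m" and g: "g \<in> Lp_space q ?m" for n f g
  unfolding KO(2)[OF f g]
 proof (rule Bochner_Integration.integral_cong[OF refl])
  fix z
  have "(LINT x|?m. K \<psi> n (z, x) * cnj (g x)) = cnj (LINT x|?m. g x * cnj (K \<psi> n (z, x)))"
   unfolding Bochner_Integration.integral_cnj[symmetric] by (simp add: mult.commute)
  then show "\<sigma>n n z * (LINT y|?m. f y * K1 n (z, y)) * (LINT x|?m. K \<psi> n (z, x) * cnj (g x)) = \<sigma>n n z * ?\<Phi> f z * cnj (?\<Psi> g z)"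
   by (cases "fst z \<in> I n") (simp_all add: \<sigma>n_def K1_def K_def weinstein_cwt_def split_beta)
 qed
 show "\<exists>T. compact_op_Lp p ?m T & (\<forall>f \<in> Lp_space p ?m. \<forall>g \<in> Lp_space q ?m.
    (LINT x|?m. T f x * cnj (g x)) = ?I \<sigma> f g)"
 proof (rule compact_operator_of_form[OF sigma_finite_weinstein_measure pq, where S=S and \<delta>="%n. Q * Lp_norm r ?X (%z. \<sigma> z - \<sigma>n n z)" and C="Q * Lp_norm r ?X \<sigma>"])
  fix f f' g assume f: "f \<in> Lp_space p ?m" and f': "f' \<in> Lp_space p ?m" and g: "g \<in> Lp_space q ?m"
  note i = form(1)[OF f g \<sigma>] form(1)[OF f' g \<sigma>]
  have ff: "(%x. f x + f' x) \<in> Lp_space p ?m" by (rule Lp_space_add[OF conjugate_exponent_ge_1(1)[OF pq] f f'])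
  have "?I \<sigma> (%x. f x + f' x) g = (LINT z|?X. \<sigma> z * ?\<Phi> f z * cnj (?\<Psi> g z) + \<sigma> z * ?\<Phi> f' z * cnj (?\<Psi> g z))"
  proof (rule integral_cong_AE)
   \<comment> \<open>Additivity of the wavelet transform rests on the atom lying in L^q, which holds
     at positive scales and thus almost everywhere.\<close>
   show "AE z in ?X. \<sigma> z * ?\<Phi> (%x. f x + f' x) z * cnj (?\<Psi> g z) = \<sigma> z * ?\<Phi> f z * cnj (?\<Psi> g z) + \<sigma> z * ?\<Phi> f' z * cnj (?\<Psi> g z)"
    using AE_weinstein_measure_X_pos by eventually_elim (simp only: weinstein_cwt_add[OF al \<phi> M pq f f'] distrib_left distrib_right)
  qed (use form(1)[OF ff g \<sigma>] i in \<open>auto intro!: borel_measurable_integrable Bochner_Integration.integrable_add\<close>)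
  then show "?I \<sigma> (%x. f x + f' x) g = ?I \<sigma> f g + ?I \<sigma> f' g"
   using i by simp
 next
  fix f g :: "(real ^ 'd) \<times> real => complex" and c
  have "?I \<sigma> (%x. c * f x) g = (LINT z|?X. c * (\<sigma> z * ?\<Phi> f z * cnj (?\<Psi> g z)))"
   by (simp only: weinstein_cwt_cmult mult_ac)
  then show "?I \<sigma> (%x. c * f x) g = c * ?I \<sigma> f g"
   by (simp only: integral_mult_right_zero)
 next
  show "0 <= Q * Lp_norm r ?X \<sigma>" "!!n. 0 <= Q * Lp_norm r ?X (%z. \<sigma> z - \<sigma>n n z)" using Q Lp_norm_nonneg by (intro mult_nonneg_nonneg; simp)+
  show "(%n. Q * Lp_norm r ?X (%z. \<sigma> z - \<sigma>n n z)) \<longlonglongrightarrow> 0" using tendsto_mult_left[OF lim, of Q] by simp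
  show "finite_rank_approximable p ?m (S n)" for n by (rule KO(3))
 next
  fix n f g assume f: "f \<in> Lp_space p ?m" and g: "g \<in> Lp_space q ?m"
  have "?I \<sigma> f g - ?I (\<sigma>n n) f g = (LINT z|?X. (\<sigma> z - \<sigma>n n z) * ?\<Phi> f z * cnj (?\<Psi> g z))"
   unfolding left_diff_distrib by (rule Bochner_Integration.integral_diff[OF form(1)[OF f g \<sigma>] form(1)[OF f g \<sigma>nL], symmetric])
  then show "cmod (?I \<sigma> f g - (LINT x|?m. S n f x * cnj (g x))) <= Q * Lp_norm r ?X (%z. \<sigma> z - \<sigma>n n z) * Lp_norm p ?m f * Lp_norm q ?m g"
   unfolding Sform[OF f g] using form(2)[OF f g dm[of n]] by simp
 qed (use form(2)[OF _ _ \<sigma>] KO(1) in auto)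
qed

theorem theorem3p12:
  fixes \<alpha> :: real
    and r r' :: ennreal
    and \<phi> \<psi> :: "(real ^ 'd) \<times> real \<Rightarrow> complex"
    and \<sigma> :: "real \<times> (real ^ 'd) \<times> real \<Rightarrow> complex"
  assumes "\<alpha> > - 1 / 2"
    and "1 \<le> r" and "r \<le> 2"
    and "inverse r + inverse r' = 1"
    and "\<sigma> \<in> Lp_space r (weinstein_measure_X \<alpha>)"
    and "\<phi> \<in> Lp_space 1 (weinstein_measure \<alpha>) \<inter> Lp_space 2 (weinstein_measure \<alpha>)
             \<inter> Lp_space \<infinity> (weinstein_measure \<alpha>)"
    and "\<psi> \<in> Lp_space 1 (weinstein_measure \<alpha>) \<inter> Lp_space 2 (weinstein_measure \<alpha>)
             \<inter> Lp_space \<infinity> (weinstein_measure \<alpha>)"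
    and "weinstein_wavelet \<alpha> \<phi>" and "weinstein_wavelet \<alpha> \<psi>"
  shows "\<forall>p \<in> {r..r'}.
    \<exists>T. is_localization_op \<alpha> \<phi> \<psi> \<sigma> p T
      \<and> (\<forall>T'. is_localization_op \<alpha> \<phi> \<psi> \<sigma> p T' \<longrightarrow>
            (\<forall>f \<in> Lp_space p (weinstein_measure \<alpha>). AE y in weinstein_measure \<alpha>. T' f y = T f y))
      \<and> compact_op_Lp p (weinstein_measure \<alpha>) T"
proof (rule ballI)
 fix p assume p: "p \<in> {r..r'}"
 let ?m = "weinstein_measure \<alpha> :: ((real ^ 'd) \<times> real) measure"
 let ?X = "weinstein_measure_X \<alpha> :: (real \<times> (real ^ 'd) \<times> real) measure"
 have \<alpha>: "\<alpha> > -1/2" using assms(1) by simp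
 have p1: "1 <= p" using assms(2) p by auto
 obtain q where pq: "inverse p + inverse q = 1" by (rule conjugate_exponent_exists[OF p1])
 \<comment> \<open>The bound r <= 2 makes r finite, as the convergence of the truncated symbols in
   L^r requires.\<close>
 obtain R where R: "r = ennreal R" "1 <= R"
  using assms(2,3) by (cases rule: exponent_ge_1_cases) (auto simp: top_unique)
 have m [measurable]: "\<phi> \<in> borel_measurable borel" "\<psi> \<in> borel_measurable borel"
  using Lp_space_measurable[of \<phi> 1 ?m] Lp_space_measurable[of \<psi> 1 ?m] assms(6,7) by auto
 have \<phi>: "\<phi> \<in> Lp_space 1 ?m" "\<phi> \<in> Lp_space top ?m" and \<psi>: "\<psi> \<in> Lp_space 1 ?m" "\<psi> \<in> Lp_space top ?m"
  using assms(6,7) by auto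
 obtain \<phi>' M where \<phi>': "integrable ?m \<phi>'" "!!x. cmod (\<phi>' x) <= M" "weinstein_wavelet \<alpha> \<phi>'" "AE x in ?m. \<phi> x = \<phi>' x"
  by (rule bounded_wavelet_representative[OF \<phi> assms(8) \<alpha>]) (rule that)
 obtain \<psi>' N where \<psi>': "integrable ?m \<psi>'" "!!x. cmod (\<psi>' x) <= N" "weinstein_wavelet \<alpha> \<psi>'" "AE x in ?m. \<psi> x = \<psi>' x"
  by (rule bounded_wavelet_representative[OF \<psi> assms(9) \<alpha>]) (rule that)
 have m': "\<phi>' \<in> borel_measurable borel" "\<psi>' \<in> borel_measurable borel"
  using borel_measurable_integrable[OF \<phi>'(1)] borel_measurable_integrable[OF \<psi>'(1)] by simp_all
 have "r <= p" "p <= r'" using p by auto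
 note product = cwt_product_bounded[OF \<alpha> \<phi>'(1,2) \<psi>'(1,2) \<phi>'(3) \<psi>'(3) assms(4) this pq]
 note main = compact_localization_form[OF \<alpha> \<phi>'(1,2) \<psi>'(1,2) R assms(4,5) pq product]
 have eq: "integrable ?X (%z. \<sigma> z * weinstein_cwt \<alpha> \<phi> f z * cnj (weinstein_cwt \<alpha> \<psi> g z))"
  "(LINT z|?X. \<sigma> z * weinstein_cwt \<alpha> \<phi> f z * cnj (weinstein_cwt \<alpha> \<psi> g z)) = (LINT z|?X. \<sigma> z * weinstein_cwt \<alpha> \<phi>' f z * cnj (weinstein_cwt \<alpha> \<psi>' g z))"
  if f: "f \<in> Lp_space p ?m" and g: "g \<in> Lp_space q ?m" for f g
 proof -
  have fm: "f \<in> borel_measurable borel" "g \<in> borel_measurable borel" using Lp_space_measurable[OF f] Lp_space_measurable[OF g] by simp_all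
  have [measurable]: "\<sigma> \<in> borel_measurable ?X" by (rule Lp_space_measurable[OF assms(5)])
  have meas: "(%z. \<sigma> z * weinstein_cwt \<alpha> \<phi> f z * cnj (weinstein_cwt \<alpha> \<psi> g z)) \<in> borel_measurable ?X"
   by (intro borel_measurable_times borel_measurable_cnj_comp borel_measurable_weinstein_cwt[OF \<alpha>] fm m) measurable
  have ae: "AE z in ?X. \<sigma> z * weinstein_cwt \<alpha> \<phi>' f z * cnj (weinstein_cwt \<alpha> \<psi>' g z) = \<sigma> z * weinstein_cwt \<alpha> \<phi> f z * cnj (weinstein_cwt \<alpha> \<psi> g z)"
   using AE_weinstein_measure_X_pos
   by eventually_elim (simp add: weinstein_cwt_cong_AE[OF \<alpha> m(1) m'(1) \<phi>'(4) fm(1)] weinstein_cwt_cong_AE[OF \<alpha> m(2) m'(2) \<psi>'(4) fm(2)])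
  note i = main(1)[OF f g]
  show "integrable ?X (%z. \<sigma> z * weinstein_cwt \<alpha> \<phi> f z * cnj (weinstein_cwt \<alpha> \<psi> g z))"
   by (rule integrable_cong_AE_imp[OF i meas]) (use ae in \<open>auto elim: eventually_mono\<close>)
  show "(LINT z|?X. \<sigma> z * weinstein_cwt \<alpha> \<phi> f z * cnj (weinstein_cwt \<alpha> \<psi> g z)) = (LINT z|?X. \<sigma> z * weinstein_cwt \<alpha> \<phi>' f z * cnj (weinstein_cwt \<alpha> \<psi>' g z))"
   by (rule integral_cong_AE[OF meas borel_measurable_integrable[OF i]]) (use ae in \<open>auto elim: eventually_mono\<close>)
 qed
 obtain T where T: "compact_op_Lp p ?m T" and Tf: "\<forall>f \<in> Lp_space p ?m. \<forall>g \<in> Lp_space q ?m.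
   (LINT x|?m. T f x * cnj (g x)) = (LINT z|?X. \<sigma> z * weinstein_cwt \<alpha> \<phi>' f z * cnj (weinstein_cwt \<alpha> \<psi>' g z))"
  using main(2) by blast
 have Tl: "bounded_linear_op_Lp p ?m T" using T unfolding compact_op_Lp_def by blast
 show "\<exists>T. is_localization_op \<alpha> \<phi> \<psi> \<sigma> p T
   & (\<forall>T'. is_localization_op \<alpha> \<phi> \<psi> \<sigma> p T' --> (\<forall>f \<in> Lp_space p ?m. AE y in ?m. T' f y = T f y))
   & compact_op_Lp p ?m T"
 proof (intro exI[of _ T] conjI T allI impI ballI)
  show "is_localization_op \<alpha> \<phi> \<psi> \<sigma> p T"
   unfolding is_localization_op_def
  proof (intro conjI Tl allI impI ballI)
   fix q' f g assume q': "inverse p + inverse q' = 1" and f: "f \<in> Lp_space p ?m" and g: "g \<in> Lp_space q' ?m"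
   \<comment> \<open>The weak formulation quantifies over all conjugate exponents; there is exactly
     one.\<close>
   have "g \<in> Lp_space q ?m" using g conjugate_exponent_unique[OF q' pq] by simp
   then show "(LINT y|?m. T f y * cnj (g y)) = (LINT z|?X. \<sigma> z * weinstein_cwt \<alpha> \<phi> f z * cnj (weinstein_cwt \<alpha> \<psi> g z))"
    using Tf f eq(2) by simp
  qed
 next
  fix T' f assume T': "is_localization_op \<alpha> \<phi> \<psi> \<sigma> p T'" and f: "f \<in> Lp_space p ?m"
  show "AE y in ?m. T' f y = T f y"
  proof (rule Lp_AE_eqI[OF sigma_finite_weinstein_measure pq])
   show "T' f \<in> Lp_space p ?m" "T f \<in> Lp_space p ?m"
    using T' Tl f unfolding is_localization_op_def bounded_linear_op_Lp_def by blast+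
   fix g assume g: "g \<in> Lp_space q ?m"
   \<comment> \<open>By the product estimate the integrand is integrable for every pair f, g, so the
     weak identity applies to T' without exception and determines all its pairings.\<close>
   have "(LINT y|?m. T' f y * cnj (g y)) = (LINT z|?X. \<sigma> z * weinstein_cwt \<alpha> \<phi> f z * cnj (weinstein_cwt \<alpha> \<psi> g z))"
    using T' pq f g eq(1)[OF f g] unfolding is_localization_op_def by blast
   then show "(LINT y|?m. T' f y * cnj (g y)) = (LINT y|?m. T f y * cnj (g y))"
    using Tf f g eq(2)[OF f g] by simp
  qed
 qed
qed

end
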